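(* Let $k\ge1$ be an odd integer, let $m\ge3k+1$, and suppose that: the regularity condition of order $m$ holds; $q_\lambda+hp_\lambda\ge0$ on $\mathbb R^d$ for all $h\in(0,h_0]$, $\lambda\in\Lambda_1$; $\sum_{\lambda\in\Lambda_1}\lambda q_\lambda=0$ on $\mathbb R^d$; $c\ge c_0$ for a constant $c_0>0$; the first and the second structural inequalities of order $m$ hold; $\Lambda_1=-\Lambda_1$; and $q_\lambda=q_{-\lambda}$, $p_{-\lambda}=-p_\lambda$ for all $\lambda\in\Lambda_1$. Then for any integer $r\ge0$ such that $3k+r\le m-1$, the unique bounded solution $v_h$ of $L_hv_h+f=0$ on $\mathbb R^d$ satisfies $$\sup_{\mathbb R^d}|D^rD_h^kv_h|\le N\|f\|_mh$$ for all $h\in(0,h_0]$, where $N$ depends only on $m,\delta,c_0,\tau_0,K$, $|\Lambda_1|$, $\|\Lambda_1\|$ and $M_0,\dots,M_m$.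
   Context: Setting. Fix $d\ge1$, $h_0\in(0,\infty)$. $\Lambda_1\subset\mathbb R^d$ is a finite set with $0\notin\Lambda_1$, and $|\Lambda_1|^2:=\sum_{\lambda\in\Lambda_1}|\lambda|^2$. For $\lambda\in\Lambda_1$, $q_\lambda\ge0$, $p_\lambda$, and also $c$, $f$, are real Borel functions on $\mathbb R^d$ (no time dependence). Spaces. $D^k\varphi$ is the collection of all $x$-partial derivatives of order $k$, $|D^k\varphi|^2=\sum_{|\alpha|=k}|D^\alpha\varphi|^2$; $D_h^k$ denotes the $k$-th derivative with respect to the parameter $h$. A bounded function $\psi$ on $\mathbb R^d$ belongs to $\mathfrak B^m$ if it is continuous and for all $|\alpha|\le m$ the generalized derivatives $D^\alpha\psi$ are bounded; $\|\psi\|_m^2:=\sup_{\mathbb R^d}\sum_{|\alpha|\le m}|D^\alpha\psi|^2$. Regularity condition of order $m$ (with constants $M_0,\dots,M_m$): $p_\lambda,q_\lambda,c,f\in\mathfrak B^m$ for all $\lambda\in\Lambda_1$ and, for $k=0,\dots,m$, $\sup_{\mathbb R^d}\big(\sum_{\lambda\in\Lambda_1}(|D^kq_\lambda|^2+|D^kp_\lambda|^2)+|D^kc|^2\big)\le M_k^2$. Finite difference operator. $\delta_{h,\lambda}\varphi(x)=h^{-1}(\varphi(x+h\lambda)-\varphi(x))$, $L_h\varphi=\frac1h\sum_{\lambda\in\Lambda_1}q_\lambda\delta_{h,\lambda}\varphi+\sum_{\lambda\in\Lambda_1}p_\lambda\delta_{h,\lambda}\varphi-c\varphi$. Under the regularity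 condition, $q_\lambda+hp_\lambda\ge0$ and $c\ge c_0>0$, the equation $L_hv_h+f=0$ on $\mathbb R^d$ has a unique bounded solution $v_h$ for each $h\in(0,h_0]$. Structural notation. Fix $\tau_0>0$, numbers $\tau_\lambda\in[0,\infty)$ ($\lambda\in\Lambda_1$), $\delta\in(0,1]$, $K\in[1,\infty)$; $\|\Lambda_1\|^2:=\sum_{\lambda\in\Lambda_1}|\tau_\lambda\lambda|^2$. Let $\Lambda_2=\{\ell^1,\dots,\ell^d\}$ consist of distinct vectors not in $\Lambda_1$ and $\Lambda=\Lambda_1\cup\Lambda_2$. For $\lambda\in\Lambda_1$: $T_{h,\lambda}\varphi(x)=\varphi(x+h\lambda)$, $\bar\delta_{h,\lambda}=\tau_\lambda h^{-1}(T_{h,\lambda}-1)$; for $\ell^i\in\Lambda_2$: $T_{h,\ell^i}=1$ (identity), $\bar\delta_{h,\ell^i}=\tau_0D_i$. For $\lambda=(\lambda^1,\lambda^2)\in\Lambda^2$: $T_{h,\lambda}=T_{h,\lambda^1}T_{h,\lambda^2}$, $\bar\delta_{h,\lambda}=\bar\delta_{h,\lambda^1}\bar\delta_{h,\lambda^2}$. For $\mu\in\Lambda^k$, $k=1,2$: $Q_{h,\mu}\varphi=h^{-1}\sum_{\lambda\in\Lambda_1}(\bar\delta_{h,\mu}q_\lambda)\delta_{h,\lambda}\varphi$, $L^0_{h,\mu}\varphi=Q_{h,\mu}\varphi+\sum_{\lambda\in\Lambda_1}(\bar\delta_{h,\mu}p_\lambda)\delta_{h,\lambda}\varphi$. Further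 $A_h(\varphi)=2\sum_{\lambda\in\Lambda}(\bar\delta_{h,\lambda}\varphi)L^0_{h,\lambda}T_{h,\lambda}\varphi$, $\mathcal Q_h(\varphi)=\sum_{\lambda\in\Lambda_1}(q_\lambda+hp_\lambda)(\delta_{h,\lambda}\varphi)^2$. $\mathfrak K$ is the set of bounded operators $\mathcal K_h$ mapping the space of bounded Borel functions on $\mathbb R^d$ into itself, preserving nonnegativity, with $\mathcal K_h1\le1$. First structural inequality of order $m$ ($m\ge1$): for any $h\in(0,h_0]$ there is $\mathcal K_h=\mathcal K_{h,m}\in\mathfrak K$ such that on $\mathbb R^d$, for all smooth $\varphi$, $$mA_h(\varphi)\le(1-\delta)\sum_{\lambda\in\Lambda}\mathcal Q_h(\bar\delta_{h,\lambda}\varphi)+K\mathcal Q_h(\varphi)+2(1-\delta)c\,\mathcal K_h\Big(\sum_{\lambda\in\Lambda}|\bar\delta_{h,\lambda}\varphi|^2\Big).$$ Second structural inequality of order $m$ ($m\ge2$): for any $h\in(0,h_0]$ and $n=1,\dots,m$ there is $\mathcal K_h=\mathcal K_{h,n}\in\mathfrak K$ such that on $\mathbb R^d$, for all smooth $\varphi$, $$n\sum_{\nu\in\Lambda}A_h(\bar\delta_{h,\nu}\varphi)+n(n-1)\sum_{\lambda\in\Lambda^2}(\bar\delta_{h,\lambda}\varphi)Q_{h,\lambda}T_{h,\lambda}\varphi\le(1-\delta)\sum_{\lambda\in\Lambda^2}\mathcal Q_h(\bar\delta_{h,\lambda}\varphi)+K\sum_{\lambda\in\Lambda}\mathcal Q_h(\bar\delta_{h,\lambda}\varphi)$$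 $$+2(1-\delta)c\,\mathcal K_h\Big(\sum_{\lambda\in\Lambda^2}|\bar\delta_{h,\lambda}\varphi|^2\Big)+K\mathcal K_h\Big(\sum_{\lambda\in\Lambda}|\bar\delta_{h,\lambda}\varphi|^2\Big).$$ *)

theory Defs
  imports "HOL-Analysis.Analysis" "HOL-Probability.Essential_Supremum"
begin

section \<open>Derivatives and function spaces\<close>

definition partial :: "'n::finite \<Rightarrow> (real^'n \<Rightarrow> real) \<Rightarrow> real^'n \<Rightarrow> real" where
  "partial i \<phi> x = frechet_derivative \<phi> (at x) (axis i 1)"

definition Ck :: "nat \<Rightarrow> (real^'n::finite \<Rightarrow> real) \<Rightarrow> bool" where
  "Ck r \<phi> \<longleftrightarrow>
     (\<forall>is. length is < r \<longrightarrow> (\<forall>x. foldr partial is \<phi> differentiable (at x))) \<and>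
     (\<forall>is. length is \<le> r \<longrightarrow> continuous_on UNIV (foldr partial is \<phi>))"

definition smooth :: "(real^'n::finite \<Rightarrow> real) \<Rightarrow> bool" where
  "smooth \<phi> \<longleftrightarrow> (\<forall>r. Ck r \<phi>)"

text \<open>Multi-indices are arbitrary functions on the finite index type.\<close>

definition mi_order :: "('n::finite \<Rightarrow> nat) \<Rightarrow> nat" where
  "mi_order \<alpha> = (\<Sum>i\<in>UNIV. \<alpha> i)"

text \<open>The partial derivatives in \<open>D\<^sup>\<alpha>\<close> are taken in some unspecified order; the order is
  irrelevant for functions of class \<open>C\<^bsup>|\<alpha>|\<^esup>\<close>, the only ones to which it is applied.\<close>

definition mi_deriv :: "('n::finite \<Rightarrow> nat) \<Rightarrow> (real^'n \<Rightarrow> real) \<Rightarrow> real^'n \<Rightarrow> real" where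
  "mi_deriv \<alpha> \<phi> = foldr partial (SOME is. \<forall>i. count_list is i = \<alpha> i) \<phi>"

definition Dnorm :: "nat \<Rightarrow> (real^'n::finite \<Rightarrow> real) \<Rightarrow> real^'n \<Rightarrow> real" where
  "Dnorm k \<phi> x = sqrt (\<Sum>\<alpha> | mi_order \<alpha> = k. (mi_deriv \<alpha> \<phi> x)\<^sup>2)"

definition is_weak_deriv ::
  "('n::finite \<Rightarrow> nat) \<Rightarrow> (real^'n \<Rightarrow> real) \<Rightarrow> (real^'n \<Rightarrow> real) \<Rightarrow> bool" where
  "is_weak_deriv \<alpha> \<psi> g \<longleftrightarrow>
     g \<in> borel_measurable borel \<and>
     (\<forall>C. compact C \<longrightarrow> set_integrable lborel C g) \<and>
     (\<forall>\<eta>. smooth \<eta> \<and> compact (closure {x. \<eta> x \<noteq> 0}) \<longrightarrow>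
        (LINT x|lborel. \<psi> x * mi_deriv \<alpha> \<eta> x) =
        (-1) ^ mi_order \<alpha> * (LINT x|lborel. g x * \<eta> x))"

text \<open>Generalized derivatives are determined only up to null sets.  Accordingly the choice below is
  used only inside essential suprema, and \<open>in_B\<close> asks for one bounded representative.\<close>

definition weak_deriv :: "('n::finite \<Rightarrow> nat) \<Rightarrow> (real^'n \<Rightarrow> real) \<Rightarrow> real^'n \<Rightarrow> real" where
  "weak_deriv \<alpha> \<psi> = (SOME g. is_weak_deriv \<alpha> \<psi> g)"

definition in_B :: "nat \<Rightarrow> (real^'n::finite \<Rightarrow> real) \<Rightarrow> bool" where
  "in_B m \<psi> \<longleftrightarrow>
     bounded (range \<psi>) \<and> continuous_on UNIV \<psi> \<and>
     (\<forall>\<alpha>. mi_order \<alpha> \<le> m \<longrightarrow> (\<exists>g. is_weak_deriv \<alpha> \<psi> g \<and> bounded (range g)))"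

definition B_norm :: "nat \<Rightarrow> (real^'n::finite \<Rightarrow> real) \<Rightarrow> real" where
  "B_norm m \<psi> = sqrt (real_of_ereal
     (esssup lborel (\<lambda>x. ereal (\<Sum>\<alpha> | mi_order \<alpha> \<le> m. (weak_deriv \<alpha> \<psi> x)\<^sup>2))))"

definition weak_Dsq :: "nat \<Rightarrow> (real^'n::finite \<Rightarrow> real) \<Rightarrow> real^'n \<Rightarrow> real" where
  "weak_Dsq k \<psi> x = (\<Sum>\<alpha> | mi_order \<alpha> = k. (weak_deriv \<alpha> \<psi> x)\<^sup>2)"

definition regularity ::
  "nat \<Rightarrow> (nat \<Rightarrow> real) \<Rightarrow> (real^'n::finite) set \<Rightarrow> (real^'n \<Rightarrow> real^'n \<Rightarrow> real) \<Rightarrow>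
   (real^'n \<Rightarrow> real^'n \<Rightarrow> real) \<Rightarrow> (real^'n \<Rightarrow> real) \<Rightarrow> (real^'n \<Rightarrow> real) \<Rightarrow> bool" where
  "regularity m M \<Lambda>1 q p c f \<longleftrightarrow>
     (\<forall>l\<in>\<Lambda>1. in_B m (q l) \<and> in_B m (p l)) \<and> in_B m c \<and> in_B m f \<and>
     (\<forall>k\<le>m. esssup lborel (\<lambda>x. ereal
        ((\<Sum>l\<in>\<Lambda>1. weak_Dsq k (q l) x + weak_Dsq k (p l) x) + weak_Dsq k c x)) \<le> ereal ((M k)\<^sup>2))"

section \<open>The finite difference equation\<close>

definition fd :: "real \<Rightarrow> real^'n::finite \<Rightarrow> (real^'n \<Rightarrow> real) \<Rightarrow> real^'n \<Rightarrow> real" where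
  "fd h l \<phi> x = (\<phi> (x + h *\<^sub>R l) - \<phi> x) / h"

definition L_op ::
  "(real^'n::finite) set \<Rightarrow> (real^'n \<Rightarrow> real^'n \<Rightarrow> real) \<Rightarrow> (real^'n \<Rightarrow> real^'n \<Rightarrow> real) \<Rightarrow>
   (real^'n \<Rightarrow> real) \<Rightarrow> real \<Rightarrow> (real^'n \<Rightarrow> real) \<Rightarrow> real^'n \<Rightarrow> real" where
  "L_op \<Lambda>1 q p c h \<phi> x =
     (1 / h) * (\<Sum>l\<in>\<Lambda>1. q l x * fd h l \<phi> x) + (\<Sum>l\<in>\<Lambda>1. p l x * fd h l \<phi> x) - c x * \<phi> x"

definition fd_solution ::
  "(real^'n::finite) set \<Rightarrow> (real^'n \<Rightarrow> real^'n \<Rightarrow> real) \<Rightarrow> (real^'n \<Rightarrow> real^'n \<Rightarrow> real) \<Rightarrow>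
   (real^'n \<Rightarrow> real) \<Rightarrow> (real^'n \<Rightarrow> real) \<Rightarrow> real \<Rightarrow> real^'n \<Rightarrow> real" where
  "fd_solution \<Lambda>1 q p c f h =
     (THE v. bounded (range v) \<and> (\<forall>x. L_op \<Lambda>1 q p c h v x + f x = 0))"

text \<open>The solution is defined for parameters in \<open>(0, h0]\<close> only, so derivatives with respect to
  the parameter are relative to this interval (hence one-sided at \<open>h0\<close>).\<close>

definition hderiv :: "real \<Rightarrow> nat \<Rightarrow> (real \<Rightarrow> real) \<Rightarrow> real \<Rightarrow> real" where
  "hderiv h0 k = (\<lambda>u h. vector_derivative u (at h within {0<..h0})) ^^ k"

section \<open>Structural inequalities\<close>

text \<open>The set \<open>\<Lambda>\<close> is the union of \<open>\<Lambda>1\<close> and \<open>range e\<close>, where the injective family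
  \<open>e\<close> lists \<open>\<Lambda>2\<close>; each \<open>e i\<close> is a mere label for the \<open>i\<close>-th coordinate direction.\<close>

definition shift ::
  "(real^'n::finite) set \<Rightarrow> real \<Rightarrow> real^'n \<Rightarrow> (real^'n \<Rightarrow> real) \<Rightarrow> real^'n \<Rightarrow> real" where
  "shift \<Lambda>1 h l \<phi> x = (if l \<in> \<Lambda>1 then \<phi> (x + h *\<^sub>R l) else \<phi> x)"

text \<open>Below, the classical derivatives in \<open>dbar\<close> are applied at most twice to the coefficients;
  these belong to \<open>\<BB>\<^sup>m\<close> with \<open>m \<ge> 4\<close> and are thus of class \<open>C\<^sup>3\<close>.\<close>

definition dbar ::
  "(real^'n::finite) set \<Rightarrow> ('n \<Rightarrow> real^'n) \<Rightarrow> real \<Rightarrow> (real^'n \<Rightarrow> real) \<Rightarrow> real \<Rightarrow> real^'n \<Rightarrow>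
   (real^'n \<Rightarrow> real) \<Rightarrow> real^'n \<Rightarrow> real" where
  "dbar \<Lambda>1 e \<tau>0 \<tau> h l \<phi> x =
     (if l \<in> \<Lambda>1 then \<tau> l / h * (\<phi> (x + h *\<^sub>R l) - \<phi> x) else \<tau>0 * partial (inv e l) \<phi> x)"

text \<open>Elements of \<open>\<Lambda>\<^sup>k\<close> are lists of length \<open>k\<close>; the operators indexed by them are compositions.\<close>

definition tuples :: "nat \<Rightarrow> 'a set \<Rightarrow> 'a list set" where
  "tuples k \<Lambda> = {\<mu>. set \<mu> \<subseteq> \<Lambda> \<and> length \<mu> = k}"

definition shifts ::
  "(real^'n::finite) set \<Rightarrow> real \<Rightarrow> (real^'n) list \<Rightarrow> (real^'n \<Rightarrow> real) \<Rightarrow> real^'n \<Rightarrow> real" where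
  "shifts \<Lambda>1 h \<mu> = foldr (shift \<Lambda>1 h) \<mu>"

definition dbars ::
  "(real^'n::finite) set \<Rightarrow> ('n \<Rightarrow> real^'n) \<Rightarrow> real \<Rightarrow> (real^'n \<Rightarrow> real) \<Rightarrow> real \<Rightarrow>
   (real^'n) list \<Rightarrow> (real^'n \<Rightarrow> real) \<Rightarrow> real^'n \<Rightarrow> real" where
  "dbars \<Lambda>1 e \<tau>0 \<tau> h \<mu> = foldr (dbar \<Lambda>1 e \<tau>0 \<tau> h) \<mu>"

definition Q_op ::
  "(real^'n::finite) set \<Rightarrow> ('n \<Rightarrow> real^'n) \<Rightarrow> real \<Rightarrow> (real^'n \<Rightarrow> real) \<Rightarrow>
   (real^'n \<Rightarrow> real^'n \<Rightarrow> real) \<Rightarrow> real \<Rightarrow> (real^'n) list \<Rightarrow>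
   (real^'n \<Rightarrow> real) \<Rightarrow> real^'n \<Rightarrow> real" where
  "Q_op \<Lambda>1 e \<tau>0 \<tau> q h \<mu> \<phi> x =
     (1 / h) * (\<Sum>l\<in>\<Lambda>1. dbars \<Lambda>1 e \<tau>0 \<tau> h \<mu> (q l) x * fd h l \<phi> x)"

definition L0_op ::
  "(real^'n::finite) set \<Rightarrow> ('n \<Rightarrow> real^'n) \<Rightarrow> real \<Rightarrow> (real^'n \<Rightarrow> real) \<Rightarrow>
   (real^'n \<Rightarrow> real^'n \<Rightarrow> real) \<Rightarrow> (real^'n \<Rightarrow> real^'n \<Rightarrow> real) \<Rightarrow> real \<Rightarrow> (real^'n) list \<Rightarrow>
   (real^'n \<Rightarrow> real) \<Rightarrow> real^'n \<Rightarrow> real" where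
  "L0_op \<Lambda>1 e \<tau>0 \<tau> q p h \<mu> \<phi> x =
     Q_op \<Lambda>1 e \<tau>0 \<tau> q h \<mu> \<phi> x +
     (\<Sum>l\<in>\<Lambda>1. dbars \<Lambda>1 e \<tau>0 \<tau> h \<mu> (p l) x * fd h l \<phi> x)"

definition A_form ::
  "(real^'n::finite) set \<Rightarrow> ('n \<Rightarrow> real^'n) \<Rightarrow> real \<Rightarrow> (real^'n \<Rightarrow> real) \<Rightarrow>
   (real^'n \<Rightarrow> real^'n \<Rightarrow> real) \<Rightarrow> (real^'n \<Rightarrow> real^'n \<Rightarrow> real) \<Rightarrow> real \<Rightarrow>
   (real^'n \<Rightarrow> real) \<Rightarrow> real^'n \<Rightarrow> real" where
  "A_form \<Lambda>1 e \<tau>0 \<tau> q p h \<phi> x =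
     2 * (\<Sum>l\<in>\<Lambda>1 \<union> range e. dbar \<Lambda>1 e \<tau>0 \<tau> h l \<phi> x *
            L0_op \<Lambda>1 e \<tau>0 \<tau> q p h [l] (shift \<Lambda>1 h l \<phi>) x)"

definition Q_form ::
  "(real^'n::finite) set \<Rightarrow> (real^'n \<Rightarrow> real^'n \<Rightarrow> real) \<Rightarrow> (real^'n \<Rightarrow> real^'n \<Rightarrow> real) \<Rightarrow>
   real \<Rightarrow> (real^'n \<Rightarrow> real) \<Rightarrow> real^'n \<Rightarrow> real" where
  "Q_form \<Lambda>1 q p h \<phi> x = (\<Sum>l\<in>\<Lambda>1. (q l x + h * p l x) * (fd h l \<phi> x)\<^sup>2)"

definition bounded_borel :: "(real^'n::finite \<Rightarrow> real) \<Rightarrow> bool" where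
  "bounded_borel \<phi> \<longleftrightarrow> \<phi> \<in> borel_measurable borel \<and> bounded (range \<phi>)"

definition admissible_K :: "((real^'n::finite \<Rightarrow> real) \<Rightarrow> (real^'n \<Rightarrow> real)) \<Rightarrow> bool" where
  "admissible_K \<K> \<longleftrightarrow>
     (\<forall>\<phi>. bounded_borel \<phi> \<longrightarrow> bounded_borel (\<K> \<phi>)) \<and>
     (\<forall>\<phi> \<psi> a b. bounded_borel \<phi> \<and> bounded_borel \<psi> \<longrightarrow>
        \<K> (\<lambda>x. a * \<phi> x + b * \<psi> x) = (\<lambda>x. a * \<K> \<phi> x + b * \<K> \<psi> x)) \<and>
     (\<exists>C. \<forall>\<phi> B. bounded_borel \<phi> \<and> (\<forall>x. \<bar>\<phi> x\<bar> \<le> B) \<longrightarrow> (\<forall>x. \<bar>\<K> \<phi> x\<bar> \<le> C * B)) \<and>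
     (\<forall>\<phi>. bounded_borel \<phi> \<and> (\<forall>x. 0 \<le> \<phi> x) \<longrightarrow> (\<forall>x. 0 \<le> \<K> \<phi> x)) \<and>
     (\<forall>x. \<K> (\<lambda>_. 1) x \<le> 1)"

definition dbar_sq ::
  "(real^'n::finite) set \<Rightarrow> ('n \<Rightarrow> real^'n) \<Rightarrow> real \<Rightarrow> (real^'n \<Rightarrow> real) \<Rightarrow> real \<Rightarrow> nat \<Rightarrow>
   (real^'n \<Rightarrow> real) \<Rightarrow> real^'n \<Rightarrow> real" where
  "dbar_sq \<Lambda>1 e \<tau>0 \<tau> h k \<phi> x =
     (\<Sum>\<mu>\<in>tuples k (\<Lambda>1 \<union> range e). (dbars \<Lambda>1 e \<tau>0 \<tau> h \<mu> \<phi> x)\<^sup>2)"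

text \<open>The operators \<open>\<K>\<close> act on bounded functions, so the structural inequalities are required for
  those smooth functions for which the arguments of \<open>\<K>\<close> are bounded.\<close>

definition first_structural ::
  "nat \<Rightarrow> real \<Rightarrow> real \<Rightarrow> real \<Rightarrow> (real^'n::finite) set \<Rightarrow> ('n \<Rightarrow> real^'n) \<Rightarrow> real \<Rightarrow>
   (real^'n \<Rightarrow> real) \<Rightarrow> (real^'n \<Rightarrow> real^'n \<Rightarrow> real) \<Rightarrow> (real^'n \<Rightarrow> real^'n \<Rightarrow> real) \<Rightarrow>
   (real^'n \<Rightarrow> real) \<Rightarrow> bool" where
  "first_structural m \<delta> K h0 \<Lambda>1 e \<tau>0 \<tau> q p c \<longleftrightarrow>
     (\<forall>h\<in>{0<..h0}. \<exists>\<K>. admissible_K \<K> \<and>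
       (\<forall>\<phi> x. smooth \<phi> \<and> bounded (range (dbar_sq \<Lambda>1 e \<tau>0 \<tau> h 1 \<phi>)) \<longrightarrow>
          real m * A_form \<Lambda>1 e \<tau>0 \<tau> q p h \<phi> x
          \<le> (1 - \<delta>) * (\<Sum>l\<in>\<Lambda>1 \<union> range e. Q_form \<Lambda>1 q p h (dbar \<Lambda>1 e \<tau>0 \<tau> h l \<phi>) x)
            + K * Q_form \<Lambda>1 q p h \<phi> x
            + 2 * (1 - \<delta>) * c x * \<K> (dbar_sq \<Lambda>1 e \<tau>0 \<tau> h 1 \<phi>) x))"

definition second_structural ::
  "nat \<Rightarrow> real \<Rightarrow> real \<Rightarrow> real \<Rightarrow> (real^'n::finite) set \<Rightarrow> ('n \<Rightarrow> real^'n) \<Rightarrow> real \<Rightarrow>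
   (real^'n \<Rightarrow> real) \<Rightarrow> (real^'n \<Rightarrow> real^'n \<Rightarrow> real) \<Rightarrow> (real^'n \<Rightarrow> real^'n \<Rightarrow> real) \<Rightarrow>
   (real^'n \<Rightarrow> real) \<Rightarrow> bool" where
  "second_structural m \<delta> K h0 \<Lambda>1 e \<tau>0 \<tau> q p c \<longleftrightarrow>
     (\<forall>h\<in>{0<..h0}. \<forall>n\<in>{1..m}. \<exists>\<K>. admissible_K \<K> \<and>
       (\<forall>\<phi> x. smooth \<phi> \<and> bounded (range (dbar_sq \<Lambda>1 e \<tau>0 \<tau> h 1 \<phi>)) \<and>
              bounded (range (dbar_sq \<Lambda>1 e \<tau>0 \<tau> h 2 \<phi>)) \<longrightarrow>
          real n * (\<Sum>l\<in>\<Lambda>1 \<union> range e. A_form \<Lambda>1 e \<tau>0 \<tau> q p h (dbar \<Lambda>1 e \<tau>0 \<tau> h l \<phi>) x)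
          + real n * (real n - 1) * (\<Sum>\<mu>\<in>tuples 2 (\<Lambda>1 \<union> range e).
              dbars \<Lambda>1 e \<tau>0 \<tau> h \<mu> \<phi> x * Q_op \<Lambda>1 e \<tau>0 \<tau> q h \<mu> (shifts \<Lambda>1 h \<mu> \<phi>) x)
          \<le> (1 - \<delta>) * (\<Sum>\<mu>\<in>tuples 2 (\<Lambda>1 \<union> range e). Q_form \<Lambda>1 q p h (dbars \<Lambda>1 e \<tau>0 \<tau> h \<mu> \<phi>) x)
            + K * (\<Sum>l\<in>\<Lambda>1 \<union> range e. Q_form \<Lambda>1 q p h (dbar \<Lambda>1 e \<tau>0 \<tau> h l \<phi>) x)
            + 2 * (1 - \<delta>) * c x * \<K> (dbar_sq \<Lambda>1 e \<tau>0 \<tau> h 2 \<phi>) x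
            + K * \<K> (dbar_sq \<Lambda>1 e \<tau>0 \<tau> h 1 \<phi>) x))"

end

theory Submission
  imports Defs
begin

text \<open>Mollifying the coefficients preserves every hypothesis, the structural inequalities included,
  because translations commute with all the operators involved; it thus suffices to find estimates
  for smooth data whose constants involve only the given parameters, and to pass to the limit.

  For smooth data, Bernstein's method bounds \<open>n\<close> derivatives of the solution \<open>u\<close> of
  \<open>L\<^sub>h u + g = 0\<close> by \<open>n\<close> derivatives of \<open>g\<close>, uniformly in \<open>h\<close>: the maximum principle is applied to
  the sum of \<open>(dbars \<mu> u)\<^sup>2\<close> over the tuples \<open>\<mu>\<close> of length \<open>n\<close>, plus a multiple of the same sum of
  order \<open>n - 1\<close>, and the structural inequalities absorb the commutators of \<open>dbars \<mu>\<close> with \<open>L\<^sub>h\<close>.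

  By Taylor's formula and the symmetry of the data, \<open>L\<^sub>h\<close> is a smooth function of \<open>h\<close> with
  \<open>j\<close>-th derivative an operator of order \<open>j + 2\<close>.  Differentiating the equation \<open>k\<close> times,
  \<open>D\<^sub>h\<^sup>k v\<close> solves the same equation with the right-hand side
  \<open>\<Sum>i<k. (k choose i) L\<^sub>h\<^sup>(\<^sup>k\<^sup>-\<^sup>i\<^sup>) D\<^sub>h\<^sup>i v\<close>, at the cost of three derivatives of the data per step.  The
  symmetry makes \<open>L\<^sub>h\<close> formally even in \<open>h\<close>, so that its derivatives of odd order are \<open>O(h)\<close> (with
  one more derivative lost).  If \<open>k\<close> is odd, one of \<open>k - i\<close> and \<open>i\<close> is odd, and the factor \<open>h\<close>
  is inherited by induction.\<close>

section \<open>Smooth functions with bounded derivatives\<close>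

text \<open>The operators \<open>\<K>\<close> of the structural inequalities need not commute with
  translations, so the inequalities do not survive mollification as they stand. What survives, and
  suffices for the maximum principle, is the consequence in which \<open>\<K> \<phi>\<close> is
  replaced by a constant bounding \<open>\<phi>\<close> from above. The replacement must follow the
  summation over the tuples of length \<open>n - 2\<close>: a sum of suprema can exceed the supremum
  of the sum, and the coefficient \<open>1 - \<delta>\<close> leaves no room for such a loss.
  Mollified data are bounded up to order \<open>m\<close> but shown to converge only at order
  \<open>m - 1\<close>. Estimates are therefore proved at order \<open>m\<close> and limits taken at
  order \<open>m - 1\<close>, which matches \<open>3 * k + r \<le> m - 1\<close>. The three
  derivatives per step reflect \<open>k - i + 2 \<le> 3 * (k - i)\<close>, sharp for
  \<open>i = k - 1\<close>. The constants of the estimates are defined before any mesh size,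
  direction or coefficient is fixed, which makes their independence of these visible.\<close>

primrec Cb :: "nat \<Rightarrow> (real^'n::finite \<Rightarrow> real) \<Rightarrow> bool" where
  "Cb 0 \<phi> \<longleftrightarrow> bounded (range \<phi>)"
| "Cb (Suc n) \<phi> \<longleftrightarrow> bounded (range \<phi>) \<and> (\<forall>x. \<phi> differentiable (at x)) \<and> (\<forall>i. Cb n (partial i \<phi>))"

text \<open>A single level of \<open>Cb\<close> only bounds the last derivatives; all levels
  together make every iterated partial derivative bounded, differentiable and hence continuous. The
  estimates are proved in this class, and rough functions enter as limits.\<close>

definition smb :: "(real^'n::finite \<Rightarrow> real) \<Rightarrow> bool" where
  "smb \<phi> \<longleftrightarrow> (\<forall>n. Cb n \<phi>)"

text \<open>Sizes only: differentiability is not part of \<open>bd\<close>, which is therefore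
  paired with \<open>smb\<close>. One constant serves all orders up to \<open>n\<close>, so that the
  loss of derivatives is tracked by a single index.\<close>

primrec bd :: "nat \<Rightarrow> real \<Rightarrow> (real^'n::finite \<Rightarrow> real) \<Rightarrow> bool" where
  "bd 0 B \<phi> \<longleftrightarrow> (\<forall>x. \<bar>\<phi> x\<bar> \<le> B)"
| "bd (Suc n) B \<phi> \<longleftrightarrow> (\<forall>x. \<bar>\<phi> x\<bar> \<le> B) \<and> (\<forall>i. bd n B (partial i \<phi>))"

lemma has_derivative_partial:
  fixes \<phi> :: "real^'n::finite \<Rightarrow> real"
  assumes "\<phi> differentiable (at x)"
  shows "(\<phi> has_derivative (\<lambda>y. \<Sum>i\<in>UNIV. y$i * partial i \<phi> x)) (at x)"
proof -
  let ?D = "frechet_derivative \<phi> (at x)"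
  have D: "(\<phi> has_derivative ?D) (at x)"
    using assms frechet_derivative_works by blast
  then have lin: "linear ?D"
    using has_derivative_linear by blast
  have "?D y = (\<Sum>i\<in>UNIV. y$i * partial i \<phi> x)" for y
  proof -
    have "?D y = ?D (\<Sum>i\<in>UNIV. y$i *\<^sub>R axis i 1)"
      using basis_expansion[of y] by (simp add: scalar_mult_eq_scaleR)
    also have "\<dots> = (\<Sum>i\<in>UNIV. y$i * ?D (axis i 1))"
      using lin by (simp add: linear_sum linear_cmul)
    finally show ?thesis by (simp add: partial_def)
  qed
  then show ?thesis using D by (metis (no_types, lifting) ext)
qed

lemma partialI:
  fixes \<phi> :: "real^'n::finite \<Rightarrow> real"
  assumes "(\<phi> has_derivative (\<lambda>y. \<Sum>i\<in>UNIV. y$i * g i)) (at x)"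
  shows "partial i \<phi> x = g i"
proof -
  have "frechet_derivative \<phi> (at x) = (\<lambda>y. \<Sum>i\<in>UNIV. y$i * g i)"
    using frechet_derivative_at[OF assms] by simp
  then show ?thesis
    by (simp add: partial_def axis_def if_distrib if_distribR sum.delta cong: if_cong)
qed

lemma Cb_bounded: "Cb n \<phi> \<Longrightarrow> bounded (range \<phi>)"
  by (cases n) auto

lemma Cb_SucD: "Cb (Suc n) \<phi> \<Longrightarrow> Cb n \<phi>"
  by (induction n arbitrary: \<phi>) auto

lemma smb_bounded: "smb \<phi> \<Longrightarrow> bounded (range \<phi>)"
  unfolding smb_def using Cb_bounded by blast

lemma smb_differentiable: "smb \<phi> \<Longrightarrow> \<phi> differentiable (at x)"
  unfolding smb_def by (metis Cb.simps(2))

lemma smb_continuous_on: "smb \<phi> \<Longrightarrow> continuous_on S \<phi>"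
  by (meson continuous_at_imp_continuous_on differentiable_imp_continuous_within smb_differentiable)

lemma smb_borel [measurable_dest]: "smb \<phi> \<Longrightarrow> \<phi> \<in> borel_measurable borel"
  by (simp add: borel_measurable_continuous_onI smb_continuous_on)

lemma smb_has_derivative:
  "smb \<phi> \<Longrightarrow> (\<phi> has_derivative (\<lambda>y. \<Sum>i\<in>UNIV. y$i * partial i \<phi> x)) (at x)"
  using has_derivative_partial smb_differentiable by blast

lemma smb_partial: "smb \<phi> \<Longrightarrow> smb (partial i \<phi>)"
  unfolding smb_def by (metis Cb.simps(2))

text \<open>For families such as translates, convolutions or tensor products: a partial derivative
  of a member is again a member, though a different one.\<close>

lemma smb_coinduct:
  assumes "\<phi> \<in> X"
    and "\<And>\<psi>. \<psi> \<in> X \<Longrightarrow> bounded (range \<psi>) \<and> (\<forall>x. \<psi> differentiable (at x)) \<and> (\<forall>i. partial i \<psi> \<in> X)"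
  shows "smb \<phi>"
proof -
  have "\<psi> \<in> X \<Longrightarrow> Cb n \<psi>" for n \<psi>
    by (induction n arbitrary: \<psi>) (use assms(2) in auto)
  then show ?thesis using assms(1) by (auto simp: smb_def)
qed

section \<open>Closure of the class under algebraic operations\<close>

lemma partial_add:
  assumes "f differentiable (at x)" "g differentiable (at x)"
  shows "partial i (\<lambda>x. f x + g x) x = partial i f x + partial i g x"
  by (rule partialI, rule has_derivative_eq_rhs)
     (rule has_derivative_add has_derivative_partial assms | auto simp: algebra_simps sum.distrib)+

lemma partial_mult:
  assumes "f differentiable (at x)" "g differentiable (at x)"
  shows "partial i (\<lambda>x. f x * g x) x = f x * partial i g x + partial i f x * g x"
  by (rule partialI, rule has_derivative_eq_rhs)
     (rule has_derivative_mult has_derivative_partial assms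
       | auto simp: algebra_simps sum.distrib sum_distrib_left)+

lemma partial_const: "partial i (\<lambda>x. k) = (\<lambda>x. 0)"
  by (rule ext, rule partialI) simp

lemma bounded_range_real: "bounded (range (f::_\<Rightarrow>real)) \<longleftrightarrow> (\<exists>B. \<forall>x. \<bar>f x\<bar> \<le> B)"
  by (auto simp: bounded_iff)

lemma bounded_range_add:
  "bounded (range (f::_\<Rightarrow>real)) \<Longrightarrow> bounded (range g) \<Longrightarrow> bounded (range (\<lambda>x. f x + g x))"
  unfolding bounded_range_real by (metis abs_triangle_ineq add_mono order_trans)

lemma bounded_range_mult:
  assumes "bounded (range (f::_\<Rightarrow>real))" "bounded (range g)"
  shows "bounded (range (\<lambda>x. f x * g x))"
proof -
  obtain A B where "\<And>x. \<bar>f x\<bar> \<le> A" "\<And>x. \<bar>g x\<bar> \<le> B"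
    using assms unfolding bounded_range_real by blast
  then have "\<bar>f x * g x\<bar> \<le> A * B" for x
    unfolding abs_mult by (meson abs_ge_zero mult_mono order_trans)
  then show ?thesis unfolding bounded_range_real by blast
qed

lemma Cb_add: "Cb n f \<Longrightarrow> Cb n g \<Longrightarrow> Cb n (\<lambda>x. f x + g x)"
proof (induction n arbitrary: f g)
  case (Suc n)
  have "partial i (\<lambda>x. f x + g x) = (\<lambda>x. partial i f x + partial i g x)" for i
    using Suc.prems by (intro ext partial_add) auto
  then show ?case using Suc by (simp add: bounded_range_add)
qed (simp add: bounded_range_add)

lemma Cb_mult: "Cb n f \<Longrightarrow> Cb n g \<Longrightarrow> Cb n (\<lambda>x. f x * g x)"
proof (induction n arbitrary: f g)
  case (Suc n)
  have "partial i (\<lambda>x. f x * g x) = (\<lambda>x. f x * partial i g x + partial i f x * g x)" for i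
    using Suc.prems by (intro ext partial_mult) auto
  moreover have "Cb n f" "Cb n g"
    using Suc.prems Cb_SucD by blast+
  ultimately show ?case using Suc by (simp add: bounded_range_mult Cb_add)
qed (simp add: bounded_range_mult)

lemma smb_add: "smb f \<Longrightarrow> smb g \<Longrightarrow> smb (\<lambda>x. f x + g x)"
  by (simp add: smb_def Cb_add)

lemma smb_mult: "smb f \<Longrightarrow> smb g \<Longrightarrow> smb (\<lambda>x. f x * g x)"
  by (simp add: smb_def Cb_mult)

lemma smb_const: "smb (\<lambda>x. k)"
  by (rule smb_coinduct[of _ "range (\<lambda>k x. k)"]) (auto simp: partial_const)

lemma smb_cmult: "smb f \<Longrightarrow> smb (\<lambda>x. k * f x)"
  by (simp add: smb_mult smb_const)

lemma smb_minus: "smb f \<Longrightarrow> smb (\<lambda>x. - f x)"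
  using smb_cmult[of f "-1"] by simp

lemma smb_diff: "smb f \<Longrightarrow> smb g \<Longrightarrow> smb (\<lambda>x. f x - g x)"
  using smb_add[of f "\<lambda>x. - g x"] by (simp add: smb_minus)

lemma smb_divide: "smb f \<Longrightarrow> smb (\<lambda>x. f x / k)"
  using smb_cmult[of f "1/k"] by simp

lemma smb_power: "smb f \<Longrightarrow> smb (\<lambda>x. f x ^ k)"
  by (induction k) (auto intro: smb_const smb_mult)

lemma smb_sum: "(\<And>a. a \<in> S \<Longrightarrow> smb (f a)) \<Longrightarrow> smb (\<lambda>x. \<Sum>a\<in>S. f a x)"
  by (induction S rule: infinite_finite_induct) (auto intro: smb_const smb_add)

lemmas smb_intros = smb_const smb_add smb_mult smb_cmult smb_minus smb_diff smb_divide smb_sum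
  smb_partial smb_power

lemma partial_add_smb:
  "smb f \<Longrightarrow> smb g \<Longrightarrow> partial i (\<lambda>x. f x + g x) = (\<lambda>x. partial i f x + partial i g x)"
  by (auto intro!: ext partial_add smb_differentiable)

lemma partial_mult_smb:
  "smb f \<Longrightarrow> smb g \<Longrightarrow> partial i (\<lambda>x. f x * g x) = (\<lambda>x. f x * partial i g x + partial i f x * g x)"
  by (auto intro!: ext partial_mult smb_differentiable)

lemma partial_cmult_smb: "smb f \<Longrightarrow> partial i (\<lambda>x. k * f x) = (\<lambda>x. k * partial i f x)"
  using partial_mult_smb[OF smb_const] by (auto simp: partial_const)

lemma partial_minus_smb: "smb f \<Longrightarrow> partial i (\<lambda>x. - f x) = (\<lambda>x. - partial i f x)"
  using partial_cmult_smb[of f i "-1"] by simp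

lemma partial_diff_smb:
  "smb f \<Longrightarrow> smb g \<Longrightarrow> partial i (\<lambda>x. f x - g x) = (\<lambda>x. partial i f x - partial i g x)"
  using partial_add_smb[of f "\<lambda>x. - g x" i] by (simp add: partial_minus_smb smb_minus)

lemma partial_divide_smb: "smb f \<Longrightarrow> partial i (\<lambda>x. f x / k) = (\<lambda>x. partial i f x / k)"
  using partial_cmult_smb[of f i "1/k"] by simp

lemma partial_sum_smb:
  "(\<And>a. a \<in> S \<Longrightarrow> smb (f a)) \<Longrightarrow> partial i (\<lambda>x. \<Sum>a\<in>S. f a x) = (\<lambda>x. \<Sum>a\<in>S. partial i (f a) x)"
  by (induction S rule: infinite_finite_induct)
     (auto simp: partial_const partial_add_smb smb_sum)

lemma partial_translate:
  assumes "smb \<phi>"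
  shows "partial i (\<lambda>x. \<phi> (x + y)) = (\<lambda>x. partial i \<phi> (x + y))"
proof (rule ext, rule partialI)
  fix x
  have "((\<lambda>x. x + y) has_derivative (\<lambda>z. z)) (at x)"
    by (auto intro!: derivative_eq_intros)
  from diff_chain_at[OF this smb_has_derivative[OF assms, of "x + y"]] show "((\<lambda>x. \<phi> (x + y)) has_derivative (\<lambda>z. \<Sum>i\<in>UNIV. z$i * partial i \<phi> (x + y))) (at x)"
    by (simp add: o_def)
qed

lemma smb_translate: "smb \<phi> \<Longrightarrow> smb (\<lambda>x. \<phi> (x + y))"
proof (rule smb_coinduct[of _ "{\<lambda>x. \<phi> (x + y) | \<phi>. smb \<phi>}"], blast, safe)
  fix \<phi> :: "real^'a \<Rightarrow> real" and x i assume s: "smb \<phi>"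
  show "bounded (range (\<lambda>x. \<phi> (x + y)))"
    using smb_bounded[OF s] by (rule bounded_subset) auto
  have "(\<phi> \<circ> (\<lambda>x. x + y)) differentiable (at x)"
    by (intro differentiable_chain_at smb_differentiable s) auto
  then show "(\<lambda>x. \<phi> (x + y)) differentiable (at x)" by (simp add: o_def)
  show "\<exists>\<phi>'. partial i (\<lambda>x. \<phi> (x + y)) = (\<lambda>x. \<phi>' (x + y)) \<and> smb \<phi>'"
    using partial_translate[OF s] smb_partial[OF s] by blast
qed

section \<open>Arithmetic of the derivative bounds\<close>

lemma bd_D0: "bd n B \<phi> \<Longrightarrow> \<bar>\<phi> x\<bar> \<le> B"
  by (cases n) auto

lemma bd_nonneg: "bd n B \<phi> \<Longrightarrow> 0 \<le> B"
  using bd_D0 by (metis abs_ge_zero order_trans)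

lemma bd_SucD: "bd (Suc n) B \<phi> \<Longrightarrow> bd n B \<phi>"
  by (induction n arbitrary: \<phi>) auto

lemma bd_le: "bd n B \<phi> \<Longrightarrow> k \<le> n \<Longrightarrow> bd k B \<phi>"
proof (induction n)
  case (Suc n) then show ?case using bd_SucD le_Suc_eq by blast
qed simp

lemma bd_partial: "bd (Suc n) B \<phi> \<Longrightarrow> bd n B (partial i \<phi>)"
  by simp

lemma bd_mono: "bd n A \<phi> \<Longrightarrow> A \<le> B \<Longrightarrow> bd n B \<phi>"
  by (induction n arbitrary: \<phi>) (auto intro: order_trans)

lemma smb_bd: "smb \<phi> \<Longrightarrow> \<exists>B. bd n B \<phi>"
proof (induction n arbitrary: \<phi>)
  case 0 then show ?case using smb_bounded by (auto simp: bounded_range_real)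
next
  case (Suc n)
  obtain A where A: "\<And>x. \<bar>\<phi> x\<bar> \<le> A"
    using smb_bounded[OF Suc.prems] by (auto simp: bounded_range_real)
  have "\<forall>i. \<exists>B. bd n B (partial i \<phi>)" using Suc smb_partial by blast
  then obtain B where B: "\<And>i. bd n (B i) (partial i \<phi>)" by metis
  have "B i \<le> (\<Sum>i\<in>UNIV. B i)" for i
    using B bd_nonneg by (intro member_le_sum) auto
  moreover have "0 \<le> A" "0 \<le> (\<Sum>i\<in>UNIV. B i)"
    using A abs_ge_zero order_trans B bd_nonneg by (blast, meson sum_nonneg)
  ultimately have "bd (Suc n) (A + (\<Sum>i\<in>UNIV. B i)) \<phi>"
    using A B by (auto intro: bd_mono add_increasing add_increasing2)
  then show ?case by blast
qed

lemma bd_add: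
  "smb f \<Longrightarrow> smb g \<Longrightarrow> bd n A f \<Longrightarrow> bd n B g \<Longrightarrow> bd n (A + B) (\<lambda>x. f x + g x)"
proof (induction n arbitrary: f g)
  case 0 then show ?case by (auto intro: order_trans[OF abs_triangle_ineq add_mono])
next
  case (Suc n)
  then show ?case
    by (auto simp: partial_add_smb smb_partial intro: order_trans[OF abs_triangle_ineq add_mono])
qed

lemma bd_cmult: "smb f \<Longrightarrow> bd n A f \<Longrightarrow> bd n (\<bar>k\<bar> * A) (\<lambda>x. k * f x)"
  by (induction n arbitrary: f)
     (auto simp: partial_cmult_smb abs_mult smb_partial intro: mult_left_mono)

lemma bd_minus: "smb f \<Longrightarrow> bd n A f \<Longrightarrow> bd n A (\<lambda>x. - f x)"
  using bd_cmult[of f n A "-1"] by simp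

lemma bd_diff:
  "smb f \<Longrightarrow> smb g \<Longrightarrow> bd n A f \<Longrightarrow> bd n B g \<Longrightarrow> bd n (A + B) (\<lambda>x. f x - g x)"
  using bd_add[of f "\<lambda>x. - g x" n A B] by (simp add: bd_minus smb_minus)

lemma bd_zero: "0 \<le> B \<Longrightarrow> bd n B (\<lambda>x. 0)"
  by (induction n) (auto simp: partial_const)

lemma bd_sum:
  "(\<And>a. a \<in> S \<Longrightarrow> smb (f a)) \<Longrightarrow> (\<And>a. a \<in> S \<Longrightarrow> bd n (A a) (f a)) \<Longrightarrow>
    bd n (\<Sum>a\<in>S. A a) (\<lambda>x. \<Sum>a\<in>S. f a x)"
  by (induction S rule: infinite_finite_induct) (auto simp: bd_zero intro!: bd_add smb_sum)

text \<open>Each differentiation doubles the number of terms in the product rule, whence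
  \<open>2 ^ n\<close>.\<close>

lemma bd_mult:
  "smb f \<Longrightarrow> smb g \<Longrightarrow> bd n A f \<Longrightarrow> bd n B g \<Longrightarrow> bd n (2 ^ n * A * B) (\<lambda>x. f x * g x)"
proof (induction n arbitrary: f g)
  case 0 then show ?case
    by (auto simp: abs_mult intro!: mult_mono order_trans[OF abs_ge_zero])
next
  case (Suc n)
  have AB: "0 \<le> A" "0 \<le> B" using Suc.prems bd_nonneg by blast+
  have "\<bar>f x * g x\<bar> \<le> 2 ^ Suc n * A * B" for x
  proof -
    have "\<bar>f x * g x\<bar> \<le> A * B"
      using Suc.prems AB by (auto simp: abs_mult intro!: mult_mono)
    also have "\<dots> \<le> 2 ^ Suc n * (A * B)"
      using mult_right_mono[OF one_le_power[of 2 "Suc n"], of "A * B"] AB by simp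
    finally show ?thesis by (simp add: mult.assoc)
  qed
  moreover have "bd n (2 ^ Suc n * A * B) (partial i (\<lambda>x. f x * g x))" for i
  proof -
    have "bd n (2 ^ n * A * B + 2 ^ n * A * B) (\<lambda>x. f x * partial i g x + partial i f x * g x)"
      using Suc.prems bd_SucD by (intro bd_add Suc.IH smb_intros) auto
    moreover have "2 ^ n * A * B + 2 ^ n * A * B = 2 ^ Suc n * A * B" by simp
    ultimately show ?thesis using Suc.prems(1,2) by (simp only: partial_mult_smb)
  qed
  ultimately show ?case by simp
qed

lemma bd_translate: "smb \<phi> \<Longrightarrow> bd n B \<phi> \<Longrightarrow> bd n B (\<lambda>x. \<phi> (x + y))"
  by (induction n arbitrary: \<phi>) (auto simp: partial_translate smb_partial)

section \<open>Mean value and Taylor estimates\<close>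

lemma sum_component_le:
  fixes y :: "real^'n::finite"
  assumes "\<And>i. \<bar>a i\<bar> \<le> B"
  shows "\<bar>\<Sum>i\<in>UNIV. y$i * a i\<bar> \<le> real CARD('n) * norm y * B"
proof -
  have "\<bar>\<Sum>i\<in>UNIV. y$i * a i\<bar> \<le> (\<Sum>i\<in>UNIV. \<bar>y$i * a i\<bar>)" by (rule sum_abs)
  also have "\<dots> \<le> (\<Sum>i\<in>(UNIV::'n set). norm y * B)"
    unfolding abs_mult using assms component_le_norm_cart by (intro sum_mono mult_mono) auto
  finally show ?thesis by simp
qed

lemma mvt_partial:
  fixes \<phi> :: "real^'n::finite \<Rightarrow> real"
  assumes "\<And>x. \<phi> differentiable (at x)"
  shows "\<exists>t\<in>{0<..<1}. \<phi> (x + y) - \<phi> x = (\<Sum>i\<in>UNIV. y$i * partial i \<phi> (x + t *\<^sub>R y))"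
proof -
  have "((\<lambda>t. x + t *\<^sub>R y) has_derivative (\<lambda>s. s *\<^sub>R y)) (at t)" for t
    by (auto intro!: derivative_eq_intros)
  from diff_chain_at[OF this has_derivative_partial[OF assms]]
  have "((\<lambda>t. \<phi> (x + t *\<^sub>R y)) has_derivative
     (\<lambda>z. \<Sum>i\<in>UNIV. z$i * partial i \<phi> (x + t *\<^sub>R y)) \<circ> (\<lambda>s. s *\<^sub>R y)) (at t)" for t
    by (simp add: o_def)
  then obtain t where "0 < t" "t < 1"
     "\<phi> (x + 1 *\<^sub>R y) - \<phi> (x + 0 *\<^sub>R y) =
      ((\<lambda>z. \<Sum>i\<in>UNIV. z$i * partial i \<phi> (x + t *\<^sub>R y)) \<circ> (\<lambda>s. s *\<^sub>R y)) (1 - 0)"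
    using mvt_simple[of 0 1 "\<lambda>t. \<phi> (x + t *\<^sub>R y)"
      "\<lambda>t. (\<lambda>z. \<Sum>i\<in>UNIV. z$i * partial i \<phi> (x + t *\<^sub>R y)) \<circ> (\<lambda>s. s *\<^sub>R y)"]
    by (auto simp: has_derivative_at_withinI)
  then show ?thesis by auto
qed

lemma increment_bound:
  fixes \<phi> :: "real^'n::finite \<Rightarrow> real"
  assumes "\<And>x. \<phi> differentiable (at x)" "\<And>i x. \<bar>partial i \<phi> x\<bar> \<le> B"
  shows "\<bar>\<phi> (x + y) - \<phi> x\<bar> \<le> real CARD('n) * norm y * B"
  using mvt_partial[of \<phi> x y] assms sum_component_le[of _ B y] by force

text \<open>The mean value theorem is applied to \<open>\<phi>\<close> and then to its partial
  derivatives. Sums over components are bounded termwise, so the constant is crude; the quadratic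
  order in \<open>y\<close> is what matters.\<close>

lemma taylor2_bound:
  fixes \<phi> :: "real^'n::finite \<Rightarrow> real"
  assumes "smb \<phi>" "bd 2 B \<phi>"
  shows "\<bar>\<phi> (x + y) - \<phi> x - (\<Sum>i\<in>UNIV. y$i * partial i \<phi> x)\<bar> \<le> (real CARD('n))\<^sup>2 * B * (norm y)\<^sup>2"
proof -
  have B: "0 \<le> B" using assms bd_nonneg by blast
  obtain t where t: "0 < t" "t < 1"
    "\<phi> (x + y) - \<phi> x = (\<Sum>i\<in>UNIV. y$i * partial i \<phi> (x + t *\<^sub>R y))"
    using mvt_partial[of \<phi> x y, OF smb_differentiable[OF assms(1)]] by auto
  have "\<bar>partial i \<phi> (x + t *\<^sub>R y) - partial i \<phi> x\<bar> \<le> real CARD('n) * norm y * B" for i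
  proof -
    have "\<bar>partial i \<phi> (x + t *\<^sub>R y) - partial i \<phi> x\<bar> \<le> real CARD('n) * norm (t *\<^sub>R y) * B"
      using assms by (intro increment_bound) (auto simp: smb_differentiable smb_partial numeral_2_eq_2)
    also have "\<dots> \<le> real CARD('n) * norm y * B"
      using t B by (intro mult_right_mono mult_left_mono) (auto simp: mult_left_le_one_le)
    finally show ?thesis .
  qed
  from sum_component_le[of "\<lambda>i. partial i \<phi> (x + t *\<^sub>R y) - partial i \<phi> x", OF this, of y]
  show ?thesis unfolding t(3)
    by (simp add: sum_subtractf[symmetric] right_diff_distrib power2_eq_square mult_ac)
qed

lemma increment_bound_smb:
  fixes \<phi> :: "real^'n::finite \<Rightarrow> real"
  assumes "smb \<phi>" "bd 1 B \<phi>"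
  shows "\<bar>\<phi> (x + y) - \<phi> x\<bar> \<le> real CARD('n) * norm y * B"
  using assms by (intro increment_bound) (auto simp: smb_differentiable)

text \<open>The second difference of \<open>\<phi>\<close> over the parallelogram spanned by two
  axes is symmetric in the axes and equals \<open>s * s\<close> times the mixed derivative, in
  either order, up to an error cubic in \<open>s\<close>.\<close>

lemma partial_commute:
  fixes \<phi> :: "real^'n::finite \<Rightarrow> real"
  assumes "smb \<phi>"
  shows "partial i (partial j \<phi>) = partial j (partial i \<phi>)"
proof
  fix x
  obtain B where B: "bd 3 B \<phi>" using smb_bd[OF assms] by blast
  let ?d = "real CARD('n)"
  have key: "\<bar>(\<phi> (x + s *\<^sub>R axis k 1 + s *\<^sub>R axis l 1) - \<phi> (x + s *\<^sub>R axis k 1) - \<phi> (x + s *\<^sub>R axis l 1) + \<phi> x)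
      - s * s * partial l (partial k \<phi>) x\<bar> \<le> (?d^3 * B + ?d^2 * B) * s^3"
    if "0 < s" for s k l
  proof -
    define a :: "real^'n" where "a = s *\<^sub>R axis k 1"
    define b :: "real^'n" where "b = s *\<^sub>R axis l 1"
    have n: "norm a = s" "norm b = s" using that by (auto simp: a_def b_def)
    have sa: "(\<Sum>i\<in>UNIV. a$i * f i) = s * f k" for f
      by (simp add: a_def axis_def if_distrib if_distribR sum.delta cong: if_cong)
    have sb: "(\<Sum>i\<in>UNIV. b$i * f i) = s * f l" for f
      by (simp add: b_def axis_def if_distrib if_distribR sum.delta cong: if_cong)
    \<comment> \<open>The increment in direction \<open>b\<close> has second derivatives that are
      already of size \<open>s\<close>, so its Taylor remainder in direction \<open>a\<close> is
      cubic and not merely quadratic.\<close>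
    define \<psi> where "\<psi> = (\<lambda>z. \<phi> (z + b) - \<phi> z)"
    have s\<psi>: "smb \<psi>" unfolding \<psi>_def by (intro smb_intros smb_translate assms)
    have p\<psi>: "partial i (\<lambda>z. f (z + b) - f z) = (\<lambda>z. partial i f (z + b) - partial i f z)"
      if "smb f" for i f
      using that by (simp add: partial_diff_smb smb_translate partial_translate)
    have incr: "\<bar>f (x + b) - f x\<bar> \<le> ?d * s * B" if "smb f" "bd 1 B f" for f x
      using increment_bound_smb[OF that, of x b] n by simp
    have "bd 2 (?d * s * B) \<psi>"
      using assms B unfolding \<psi>_def
      by (auto simp: numeral_2_eq_2 numeral_3_eq_3 p\<psi> smb_partial intro!: incr)
    from taylor2_bound[OF s\<psi> this, of x a]
    have 1: "\<bar>\<psi> (x + a) - \<psi> x - s * partial k \<psi> x\<bar> \<le> ?d^3 * B * s^3"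
      by (simp add: sa n power2_eq_square power3_eq_cube mult_ac)
    have "\<bar>partial k \<phi> (x + b) - partial k \<phi> x - s * partial l (partial k \<phi>) x\<bar> \<le> ?d^2 * B * s^2"
      using taylor2_bound[of "partial k \<phi>" B x b] assms B
      by (simp add: sb n smb_partial numeral_2_eq_2 numeral_3_eq_3)
    then have "\<bar>s * (partial k \<phi> (x + b) - partial k \<phi> x - s * partial l (partial k \<phi>) x)\<bar> \<le> s * (?d^2 * B * s^2)"
      unfolding abs_mult using that by simp
    with 1 show ?thesis unfolding \<psi>_def p\<psi>[OF assms] a_def[symmetric] b_def[symmetric]
      by (simp add: algebra_simps power3_eq_cube power2_eq_square)
  qed
  have "\<bar>partial i (partial j \<phi>) x - partial j (partial i \<phi>) x\<bar> \<le> (2 * (?d^3 * B + ?d^2 * B)) * s" if s: "0 < s" for s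
  proof -
    have "s * s * \<bar>partial i (partial j \<phi>) x - partial j (partial i \<phi>) x\<bar>
      = \<bar>s * s * partial i (partial j \<phi>) x - s * s * partial j (partial i \<phi>) x\<bar>"
      using s by (simp add: abs_mult flip: right_diff_distrib)
    also have "\<dots> \<le> 2 * ((?d^3 * B + ?d^2 * B) * s^3)"
      using key[OF s, of i j] key[OF s, of j i] by (simp add: add.commute add.left_commute) 
    also have "\<dots> = s * s * ((2 * (?d^3 * B + ?d^2 * B)) * s)"
      by (simp add: power3_eq_cube)
    finally show ?thesis using s by simp
  qed
  then have "((\<lambda>s. (2 * (?d^3 * B + ?d^2 * B)) * s) \<longlongrightarrow> 0) (at_right 0) \<Longrightarrow>
      \<bar>partial i (partial j \<phi>) x - partial j (partial i \<phi>) x\<bar> \<le> 0"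
    by (intro tendsto_lowerbound[of _ 0 "at_right 0"]) (auto simp: eventually_at_filter)
  moreover have "((\<lambda>s. (2 * (?d^3 * B + ?d^2 * B)) * s) \<longlongrightarrow> 0) (at_right 0)"
    by (auto intro!: tendsto_eq_intros)
  ultimately show "partial i (partial j \<phi>) x = partial j (partial i \<phi>) x" by simp
qed

section \<open>Translation invariant operators\<close>

text \<open>Linear translation invariant operators commute with the partial derivatives, so that a bound of
  \<open>\<bar>T \<phi>\<bar>\<close> by derivatives of \<open>\<phi>\<close> carries over to all derivatives of \<open>T \<phi>\<close>.\<close>

definition tinv ::
  "((real^'n::finite \<Rightarrow> real) \<Rightarrow> (real^'n \<Rightarrow> real)) \<Rightarrow> nat \<Rightarrow> real \<Rightarrow> bool" where
  "tinv T k C \<longleftrightarrow> 0 \<le> C \<and>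
     (\<forall>\<phi> \<psi> a b. smb \<phi> \<and> smb \<psi> \<longrightarrow> T (\<lambda>x. a * \<phi> x + b * \<psi> x) = (\<lambda>x. a * T \<phi> x + b * T \<psi> x)) \<and>
     (\<forall>\<phi> y. smb \<phi> \<longrightarrow> T (\<lambda>z. \<phi> (z + y)) = (\<lambda>z. T \<phi> (z + y))) \<and>
     (\<forall>\<phi>. smb \<phi> \<longrightarrow> smb (T \<phi>) \<and> (\<forall>i. partial i (T \<phi>) = T (partial i \<phi>))) \<and>
     (\<forall>\<phi> B x. smb \<phi> \<and> bd k B \<phi> \<longrightarrow> \<bar>T \<phi> x\<bar> \<le> C * B)"

lemma tinv_nonneg: "tinv T k C \<Longrightarrow> 0 \<le> C"
  and tinv_lin: "tinv T k C \<Longrightarrow> smb \<phi> \<Longrightarrow> smb \<psi> \<Longrightarrow>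
    T (\<lambda>x. a * \<phi> x + b * \<psi> x) = (\<lambda>x. a * T \<phi> x + b * T \<psi> x)"
  and tinv_translate: "tinv T k C \<Longrightarrow> smb \<phi> \<Longrightarrow> T (\<lambda>z. \<phi> (z + y)) = (\<lambda>z. T \<phi> (z + y))"
  and tinv_smb: "tinv T k C \<Longrightarrow> smb \<phi> \<Longrightarrow> smb (T \<phi>)"
  and tinv_partial_commute: "tinv T k C \<Longrightarrow> smb \<phi> \<Longrightarrow> partial i (T \<phi>) = T (partial i \<phi>)"
  and tinv_bound: "tinv T k C \<Longrightarrow> smb \<phi> \<Longrightarrow> bd k B \<phi> \<Longrightarrow> \<bar>T \<phi> x\<bar> \<le> C * B"
  unfolding tinv_def by blast+

lemma tinv_zero: "tinv T k C \<Longrightarrow> T (\<lambda>x. 0) = (\<lambda>x. 0)"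
  using tinv_lin[of T k C "\<lambda>x. 0" "\<lambda>x. 0" 0 0] by (simp add: smb_const)

lemma tinv_cmult: "tinv T k C \<Longrightarrow> smb \<phi> \<Longrightarrow> T (\<lambda>x. a * \<phi> x) = (\<lambda>x. a * T \<phi> x)"
  using tinv_lin[of T k C \<phi> \<phi> a 0] by simp

lemma tinv_add: "tinv T k C \<Longrightarrow> smb \<phi> \<Longrightarrow> smb \<psi> \<Longrightarrow> T (\<lambda>x. \<phi> x + \<psi> x) = (\<lambda>x. T \<phi> x + T \<psi> x)"
  using tinv_lin[of T k C \<phi> \<psi> 1 1] by simp

lemma tinv_diff: "tinv T k C \<Longrightarrow> smb \<phi> \<Longrightarrow> smb \<psi> \<Longrightarrow> T (\<lambda>x. \<phi> x - \<psi> x) = (\<lambda>x. T \<phi> x - T \<psi> x)"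
  using tinv_lin[of T k C \<phi> \<psi> 1 "-1"] by simp

lemma tinv_sum_arg:
  "tinv T k C \<Longrightarrow> (\<And>a. a \<in> S \<Longrightarrow> smb (f a)) \<Longrightarrow> T (\<lambda>x. \<Sum>a\<in>S. f a x) = (\<lambda>x. \<Sum>a\<in>S. T (f a) x)"
proof (induction S rule: infinite_finite_induct)
  case (insert b S)
  then show ?case using tinv_add[of T k C "f b" "\<lambda>x. \<Sum>a\<in>S. f a x"] by (simp add: smb_sum)
qed (auto simp: tinv_zero)

text \<open>The partial derivative of the remainder is the remainder of the partial derivative, so
  the quadratic bound holds at every order. An operator of order \<open>k\<close> can then be
  applied to a remainder.\<close>

lemma taylor_remainder_bd:
  fixes \<phi> :: "real^'n::finite \<Rightarrow> real"
  assumes "smb \<phi>" "bd (k + 2) B \<phi>"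
  shows "bd k ((real CARD('n))\<^sup>2 * B * (norm y)\<^sup>2)
    (\<lambda>z. \<phi> (z + y) - \<phi> z - (\<Sum>i\<in>UNIV. y$i * partial i \<phi> z))"
  using assms
proof (induction k arbitrary: \<phi>)
  case 0 then show ?case using taylor2_bound[of \<phi> B _ y] by (simp add: numeral_2_eq_2)
next
  case (Suc k)
  have s: "smb \<phi>" by fact
  have "bd 2 B \<phi>" using Suc.prems(2) by (rule bd_le) simp
  note t = taylor2_bound[OF s this, of _ y]
  have "partial j (\<lambda>z. \<phi> (z + y) - \<phi> z - (\<Sum>i\<in>UNIV. y$i * partial i \<phi> z)) =
    (\<lambda>z. partial j \<phi> (z + y) - partial j \<phi> z - (\<Sum>i\<in>UNIV. y$i * partial i (partial j \<phi>) z))" for j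
    using s by (simp add: partial_diff_smb partial_translate smb_intros smb_translate
        partial_sum_smb partial_cmult_smb partial_commute[of \<phi> j])
  then show ?case using t Suc.IH[of "partial _ \<phi>"] Suc.prems by (simp add: smb_partial)
qed

lemma has_derivative_quadratic:
  fixes f :: "'a::real_normed_vector \<Rightarrow> real"
  assumes "bounded_linear D" "\<And>y. \<bar>f (x + y) - f x - D y\<bar> \<le> C * (norm y)\<^sup>2"
  shows "(f has_derivative D) (at x)"
  unfolding has_derivative_at_alt
proof (intro conjI allI impI assms)
  fix e :: real assume e: "0 < e"
  define d where "d = e / (\<bar>C\<bar> + 1)"
  have "norm (f y - f x - D (y - x)) \<le> e * norm (y - x)" if "norm (y - x) < d" for y
  proof -
    have "norm (f y - f x - D (y - x)) \<le> C * (norm (y - x))\<^sup>2"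
      using assms(2)[of "y - x"] by simp
    also have "\<dots> \<le> (\<bar>C\<bar> + 1) * norm (y - x) * norm (y - x)"
      by (simp add: power2_eq_square mult.assoc mult_right_mono)
    also have "\<dots> \<le> e * norm (y - x)"
      using that e by (intro mult_right_mono) (simp_all add: d_def field_simps less_imp_le)
    finally show ?thesis .
  qed
  then show "\<exists>d>0. \<forall>y. norm (y - x) < d \<longrightarrow> norm (f y - f x - D (y - x)) \<le> e * norm (y - x)"
    using e by (intro exI[of _ d]) (auto simp: d_def)
qed

lemma bounded_linear_component_sum: "bounded_linear (\<lambda>y::real^'n::finite. \<Sum>i\<in>UNIV. y$i * g i)"
  by (intro bounded_linear_sum bounded_linear_mult_const bounded_linear_vec_nth)

text \<open>Apply \<open>T\<close> to the Taylor remainder of \<open>\<phi>\<close> for the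
  increment \<open>y\<close>. By linearity and translation invariance the result is the increment of
  \<open>T \<phi>\<close> minus the candidate differential built from the
  \<open>T (partial i \<phi>)\<close>, and the bound of order \<open>k\<close> makes it quadratic in
  \<open>y\<close>. Smoothness of \<open>T \<phi>\<close> and commutation with
  \<open>partial\<close> are thus obtained once for all operators.\<close>

lemma tinvI:
  fixes T :: "(real^'n::finite \<Rightarrow> real) \<Rightarrow> (real^'n \<Rightarrow> real)"
  assumes C: "0 \<le> C"
    and lin: "\<And>\<phi> \<psi> a b. smb \<phi> \<Longrightarrow> smb \<psi> \<Longrightarrow>
      T (\<lambda>x. a * \<phi> x + b * \<psi> x) = (\<lambda>x. a * T \<phi> x + b * T \<psi> x)"
    and tr: "\<And>\<phi> y. smb \<phi> \<Longrightarrow> T (\<lambda>z. \<phi> (z + y)) = (\<lambda>z. T \<phi> (z + y))"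
    and bnd: "\<And>\<phi> B x. smb \<phi> \<Longrightarrow> bd k B \<phi> \<Longrightarrow> \<bar>T \<phi> x\<bar> \<le> C * B"
  shows "tinv T k C"
proof -
  have z: "T (\<lambda>x. 0) = (\<lambda>x. 0)" using lin[OF smb_const smb_const, of 0 0 0 0] by simp
  have sm: "T (\<lambda>x. \<Sum>i\<in>S. a i * f i x) = (\<lambda>x. \<Sum>i\<in>S. a i * T (f i) x)"
    if "finite S" "\<And>i. smb (f i)" for S a and f :: "'n \<Rightarrow> _"
    using that(1)
  proof (induction S)
    case (insert i S)
    then show ?case using lin[OF that(2)[of i] smb_sum[of S "\<lambda>i x. a i * f i x"], of "a i" 1] that(2)
      by (simp add: smb_cmult)
  qed (simp add: z)
  have der: "(T \<phi> has_derivative (\<lambda>y. \<Sum>i\<in>UNIV. y$i * T (partial i \<phi>) x)) (at x)" if s: "smb \<phi>" for \<phi> x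
  proof -
    obtain B where B: "bd (k + 2) B \<phi>" using smb_bd[OF s] by blast
    have "T \<phi> (x + y) - T \<phi> x - (\<Sum>i\<in>UNIV. y$i * T (partial i \<phi>) x) =
       T (\<lambda>z. \<phi> (z + y) - \<phi> z - (\<Sum>i\<in>UNIV. y$i * partial i \<phi> z)) x" for y
    proof -
      have s2: "smb (\<lambda>z. \<Sum>i\<in>UNIV. y$i * partial i \<phi> z)" by (intro smb_intros s)
      have "T (\<lambda>z. \<phi> (z + y) - \<phi> z - (\<Sum>i\<in>UNIV. y$i * partial i \<phi> z)) =
         (\<lambda>x. T (\<lambda>z. \<phi> (z + y) - \<phi> z) x - T (\<lambda>z. \<Sum>i\<in>UNIV. y$i * partial i \<phi> z) x)"
        using lin[OF _ s2, of "\<lambda>z. \<phi> (z + y) - \<phi> z" 1 "-1"] by (simp add: smb_intros smb_translate s)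
      moreover have "T (\<lambda>z. \<phi> (z + y) - \<phi> z) = (\<lambda>x. T \<phi> (x + y) - T \<phi> x)"
        using lin[OF smb_translate[OF s, of y] s, of 1 "-1"] tr[OF s, of y] by simp
      ultimately show ?thesis using sm[of UNIV "\<lambda>i. partial i \<phi>" "\<lambda>i. y$i"] s by (simp add: smb_partial)
    qed
    then have "\<bar>T \<phi> (x + y) - T \<phi> x - (\<Sum>i\<in>UNIV. y$i * T (partial i \<phi>) x)\<bar>
        \<le> (C * (real CARD('n))\<^sup>2 * B) * (norm y)\<^sup>2" for y
      using bnd[OF _ taylor_remainder_bd[OF s B, of y], of x]
      by (simp add: smb_intros smb_translate s mult.assoc)
    then show ?thesis by (intro has_derivative_quadratic bounded_linear_component_sum)
  qed
  have pc: "partial i (T \<phi>) = T (partial i \<phi>)" if "smb \<phi>" for i \<phi>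
    by (intro ext partialI der that)
  have "smb (T \<phi>)" if "smb \<phi>" for \<phi>
  proof (rule smb_coinduct[of _ "T ` {\<phi>. smb \<phi>}"], use that in blast, safe)
    fix \<phi> :: "real^'n \<Rightarrow> real" and x i assume s: "smb \<phi>"
    obtain B where "bd k B \<phi>" using smb_bd[OF s] by blast
    then show "bounded (range (T \<phi>))" using bnd[OF s] by (auto simp: bounded_range_real)
    show "T \<phi> differentiable at x" using der[OF s] differentiable_def by blast
    show "partial i (T \<phi>) \<in> T ` {\<phi>. smb \<phi>}" using pc[OF s] smb_partial[OF s] by blast
  qed
  then show ?thesis using C lin tr bnd pc by (auto simp: tinv_def)
qed

lemma tinv_bd: "tinv T k C \<Longrightarrow> smb \<phi> \<Longrightarrow> bd (n + k) B \<phi> \<Longrightarrow> bd n (C * B) (T \<phi>)"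
proof (induction n arbitrary: \<phi>)
  case (Suc n)
  have "bd k B \<phi>" using Suc.prems(3) by (rule bd_le) simp
  then show ?case using Suc by (simp add: tinv_bound tinv_partial_commute smb_partial)
qed (simp add: tinv_bound)

text \<open>The qualitative part of \<open>tinv\<close> does not involve the bound. It can be
  established with a crude one, such as \<open>2 / h\<close> for a difference quotient, which is
  then exchanged for a bound uniform in \<open>h\<close> at the price of derivatives.\<close>

lemma tinv_improve:
  assumes "tinv T k C" "0 \<le> D" "\<And>\<phi> B x. smb \<phi> \<Longrightarrow> bd j B \<phi> \<Longrightarrow> \<bar>T \<phi> x\<bar> \<le> D * B"
  shows "tinv T j D"
  using assms unfolding tinv_def by blast

section \<open>Elementary operators and their combinations\<close>

lemma tinv_id: "tinv (\<lambda>\<phi>. \<phi>) 0 1"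
  by (rule tinvI) auto

lemma tinv_shiftop: "tinv (\<lambda>\<phi> x. \<phi> (x + y)) 0 1"
  by (rule tinvI) (auto simp: add.commute add.left_commute)

lemma tinv_partial: "tinv (partial i) 1 1"
  by (rule tinvI)
     (auto simp: partial_add_smb partial_cmult_smb partial_translate smb_cmult)

lemma tinv_comp:
  assumes T: "tinv T k C" and S: "tinv S j D"
  shows "tinv (\<lambda>\<phi>. T (S \<phi>)) (k + j) (C * D)"
proof -
  have "\<bar>T (S \<phi>) x\<bar> \<le> C * D * B" if "smb \<phi>" "bd (k + j) B \<phi>" for \<phi> B x
    using tinv_bound[OF T tinv_smb[OF S that(1)] tinv_bd[OF S that]] by (simp add: mult.assoc)
  then show ?thesis
    using tinv_nonneg[OF T] tinv_nonneg[OF S]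
    by (auto simp: tinv_def[of "\<lambda>\<phi>. T (S \<phi>)"] tinv_lin[OF S] tinv_lin[OF T] tinv_smb[OF S] tinv_smb[OF T]
        tinv_translate[OF S] tinv_translate[OF T] tinv_partial_commute[OF S] tinv_partial_commute[OF T]
        smb_partial)
qed

lemma tinv_scale:
  assumes T: "tinv T k C"
  shows "tinv (\<lambda>\<phi> x. a * T \<phi> x) k (\<bar>a\<bar> * C)"
proof (rule tinvI)
  show "\<bar>a * T \<phi> x\<bar> \<le> \<bar>a\<bar> * C * B" if "smb \<phi>" "bd k B \<phi>" for \<phi> B x
    using tinv_bound[OF T that, of x] by (simp add: abs_mult mult.assoc mult_left_mono)
  show "(\<lambda>x. a * T (\<lambda>z. \<phi> (z + y)) x) = (\<lambda>z. a * T \<phi> (z + y))" if "smb \<phi>" for \<phi> y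
    by (simp add: tinv_translate[OF T that])
qed (use T in \<open>auto simp: tinv_lin[OF T] tinv_nonneg algebra_simps\<close>)

lemma tinv_plus:
  assumes T: "tinv T k C" and S: "tinv S k D"
  shows "tinv (\<lambda>\<phi> x. T \<phi> x + S \<phi> x) k (C + D)"
proof (rule tinvI)
  show "\<bar>T \<phi> x + S \<phi> x\<bar> \<le> (C + D) * B" if "smb \<phi>" "bd k B \<phi>" for \<phi> B x
    using tinv_bound[OF T that, of x] tinv_bound[OF S that, of x] by (simp add: distrib_right)
  show "(\<lambda>x. T (\<lambda>z. \<phi> (z + y)) x + S (\<lambda>z. \<phi> (z + y)) x) = (\<lambda>z. T \<phi> (z + y) + S \<phi> (z + y))"
    if "smb \<phi>" for \<phi> y
    by (simp add: tinv_translate[OF T that] tinv_translate[OF S that])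
qed (use T S in \<open>auto simp: tinv_lin[OF T] tinv_lin[OF S] tinv_nonneg algebra_simps\<close>)

lemma tinv_null: "tinv (\<lambda>\<phi> x. 0) k 0"
  by (rule tinvI) auto

lemma tinv_sum:
  "finite S \<Longrightarrow> (\<And>a. a \<in> S \<Longrightarrow> tinv (T a) k (C a)) \<Longrightarrow> tinv (\<lambda>\<phi> x. \<Sum>a\<in>S. T a \<phi> x) k (\<Sum>a\<in>S. C a)"
  by (induction S rule: finite_induct) (auto intro: tinv_null tinv_plus)

definition dir :: "real^'n::finite \<Rightarrow> (real^'n \<Rightarrow> real) \<Rightarrow> real^'n \<Rightarrow> real" where
  "dir l \<phi> x = (\<Sum>i\<in>UNIV. l$i * partial i \<phi> x)"

lemma tinv_dir: "tinv (dir (l::real^'n::finite)) 1 (real CARD('n) * norm l)"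
proof (rule tinv_improve)
  show "tinv (dir l) 1 (\<Sum>i\<in>UNIV. \<bar>l$i\<bar> * 1)"
    unfolding dir_def by (intro tinv_sum tinv_scale tinv_partial) auto
  show "\<bar>dir l \<phi> x\<bar> \<le> real CARD('n) * norm l * B" if "bd 1 B \<phi>" for \<phi> B x
    unfolding dir_def using that by (intro sum_component_le) auto
qed simp

lemma tinv_fd:
  fixes l :: "real^'n::finite"
  assumes "0 < h"
  shows "tinv (fd h l) 1 (real CARD('n) * norm l)"
proof (rule tinv_improve)
  have "tinv (\<lambda>\<phi> x. (1/h) * \<phi> (x + h *\<^sub>R l) + (- 1/h) * \<phi> x) 0 (\<bar>1/h\<bar> * 1 + \<bar>- 1/h\<bar> * 1)"
    by (intro tinv_plus tinv_scale tinv_id tinv_shiftop)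
  then show "tinv (fd h l) 0 (\<bar>1/h\<bar> * 1 + \<bar>- 1/h\<bar> * 1)"
    unfolding fd_def[abs_def] by (simp add: diff_divide_distrib)
  show "\<bar>fd h l \<phi> x\<bar> \<le> real CARD('n) * norm l * B" if "smb \<phi>" "bd 1 B \<phi>" for \<phi> B x
    using increment_bound_smb[OF that, of x "h *\<^sub>R l"] assms
    by (simp add: fd_def abs_mult field_simps)
qed simp

lemma tinv_commute_translate_partial:
  assumes T: "tinv T k C" and s: "smb \<phi>"
  shows "T (\<lambda>x. a * (\<phi> (x + y) - \<phi> x)) = (\<lambda>x. a * (T \<phi> (x + y) - T \<phi> x))"
    "T (\<lambda>x. a * partial i \<phi> x) = (\<lambda>x. a * partial i (T \<phi>) x)"
  by (simp_all add: tinv_cmult[OF T] tinv_diff[OF T] tinv_translate[OF T] smb_diff smb_translate s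
      smb_partial tinv_partial_commute[OF T s])

lemma tinv_commute_fd: "tinv T k C \<Longrightarrow> smb \<phi> \<Longrightarrow> T (fd h l \<phi>) = fd h l (T \<phi>)"
  using tinv_commute_translate_partial(1)[of T k C \<phi> "1/h" "h *\<^sub>R l"]
  by (simp add: fd_def[abs_def])

lemma tinv_dir_pow: "tinv (dir (l::real^'n::finite) ^^ j) j ((real CARD('n) * norm l) ^ j)"
proof (induction j)
  case 0 then show ?case using tinv_id by (simp add: id_def)
next
  case (Suc j)
  then show ?case using tinv_comp[OF tinv_dir[of l] Suc] by (simp add: o_def)
qed

section \<open>Limits of sequences of smooth functions\<close>

primrec cvg :: "nat \<Rightarrow> (nat \<Rightarrow> real^'n::finite \<Rightarrow> real) \<Rightarrow> (real^'n \<Rightarrow> real) \<Rightarrow> bool" where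
  "cvg 0 F \<phi> \<longleftrightarrow> uniform_limit UNIV F \<phi> sequentially"
| "cvg (Suc n) F \<phi> \<longleftrightarrow> uniform_limit UNIV F \<phi> sequentially \<and> (\<forall>x. \<phi> differentiable (at x)) \<and>
     (\<forall>i. cvg n (\<lambda>j. partial i (F j)) (partial i \<phi>))"

definition ucauchy :: "nat \<Rightarrow> (nat \<Rightarrow> real^'n::finite \<Rightarrow> real) \<Rightarrow> bool" where
  "ucauchy n F \<longleftrightarrow> (\<forall>e>0. \<exists>N. \<forall>i\<ge>N. \<forall>j\<ge>N. bd n e (\<lambda>x. F i x - F j x))"

lemma cvg_uniform: "cvg n F \<phi> \<Longrightarrow> uniform_limit UNIV F \<phi> sequentially"
  by (cases n) auto

lemma cvg_pointwise: "cvg n F \<phi> \<Longrightarrow> (\<lambda>j. F j x) \<longlonglongrightarrow> \<phi> x"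
  by (rule tendsto_uniform_limitI[OF cvg_uniform]) auto

lemma cvg_bd: "cvg n F \<phi> \<Longrightarrow> (\<And>j. bd n B (F j)) \<Longrightarrow> bd n B \<phi>"
proof (induction n arbitrary: F \<phi>)
  case 0
  have "\<bar>\<phi> x\<bar> \<le> B" for x
    by (rule LIMSEQ_le_const2[OF tendsto_rabs[OF cvg_pointwise[OF 0(1), of x]]])
       (use 0(2) in auto)
  then show ?case by simp
next
  case (Suc n)
  have "\<bar>\<phi> x\<bar> \<le> B" for x
    by (rule LIMSEQ_le_const2[OF tendsto_rabs[OF cvg_pointwise[OF Suc.prems(1), of x]]])
       (use Suc.prems(2) bd_D0 in blast)
  moreover have "bd n B (partial i \<phi>)" for i
    by (rule Suc.IH[of "\<lambda>j. partial i (F j)"]) (use Suc.prems in simp_all)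
  ultimately show ?case by simp
qed

text \<open>Completeness for the norms described by \<open>bd\<close>. The induction hypothesis
  supplies uniform limits of the partial derivatives; the theorem on differentiating a sequence
  identifies them with the partial derivatives of the limit.\<close>

lemma cvg_exists:
  "(\<And>j. smb (F j)) \<Longrightarrow> ucauchy n F \<Longrightarrow> \<exists>\<phi>. cvg n F \<phi>"
proof (induction n arbitrary: F)
  case 0
  have "uniformly_Cauchy_on UNIV F"
    unfolding uniformly_Cauchy_on_def dist_real_def
  proof (intro allI impI)
    fix e :: real assume "0 < e"
    then obtain N where "\<forall>i\<ge>N. \<forall>j\<ge>N. bd 0 (e/2) (\<lambda>x. F i x - F j x)"
      using 0(2) unfolding ucauchy_def by (meson half_gt_zero)
    then have "\<forall>x\<in>UNIV. \<forall>m\<ge>N. \<forall>n\<ge>N. \<bar>F m x - F n x\<bar> \<le> e/2" by simp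
    moreover have "e/2 < e" using \<open>0 < e\<close> by simp
    ultimately show "\<exists>M. \<forall>x\<in>UNIV. \<forall>m\<ge>M. \<forall>n\<ge>M. \<bar>F m x - F n x\<bar> < e"
      using le_less_trans by blast
  qed
  then have "uniformly_convergent_on UNIV F" by (rule Cauchy_uniformly_convergent)
  then show ?case by (auto simp: uniformly_convergent_on_def)
next
  case (Suc n)
  have c0: "ucauchy 0 F" using Suc.prems(2) unfolding ucauchy_def by (meson bd_le le0)
  have "uniformly_Cauchy_on UNIV F"
    unfolding uniformly_Cauchy_on_def dist_real_def
  proof (intro allI impI)
    fix e :: real assume "0 < e"
    then obtain N where "\<forall>i\<ge>N. \<forall>j\<ge>N. bd 0 (e/2) (\<lambda>x. F i x - F j x)"
      using c0 unfolding ucauchy_def by (meson half_gt_zero)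
    then have "\<forall>x\<in>UNIV. \<forall>m\<ge>N. \<forall>n\<ge>N. \<bar>F m x - F n x\<bar> \<le> e/2" by simp
    moreover have "e/2 < e" using \<open>0 < e\<close> by simp
    ultimately show "\<exists>M. \<forall>x\<in>UNIV. \<forall>m\<ge>M. \<forall>n\<ge>M. \<bar>F m x - F n x\<bar> < e"
      using le_less_trans by blast
  qed
  then obtain \<phi> where \<phi>: "uniform_limit UNIV F \<phi> sequentially"
    using Cauchy_uniformly_convergent by (auto simp: uniformly_convergent_on_def)
  have "\<exists>g. cvg n (\<lambda>j. partial i (F j)) g" for i
  proof (rule Suc.IH)
    have "ucauchy n (\<lambda>j. partial i (F j))"
      unfolding ucauchy_def
    proof (intro allI impI)
      fix e :: real assume "0 < e"
      then obtain N where N: "\<forall>k\<ge>N. \<forall>j\<ge>N. bd (Suc n) e (\<lambda>x. F k x - F j x)"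
        using Suc.prems(2) unfolding ucauchy_def by blast
      have "bd n e (\<lambda>x. partial i (F k) x - partial i (F j) x)" if "N \<le> k" "N \<le> j" for k j
        using bd_partial[OF N[rule_format, OF that], of i] by (simp add: partial_diff_smb Suc.prems(1))
      then show "\<exists>N. \<forall>k\<ge>N. \<forall>j\<ge>N. bd n e (\<lambda>x. partial i (F k) x - partial i (F j) x)" by blast
    qed
    then show "ucauchy n (\<lambda>j. partial i (F j))" .
  qed (simp add: Suc.prems(1) smb_partial)
  then obtain g where g: "\<And>i. cvg n (\<lambda>j. partial i (F j)) (g i)" by metis
  have "\<exists>\<psi>. \<forall>x\<in>UNIV. (\<lambda>j. F j x) \<longlonglongrightarrow> \<psi> x \<and>
     (\<psi> has_derivative (\<lambda>y. \<Sum>i\<in>UNIV. y$i * g i x)) (at x within UNIV)"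
  proof (rule has_derivative_sequence[where f' = "\<lambda>j x y. \<Sum>i\<in>UNIV. y$i * partial i (F j) x"])
    fix e :: real assume e: "0 < e"
    \<comment> \<open>A deviation \<open>e'\<close> of every partial derivative changes the
      differential at \<open>y\<close> by at most \<open>CARD('a) * norm y * e'\<close>.\<close>
    define e' where "e' = e / real CARD('a)"
    have e': "0 < e'" using e by (simp add: e'_def)
    have "\<forall>\<^sub>F j in sequentially. \<forall>i. \<forall>x. \<bar>partial i (F j) x - g i x\<bar> < e'"
      using e' cvg_uniform[OF g] unfolding uniform_limit_iff dist_real_def
      by (auto intro!: eventually_all_finite)
    then show "\<forall>\<^sub>F j in sequentially. \<forall>x\<in>UNIV. \<forall>y.
        norm ((\<Sum>i\<in>UNIV. y$i * partial i (F j) x) - (\<Sum>i\<in>UNIV. y$i * g i x)) \<le> e * norm y"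
    proof eventually_elim
      case (elim j)
      have "\<bar>\<Sum>i\<in>UNIV. y$i * (partial i (F j) x - g i x)\<bar> \<le> real CARD('a) * norm y * e'" for x y
        using elim by (intro sum_component_le) (auto intro: less_imp_le)
      then show ?case by (simp add: e'_def sum_subtractf[symmetric] right_diff_distrib mult.commute)
    qed
  qed (auto intro: smb_has_derivative Suc.prems(1) tendsto_uniform_limitI[OF \<phi>] UNIV_I)
  then obtain \<psi> where \<psi>: "\<And>x. (\<lambda>j. F j x) \<longlonglongrightarrow> \<psi> x"
     "\<And>x. (\<psi> has_derivative (\<lambda>y. \<Sum>i\<in>UNIV. y$i * g i x)) (at x)" by auto
  have "\<psi> = \<phi>"
    using \<psi>(1) tendsto_uniform_limitI[OF \<phi>] LIMSEQ_unique by blast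
  moreover have "partial i \<psi> = g i" for i
    by (intro ext partialI \<psi>)
  ultimately have "cvg (Suc n) F \<phi>"
    using \<phi> g \<psi>(2) by (auto simp: differentiable_def)
  then show ?case by blast
qed

lemma cvg_foldr:
  "cvg n F \<phi> \<Longrightarrow> length is \<le> n \<Longrightarrow> cvg (n - length is) (\<lambda>j. foldr partial is (F j)) (foldr partial is \<phi>)"
\<comment> \<open>\<open>foldr\<close> applies the last entry of the list first, and the recursion
  of \<open>cvg\<close> peels off the derivative that acts first; hence the induction from the right
  end.\<close>
proof (induction "is" arbitrary: n F \<phi> rule: rev_induct)
  case (snoc i "is")
  then obtain n' where n: "n = Suc n'" by (cases n) auto
  then show ?case using snoc.IH[of n' "\<lambda>j. partial i (F j)" "partial i \<phi>"] snoc.prems by simp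
qed simp

lemma smb_foldr: "smb \<phi> \<Longrightarrow> smb (foldr partial is \<phi>)"
  by (induction "is") (auto intro: smb_partial)

lemma bd_foldr: "bd n B \<phi> \<Longrightarrow> length is \<le> n \<Longrightarrow> bd (n - length is) B (foldr partial is \<phi>)"
proof (induction "is" arbitrary: n \<phi> rule: rev_induct)
  case (snoc i "is")
  then obtain n' where n: "n = Suc n'" by (cases n) auto
  then show ?case using snoc.IH[of n' "partial i \<phi>"] snoc.prems by simp
qed simp

lemma bd_foldrI:
  "(\<And>is x. length is \<le> n \<Longrightarrow> \<bar>foldr partial is \<phi> x\<bar> \<le> B) \<Longrightarrow> bd n B \<phi>"
proof (induction n arbitrary: \<phi>)
  case 0 show ?case using 0[of "[]"] by simp
next
  case (Suc n)
  have "bd n B (partial i \<phi>)" for i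
  proof (rule Suc.IH)
    fix "is" x assume "length (is :: 'a list) \<le> n"
    then show "\<bar>foldr partial is (partial i \<phi>) x\<bar> \<le> B" using Suc.prems[of "is @ [i]" x] by simp
  qed
  then show ?case using Suc.prems[of "[]"] by simp
qed

lemma cvg_Ck:
  assumes "cvg n F \<phi>" "\<And>j. smb (F j)"
  shows "Ck n \<phi>"
  unfolding Ck_def
proof (intro conjI allI impI)
  fix "is" x assume "length (is :: 'a list) < n"
  then obtain k where "n - length is = Suc k" by (metis Suc_diff_Suc)
  then show "foldr partial is \<phi> differentiable at x"
    using cvg_foldr[OF assms(1), of "is"] \<open>length is < n\<close> by simp
next
  fix "is" assume "length (is :: 'a list) \<le> n"
  then show "continuous_on UNIV (foldr partial is \<phi>)"
    using cvg_uniform[OF cvg_foldr[OF assms(1), of "is"]]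
    by (intro uniform_limit_theorem[where F = sequentially])
       (simp_all add: smb_continuous_on smb_foldr assms(2))
qed

lemma smb_smooth: "smb \<phi> \<Longrightarrow> smooth \<phi>"
  unfolding smooth_def Ck_def
  by (auto intro: smb_continuous_on smb_differentiable smb_foldr)

lemma cvg_smb:
  assumes "\<And>n. cvg n F \<phi>" "\<And>j. smb (F j)"
  shows "smb \<phi>"
proof (rule smb_coinduct[of _ "{\<phi>. \<exists>F. (\<forall>n. cvg n F \<phi>) \<and> (\<forall>j. smb (F j))}"], use assms in blast, safe)
  fix \<psi> x i and F :: "nat \<Rightarrow> real^'a \<Rightarrow> real"
  assume F: "\<forall>n. cvg n F \<psi>" "\<forall>j. smb (F j)"
  show "\<psi> differentiable at x" using F(1) by (metis cvg.simps(2))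
  have "cvg n (\<lambda>j. partial i (F j)) (partial i \<psi>)" for n
    using F(1)[rule_format, of "Suc n"] by simp
  then show "\<exists>F. (\<forall>n. cvg n F (partial i \<psi>)) \<and> (\<forall>j. smb (F j))"
    using F(2) smb_partial by blast
  have "uniform_limit UNIV F \<psi> sequentially" using F(1) cvg_uniform by blast
  then have "\<forall>\<^sub>F j in sequentially. \<forall>x\<in>UNIV. dist (F j x) (\<psi> x) < 1"
    unfolding uniform_limit_iff by (meson zero_less_one)
  then obtain j where j: "\<And>x. dist (F j x) (\<psi> x) < 1"
    by (auto dest!: eventually_happens simp: trivial_limit_sequentially)
  obtain B where B: "\<And>x. \<bar>F j x\<bar> \<le> B"
    using smb_bounded F(2) by (metis bounded_range_real)
  have "\<bar>\<psi> x\<bar> \<le> B + 1" for x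
    using j[of x] B[of x] unfolding dist_real_def by linarith
  then show "bounded (range \<psi>)" by (auto simp: bounded_range_real)
qed

section \<open>The maximum principle and solvability\<close>

text \<open>On the whole space a supremum need not be attained. At a point where \<open>W\<close> is
  within \<open>\<eta>\<close> of it no increment exceeds \<open>\<eta>\<close>, and bounded
  nonnegative coefficients turn this into a bound for the difference operator.\<close>

lemma approximate_maximum:
  fixes W :: "real^'n::finite \<Rightarrow> real"
  assumes bdd: "bdd_above (range W)"
    and a: "\<And>l x. l \<in> S \<Longrightarrow> 0 \<le> a l x \<and> a l x \<le> A l"
    and e: "0 < e"
  shows "\<exists>x. (SUP z. W z) - e \<le> W x \<and> (\<Sum>l\<in>S. a l x * (W (x + y l) - W x)) \<le> e"
proof -
  define s where "s = (\<Sum>l\<in>S. A l)"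
  have s: "0 \<le> s" unfolding s_def using a order_trans by (intro sum_nonneg) blast
  define \<eta> where "\<eta> = e / (1 + s)"
  have \<eta>: "0 < \<eta>" "\<eta> \<le> e" "s * \<eta> \<le> e" using e s by (auto simp: \<eta>_def field_simps)
  obtain x where x: "(SUP z. W z) - \<eta> < W x"
    using less_cSUP_iff[of UNIV W "(SUP z. W z) - \<eta>"] bdd \<eta> by auto
  have "a l x * (W (x + y l) - W x) \<le> A l * \<eta>" if l: "l \<in> S" for l
  proof -
    have "W (x + y l) \<le> (SUP z. W z)" using bdd by (simp add: cSUP_upper)
    then have "W (x + y l) - W x \<le> \<eta>" using x by linarith
    then have "a l x * (W (x + y l) - W x) \<le> a l x * \<eta>"
      using a[OF l] mult_left_mono by blast
    also have "\<dots> \<le> A l * \<eta>" using a[OF l] \<eta> by (simp add: mult_right_mono)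
    finally show ?thesis .
  qed
  then have "(\<Sum>l\<in>S. a l x * (W (x + y l) - W x)) \<le> s * \<eta>"
    unfolding s_def sum_distrib_right by (rule sum_mono)
  then show ?thesis using x \<eta> by (intro exI[of _ x]) auto
qed

lemma maximum_principle_upper:
  fixes u :: "real^'n::finite \<Rightarrow> real"
  assumes bu: "bounded (range u)"
    and a: "\<And>l x. l \<in> S \<Longrightarrow> 0 \<le> a l x \<and> a l x \<le> A l"
    and c: "0 < c0" "\<And>x. c0 \<le> c x"
    and eq: "\<And>x. (\<Sum>l\<in>S. a l x * (u (x + y l) - u x)) - c x * u x + g x = 0"
    and g: "\<And>x. g x \<le> G" and G: "0 \<le> G"
  shows "c0 * u z \<le> G"
proof (rule field_le_epsilon)
  fix e0 :: real assume e0: "0 < e0"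
  define e where "e = e0 / (1 + c0)"
  have e: "0 < e" using e0 c by (simp add: e_def)
  have bdd: "bdd_above (range u)" by (rule bounded_imp_bdd_above[OF bu])
  have uz: "u z \<le> (SUP z. u z)" using bdd by (simp add: cSUP_upper)
  have "\<exists>x. (SUP z. u z) - e \<le> u x \<and> (\<Sum>l\<in>S. a l x * (u (x + y l) - u x)) \<le> e"
    by (rule approximate_maximum[where A = A, OF bdd a e])
  then obtain x where x: "(SUP z. u z) - e \<le> u x" "(\<Sum>l\<in>S. a l x * (u (x + y l) - u x)) \<le> e"
    by blast
  have 1: "c x * u x \<le> G + e" using eq[of x] g[of x] x(2) by linarith
  have "c0 * (u z - e) \<le> G + e"
  \<comment> \<open>Only for a positive value may \<open>c x\<close> be replaced by its lower bound
    \<open>c0\<close>.\<close>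
  proof (cases "u z - e \<le> 0")
    case True
    then have "c0 * (u z - e) \<le> 0" using c by (simp add: mult_nonneg_nonpos)
    then show ?thesis using G e by linarith
  next
    case False
    have "c0 * (u z - e) \<le> c x * u x"
      using c(2)[of x] c(1) False uz x(1) by (intro mult_mono) auto
    then show ?thesis using 1 by linarith
  qed
  moreover have "e * (1 + c0) = e0" using c by (simp add: e_def)
  ultimately show "c0 * u z \<le> G + e0" by (simp add: algebra_simps)
qed

lemma maximum_principle:
  fixes u :: "real^'n::finite \<Rightarrow> real"
  assumes bu: "bounded (range u)"
    and a: "\<And>l x. l \<in> S \<Longrightarrow> 0 \<le> a l x \<and> a l x \<le> A l"
    and c: "0 < c0" "\<And>x. c0 \<le> c x"
    and eq: "\<And>x. (\<Sum>l\<in>S. a l x * (u (x + y l) - u x)) - c x * u x + g x = 0"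
    and g: "\<And>x. \<bar>g x\<bar> \<le> G"
  shows "\<bar>u z\<bar> \<le> G / c0"
proof -
  have G: "0 \<le> G" using g abs_ge_zero order_trans by blast
  have 1: "c0 * u z \<le> G"
    by (rule maximum_principle_upper[OF bu a c eq _ G]) (use g abs_le_D1 in blast)+
  have 2: "c0 * (- u z) \<le> G"
  proof (rule maximum_principle_upper[where u = "\<lambda>x. - u x" and g = "\<lambda>x. - g x"])
    show "bounded (range (\<lambda>x. - u x))" using bu by (simp add: bounded_range_real)
    show "(\<Sum>l\<in>S. a l x * (- u (x + y l) - - u x)) - c x * - u x + - g x = 0" for x
    proof -
      have "(\<Sum>l\<in>S. a l x * (- u (x + y l) - - u x)) = - (\<Sum>l\<in>S. a l x * (u (x + y l) - u x))"
        by (simp add: sum_negf[symmetric] algebra_simps)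
      then show ?thesis using eq[of x] by simp
    qed
    show "- g x \<le> G" for x using g[of x] by linarith
  qed (fact a c G)+
  show ?thesis using 1 2 c by (simp add: abs_le_iff field_simps)
qed

text \<open>With \<open>\<kappa>\<close> the inverse of a bound for the total coefficient, the
  equation reads \<open>u = B u + \<kappa> * g\<close>, where \<open>B\<close> has nonnegative
  weights of total mass at most \<open>\<theta> < 1\<close>. The iterates converge together with all
  derivatives: \<open>partial i\<close> commutes with \<open>B\<close> up to the operator
  \<open>B' i\<close> of order zero, so the derivatives of the increments obey the same recursion
  with a source already known to decay geometrically.\<close>

lemma solution_exists:
  fixes y :: "'l \<Rightarrow> real^'n::finite"
  assumes fin: "finite S"
    and a: "\<And>l. l \<in> S \<Longrightarrow> smb (a l)" "\<And>l x. l \<in> S \<Longrightarrow> 0 \<le> a l x"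
    and c: "smb c" "0 < c0" "\<And>x. c0 \<le> c x" and g: "smb g"
  shows "\<exists>u. smb u \<and> (\<forall>x. (\<Sum>l\<in>S. a l x * (u (x + y l) - u x)) - c x * u x + g x = 0)"
proof -
  have "\<forall>l\<in>S. \<exists>B. \<forall>x. \<bar>a l x\<bar> \<le> B"
    using smb_bounded[OF a(1)] bounded_range_real by blast
  then obtain A where A: "\<And>l x. l \<in> S \<Longrightarrow> \<bar>a l x\<bar> \<le> A l" by metis
  obtain C1 where C1: "\<And>x. \<bar>c x\<bar> \<le> C1"
    using smb_bounded[OF c(1)] bounded_range_real by blast
  define tot where "tot = (\<Sum>l\<in>S. A l) + C1"
  have tot1: "(\<Sum>l\<in>S. a l x) + c x \<le> tot" for x
    unfolding tot_def using A C1 abs_le_D1 by (intro add_mono sum_mono) blast+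
  have sa: "0 \<le> (\<Sum>l\<in>S. a l x)" for x using a(2) by (simp add: sum_nonneg)
  have tot0: "c0 \<le> tot" "0 < tot" using tot1[of 0] sa[of 0] c(2) c(3)[of 0] by auto
  define \<kappa> where "\<kappa> = 1 / tot"
  define \<theta> where "\<theta> = 1 - \<kappa> * c0"
  \<comment> \<open>A rate strictly between \<open>\<theta>\<close> and \<open>1\<close>: sources
    decaying like \<open>\<rho>^j\<close> then give solutions decaying like \<open>\<rho>^j\<close>,
    and the same rate persists for derivatives of all orders.\<close>
  define \<rho> where "\<rho> = 1 - \<kappa> * c0 / 2"
  have \<kappa>: "0 < \<kappa>" using tot0 by (simp add: \<kappa>_def)
  have \<theta>: "0 \<le> \<theta>" "\<theta> < \<rho>" "0 < \<rho>" "\<rho> < 1"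
    using \<kappa> c(2) tot0 by (auto simp: \<theta>_def \<rho>_def \<kappa>_def field_simps)
  define B where "B = (\<lambda>\<phi> x. \<phi> x + \<kappa> * ((\<Sum>l\<in>S. a l x * (\<phi> (x + y l) - \<phi> x)) - c x * \<phi> x))"
  define B' where "B' = (\<lambda>i \<phi> x. \<kappa> * ((\<Sum>l\<in>S. partial i (a l) x * (\<phi> (x + y l) - \<phi> x)) - partial i c x * \<phi> x))"
  have sB: "smb (B \<phi>)" if "smb \<phi>" for \<phi>
    unfolding B_def by (intro smb_intros smb_translate a c that)
  have sB': "smb (B' i \<phi>)" if "smb \<phi>" for i \<phi>
    unfolding B'_def by (intro smb_intros smb_translate a c that)
  have pB: "partial i (B \<phi>) = (\<lambda>x. B (partial i \<phi>) x + B' i \<phi> x)" if s: "smb \<phi>" for i \<phi>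
    unfolding B_def B'_def
    by (simp add: partial_add_smb partial_cmult_smb partial_diff_smb partial_sum_smb partial_mult_smb
        partial_translate smb_intros smb_translate a c s sum.distrib sum_subtractf algebra_simps cong: sum.cong)
  have bB: "\<bar>B \<phi> x\<bar> \<le> \<theta> * M" if M: "\<And>x. \<bar>\<phi> x\<bar> \<le> M" for \<phi> M x
  proof -
    have eq: "B \<phi> x = (1 - \<kappa> * ((\<Sum>l\<in>S. a l x) + c x)) * \<phi> x + \<kappa> * (\<Sum>l\<in>S. a l x * \<phi> (x + y l))"
      by (simp add: B_def algebra_simps sum_subtractf sum_distrib_left sum_distrib_right)
    have pos: "0 \<le> 1 - \<kappa> * ((\<Sum>l\<in>S. a l x) + c x)"
      using tot1[of x] tot0 by (simp add: \<kappa>_def field_simps)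
    have M0: "0 \<le> M" using M abs_ge_zero order_trans by blast
    have 1: "\<bar>(1 - \<kappa> * ((\<Sum>l\<in>S. a l x) + c x)) * \<phi> x\<bar> \<le> (1 - \<kappa> * ((\<Sum>l\<in>S. a l x) + c x)) * M"
      using pos M[of x] by (simp add: abs_mult mult_left_mono)
    have "\<bar>\<Sum>l\<in>S. a l x * \<phi> (x + y l)\<bar> \<le> (\<Sum>l\<in>S. \<bar>a l x * \<phi> (x + y l)\<bar>)" by (rule sum_abs)
    also have "\<dots> \<le> (\<Sum>l\<in>S. a l x * M)"
      using a(2) M by (intro sum_mono) (simp add: abs_mult mult_left_mono)
    finally have 2: "\<bar>\<kappa> * (\<Sum>l\<in>S. a l x * \<phi> (x + y l))\<bar> \<le> \<kappa> * ((\<Sum>l\<in>S. a l x) * M)"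
      using \<kappa> by (simp add: abs_mult sum_distrib_right mult_left_mono)
    have "\<bar>B \<phi> x\<bar> \<le> (1 - \<kappa> * ((\<Sum>l\<in>S. a l x) + c x)) * M + \<kappa> * ((\<Sum>l\<in>S. a l x) * M)"
      unfolding eq using 1 2 abs_triangle_ineq order_trans by (smt (verit))
    also have "\<dots> = M - \<kappa> * c x * M" by (simp add: algebra_simps)
    also have "\<dots> \<le> \<theta> * M"
      using c(3)[of x] \<kappa> M0 by (simp add: \<theta>_def left_diff_distrib mult_right_mono)
    finally show ?thesis .
  qed
  have sup: "\<exists>Z. \<forall>j. bd 0 (Z * \<rho>^j) (z j)"
    if z: "smb (z 0)" "\<And>j. z (Suc j) = (\<lambda>x. B (z j) x + r j x)" "\<And>j. bd 0 (G * \<rho>^j) (r j)" for z r G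
  proof -
    obtain Z0 where Z0: "\<And>x. \<bar>z 0 x\<bar> \<le> Z0"
      using smb_bounded[OF z(1)] bounded_range_real by blast
    \<comment> \<open>Large enough for the initial value and for
      \<open>\<theta> * Z + G \<le> \<rho> * Z\<close>, which closes the induction.\<close>
    define Z where "Z = max Z0 (G / (\<rho> - \<theta>))"
    have Z: "\<theta> * Z + G \<le> \<rho> * Z"
    proof -
      have "G / (\<rho> - \<theta>) \<le> Z" by (simp add: Z_def)
      then show ?thesis using \<theta> by (simp add: field_simps)
    qed
    have "\<bar>z j x\<bar> \<le> Z * \<rho>^j" for j x
    proof (induction j arbitrary: x)
      case 0 then show ?case using Z0[of x] by (simp add: Z_def)
    next
      case (Suc j)
      have "\<bar>z (Suc j) x\<bar> \<le> \<theta> * (Z * \<rho>^j) + G * \<rho>^j"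
      proof -
        have "\<bar>B (z j) x\<bar> \<le> \<theta> * (Z * \<rho>^j)" by (rule bB) (rule Suc.IH)
        moreover have "\<bar>r j x\<bar> \<le> G * \<rho>^j" using z(3)[of j] by simp
        ultimately show ?thesis unfolding z(2) by linarith
      qed
      also have "\<dots> = (\<theta> * Z + G) * \<rho>^j" by (simp add: algebra_simps)
      also have "\<dots> \<le> (\<rho> * Z) * \<rho>^j" using Z \<theta> by (intro mult_right_mono) auto
      finally show ?case by (simp add: mult_ac)
    qed
    then show ?thesis by auto
  qed
  \<comment> \<open>All sources \<open>r\<close> are covered at once because
    \<open>partial i (z j)\<close> has the new source
    \<open>B' i (z j) + partial i (r j)\<close>.\<close>
  have geo: "\<exists>Z. \<forall>j. bd n (Z * \<rho>^j) (z j)"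
    if "\<And>j. smb (z j)" "\<And>j. smb (r j)" "\<And>j. z (Suc j) = (\<lambda>x. B (z j) x + r j x)" "\<And>j. bd n (G * \<rho>^j) (r j)"
    for z r G n
    using that
  proof (induction n arbitrary: z r G)
    case 0 then show ?case using sup[of z r G] by blast
  next
    case (Suc n)
    have "\<And>j. bd n (G * \<rho>^j) (r j)" using Suc.prems(4) bd_SucD by blast
    then have "\<exists>Z. \<forall>j. bd n (Z * \<rho>^j) (z j)"
      by (intro Suc.IH[of z r G] Suc.prems(1-3))
    then obtain Z where Z: "\<And>j. bd n (Z * \<rho>^j) (z j)" by blast
    have "\<And>j. bd 0 (G * \<rho>^j) (r j)" using Suc.prems(4) bd_le by blast
    then have "\<exists>Z. \<forall>j. bd 0 (Z * \<rho>^j) (z j)"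
      by (intro sup[of z r G] Suc.prems(1,3))
    then obtain Z0 where Z0: "\<And>j. bd 0 (Z0 * \<rho>^j) (z j)" by blast
    have "\<exists>W. \<forall>j. bd n (W * \<rho>^j) (partial i (z j))" for i
    proof -
      define r' where "r' = (\<lambda>j x. B' i (z j) x + partial i (r j) x)"
      have "\<forall>l\<in>S. \<exists>D. bd n D (partial i (a l))" using a(1) smb_partial smb_bd by blast
      then obtain D where D: "\<And>l. l \<in> S \<Longrightarrow> bd n (D l) (partial i (a l))" by metis
      obtain E where E: "bd n E (partial i c)" using smb_bd smb_partial c(1) by blast
      define G' where "G' = \<kappa> * ((\<Sum>l\<in>S. 2^n * D l * (Z + Z)) + 2^n * E * Z) + G"
      have "bd n (G' * \<rho>^j) (r' j)" for j
      proof -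
        have "bd n (\<bar>\<kappa>\<bar> * ((\<Sum>l\<in>S. 2^n * D l * (Z * \<rho>^j + Z * \<rho>^j)) + 2^n * E * (Z * \<rho>^j)) + G * \<rho>^j) (r' j)"
          unfolding r'_def B'_def
          by (intro bd_add bd_cmult bd_diff bd_sum bd_mult bd_translate D E Z bd_partial
              smb_intros smb_translate a c Suc.prems)
        then show ?thesis
          using \<kappa> by (simp add: G'_def algebra_simps sum_distrib_left sum_distrib_right)
      qed
      moreover have "partial i (z (Suc j)) = (\<lambda>x. B (partial i (z j)) x + r' j x)" for j
        unfolding Suc.prems(3) r'_def
        by (simp add: partial_add_smb sB pB Suc.prems(1,2) add.assoc)
      moreover have "smb (r' j)" for j unfolding r'_def by (intro smb_intros sB' Suc.prems)
      ultimately show ?thesis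
        by (intro Suc.IH[of "\<lambda>j. partial i (z j)" r' G']) (auto intro: smb_partial Suc.prems)
    qed
    then obtain W where W: "\<And>i j. bd n (W i * \<rho>^j) (partial i (z j))" by metis
    define V where "V = \<bar>Z0\<bar> + (\<Sum>i\<in>UNIV. \<bar>W i\<bar>)"
    have "W i \<le> V" for i
      unfolding V_def using member_le_sum[of i UNIV "\<lambda>i. \<bar>W i\<bar>"] abs_ge_self[of "W i"] abs_ge_zero[of Z0]
      by (simp del: abs_ge_self)
    moreover have "Z0 \<le> V"
    proof -
      have "0 \<le> (\<Sum>i\<in>UNIV. \<bar>W i\<bar>)" by (simp add: sum_nonneg)
      then show ?thesis unfolding V_def using abs_ge_self[of Z0] by linarith
    qed
    ultimately have "W i * \<rho>^j \<le> V * \<rho>^j" "Z0 * \<rho>^j \<le> V * \<rho>^j" for i j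
      using \<theta> by (auto intro: mult_right_mono)
    then have "bd (Suc n) (V * \<rho>^j) (z j)" for j
    proof -
      have "\<bar>z j x\<bar> \<le> V * \<rho>^j" for x
        using Z0[of j] \<open>Z0 * \<rho>^j \<le> V * \<rho>^j\<close> by (meson bd_D0 order_trans)
      then show ?thesis using bd_mono[OF W] \<open>\<And>i. W i * \<rho>^j \<le> V * \<rho>^j\<close> by simp
    qed
    then show ?case by blast
  qed
  define u where "u = rec_nat (\<lambda>x. 0) (\<lambda>_ v x. B v x + \<kappa> * g x)"
  have u0: "u 0 = (\<lambda>x. 0)" and uS: "u (Suc j) = (\<lambda>x. B (u j) x + \<kappa> * g x)" for j
    by (simp_all add: u_def)
  have su: "smb (u j)" for j by (induction j) (auto simp: u0 uS intro!: smb_intros sB g)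
  \<comment> \<open>The increments of the iteration satisfy the homogeneous recursion; their
    geometric decay makes the iterates Cauchy at every order.\<close>
  define z where "z = (\<lambda>j x. u (Suc j) x - u j x)"
  have sz: "smb (z j)" for j unfolding z_def by (intro smb_intros su)
  have zS: "z (Suc j) = (\<lambda>x. B (z j) x + 0)" for j
    unfolding z_def uS[of "Suc j"] unfolding uS[of j]
    by (rule ext) (simp add: B_def algebra_simps sum_subtractf sum.distrib)
  have uc: "ucauchy n u" for n
  proof -
    obtain Z where Z: "\<And>j. bd n (Z * \<rho>^j) (z j)"
      using geo[of z "\<lambda>j x. 0" n 0] sz zS smb_const[of 0] bd_zero[of 0 n] by auto
    have Z0: "0 \<le> Z" using bd_nonneg[OF Z[of 0]] by simp
    have *: "bd n (Z * (\<rho>^j - \<rho>^(j+k)) / (1 - \<rho>)) (\<lambda>x. u (j+k) x - u j x)" for j k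
    proof (induction k)
      case 0 then show ?case by (simp add: bd_zero)
    next
      case (Suc k)
      have "bd n (Z * (\<rho>^j - \<rho>^(j+k)) / (1 - \<rho>) + Z * \<rho>^(j+k)) (\<lambda>x. (u (j+k) x - u j x) + z (j+k) x)"
        by (intro bd_add Suc Z smb_diff su sz)
      moreover have "Z * (\<rho>^j - \<rho>^(j+k)) / (1 - \<rho>) + Z * \<rho>^(j+k) = Z * (\<rho>^j - \<rho>^(j+Suc k)) / (1 - \<rho>)"
        using \<theta> by (simp add: field_simps)
      ultimately show ?case by (simp add: z_def)
    qed
    have **: "bd n (Z * \<rho>^N / (1 - \<rho>)) (\<lambda>x. u i x - u j x)" if "N \<le> j" "j \<le> i" for i j N
    proof -
      have "Z * (\<rho>^j - \<rho>^i) / (1 - \<rho>) \<le> Z * \<rho>^N / (1 - \<rho>)"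
      proof (intro divide_right_mono mult_left_mono)
        have "\<rho>^j \<le> \<rho>^N" "0 \<le> \<rho>^i" using that \<theta> by (auto intro: power_decreasing)
        then show "\<rho>^j - \<rho>^i \<le> \<rho>^N" by linarith
      qed (use Z0 \<theta> in auto)
      then show ?thesis using *[of j "i - j"] that bd_mono by auto
    qed
    show ?thesis
      unfolding ucauchy_def
    proof (intro allI impI)
      fix e :: real assume e: "0 < e"
      have "(\<lambda>N. Z * \<rho>^N / (1 - \<rho>)) \<longlonglongrightarrow> Z * 0 / (1 - \<rho>)"
        using \<theta> by (intro tendsto_intros LIMSEQ_realpow_zero) auto
      then have "\<forall>\<^sub>F N in sequentially. Z * \<rho>^N / (1 - \<rho>) < e"
        using e by (auto intro: order_tendstoD)
      then obtain N where N: "Z * \<rho>^N / (1 - \<rho>) < e"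
        by (auto dest!: eventually_happens simp: trivial_limit_sequentially)
      have "bd n e (\<lambda>x. u i x - u j x)" if "N \<le> i" "N \<le> j" for i j
      proof (cases "j \<le> i")
        case True then show ?thesis using **[of N j i] that N bd_mono less_imp_le by blast
      next
        case False
        then have "bd n e (\<lambda>x. u j x - u i x)" using **[of N i j] that N bd_mono less_imp_le nat_le_linear by blast
        then show ?thesis using bd_minus[of "\<lambda>x. u j x - u i x"] by (simp add: smb_diff su)
      qed
      then show "\<exists>N. \<forall>i\<ge>N. \<forall>j\<ge>N. bd n e (\<lambda>x. u i x - u j x)" by blast
    qed
  qed
  obtain \<phi> where \<phi>: "\<And>n. cvg n u (\<phi> n)" using cvg_exists[OF su uc] by metis
  have "\<phi> n = \<phi> 0" for n
    using cvg_pointwise[OF \<phi>] LIMSEQ_unique by blast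
  then have c\<phi>: "cvg n u (\<phi> 0)" for n using \<phi> by metis
  define v where "v = \<phi> 0"
  have lim: "(\<lambda>j. u j x) \<longlonglongrightarrow> v x" for x using cvg_pointwise[OF c\<phi>] by (simp add: v_def)
  have lim1: "(\<lambda>j. B (u j) x + \<kappa> * g x) \<longlonglongrightarrow> B v x + \<kappa> * g x" for x
    unfolding B_def by (intro tendsto_intros lim)
  have lim2: "(\<lambda>j. B (u j) x + \<kappa> * g x) \<longlonglongrightarrow> v x" for x
    using LIMSEQ_Suc[OF lim[of x]] by (simp add: uS)
  have "\<kappa> * ((\<Sum>l\<in>S. a l x * (v (x + y l) - v x)) - c x * v x + g x) = 0" for x
    using LIMSEQ_unique[OF lim2[of x] lim1[of x]] by (simp add: B_def distrib_left)
  then have "(\<Sum>l\<in>S. a l x * (v (x + y l) - v x)) - c x * v x + g x = 0" for x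
    using \<kappa> unfolding mult_eq_0_iff by blast
  moreover have "smb v" using cvg_smb[OF c\<phi> su] by (simp add: v_def)
  ultimately show ?thesis by blast
qed

section \<open>Leibniz formulas for the generalized differences\<close>

text \<open>All ways to deal the entries of a list to two factors with the order preserved,
  repetitions included, as produced by iterating a product rule.\<close>

fun splits :: "'a list \<Rightarrow> ('a list \<times> 'a list) list" where
  "splits [] = [([], [])]"
| "splits (a # \<kappa>) = map (\<lambda>(\<mu>, \<nu>). (a # \<mu>, \<nu>)) (splits \<kappa>) @ map (\<lambda>(\<mu>, \<nu>). (\<mu>, a # \<nu>)) (splits \<kappa>)"

lemma sum_splits_Cons:
  "(\<Sum>(\<mu>, \<nu>)\<leftarrow>splits (a # \<kappa>). F \<mu> \<nu>) =
    (\<Sum>(\<mu>, \<nu>)\<leftarrow>splits \<kappa>. F (a # \<mu>) \<nu>) + (\<Sum>(\<mu>, \<nu>)\<leftarrow>splits \<kappa>. F \<mu> (a # \<nu>) :: real)"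
  by (simp add: o_def case_prod_unfold)

lemma length_splits: "length (splits \<kappa>) = 2 ^ length \<kappa>"
  by (induction \<kappa>) auto

lemma splits_length: "(\<mu>, \<nu>) \<in> set (splits \<kappa>) \<Longrightarrow> length \<mu> + length \<nu> = length \<kappa>"
  by (induction \<kappa> arbitrary: \<mu> \<nu>) auto

lemma sum_splits_Nil:
  "(\<Sum>(\<mu>, \<nu>)\<leftarrow>splits \<kappa>. if \<mu> = [] then F \<mu> \<nu> else 0) = (F [] \<kappa> :: real)"
proof (induction \<kappa> arbitrary: F)
  case (Cons a \<kappa>)
  show ?case unfolding sum_splits_Cons using Cons[of "\<lambda>\<mu> \<nu>. F \<mu> (a # \<nu>)"]
    by (simp add: case_prod_unfold)
qed simp

lemma splits_prod_list:
  "(\<mu>, \<nu>) \<in> set (splits \<kappa>) \<Longrightarrow> prod_list (map w \<mu>) * prod_list (map w \<nu>) = (prod_list (map w \<kappa>) :: real)"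
  by (induction \<kappa> arbitrary: \<mu> \<nu>) (auto simp: mult.assoc mult.left_commute)

lemma sum_splits_cong:
  "(\<And>\<mu> \<nu>. (\<mu>, \<nu>) \<in> set (splits \<kappa>) \<Longrightarrow> F \<mu> \<nu> = G \<mu> \<nu>) \<Longrightarrow>
    (\<Sum>(\<mu>, \<nu>)\<leftarrow>splits \<kappa>. F \<mu> \<nu>) = (\<Sum>(\<mu>, \<nu>)\<leftarrow>splits \<kappa>. G \<mu> \<nu> :: real)"
  by (intro arg_cong[of _ _ sum_list] map_cong) auto

lemma sum_splits_add:
  "(\<Sum>(\<mu>, \<nu>)\<leftarrow>splits \<kappa>. F \<mu> \<nu> + G \<mu> \<nu>) =
    (\<Sum>(\<mu>, \<nu>)\<leftarrow>splits \<kappa>. F \<mu> \<nu>) + (\<Sum>(\<mu>, \<nu>)\<leftarrow>splits \<kappa>. G \<mu> \<nu> :: real)"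
  by (simp add: case_prod_unfold sum_list_addf)

lemma sum_splits_const_mult:
  "(\<Sum>(\<mu>, \<nu>)\<leftarrow>splits \<kappa>. k * F \<mu> \<nu>) = k * (\<Sum>(\<mu>, \<nu>)\<leftarrow>splits \<kappa>. F \<mu> \<nu> :: real)"
  by (simp add: case_prod_unfold sum_list_const_mult)

lemma sum_list_abs_bound:
  "(\<And>z. z \<in> set xs \<Longrightarrow> \<bar>f z\<bar> \<le> b) \<Longrightarrow> \<bar>sum_list (map f xs)\<bar> \<le> real (length xs) * (b::real)"
proof (induction xs)
  case (Cons a xs)
  have "\<bar>f a\<bar> \<le> b" "\<bar>sum_list (map f xs)\<bar> \<le> real (length xs) * b" using Cons by auto
  then show ?case by (simp add: algebra_simps)
qed simp

lemma sum_splits_bound: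
  assumes "\<And>\<mu> \<nu>. (\<mu>, \<nu>) \<in> set (splits \<kappa>) \<Longrightarrow> \<bar>F \<mu> \<nu>\<bar> \<le> b"
  shows "\<bar>\<Sum>(\<mu>, \<nu>)\<leftarrow>splits \<kappa>. F \<mu> \<nu>\<bar> \<le> 2 ^ length \<kappa> * (b::real)"
  using sum_list_abs_bound[of "splits \<kappa>" "\<lambda>(\<mu>, \<nu>). F \<mu> \<nu>" b] assms
  by (auto simp: length_splits)

section \<open>Sums over tuples\<close>

lemma tuples_0: "tuples 0 S = {[]}"
  by (auto simp: tuples_def)

lemma finite_tuples: "finite S \<Longrightarrow> finite (tuples n S)"
  unfolding tuples_def by (rule finite_lists_length_eq)

lemma sum_tuples_Suc:
  assumes "finite S"
  shows "(\<Sum>\<kappa>\<in>tuples (Suc n) S. F \<kappa>) = (\<Sum>a\<in>S. \<Sum>\<kappa>\<in>tuples n S. F (a # \<kappa>))"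
proof -
  have "tuples (Suc n) S = (\<lambda>(a, \<kappa>). a # \<kappa>) ` (S \<times> tuples n S)"
    by (auto simp: tuples_def length_Suc_conv image_iff)
  moreover have "inj_on (\<lambda>(a, \<kappa>). a # \<kappa>) (S \<times> tuples n S)"
    by (auto simp: inj_on_def)
  ultimately show ?thesis
    by (simp add: sum.reindex sum.cartesian_product case_prod_unfold)
qed

lemma sum_tuples_1: "finite S \<Longrightarrow> (\<Sum>\<kappa>\<in>tuples 1 S. F \<kappa>) = (\<Sum>a\<in>S. F [a])"
  using sum_tuples_Suc[of S F 0] by (simp add: tuples_0)

lemma sum_tuples_prod:
  fixes w :: "'a \<Rightarrow> real"
  assumes "finite S"
  shows "(\<Sum>\<kappa>\<in>tuples n S. prod_list (map w \<kappa>)) = (\<Sum>a\<in>S. w a) ^ n"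
  by (induction n) (simp_all add: tuples_0 sum_tuples_Suc assms sum_distrib_left[symmetric] sum_distrib_right[symmetric])

text \<open>For each of the \<open>n choose j\<close> sets of positions, splitting is a bijection
  between tuples of length \<open>n\<close> and pairs of tuples of lengths \<open>j\<close> and
  \<open>n - j\<close>. In the induction the first entry goes to one side or the other, which is
  Pascal's rule.\<close>

lemma sum_tuples_splits:
  assumes S: "finite S"
  shows "(\<Sum>\<kappa>\<in>tuples n S. \<Sum>(\<mu>, \<nu>)\<leftarrow>splits \<kappa>. if length \<mu> = j then F \<mu> \<nu> else 0) =
    (if j \<le> n then real (n choose j) * (\<Sum>\<mu>\<in>tuples j S. \<Sum>\<nu>\<in>tuples (n - j) S. F \<mu> \<nu>) else 0)"
proof (induction n arbitrary: j F)
  case 0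
  then show ?case by (auto simp: tuples_0)
next
  case (Suc n)
  define T where "T = (\<lambda>n j F. (\<Sum>\<kappa>\<in>tuples n S. \<Sum>(\<mu>, \<nu>)\<leftarrow>splits \<kappa>. if length \<mu> = j then F \<mu> \<nu> else (0::real)))"
  have sumT: "(\<Sum>a\<in>S. T n j (F a)) = T n j (\<lambda>\<mu> \<nu>. \<Sum>a\<in>S. F a \<mu> \<nu>)" for j and F :: "'a \<Rightarrow> 'a list \<Rightarrow> 'a list \<Rightarrow> real"
  proof -
    have *: "(\<Sum>a\<in>S. (\<Sum>(\<mu>, \<nu>)\<leftarrow>xs. if length \<mu> = j then F a \<mu> \<nu> else 0)) =
       (\<Sum>(\<mu>, \<nu>)\<leftarrow>xs. if length \<mu> = j then (\<Sum>a\<in>S. F a \<mu> \<nu>) else 0)" for xs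
      by (induction xs) (auto simp: sum.distrib)
    show ?thesis unfolding T_def by (subst sum.swap) (simp add: *)
  qed
  have "T (Suc n) j F = (\<Sum>a\<in>S. \<Sum>\<kappa>\<in>tuples n S. (\<Sum>(\<mu>, \<nu>)\<leftarrow>splits \<kappa>. if Suc (length \<mu>) = j then F (a # \<mu>) \<nu> else 0)
      + (\<Sum>(\<mu>, \<nu>)\<leftarrow>splits \<kappa>. if length \<mu> = j then F \<mu> (a # \<nu>) else 0))"
    unfolding T_def sum_tuples_Suc[OF S] sum_splits_Cons by simp
  also have "\<dots> = (\<Sum>a\<in>S. \<Sum>\<kappa>\<in>tuples n S. (\<Sum>(\<mu>, \<nu>)\<leftarrow>splits \<kappa>. if Suc (length \<mu>) = j then F (a # \<mu>) \<nu> else 0))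
      + (\<Sum>a\<in>S. T n j (\<lambda>\<mu> \<nu>. F \<mu> (a # \<nu>)))"
    unfolding T_def by (simp only: sum.distrib)
  finally have *: "T (Suc n) j F = (\<Sum>a\<in>S. \<Sum>\<kappa>\<in>tuples n S. (\<Sum>(\<mu>, \<nu>)\<leftarrow>splits \<kappa>. if Suc (length \<mu>) = j then F (a # \<mu>) \<nu> else 0))
      + T n j (\<lambda>\<mu> \<nu>. \<Sum>a\<in>S. F \<mu> (a # \<nu>))" unfolding sumT .
  have IH: "T n j F = (if j \<le> n then real (n choose j) * (\<Sum>\<mu>\<in>tuples j S. \<Sum>\<nu>\<in>tuples (n - j) S. F \<mu> \<nu>) else 0)" for j F
    using Suc.IH[where j = j and F = F] unfolding T_def .
  have "T (Suc n) j F = (if j \<le> Suc n then real (Suc n choose j) * (\<Sum>\<mu>\<in>tuples j S. \<Sum>\<nu>\<in>tuples (Suc n - j) S. F \<mu> \<nu>) else 0)"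
  proof (cases j)
    case 0
    have "(\<Sum>\<nu>\<in>tuples n S. \<Sum>a\<in>S. F [] (a # \<nu>)) = (\<Sum>a\<in>S. \<Sum>\<nu>\<in>tuples n S. F [] (a # \<nu>))"
      by (rule sum.swap)
    then show ?thesis unfolding * IH by (simp add: 0 tuples_0 sum_tuples_Suc[OF S] case_prod_unfold)
  next
    case (Suc i)
    have "(\<Sum>a\<in>S. \<Sum>\<kappa>\<in>tuples n S. (\<Sum>(\<mu>, \<nu>)\<leftarrow>splits \<kappa>. if Suc (length \<mu>) = j then F (a # \<mu>) \<nu> else 0))
       = T n i (\<lambda>\<mu> \<nu>. \<Sum>a\<in>S. F (a # \<mu>) \<nu>)"
      using sumT[of i "\<lambda>a \<mu> \<nu>. F (a # \<mu>) \<nu>"] unfolding T_def Suc by simp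
    also have "\<dots> = (if i \<le> n then real (n choose i) * (\<Sum>\<mu>\<in>tuples i S. \<Sum>\<nu>\<in>tuples (n - i) S. \<Sum>a\<in>S. F (a # \<mu>) \<nu>) else 0)"
      by (rule IH)
    also have "(\<Sum>\<mu>\<in>tuples i S. \<Sum>\<nu>\<in>tuples (n - i) S. \<Sum>a\<in>S. F (a # \<mu>) \<nu>) =
       (\<Sum>\<mu>\<in>tuples j S. \<Sum>\<nu>\<in>tuples (Suc n - j) S. F \<mu> \<nu>)"
    proof -
      have "(\<Sum>\<mu>\<in>tuples i S. \<Sum>\<nu>\<in>tuples (n - i) S. \<Sum>a\<in>S. F (a # \<mu>) \<nu>) =
         (\<Sum>\<mu>\<in>tuples i S. \<Sum>a\<in>S. \<Sum>\<nu>\<in>tuples (n - i) S. F (a # \<mu>) \<nu>)"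
        by (intro sum.cong refl sum.swap)
      also have "\<dots> = (\<Sum>a\<in>S. \<Sum>\<mu>\<in>tuples i S. \<Sum>\<nu>\<in>tuples (n - i) S. F (a # \<mu>) \<nu>)"
        by (rule sum.swap)
      finally show ?thesis by (simp add: Suc sum_tuples_Suc[OF S])
    qed
    finally have 1: "(\<Sum>a\<in>S. \<Sum>\<kappa>\<in>tuples n S. (\<Sum>(\<mu>, \<nu>)\<leftarrow>splits \<kappa>. if Suc (length \<mu>) = j then F (a # \<mu>) \<nu> else 0))
       = (if i \<le> n then real (n choose i) * (\<Sum>\<mu>\<in>tuples j S. \<Sum>\<nu>\<in>tuples (Suc n - j) S. F \<mu> \<nu>) else 0)" .
    have 2: "T n j (\<lambda>\<mu> \<nu>. \<Sum>a\<in>S. F \<mu> (a # \<nu>)) =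
      (if j \<le> n then real (n choose j) * (\<Sum>\<mu>\<in>tuples j S. \<Sum>\<nu>\<in>tuples (Suc n - j) S. F \<mu> \<nu>) else 0)"
    proof (cases "j \<le> n")
      case True
      have "(\<Sum>\<mu>\<in>tuples j S. \<Sum>\<nu>\<in>tuples (n - j) S. \<Sum>a\<in>S. F \<mu> (a # \<nu>)) =
          (\<Sum>\<mu>\<in>tuples j S. \<Sum>a\<in>S. \<Sum>\<nu>\<in>tuples (n - j) S. F \<mu> (a # \<nu>))"
        by (intro sum.cong refl sum.swap)
      then show ?thesis unfolding IH using True by (simp add: Suc_diff_le sum_tuples_Suc[OF S])
    qed (simp add: IH)
    show ?thesis unfolding * 1 2 by (auto simp: Suc algebra_simps binomial_eq_0 not_le)
  qed
  then show ?case unfolding T_def .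
qed

section \<open>Generalized differences and their product rules\<close>

locale diffs =
  fixes \<Lambda>1 :: "(real^'n::finite) set" and e :: "'n \<Rightarrow> real^'n" and \<tau>0 :: real
    and \<tau> :: "real^'n \<Rightarrow> real" and h :: real
  assumes fin: "finite \<Lambda>1" and h: "0 < h" and \<tau>0: "0 < \<tau>0" and \<tau>: "\<And>l. l \<in> \<Lambda>1 \<Longrightarrow> 0 \<le> \<tau> l"
    and e: "inj e" and disj: "range e \<inter> \<Lambda>1 = {}"
begin

abbreviation \<Lambda> where "\<Lambda> \<equiv> \<Lambda>1 \<union> range e"
abbreviation D where "D \<equiv> dbar \<Lambda>1 e \<tau>0 \<tau> h"
abbreviation Ds where "Ds \<equiv> dbars \<Lambda>1 e \<tau>0 \<tau> h"
abbreviation sh where "sh \<equiv> shift \<Lambda>1 h"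
abbreviation shs where "shs \<equiv> shifts \<Lambda>1 h"
abbreviation Dsq where "Dsq \<equiv> dbar_sq \<Lambda>1 e \<tau>0 \<tau> h"

text \<open>A constant for \<open>D l\<close> as an operator of order one, uniform in
  \<open>h\<close>. It is proportional to \<open>\<tau> l * norm l\<close> on
  \<open>\<Lambda>1\<close>, so that its squares sum to something controlled by the weighted size of
  \<open>\<Lambda>1\<close>.\<close>

definition wt :: "real^'n \<Rightarrow> real" where
  "wt l = (if l \<in> \<Lambda>1 then real CARD('n) * (\<tau> l * norm l) else \<tau>0)"

abbreviation wts where "wts \<mu> \<equiv> prod_list (map wt \<mu>)"

lemma fin\<Lambda>: "finite \<Lambda>" using fin by simp

lemma wt_nonneg: "0 \<le> wt l"
  using \<tau> \<tau>0 by (auto simp: wt_def)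

lemma wts_nonneg: "0 \<le> wts \<mu>"
  by (induction \<mu>) (auto simp: wt_nonneg)

lemma tinv_D: "tinv (D l) 1 (wt l)"
proof (cases "l \<in> \<Lambda>1")
  case True
  have "tinv (\<lambda>\<phi> x. \<tau> l * fd h l \<phi> x) 1 (\<bar>\<tau> l\<bar> * (real CARD('n) * norm l))"
    by (intro tinv_scale tinv_fd h)
  moreover have "D l = (\<lambda>\<phi> x. \<tau> l * fd h l \<phi> x)" "\<bar>\<tau> l\<bar> * (real CARD('n) * norm l) = wt l"
    using True \<tau> by (auto simp: dbar_def fd_def wt_def fun_eq_iff)
  ultimately show ?thesis by simp
next
  case False
  have "tinv (\<lambda>\<phi> x. \<tau>0 * partial (inv e l) \<phi> x) 1 (\<bar>\<tau>0\<bar> * 1)"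
    by (intro tinv_scale tinv_partial)
  moreover have "D l = (\<lambda>\<phi> x. \<tau>0 * partial (inv e l) \<phi> x)" "\<bar>\<tau>0\<bar> * 1 = wt l"
    using False \<tau>0 by (auto simp: dbar_def wt_def fun_eq_iff)
  ultimately show ?thesis by simp
qed

lemma dbars_Nil: "dbars A e' t0 t h' [] \<phi> = \<phi>" by (simp add: dbars_def)
lemma dbars_Cons: "dbars A e' t0 t h' (a # \<mu>) \<phi> = dbar A e' t0 t h' a (dbars A e' t0 t h' \<mu> \<phi>)"
  by (simp add: dbars_def)
lemma dbars_append:
  "dbars A e' t0 t h' (\<mu> @ \<nu>) \<phi> = dbars A e' t0 t h' \<mu> (dbars A e' t0 t h' \<nu> \<phi>)"
  by (simp add: dbars_def)
lemma shifts_Nil: "shifts A h' [] \<phi> = \<phi>" by (simp add: shifts_def)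
lemma shifts_Cons: "shifts A h' (a # \<mu>) \<phi> = shift A h' a (shifts A h' \<mu> \<phi>)"
  by (simp add: shifts_def)

lemma tinv_Ds: "tinv (Ds \<mu>) (length \<mu>) (wts \<mu>)"
proof (induction \<mu>)
  case Nil
  have "Ds [] = (\<lambda>\<phi>. \<phi>)" by (simp add: dbars_Nil fun_eq_iff)
  then show ?case using tinv_id by simp
next
  case (Cons a \<mu>)
  have "Ds (a # \<mu>) = (\<lambda>\<phi>. D a (Ds \<mu> \<phi>))" by (simp add: dbars_Cons fun_eq_iff)
  then show ?case using tinv_comp[OF tinv_D[of a] Cons] by simp
qed

lemma tinv_sh: "tinv (sh l) 0 1"
proof (cases "l \<in> \<Lambda>1")
  case True
  then have "sh l = (\<lambda>\<phi> x. \<phi> (x + h *\<^sub>R l))" by (simp add: shift_def fun_eq_iff)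
  then show ?thesis using tinv_shiftop by simp
next
  case False
  then have "sh l = (\<lambda>\<phi>. \<phi>)" by (simp add: shift_def fun_eq_iff)
  then show ?thesis using tinv_id by simp
qed

lemma tinv_shs: "tinv (shs \<mu>) 0 1"
proof (induction \<mu>)
  case Nil
  have "shs [] = (\<lambda>\<phi>. \<phi>)" by (simp add: shifts_Nil fun_eq_iff)
  then show ?case using tinv_id by simp
next
  case (Cons a \<mu>)
  have "shs (a # \<mu>) = (\<lambda>\<phi>. sh a (shs \<mu> \<phi>))" by (simp add: shifts_Cons fun_eq_iff)
  then show ?case using tinv_comp[OF tinv_sh[of a] Cons] by simp
qed

lemma tinv_commute_D: "tinv T k C \<Longrightarrow> smb \<phi> \<Longrightarrow> T (D l \<phi>) = D l (T \<phi>)"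
  using tinv_commute_translate_partial(1)[of T k C \<phi> "\<tau> l / h" "h *\<^sub>R l"]
    tinv_commute_translate_partial(2)[of T k C \<phi> \<tau>0 "inv e l"]
  by (cases "l \<in> \<Lambda>1") (simp_all add: dbar_def[abs_def])

lemma tinv_commute_Ds: "tinv T k C \<Longrightarrow> smb \<phi> \<Longrightarrow> T (Ds \<mu> \<phi>) = Ds \<mu> (T \<phi>)"
  by (induction \<mu>) (auto simp: dbars_Nil dbars_Cons tinv_commute_D tinv_smb[OF tinv_Ds])

lemma smb_D: "smb \<phi> \<Longrightarrow> smb (D l \<phi>)" by (rule tinv_smb[OF tinv_D])
lemma smb_Ds: "smb \<phi> \<Longrightarrow> smb (Ds \<mu> \<phi>)" by (rule tinv_smb[OF tinv_Ds])
lemma smb_sh: "smb \<phi> \<Longrightarrow> smb (sh l \<phi>)" by (rule tinv_smb[OF tinv_sh])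
lemma smb_shs: "smb \<phi> \<Longrightarrow> smb (shs \<mu> \<phi>)" by (rule tinv_smb[OF tinv_shs])
lemma smb_fd: "smb \<phi> \<Longrightarrow> smb (fd h l \<phi>)" by (rule tinv_smb[OF tinv_fd[OF h]])

text \<open>The product rule for a forward difference is one-sided: the second factor is shifted
  where the first one is differenced. This is the origin of the shifts in the structural
  inequalities.\<close>

lemma D_mult:
  assumes "smb f" "smb g"
  shows "D l (\<lambda>x. f x * g x) = (\<lambda>x. f x * D l g x + D l f x * sh l g x)"
  using assms by (auto simp: fun_eq_iff dbar_def shift_def partial_mult_smb algebra_simps)

text \<open>The operators \<open>D l\<close> commute on smooth functions, so only the multiset of
  indices matters.\<close>

lemma Ds_split_perm:
  assumes "smb \<phi>" "(\<mu>, \<nu>) \<in> set (splits \<kappa>)"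
  shows "Ds \<kappa> \<phi> = Ds \<mu> (Ds \<nu> \<phi>)"
  using assms(2)
proof (induction \<kappa> arbitrary: \<mu> \<nu>)
  case (Cons a \<kappa>)
  then consider \<mu>' where "\<mu> = a # \<mu>'" "(\<mu>', \<nu>) \<in> set (splits \<kappa>)"
    | \<nu>' where "\<nu> = a # \<nu>'" "(\<mu>, \<nu>') \<in> set (splits \<kappa>)" by auto
  then show ?case
  proof cases
    case 1 then show ?thesis using Cons.IH by (simp add: dbars_Cons)
  next
    case 2
    have "Ds \<mu> (D a (Ds \<nu>' \<phi>)) = D a (Ds \<mu> (Ds \<nu>' \<phi>))"
      by (rule tinv_commute_D[OF tinv_Ds smb_Ds[OF assms(1)]])
    then show ?thesis using Cons.IH[OF 2(2)] 2(1) by (simp add: dbars_Cons)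
  qed
qed (simp add: dbars_Nil)

text \<open>\<open>G \<mu>\<close> stands for an operator whose coefficients have already been
  differenced along \<open>\<mu>\<close>. The hypothesis \<open>DG\<close> is the product rule for
  one further difference, and iterating it distributes \<open>\<kappa>\<close> between coefficients
  and argument. It serves multiplication by \<open>c\<close> as well as the operators
  \<open>L0\<close>.\<close>

lemma Ds_splits:
  assumes G: "\<And>\<mu> \<psi>. smb \<psi> \<Longrightarrow> smb (G \<mu> \<psi>)"
    and DG: "\<And>a \<mu> \<psi>. smb \<psi> \<Longrightarrow> D a (G \<mu> \<psi>) = (\<lambda>x. G \<mu> (D a \<psi>) x + G (a # \<mu>) (sh a \<psi>) x)"
    and u: "smb u"
  shows "Ds \<kappa> (G [] u) x = (\<Sum>(\<mu>, \<nu>)\<leftarrow>splits \<kappa>. G \<mu> (shs \<mu> (Ds \<nu> u)) x)"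
proof (induction \<kappa> arbitrary: x)
  case Nil then show ?case by (simp add: dbars_Nil shifts_Nil)
next
  case (Cons a \<kappa>)
  have "Ds (a # \<kappa>) (G [] u) = D a (\<lambda>x. \<Sum>(\<mu>, \<nu>)\<leftarrow>splits \<kappa>. G \<mu> (shs \<mu> (Ds \<nu> u)) x)"
    unfolding dbars_Cons using Cons by presburger
  also have "\<dots> = (\<lambda>x. \<Sum>(\<mu>, \<nu>)\<leftarrow>splits \<kappa>. D a (G \<mu> (shs \<mu> (Ds \<nu> u))) x)"
  proof -
    have "D a (\<lambda>x. \<Sum>(\<mu>, \<nu>)\<leftarrow>xs. G \<mu> (shs \<mu> (Ds \<nu> u)) x) =
        (\<lambda>x. \<Sum>(\<mu>, \<nu>)\<leftarrow>xs. D a (G \<mu> (shs \<mu> (Ds \<nu> u))) x)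
       \<and> smb (\<lambda>x. \<Sum>(\<mu>, \<nu>)\<leftarrow>xs. G \<mu> (shs \<mu> (Ds \<nu> u)) x)" for xs
    proof (induction xs)
      case Nil then show ?case by (simp add: tinv_zero[OF tinv_D] smb_const)
    next
      case (Cons z xs)
      obtain \<mu> \<nu> where z: "z = (\<mu>, \<nu>)" by (cases z)
      have "smb (G \<mu> (shs \<mu> (Ds \<nu> u)))" by (intro G smb_Ds smb_shs u)
      then show ?case using Cons tinv_add[OF tinv_D] by (simp add: z smb_add)
    qed
    then show ?thesis by blast
  qed
  also have "\<dots> = (\<lambda>x. \<Sum>(\<mu>, \<nu>)\<leftarrow>splits \<kappa>. G \<mu> (shs \<mu> (Ds (a # \<nu>) u)) x + G (a # \<mu>) (shs (a # \<mu>) (Ds \<nu> u)) x)"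
  proof -
    have "D a (G \<mu> (shs \<mu> (Ds \<nu> u))) =
       (\<lambda>x. G \<mu> (shs \<mu> (Ds (a # \<nu>) u)) x + G (a # \<mu>) (shs (a # \<mu>) (Ds \<nu> u)) x)" for \<mu> \<nu>
      by (subst DG) (simp_all add: smb_Ds smb_shs u dbars_Cons shifts_Cons
          tinv_commute_D[OF tinv_shs smb_Ds[OF u], symmetric])
    then show ?thesis by simp
  qed
  finally show ?case unfolding sum_splits_Cons by (simp add: sum_splits_add)
qed

lemma Ds_mult:
  assumes c: "smb c" and u: "smb u"
  shows "Ds \<kappa> (\<lambda>x. c x * u x) x = (\<Sum>(\<mu>, \<nu>)\<leftarrow>splits \<kappa>. Ds \<mu> c x * shs \<mu> (Ds \<nu> u) x)"
  using Ds_splits[of "\<lambda>\<mu> \<psi> x. Ds \<mu> c x * \<psi> x" u \<kappa> x]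
  by (simp add: D_mult smb_mult smb_Ds c u dbars_Nil dbars_Cons)

definition Rop :: "(real^'n \<Rightarrow> real^'n \<Rightarrow> real) \<Rightarrow> (real^'n) list \<Rightarrow> (real^'n \<Rightarrow> real) \<Rightarrow> real^'n \<Rightarrow> real" where
  "Rop r \<mu> \<psi> x = (\<Sum>l\<in>\<Lambda>1. Ds \<mu> (r l) x * fd h l \<psi> x)"

lemma smb_Rop: "(\<And>l. l \<in> \<Lambda>1 \<Longrightarrow> smb (r l)) \<Longrightarrow> smb \<psi> \<Longrightarrow> smb (Rop r \<mu> \<psi>)"
  unfolding Rop_def by (intro smb_intros smb_Ds smb_fd)

lemma D_Rop:
  assumes r: "\<And>l. l \<in> \<Lambda>1 \<Longrightarrow> smb (r l)" and \<psi>: "smb \<psi>"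
  shows "D a (Rop r \<mu> \<psi>) = (\<lambda>x. Rop r \<mu> (D a \<psi>) x + Rop r (a # \<mu>) (sh a \<psi>) x)"
proof -
  have "D a (\<lambda>x. \<Sum>l\<in>\<Lambda>1. Ds \<mu> (r l) x * fd h l \<psi> x) = (\<lambda>x. \<Sum>l\<in>\<Lambda>1. D a (\<lambda>x. Ds \<mu> (r l) x * fd h l \<psi> x) x)"
    by (rule tinv_sum_arg[OF tinv_D]) (intro smb_intros smb_Ds smb_fd r \<psi>)
  also have "\<dots> = (\<lambda>x. \<Sum>l\<in>\<Lambda>1. Ds \<mu> (r l) x * fd h l (D a \<psi>) x + Ds (a # \<mu>) (r l) x * fd h l (sh a \<psi>) x)"
  proof (intro ext sum.cong refl)
    fix l x assume l: "l \<in> \<Lambda>1"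
    show "D a (\<lambda>x. Ds \<mu> (r l) x * fd h l \<psi> x) x =
      Ds \<mu> (r l) x * fd h l (D a \<psi>) x + Ds (a # \<mu>) (r l) x * fd h l (sh a \<psi>) x"
      using D_mult[OF smb_Ds[OF r[OF l]] smb_fd[OF \<psi>], of a \<mu> l]
      by (simp add: dbars_Cons tinv_commute_fd[OF tinv_D \<psi>] tinv_commute_fd[OF tinv_sh \<psi>])
  qed
  finally show ?thesis unfolding Rop_def[abs_def] by (simp add: sum.distrib)
qed

lemma sum_tuples_append:
  "finite S \<Longrightarrow> (\<Sum>\<kappa>\<in>tuples (j + k) S. F \<kappa>) = (\<Sum>\<mu>\<in>tuples j S. \<Sum>\<nu>\<in>tuples k S. F (\<mu> @ \<nu>))"
  by (induction j arbitrary: F) (simp_all add: tuples_0 sum_tuples_Suc)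

end

section \<open>A priori estimates for smooth data\<close>

text \<open>The parameters on which the final constant may depend: \<open>d\<close> is the
  dimension, \<open>s1\<close> and \<open>s2\<close> are the sizes of \<open>\<Lambda>1\<close>
  without and with the weights \<open>\<tau>\<close>, and \<open>Mb\<close> dominates all the
  \<open>M k\<close>. A constant defined from these parameters alone cannot involve
  \<open>h\<close>, \<open>h0\<close>, the coefficients or the number of directions.\<close>

locale cst =
  fixes m :: nat and d \<delta> c0 \<tau>0 K s1 s2 Mb :: real
  assumes \<delta>: "0 < \<delta>" "\<delta> \<le> 1" and c0: "0 < c0" and \<tau>0_pos: "0 < \<tau>0" and K: "1 \<le> K"
    and s1: "0 \<le> s1" and Mb: "0 \<le> Mb" and d: "0 \<le> d"
begin

text \<open>\<open>SS\<close> bounds the sum of the squares of \<open>wt\<close> over all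
  directions; \<open>CR n\<close> belongs to the lower order part of the commutator at order
  \<open>n\<close>, and \<open>CQ\<close> to the quadratic form.\<close>

definition SS :: real where "SS = d\<^sup>2 * s2\<^sup>2 + d * \<tau>0\<^sup>2"
definition CR :: "nat \<Rightarrow> real" where "CR n = 2 ^ n * (Mb + Mb * (d\<^sup>2 * s1\<^sup>2 + d * s1)) + 1"
definition CQ :: real where "CQ = 2 * Mb * d\<^sup>2 * s1\<^sup>2"

lemma SS_nonneg: "0 \<le> SS" using d by (simp add: SS_def)
lemma CR_nonneg: "0 \<le> CR n" using Mb d s1 by (simp add: CR_def)
lemma CQ_nonneg: "0 \<le> CQ" using Mb d s1 by (simp add: CQ_def)

end

text \<open>\<open>S1\<close> and \<open>S2\<close> are the structural inequalities with
  \<open>\<K>\<close> eliminated: \<open>s\<close> and \<open>s'\<close> are upper bounds for its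
  arguments. \<open>S2\<close> is stated for a finite family so that these bound the sums over the
  family. \<open>S1\<close> carries no factor \<open>m\<close>, since it serves order one.\<close>

locale bern = cst m d \<delta> c0 \<tau>0 K s1 s2 Mb + diffs \<Lambda>1 e \<tau>0 \<tau> h
  for m d \<delta> c0 \<tau>0 K s1 s2 Mb and \<Lambda>1 :: "(real^'n::finite) set" and e \<tau> h +
  fixes q p :: "real^'n \<Rightarrow> real^'n \<Rightarrow> real" and c :: "real^'n \<Rightarrow> real"
  assumes d_eq: "d = real CARD('n)"
    and s1_bound: "(\<Sum>l\<in>\<Lambda>1. (norm l)\<^sup>2) \<le> s1\<^sup>2"
    and s2_bound: "(\<Sum>l\<in>\<Lambda>1. (norm (\<tau> l *\<^sub>R l))\<^sup>2) \<le> s2\<^sup>2"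
    and sym: "uminus ` \<Lambda>1 = \<Lambda>1" "\<And>l. l \<in> \<Lambda>1 \<Longrightarrow> q (- l) = q l"
      "\<And>l. l \<in> \<Lambda>1 \<Longrightarrow> p (- l) = (\<lambda>x. - p l x)"
    and smb_qpc: "\<And>l. l \<in> \<Lambda>1 \<Longrightarrow> smb (q l)" "\<And>l. l \<in> \<Lambda>1 \<Longrightarrow> smb (p l)" "smb c"
    and q_bound: "\<And>is x. length is \<le> m \<Longrightarrow> (\<Sum>l\<in>\<Lambda>1. (foldr partial is (q l) x)\<^sup>2) \<le> Mb\<^sup>2"
    and p_bound: "\<And>is x. length is \<le> m \<Longrightarrow> (\<Sum>l\<in>\<Lambda>1. (foldr partial is (p l) x)\<^sup>2) \<le> Mb\<^sup>2"
    and c_bound: "bd m Mb c"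
    and qp: "\<And>l x. l \<in> \<Lambda>1 \<Longrightarrow> 0 \<le> q l x + h * p l x"
    and c_ge: "\<And>x. c0 \<le> c x"
    and S1: "\<And>\<phi> x s. smb \<phi> \<Longrightarrow> (\<And>z. dbar_sq \<Lambda>1 e \<tau>0 \<tau> h 1 \<phi> z \<le> s) \<Longrightarrow>
       A_form \<Lambda>1 e \<tau>0 \<tau> q p h \<phi> x
          \<le> (1 - \<delta>) * (\<Sum>l\<in>\<Lambda>1 \<union> range e. Q_form \<Lambda>1 q p h (dbar \<Lambda>1 e \<tau>0 \<tau> h l \<phi>) x)
            + K * Q_form \<Lambda>1 q p h \<phi> x + 2 * (1 - \<delta>) * c x * s"
    and S2: "\<And>n (I :: (real^'n) list set) \<Phi> x s s'.
       2 \<le> n \<Longrightarrow> n \<le> m \<Longrightarrow> finite I \<Longrightarrow> (\<And>i. i \<in> I \<Longrightarrow> smb (\<Phi> i)) \<Longrightarrow>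
       (\<And>z. (\<Sum>i\<in>I. dbar_sq \<Lambda>1 e \<tau>0 \<tau> h 2 (\<Phi> i) z) \<le> s) \<Longrightarrow>
       (\<And>z. (\<Sum>i\<in>I. dbar_sq \<Lambda>1 e \<tau>0 \<tau> h 1 (\<Phi> i) z) \<le> s') \<Longrightarrow>
       real n * (\<Sum>i\<in>I. \<Sum>l\<in>\<Lambda>1 \<union> range e. A_form \<Lambda>1 e \<tau>0 \<tau> q p h (dbar \<Lambda>1 e \<tau>0 \<tau> h l (\<Phi> i)) x)
       + real n * (real n - 1) * (\<Sum>i\<in>I. \<Sum>\<mu>\<in>tuples 2 (\<Lambda>1 \<union> range e).
              dbars \<Lambda>1 e \<tau>0 \<tau> h \<mu> (\<Phi> i) x * Q_op \<Lambda>1 e \<tau>0 \<tau> q h \<mu> (shifts \<Lambda>1 h \<mu> (\<Phi> i)) x)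
       \<le> (1 - \<delta>) * (\<Sum>i\<in>I. \<Sum>\<mu>\<in>tuples 2 (\<Lambda>1 \<union> range e). Q_form \<Lambda>1 q p h (dbars \<Lambda>1 e \<tau>0 \<tau> h \<mu> (\<Phi> i)) x)
            + K * (\<Sum>i\<in>I. \<Sum>l\<in>\<Lambda>1 \<union> range e. Q_form \<Lambda>1 q p h (dbar \<Lambda>1 e \<tau>0 \<tau> h l (\<Phi> i)) x)
            + 2 * (1 - \<delta>) * c x * s + K * s'"
begin

abbreviation A where "A \<equiv> A_form \<Lambda>1 e \<tau>0 \<tau> q p h"
abbreviation Qf where "Qf \<equiv> Q_form \<Lambda>1 q p h"
abbreviation Qo where "Qo \<equiv> Q_op \<Lambda>1 e \<tau>0 \<tau> q h"
abbreviation L0 where "L0 \<equiv> L0_op \<Lambda>1 e \<tau>0 \<tau> q p h"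
abbreviation Lz where "Lz \<equiv> L0 []"

lemma Qo_eq: "Qo \<mu> \<psi> x = (1 / h) * Rop q \<mu> \<psi> x"
  by (simp add: Q_op_def Rop_def)

lemma L0_eq: "L0 \<mu> \<psi> x = Qo \<mu> \<psi> x + Rop p \<mu> \<psi> x"
  by (simp add: L0_op_def Rop_def)

text \<open>For fixed \<open>g\<close> the combination of the coefficients with weights
  \<open>g l\<close> is a single smooth function, whose derivatives are bounded by Cauchy-Schwarz in
  \<open>l\<close>. Applying \<open>Ds \<mu>\<close> to it avoids any dependence on the number of
  directions.\<close>

lemma comb_bound:
  assumes r: "\<And>l. l \<in> \<Lambda>1 \<Longrightarrow> smb (r l)"
    and rb: "\<And>is x. length is \<le> m \<Longrightarrow> (\<Sum>l\<in>\<Lambda>1. (foldr partial is (r l) x)\<^sup>2) \<le> Mb\<^sup>2"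
    and \<mu>: "length \<mu> \<le> m"
  shows "\<bar>\<Sum>l\<in>\<Lambda>1. Ds \<mu> (r l) x * g l\<bar> \<le> wts \<mu> * (Mb * L2_set g \<Lambda>1)"
proof -
  define P where "P = (\<lambda>z. \<Sum>l\<in>\<Lambda>1. g l * r l z)"
  have P: "smb P" unfolding P_def by (intro smb_intros r)
  have fP: "foldr partial is P = (\<lambda>z. \<Sum>l\<in>\<Lambda>1. g l * foldr partial is (r l) z)" for "is"
    by (induction "is") (simp_all add: P_def partial_sum_smb partial_cmult_smb smb_cmult smb_foldr r)
  have "bd (length \<mu>) (Mb * L2_set g \<Lambda>1) P"
  proof (rule bd_foldrI)
    fix "is" :: "'n list" and z assume "length is \<le> length \<mu>"
    then have "(\<Sum>l\<in>\<Lambda>1. (foldr partial is (r l) z)\<^sup>2) \<le> Mb\<^sup>2" using \<mu> rb by simp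
    then have 1: "L2_set (\<lambda>l. foldr partial is (r l) z) \<Lambda>1 \<le> Mb"
      unfolding L2_set_def using Mb real_le_lsqrt by (simp add: sum_nonneg)
    have "\<bar>foldr partial is P z\<bar> \<le> (\<Sum>l\<in>\<Lambda>1. \<bar>g l\<bar> * \<bar>foldr partial is (r l) z\<bar>)"
      unfolding fP abs_mult[symmetric] by (rule sum_abs)
    also have "\<dots> \<le> L2_set g \<Lambda>1 * L2_set (\<lambda>l. foldr partial is (r l) z) \<Lambda>1"
      by (rule L2_set_mult_ineq)
    also have "\<dots> \<le> L2_set g \<Lambda>1 * Mb" using 1 by (intro mult_left_mono) auto
    finally show "\<bar>foldr partial is P z\<bar> \<le> Mb * L2_set g \<Lambda>1" by (simp add: mult.commute)
  qed
  from tinv_bound[OF tinv_Ds P this, of x]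
  have "\<bar>Ds \<mu> P x\<bar> \<le> wts \<mu> * (Mb * L2_set g \<Lambda>1)" .
  moreover have "Ds \<mu> P = (\<lambda>x. \<Sum>l\<in>\<Lambda>1. g l * Ds \<mu> (r l) x)"
    unfolding P_def by (subst tinv_sum_arg[OF tinv_Ds]) (simp_all add: smb_cmult r tinv_cmult[OF tinv_Ds])
  ultimately show ?thesis by (simp add: mult.commute)
qed

lemma L2_norm_bound: "L2_set norm \<Lambda>1 \<le> s1"
  unfolding L2_set_def using s1 s1_bound real_le_lsqrt by (simp add: sum_nonneg)

lemma Rop_p_bound:
  assumes "smb \<psi>" "bd 1 B \<psi>" "length \<mu> \<le> m"
  shows "\<bar>Rop p \<mu> \<psi> x\<bar> \<le> wts \<mu> * (Mb * (d * s1) * B)"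
proof -
  have B: "0 \<le> B" using assms(2) bd_nonneg by blast
  have "L2_set (\<lambda>l. fd h l \<psi> x) \<Lambda>1 = L2_set (\<lambda>l. \<bar>fd h l \<psi> x\<bar>) \<Lambda>1" by (simp add: L2_set_def)
  also have "\<dots> \<le> L2_set (\<lambda>l. d * B * norm l) \<Lambda>1"
    using tinv_bound[OF tinv_fd[OF h] assms(1,2)] by (intro L2_set_mono) (auto simp: d_eq mult_ac)
  also have "\<dots> = d * B * L2_set norm \<Lambda>1" using B d by (simp add: L2_set_right_distrib)
  also have "\<dots> \<le> d * B * s1" using B d L2_norm_bound by (simp add: mult_left_mono)
  finally have "Mb * L2_set (\<lambda>l. fd h l \<psi> x) \<Lambda>1 \<le> Mb * (d * B * s1)"
    using Mb by (rule mult_left_mono)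
  also have "\<dots> = Mb * (d * s1) * B" by simp
  finally have "Mb * L2_set (\<lambda>l. fd h l \<psi> x) \<Lambda>1 \<le> Mb * (d * s1) * B" .
  then have "wts \<mu> * (Mb * L2_set (\<lambda>l. fd h l \<psi> x) \<Lambda>1) \<le> wts \<mu> * (Mb * (d * s1) * B)"
    using wts_nonneg by (simp add: mult_left_mono)
  then show ?thesis unfolding Rop_def using comb_bound[OF smb_qpc(2) p_bound assms(3)] order_trans by blast
qed

lemma sum_sym: "(\<Sum>l\<in>\<Lambda>1. F (- l)) = (\<Sum>l\<in>\<Lambda>1. F l)" for F :: "_ \<Rightarrow> real"
  using sum.reindex[of uminus \<Lambda>1 F] sym(1) by (simp add: o_def)

text \<open>Since \<open>q (- l) = q l\<close>, the differences along \<open>l\<close> and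
  \<open>- l\<close> may be averaged. With the factor \<open>1 / h\<close> this becomes a symmetric
  second difference, bounded by second derivatives uniformly in \<open>h\<close>.\<close>

lemma Qo_bound:
  assumes "smb \<psi>" "bd 2 B \<psi>" "length \<mu> \<le> m"
  shows "\<bar>Qo \<mu> \<psi> x\<bar> \<le> wts \<mu> * (Mb * (d\<^sup>2 * s1\<^sup>2) * B)"
proof -
  define g where "g l = (fd h l \<psi> x + fd h (- l) \<psi> x) / (2 * h)" for l
  have B: "0 \<le> B" using assms(2) bd_nonneg by blast
  have gl: "\<bar>g l\<bar> \<le> d\<^sup>2 * B * (norm l)\<^sup>2" for l
  proof -
    define X where "X = \<psi> (x + h *\<^sub>R l) - \<psi> x - (\<Sum>i\<in>UNIV. (h *\<^sub>R l)$i * partial i \<psi> x)"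
    define Y where "Y = \<psi> (x + h *\<^sub>R (- l)) - \<psi> x - (\<Sum>i\<in>UNIV. (h *\<^sub>R (- l))$i * partial i \<psi> x)"
    have X: "\<bar>X\<bar> \<le> d\<^sup>2 * B * (h\<^sup>2 * (norm l)\<^sup>2)" and Y: "\<bar>Y\<bar> \<le> d\<^sup>2 * B * (h\<^sup>2 * (norm l)\<^sup>2)"
      using taylor2_bound[OF assms(1,2), of x "h *\<^sub>R l"] taylor2_bound[OF assms(1,2), of x "h *\<^sub>R (- l)"]
      by (simp_all add: X_def Y_def d_eq power_mult_distrib)
    \<comment> \<open>In the sum of the two Taylor remainders the first order terms cancel.\<close>
    have "X + Y = 2 * h\<^sup>2 * g l"
      using h by (simp add: X_def Y_def g_def fd_def sum_negf field_simps power2_eq_square)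
    then have "2 * h\<^sup>2 * \<bar>g l\<bar> = \<bar>X + Y\<bar>" by (simp add: abs_mult)
    also have "\<dots> \<le> d\<^sup>2 * B * (h\<^sup>2 * (norm l)\<^sup>2) + d\<^sup>2 * B * (h\<^sup>2 * (norm l)\<^sup>2)"
      using X Y by linarith
    also have "\<dots> = 2 * h\<^sup>2 * (d\<^sup>2 * B * (norm l)\<^sup>2)" by simp
    finally show ?thesis using h by simp
  qed
  have "Qo \<mu> \<psi> x = (1 / h) * (\<Sum>l\<in>\<Lambda>1. Ds \<mu> (q l) x * fd h l \<psi> x)"
    by (simp add: Qo_eq Rop_def)
  also have "(\<Sum>l\<in>\<Lambda>1. Ds \<mu> (q l) x * fd h l \<psi> x) = (\<Sum>l\<in>\<Lambda>1. Ds \<mu> (q (- l)) x * fd h (- l) \<psi> x)"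
    by (rule sum_sym[symmetric])
  also have "\<dots> = (\<Sum>l\<in>\<Lambda>1. Ds \<mu> (q l) x * fd h (- l) \<psi> x)" using sym(2) by simp
  finally have "Qo \<mu> \<psi> x = (1 / h) * (\<Sum>l\<in>\<Lambda>1. Ds \<mu> (q l) x * fd h (- l) \<psi> x)" .
  moreover have "Qo \<mu> \<psi> x = (1 / h) * (\<Sum>l\<in>\<Lambda>1. Ds \<mu> (q l) x * fd h l \<psi> x)"
    by (simp add: Qo_eq Rop_def)
  ultimately have "2 * Qo \<mu> \<psi> x = (1 / h) * (\<Sum>l\<in>\<Lambda>1. Ds \<mu> (q l) x * fd h l \<psi> x)
      + (1 / h) * (\<Sum>l\<in>\<Lambda>1. Ds \<mu> (q l) x * fd h (- l) \<psi> x)" by linarith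
  then have "2 * Qo \<mu> \<psi> x = (1 / h) * (\<Sum>l\<in>\<Lambda>1. Ds \<mu> (q l) x * (fd h l \<psi> x + fd h (- l) \<psi> x))"
    by (simp add: distrib_left sum.distrib add_divide_distrib)
  then have eq: "Qo \<mu> \<psi> x = (\<Sum>l\<in>\<Lambda>1. Ds \<mu> (q l) x * g l)"
    using h by (simp add: g_def sum_divide_distrib[symmetric] field_simps)
  have "L2_set g \<Lambda>1 \<le> (\<Sum>l\<in>\<Lambda>1. \<bar>g l\<bar>)" by (rule L2_set_le_sum_abs)
  also have "\<dots> \<le> (\<Sum>l\<in>\<Lambda>1. d\<^sup>2 * B * (norm l)\<^sup>2)" by (intro sum_mono gl)
  also have "\<dots> = d\<^sup>2 * B * (\<Sum>l\<in>\<Lambda>1. (norm l)\<^sup>2)" by (simp add: sum_distrib_left)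
  also have "\<dots> \<le> d\<^sup>2 * B * s1\<^sup>2" using B s1_bound by (intro mult_left_mono) auto
  finally have "Mb * L2_set g \<Lambda>1 \<le> Mb * (d\<^sup>2 * B * s1\<^sup>2)"
    using Mb by (rule mult_left_mono)
  also have "\<dots> = Mb * (d\<^sup>2 * s1\<^sup>2) * B" by simp
  finally have "Mb * L2_set g \<Lambda>1 \<le> Mb * (d\<^sup>2 * s1\<^sup>2) * B" .
  then have "wts \<mu> * (Mb * L2_set g \<Lambda>1) \<le> wts \<mu> * (Mb * (d\<^sup>2 * s1\<^sup>2) * B)"
    using wts_nonneg by (simp add: mult_left_mono)
  then show ?thesis unfolding eq using comb_bound[OF smb_qpc(1) q_bound assms(3)] order_trans by blast
qed

lemma q_le: "l \<in> \<Lambda>1 \<Longrightarrow> \<bar>q l x\<bar> \<le> Mb"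
proof -
  assume l: "l \<in> \<Lambda>1"
  have "(q l x)\<^sup>2 \<le> (\<Sum>l\<in>\<Lambda>1. (q l x)\<^sup>2)" using l fin by (intro member_le_sum) auto
  also have "\<dots> \<le> Mb\<^sup>2" using q_bound[of "[]" x] by simp
  finally show ?thesis using Mb abs_le_square_iff[of "q l x" Mb] by simp
qed

text \<open>Nonnegativity for the direction \<open>- l\<close> reads
  \<open>h * p l x \<le> q l x\<close>, so the bound is free of \<open>h\<close>.\<close>

lemma qp_le:
  assumes l: "l \<in> \<Lambda>1"
  shows "q l x + h * p l x \<le> 2 * Mb"
proof -
  have "- l \<in> \<Lambda>1" using l sym(1) by blast
  from qp[OF this, of x] have "h * p l x \<le> q l x" using sym(2,3)[OF l] by simp
  moreover have "q l x \<le> Mb" using q_le[OF l, of x] by simp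
  ultimately show ?thesis by simp
qed

lemma Qf_nonneg: "0 \<le> Qf \<phi> x"
  unfolding Q_form_def using qp by (intro sum_nonneg mult_nonneg_nonneg) auto

lemma Qf_bound:
  assumes "smb \<phi>" "bd 1 B \<phi>"
  shows "Qf \<phi> x \<le> CQ * B\<^sup>2"
proof -
  have "(q l x + h * p l x) * (fd h l \<phi> x)\<^sup>2 \<le> 2 * Mb * (d\<^sup>2 * B\<^sup>2 * (norm l)\<^sup>2)" if l: "l \<in> \<Lambda>1" for l
  proof (rule mult_mono)
    have "\<bar>fd h l \<phi> x\<bar> \<le> d * norm l * B" using tinv_bound[OF tinv_fd[OF h] assms] by (simp add: d_eq)
    then have "(fd h l \<phi> x)\<^sup>2 \<le> (d * norm l * B)\<^sup>2" using abs_le_square_iff by fastforce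
    then show "(fd h l \<phi> x)\<^sup>2 \<le> d\<^sup>2 * B\<^sup>2 * (norm l)\<^sup>2" by (simp add: power_mult_distrib mult_ac)
  qed (use qp[OF l] qp_le[OF l] Mb in auto)
  then have "Qf \<phi> x \<le> (\<Sum>l\<in>\<Lambda>1. 2 * Mb * (d\<^sup>2 * B\<^sup>2 * (norm l)\<^sup>2))"
    unfolding Q_form_def by (rule sum_mono)
  also have "\<dots> = 2 * Mb * d\<^sup>2 * B\<^sup>2 * (\<Sum>l\<in>\<Lambda>1. (norm l)\<^sup>2)" by (simp add: sum_distrib_left mult_ac)
  also have "\<dots> \<le> 2 * Mb * d\<^sup>2 * B\<^sup>2 * s1\<^sup>2" using s1_bound Mb by (intro mult_left_mono) auto
  finally show ?thesis by (simp add: CQ_def mult_ac)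
qed

lemma wt_sq_sum: "(\<Sum>l\<in>\<Lambda>. (wt l)\<^sup>2) \<le> SS"
proof -
  have "(\<Sum>l\<in>\<Lambda>. (wt l)\<^sup>2) = (\<Sum>l\<in>\<Lambda>1. (wt l)\<^sup>2) + (\<Sum>l\<in>range e. (wt l)\<^sup>2)"
    using disj fin by (intro sum.union_disjoint) auto
  also have "(\<Sum>l\<in>\<Lambda>1. (wt l)\<^sup>2) = d\<^sup>2 * (\<Sum>l\<in>\<Lambda>1. (norm (\<tau> l *\<^sub>R l))\<^sup>2)"
    by (simp add: wt_def d_eq power_mult_distrib sum_distrib_left)
  also have "(\<Sum>l\<in>range e. (wt l)\<^sup>2) = (\<Sum>l\<in>range e. \<tau>0\<^sup>2)"
    using disj by (intro sum.cong) (auto simp: wt_def)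
  also have "\<dots> = d * \<tau>0\<^sup>2" using e by (simp add: card_image d_eq)
  also have "d\<^sup>2 * (\<Sum>l\<in>\<Lambda>1. (norm (\<tau> l *\<^sub>R l))\<^sup>2) \<le> d\<^sup>2 * s2\<^sup>2"
    using s2_bound by (intro mult_left_mono) auto
  finally show ?thesis by (simp add: SS_def)
qed

lemma wts_sq_sum: "(\<Sum>\<kappa>\<in>tuples n \<Lambda>. (wts \<kappa>)\<^sup>2) \<le> SS ^ n"
proof -
  have "(wts \<kappa>)\<^sup>2 = prod_list (map (\<lambda>l. (wt l)\<^sup>2) \<kappa>)" for \<kappa>
    by (induction \<kappa>) (auto simp: power_mult_distrib)
  then have "(\<Sum>\<kappa>\<in>tuples n \<Lambda>. (wts \<kappa>)\<^sup>2) = (\<Sum>l\<in>\<Lambda>. (wt l)\<^sup>2) ^ n"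
    using sum_tuples_prod[OF fin\<Lambda>, where n = n and w = "\<lambda>l. (wt l)\<^sup>2"] by simp
  also have "\<dots> \<le> SS ^ n" using wt_sq_sum by (intro power_mono) (auto simp: sum_nonneg)
  finally show ?thesis .
qed

text \<open>Bounds proportional to \<open>wts \<kappa>\<close> are square summable over the tuples
  with a constant independent of the number of tuples.\<close>

lemma weighted_L2_bound:
  assumes "\<And>\<kappa>. \<kappa> \<in> tuples n \<Lambda> \<Longrightarrow> \<bar>R \<kappa>\<bar> \<le> wts \<kappa> * B" "0 \<le> B"
  shows "L2_set R (tuples n \<Lambda>) \<le> sqrt (SS ^ n) * B"
proof -
  have "L2_set R (tuples n \<Lambda>) = L2_set (\<lambda>\<kappa>. \<bar>R \<kappa>\<bar>) (tuples n \<Lambda>)" by (simp add: L2_set_def)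
  also have "\<dots> \<le> L2_set (\<lambda>\<kappa>. wts \<kappa> * B) (tuples n \<Lambda>)"
    using assms(1) by (intro L2_set_mono) auto
  also have "\<dots> = L2_set wts (tuples n \<Lambda>) * B" using assms(2) by (simp add: L2_set_left_distrib)
  also have "\<dots> \<le> sqrt (SS ^ n) * B"
    unfolding L2_set_def using wts_sq_sum assms(2) by (intro mult_right_mono) auto
  finally show ?thesis .
qed

lemma Dsq_bound:
  assumes "smb u" "bd n B u"
  shows "Dsq n u x \<le> SS ^ n * B\<^sup>2"
proof -
  have "0 \<le> B" using assms(2) bd_nonneg by blast
  moreover have "\<bar>Ds \<kappa> u x\<bar> \<le> wts \<kappa> * B" if "\<kappa> \<in> tuples n \<Lambda>" for \<kappa>
    using tinv_bound[OF tinv_Ds[of \<kappa>] assms(1)] assms(2) that by (simp add: tuples_def)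
  ultimately have "L2_set (\<lambda>\<kappa>. Ds \<kappa> u x) (tuples n \<Lambda>) \<le> sqrt (SS ^ n) * B"
    by (intro weighted_L2_bound)
  then have "(L2_set (\<lambda>\<kappa>. Ds \<kappa> u x) (tuples n \<Lambda>))\<^sup>2 \<le> (sqrt (SS ^ n) * B)\<^sup>2"
    by (intro power_mono) auto
  then show ?thesis
    using SS_nonneg by (simp add: L2_set_def dbar_sq_def sum_nonneg power_mult_distrib)
qed

text \<open>In this form the coefficients are nonnegative, as the maximum principle
  requires.\<close>

lemma Lz_alt: "Lz \<phi> x = (\<Sum>l\<in>\<Lambda>1. (q l x + h * p l x) / h\<^sup>2 * (\<phi> (x + h *\<^sub>R l) - \<phi> x))"
  using h unfolding L0_op_def Q_op_def dbars_Nil fd_def sum_distrib_left sum.distrib[symmetric]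
  by (intro sum.cong refl) (simp add: field_simps power2_eq_square)

lemma Lz_sum: "Lz (\<lambda>x. \<Sum>i\<in>I. f i x) x = (\<Sum>i\<in>I. Lz (f i) x)"
  unfolding Lz_alt by (subst sum.swap) (simp add: sum_subtractf[symmetric] sum_distrib_left)

lemma Lz_cmult: "Lz (\<lambda>x. k * f x) x = k * Lz f x"
  unfolding Lz_alt by (simp add: sum_distrib_left algebra_simps)

lemma Lz_add: "Lz (\<lambda>x. f x + g x) x = Lz f x + Lz g x"
  unfolding Lz_alt sum.distrib[symmetric]
  by (intro sum.cong refl) (simp add: algebra_simps add_divide_distrib diff_divide_distrib)

text \<open>The quadratic form \<open>Qf\<close> is the carre du champ of \<open>Lz\<close>. For
  \<open>\<phi>\<close> a difference of the solution it is the good term in Bernstein's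
  method.\<close>

lemma Lz_square: "Lz (\<lambda>x. (\<phi> x)\<^sup>2) x = 2 * \<phi> x * Lz \<phi> x + Qf \<phi> x"
  unfolding Lz_alt Q_form_def fd_def sum_distrib_left sum.distrib[symmetric]
  using h by (intro sum.cong refl) (simp add: field_simps power2_eq_square)

lemma Ds_Lz:
  assumes u: "smb u"
  shows "Ds \<kappa> (Lz u) x = (\<Sum>(\<mu>, \<nu>)\<leftarrow>splits \<kappa>. L0 \<mu> (shs \<mu> (Ds \<nu> u)) x)"
proof (rule Ds_splits[OF _ _ u])
  have L0': "L0 \<mu> \<psi> = (\<lambda>x. (1 / h) * Rop q \<mu> \<psi> x + Rop p \<mu> \<psi> x)" for \<mu> \<psi>
    by (simp add: fun_eq_iff L0_eq Qo_eq)
  show "smb (L0 \<mu> \<psi>)" if "smb \<psi>" for \<mu> \<psi>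
    unfolding L0' using that by (simp add: smb_Rop smb_qpc smb_add smb_cmult smb_divide)
  show "D a (L0 \<mu> \<psi>) = (\<lambda>x. L0 \<mu> (D a \<psi>) x + L0 (a # \<mu>) (sh a \<psi>) x)" if \<psi>: "smb \<psi>" for a \<mu> \<psi>
  proof -
    have s: "smb (Rop q \<mu> \<psi>)" "smb (Rop p \<mu> \<psi>)" by (simp_all add: smb_Rop smb_qpc \<psi>)
    have "D a (L0 \<mu> \<psi>) = (\<lambda>x. (1 / h) * D a (Rop q \<mu> \<psi>) x + D a (Rop p \<mu> \<psi>) x)"
      unfolding L0' by (simp only: tinv_add[OF tinv_D] tinv_cmult[OF tinv_D] s smb_cmult)
    then show ?thesis
      unfolding L0' by (simp add: D_Rop smb_qpc \<psi> algebra_simps add_divide_distrib)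
  qed
qed

end

section \<open>The equation satisfied by the sums of squared differences\<close>

context bern
begin

lemma sum_Ds_splits:
  assumes u: "smb u"
  shows "(\<Sum>\<kappa>\<in>tuples n \<Lambda>. Ds \<kappa> u x * (\<Sum>(\<mu>, \<nu>)\<leftarrow>splits \<kappa>. if length \<mu> = j then F \<mu> \<nu> else 0)) =
    (if j \<le> n then real (n choose j) * (\<Sum>\<mu>\<in>tuples j \<Lambda>. \<Sum>\<nu>\<in>tuples (n - j) \<Lambda>. Ds \<mu> (Ds \<nu> u) x * F \<mu> \<nu>) else 0)"
proof -
  have "Ds \<kappa> u x * (\<Sum>(\<mu>, \<nu>)\<leftarrow>splits \<kappa>. if length \<mu> = j then F \<mu> \<nu> else 0) =
     (\<Sum>(\<mu>, \<nu>)\<leftarrow>splits \<kappa>. if length \<mu> = j then Ds \<mu> (Ds \<nu> u) x * F \<mu> \<nu> else 0)" for \<kappa>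
    unfolding sum_splits_const_mult[symmetric]
    by (intro sum_splits_cong) (auto simp: Ds_split_perm[OF u])
  then show ?thesis
    using sum_tuples_splits[OF fin\<Lambda>, where n = n and j = j and F = "\<lambda>\<mu> \<nu>. Ds \<mu> (Ds \<nu> u) x * F \<mu> \<nu>"] by simp
qed

text \<open>The source and that part of the commutator of \<open>Ds \<kappa>\<close> with the
  equation which involves at most \<open>length \<kappa> - 1\<close> derivatives of
  \<open>u\<close>: differences fall on \<open>c\<close> at least once, on \<open>p\<close> exactly
  twice, or on all of \<open>L0\<close> three times or more. One difference on \<open>L0\<close>,
  and two on the part with \<open>q\<close>, are left to the structural inequalities.\<close>

definition rest :: "(real^'n \<Rightarrow> real) \<Rightarrow> (real^'n \<Rightarrow> real) \<Rightarrow> (real^'n) list \<Rightarrow> real^'n \<Rightarrow> real" where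
  "rest u g \<kappa> x = (\<Sum>(\<mu>, \<nu>)\<leftarrow>splits \<kappa>.
      (if \<mu> = [] then 0 else Ds \<mu> c x * shs \<mu> (Ds \<nu> u) x) -
      (if length \<mu> = 2 then Rop p \<mu> (shs \<mu> (Ds \<nu> u)) x
       else if 3 \<le> length \<mu> then L0 \<mu> (shs \<mu> (Ds \<nu> u)) x else 0)) - Ds \<kappa> g x"

lemma Lz_Ds:
  assumes u: "smb u" and g: "smb g" and eq: "\<And>x. Lz u x - c x * u x + g x = 0"
  shows "Lz (Ds \<kappa> u) x = c x * Ds \<kappa> u x + rest u g \<kappa> x
    - (\<Sum>(\<mu>, \<nu>)\<leftarrow>splits \<kappa>. if length \<mu> = 1 then L0 \<mu> (shs \<mu> (Ds \<nu> u)) x else 0)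
    - (\<Sum>(\<mu>, \<nu>)\<leftarrow>splits \<kappa>. if length \<mu> = 2 then Qo \<mu> (shs \<mu> (Ds \<nu> u)) x else 0)"
proof -
  have Lu: "Lz u = (\<lambda>x. c x * u x - g x)"
  proof
    fix x show "Lz u x = c x * u x - g x" using eq[of x] by linarith
  qed
  have "Ds \<kappa> (Lz u) x = Ds \<kappa> (\<lambda>x. c x * u x) x - Ds \<kappa> g x"
    unfolding Lu by (simp add: tinv_diff[OF tinv_Ds] smb_mult smb_qpc u g)
  then have 1: "(\<Sum>(\<mu>, \<nu>)\<leftarrow>splits \<kappa>. L0 \<mu> (shs \<mu> (Ds \<nu> u)) x)
     = (\<Sum>(\<mu>, \<nu>)\<leftarrow>splits \<kappa>. Ds \<mu> c x * shs \<mu> (Ds \<nu> u) x) - Ds \<kappa> g x"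
    unfolding Ds_Lz[OF u] Ds_mult[OF smb_qpc(3) u] .
  define a1 where "a1 = (\<lambda>\<mu> \<nu>. if length \<mu> = 1 then L0 \<mu> (shs \<mu> (Ds \<nu> u)) x else 0)"
  define a2 where "a2 = (\<lambda>\<mu> \<nu>. if length \<mu> = 2 then Qo \<mu> (shs \<mu> (Ds \<nu> u)) x else 0)"
  define a3 where "a3 = (\<lambda>\<mu> \<nu>. if length \<mu> = 2 then Rop p \<mu> (shs \<mu> (Ds \<nu> u)) x
       else if 3 \<le> length \<mu> then L0 \<mu> (shs \<mu> (Ds \<nu> u)) x else 0)"
  define b where "b = (\<lambda>\<mu> \<nu>. if \<mu> = [] then 0 else Ds \<mu> c x * shs \<mu> (Ds \<nu> u) x)"
  have n0: "L0 \<mu> (shs \<mu> (Ds \<nu> u)) x = (if \<mu> = [] then L0 \<mu> (shs \<mu> (Ds \<nu> u)) x else 0) + (a1 \<mu> \<nu> + (a2 \<mu> \<nu> + a3 \<mu> \<nu>))" for \<mu> \<nu>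
  proof -
    consider "length \<mu> = 0" | "length \<mu> = 1" | "length \<mu> = 2" | "3 \<le> length \<mu>" by linarith
    then show ?thesis by cases (auto simp: a1_def a2_def a3_def L0_eq)
  qed
  have 2: "(\<Sum>(\<mu>, \<nu>)\<leftarrow>splits \<kappa>. L0 \<mu> (shs \<mu> (Ds \<nu> u)) x) = Lz (Ds \<kappa> u) x +
     ((\<Sum>(\<mu>, \<nu>)\<leftarrow>splits \<kappa>. a1 \<mu> \<nu>) + ((\<Sum>(\<mu>, \<nu>)\<leftarrow>splits \<kappa>. a2 \<mu> \<nu>) + (\<Sum>(\<mu>, \<nu>)\<leftarrow>splits \<kappa>. a3 \<mu> \<nu>)))"
    by (subst n0, unfold sum_splits_add) (simp add: sum_splits_Nil shifts_Nil)
  have n1: "Ds \<mu> c x * shs \<mu> (Ds \<nu> u) x = (if \<mu> = [] then Ds \<mu> c x * shs \<mu> (Ds \<nu> u) x else 0) + b \<mu> \<nu>" for \<mu> \<nu>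
    by (simp add: b_def)
  have 3: "(\<Sum>(\<mu>, \<nu>)\<leftarrow>splits \<kappa>. Ds \<mu> c x * shs \<mu> (Ds \<nu> u) x) = c x * Ds \<kappa> u x + (\<Sum>(\<mu>, \<nu>)\<leftarrow>splits \<kappa>. b \<mu> \<nu>)"
    by (subst n1, unfold sum_splits_add) (simp add: sum_splits_Nil shifts_Nil dbars_Nil)
  have 4: "rest u g \<kappa> x = (\<Sum>(\<mu>, \<nu>)\<leftarrow>splits \<kappa>. b \<mu> \<nu>) - (\<Sum>(\<mu>, \<nu>)\<leftarrow>splits \<kappa>. a3 \<mu> \<nu>) - Ds \<kappa> g x"
    unfolding rest_def b_def a3_def by (simp add: case_prod_unfold sum_list_subtractf)
  show ?thesis using 1 2 3 4 unfolding a1_def a2_def by linarith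
qed

lemma rest_bound:
  assumes u: "smb u" "bd k B u" and g: "smb g" "bd (Suc k) B g" and k: "Suc k \<le> m"
    and \<kappa>: "length \<kappa> = Suc k"
  shows "\<bar>rest u g \<kappa> x\<bar> \<le> wts \<kappa> * (CR (Suc k) * B)"
proof -
  have B: "0 \<le> B" using u(2) bd_nonneg by blast
  define E where "E = Mb * (d\<^sup>2 * s1\<^sup>2 + d * s1)"
  have E: "0 \<le> E" "Mb * (d\<^sup>2 * s1\<^sup>2) * B \<le> E * B" "Mb * (d * s1) * B \<le> E * B"
    using Mb d s1 B by (auto simp: E_def intro!: mult_right_mono mult_left_mono)
  have split: "\<bar>(if \<mu> = [] then 0 else Ds \<mu> c x * shs \<mu> (Ds \<nu> u) x) -
      (if length \<mu> = 2 then Rop p \<mu> (shs \<mu> (Ds \<nu> u)) x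
       else if 3 \<le> length \<mu> then L0 \<mu> (shs \<mu> (Ds \<nu> u)) x else 0)\<bar> \<le> wts \<kappa> * ((Mb + E) * B)"
    if sp: "(\<mu>, \<nu>) \<in> set (splits \<kappa>)" for \<mu> \<nu>
  proof -
    have len: "length \<mu> + length \<nu> = Suc k" using splits_length[OF sp] \<kappa> by simp
    have lm: "length \<mu> \<le> m" using len k by simp
    have w: "wts \<kappa> = wts \<mu> * wts \<nu>" using splits_prod_list[OF sp] by simp
    have s: "smb (shs \<mu> (Ds \<nu> u))" by (intro smb_shs smb_Ds u)
    have bsh: "bd j (wts \<nu> * B) (shs \<mu> (Ds \<nu> u))" if "j + length \<nu> \<le> k" for j
    proof -
      have "bd j (wts \<nu> * B) (Ds \<nu> u)"
        by (rule tinv_bd[OF tinv_Ds u(1)]) (rule bd_le[OF u(2) that])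
      then show ?thesis using tinv_bd[OF tinv_shs smb_Ds[OF u(1)], of j "wts \<nu> * B"] by simp
    qed
    have 1: "\<bar>if \<mu> = [] then 0 else Ds \<mu> c x * shs \<mu> (Ds \<nu> u) x\<bar> \<le> wts \<kappa> * (Mb * B)"
    proof (cases "\<mu> = []")
      case True then show ?thesis using wts_nonneg Mb B by simp
    next
      case False
      have "\<bar>Ds \<mu> c x\<bar> \<le> wts \<mu> * Mb"
        by (rule tinv_bound[OF tinv_Ds smb_qpc(3)]) (rule bd_le[OF c_bound lm])
      moreover have "\<bar>shs \<mu> (Ds \<nu> u) x\<bar> \<le> wts \<nu> * B"
      proof (rule bd_D0, rule bsh[of 0])
        show "0 + length \<nu> \<le> k" using len False by (cases \<mu>) auto
      qed
      ultimately have "\<bar>Ds \<mu> c x\<bar> * \<bar>shs \<mu> (Ds \<nu> u) x\<bar> \<le> (wts \<mu> * Mb) * (wts \<nu> * B)"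
        using wts_nonneg Mb by (intro mult_mono) auto
      then show ?thesis using False by (simp add: abs_mult w mult_ac)
    qed
    have 2: "\<bar>if length \<mu> = 2 then Rop p \<mu> (shs \<mu> (Ds \<nu> u)) x
       else if 3 \<le> length \<mu> then L0 \<mu> (shs \<mu> (Ds \<nu> u)) x else 0\<bar> \<le> wts \<kappa> * (E * B)"
    proof -
      have P: "\<bar>Rop p \<mu> (shs \<mu> (Ds \<nu> u)) x\<bar> \<le> wts \<kappa> * (Mb * (d * s1) * B)" if "1 + length \<nu> \<le> k"
        using Rop_p_bound[OF s bsh[OF that] lm, of x] by (simp add: w mult_ac)
      consider "length \<mu> < 2" | "length \<mu> = 2" | "3 \<le> length \<mu>" by linarith
      then show ?thesis
      proof cases
        case 1 then show ?thesis using wts_nonneg E B by simp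
      next
        case 2
        then have "\<bar>Rop p \<mu> (shs \<mu> (Ds \<nu> u)) x\<bar> \<le> wts \<kappa> * (Mb * (d * s1) * B)" using P len by simp
        also have "\<dots> \<le> wts \<kappa> * (E * B)" using E wts_nonneg by (intro mult_left_mono) auto
        finally show ?thesis using 2 by simp
      next
        case 3
        have Q: "\<bar>Qo \<mu> (shs \<mu> (Ds \<nu> u)) x\<bar> \<le> wts \<kappa> * (Mb * (d\<^sup>2 * s1\<^sup>2) * B)"
          using Qo_bound[OF s bsh lm, of x] 3 len by (simp add: w mult_ac)
        have "\<bar>L0 \<mu> (shs \<mu> (Ds \<nu> u)) x\<bar> \<le> wts \<kappa> * (Mb * (d\<^sup>2 * s1\<^sup>2) * B) + wts \<kappa> * (Mb * (d * s1) * B)"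
          unfolding L0_eq using Q P 3 len by (intro order_trans[OF abs_triangle_ineq] add_mono) auto
        also have "\<dots> = wts \<kappa> * (E * B)" by (simp add: E_def algebra_simps)
        finally show ?thesis using 3 by simp
      qed
    qed
    show ?thesis using 1 2 by (simp add: algebra_simps)
  qed
  have "\<bar>\<Sum>(\<mu>, \<nu>)\<leftarrow>splits \<kappa>.
      (if \<mu> = [] then 0 else Ds \<mu> c x * shs \<mu> (Ds \<nu> u) x) -
      (if length \<mu> = 2 then Rop p \<mu> (shs \<mu> (Ds \<nu> u)) x
       else if 3 \<le> length \<mu> then L0 \<mu> (shs \<mu> (Ds \<nu> u)) x else 0)\<bar> \<le> 2 ^ length \<kappa> * (wts \<kappa> * ((Mb + E) * B))"
    by (rule sum_splits_bound) (rule split)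
  moreover have "\<bar>Ds \<kappa> g x\<bar> \<le> wts \<kappa> * B"
    using tinv_bound[OF tinv_Ds g(1)] g(2) \<kappa> by metis
  ultimately have "\<bar>rest u g \<kappa> x\<bar> \<le> 2 ^ length \<kappa> * (wts \<kappa> * ((Mb + E) * B)) + wts \<kappa> * B"
    unfolding rest_def by linarith
  also have "\<dots> = wts \<kappa> * (CR (Suc k) * B)" by (simp add: \<kappa> CR_def E_def algebra_simps)
  finally show ?thesis .
qed

definition QQ :: "(real^'n \<Rightarrow> real) \<Rightarrow> nat \<Rightarrow> real^'n \<Rightarrow> real" where
  "QQ u n x = (\<Sum>\<kappa>\<in>tuples n \<Lambda>. Qf (Ds \<kappa> u) x)"

lemma QQ_nonneg: "0 \<le> QQ u n x"
  unfolding QQ_def using Qf_nonneg by (simp add: sum_nonneg)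

text \<open>The commutator terms of full order, paired with \<open>Ds \<kappa> u\<close> and summed
  over \<open>\<kappa>\<close>. The factors come from \<open>sum_tuples_splits\<close>:
  \<open>2 * (n choose 1)\<close>, with the 2 contained in \<open>A\<close>, and
  \<open>2 * (n choose 2) = n * (n - 1)\<close>.\<close>

definition main :: "(real^'n \<Rightarrow> real) \<Rightarrow> nat \<Rightarrow> real^'n \<Rightarrow> real" where
  "main u n x = real n * (\<Sum>\<nu>\<in>tuples (n - 1) \<Lambda>. A (Ds \<nu> u) x) +
     (if 2 \<le> n then real n * (real n - 1) * (\<Sum>\<nu>\<in>tuples (n - 2) \<Lambda>. \<Sum>\<mu>\<in>tuples 2 \<Lambda>.
        Ds \<mu> (Ds \<nu> u) x * Qo \<mu> (shs \<mu> (Ds \<nu> u)) x) else 0)"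

lemma A_eq: "A \<phi> x = 2 * (\<Sum>\<mu>\<in>tuples 1 \<Lambda>. Ds \<mu> \<phi> x * L0 \<mu> (shs \<mu> \<phi>) x)"
  unfolding A_form_def by (subst sum_tuples_1[OF fin\<Lambda>]) (simp add: dbars_Cons dbars_Nil shifts_Cons shifts_Nil)

lemma Lz_Dsq:
  assumes u: "smb u" and g: "smb g" and eq: "\<And>x. Lz u x - c x * u x + g x = 0" and n: "1 \<le> n"
  shows "Lz (Dsq n u) x = QQ u n x + 2 * c x * Dsq n u x - main u n x
    + 2 * (\<Sum>\<kappa>\<in>tuples n \<Lambda>. Ds \<kappa> u x * rest u g \<kappa> x)"
proof -
  define X where "X j F = (\<Sum>\<kappa>\<in>tuples n \<Lambda>. Ds \<kappa> u x * (\<Sum>(\<mu>, \<nu>)\<leftarrow>splits \<kappa>. if length \<mu> = j then F \<mu> \<nu> else 0))"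
    for j :: nat and F :: "(real^'n) list \<Rightarrow> (real^'n) list \<Rightarrow> real"
  have "Lz (Dsq n u) x = (\<Sum>\<kappa>\<in>tuples n \<Lambda>. 2 * Ds \<kappa> u x * Lz (Ds \<kappa> u) x + Qf (Ds \<kappa> u) x)"
    unfolding dbar_sq_def[abs_def] by (simp add: Lz_sum Lz_square)
  also have "\<dots> = (\<Sum>\<kappa>\<in>tuples n \<Lambda>. Qf (Ds \<kappa> u) x + 2 * c x * (Ds \<kappa> u x)\<^sup>2 + 2 * (Ds \<kappa> u x * rest u g \<kappa> x)
      - 2 * (Ds \<kappa> u x * (\<Sum>(\<mu>, \<nu>)\<leftarrow>splits \<kappa>. if length \<mu> = 1 then L0 \<mu> (shs \<mu> (Ds \<nu> u)) x else 0))
      - 2 * (Ds \<kappa> u x * (\<Sum>(\<mu>, \<nu>)\<leftarrow>splits \<kappa>. if length \<mu> = 2 then Qo \<mu> (shs \<mu> (Ds \<nu> u)) x else 0)))"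
    by (intro sum.cong refl, subst Lz_Ds[OF u g eq]) (simp add: algebra_simps power2_eq_square)
  also have "\<dots> = QQ u n x + 2 * c x * Dsq n u x + 2 * (\<Sum>\<kappa>\<in>tuples n \<Lambda>. Ds \<kappa> u x * rest u g \<kappa> x)
      - 2 * X 1 (\<lambda>\<mu> \<nu>. L0 \<mu> (shs \<mu> (Ds \<nu> u)) x) - 2 * X 2 (\<lambda>\<mu> \<nu>. Qo \<mu> (shs \<mu> (Ds \<nu> u)) x)"
    unfolding X_def QQ_def dbar_sq_def by (simp only: sum.distrib sum_subtractf sum_distrib_left)
  also have "2 * X 1 (\<lambda>\<mu> \<nu>. L0 \<mu> (shs \<mu> (Ds \<nu> u)) x) = real n * (\<Sum>\<nu>\<in>tuples (n - 1) \<Lambda>. A (Ds \<nu> u) x)"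
  proof -
    have "X 1 (\<lambda>\<mu> \<nu>. L0 \<mu> (shs \<mu> (Ds \<nu> u)) x) =
      real n * (\<Sum>\<mu>\<in>tuples 1 \<Lambda>. \<Sum>\<nu>\<in>tuples (n - 1) \<Lambda>. Ds \<mu> (Ds \<nu> u) x * L0 \<mu> (shs \<mu> (Ds \<nu> u)) x)"
      unfolding X_def sum_Ds_splits[OF u] using n by simp
    also have "(\<Sum>\<mu>\<in>tuples 1 \<Lambda>. \<Sum>\<nu>\<in>tuples (n - 1) \<Lambda>. Ds \<mu> (Ds \<nu> u) x * L0 \<mu> (shs \<mu> (Ds \<nu> u)) x)
      = (\<Sum>\<nu>\<in>tuples (n - 1) \<Lambda>. \<Sum>\<mu>\<in>tuples 1 \<Lambda>. Ds \<mu> (Ds \<nu> u) x * L0 \<mu> (shs \<mu> (Ds \<nu> u)) x)"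
      by (rule sum.swap)
    finally show ?thesis unfolding A_eq by (simp only: sum_distrib_left[symmetric])
  qed
  also have "2 * X 2 (\<lambda>\<mu> \<nu>. Qo \<mu> (shs \<mu> (Ds \<nu> u)) x) =
     (if 2 \<le> n then real n * (real n - 1) * (\<Sum>\<nu>\<in>tuples (n - 2) \<Lambda>. \<Sum>\<mu>\<in>tuples 2 \<Lambda>.
        Ds \<mu> (Ds \<nu> u) x * Qo \<mu> (shs \<mu> (Ds \<nu> u)) x) else 0)"
  proof (cases "2 \<le> n")
    case True
    have ch: "2 * real (n choose 2) = real n * (real n - 1)"
    proof -
      have "even (n * (n - 1))" using True by (cases "even n") auto
      then have "2 * (n choose 2) = n * (n - 1)" by (simp add: choose_two)
      then have "real (2 * (n choose 2)) = real (n * (n - 1))" by presburger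
      then show ?thesis using True by (simp add: of_nat_diff)
    qed
    have "X 2 (\<lambda>\<mu> \<nu>. Qo \<mu> (shs \<mu> (Ds \<nu> u)) x) =
      real (n choose 2) * (\<Sum>\<mu>\<in>tuples 2 \<Lambda>. \<Sum>\<nu>\<in>tuples (n - 2) \<Lambda>. Ds \<mu> (Ds \<nu> u) x * Qo \<mu> (shs \<mu> (Ds \<nu> u)) x)"
      unfolding X_def sum_Ds_splits[OF u] using True by simp
    also have "(\<Sum>\<mu>\<in>tuples 2 \<Lambda>. \<Sum>\<nu>\<in>tuples (n - 2) \<Lambda>. Ds \<mu> (Ds \<nu> u) x * Qo \<mu> (shs \<mu> (Ds \<nu> u)) x)
      = (\<Sum>\<nu>\<in>tuples (n - 2) \<Lambda>. \<Sum>\<mu>\<in>tuples 2 \<Lambda>. Ds \<mu> (Ds \<nu> u) x * Qo \<mu> (shs \<mu> (Ds \<nu> u)) x)"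
      by (rule sum.swap)
    finally show ?thesis using True by (simp only: ch[symmetric] if_True mult.assoc)
  next
    case False then show ?thesis unfolding X_def sum_Ds_splits[OF u] by simp
  qed
  finally show ?thesis unfolding main_def by linarith
qed

lemma Dsq_1: "Dsq 1 \<phi> x = (\<Sum>l\<in>\<Lambda>. (D l \<phi> x)\<^sup>2)"
  unfolding dbar_sq_def by (subst sum_tuples_1[OF fin\<Lambda>]) (simp add: dbars_Cons dbars_Nil)

text \<open>For \<open>n = 1\<close> this is \<open>S1\<close>. For larger \<open>n\<close> the
  tuples of length \<open>n\<close> are cut into two entries and the remaining \<open>n - 2\<close>,
  and \<open>S2\<close> is applied to the family of all \<open>Ds i u\<close> indexed by the
  latter.\<close>

lemma main_bound:
  assumes u: "smb u" and n: "1 \<le> n" "n \<le> m"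
    and X: "\<And>z. Dsq n u z \<le> X" and Y: "\<And>z. Dsq (n - 1) u z \<le> Y"
  shows "main u n x \<le> (1 - \<delta>) * QQ u n x + K * QQ u (n - 1) x + 2 * (1 - \<delta>) * c x * X + K * Y"
proof (cases "n = 1")
  case True
  have "0 \<le> Y" using Y[of 0] order_trans unfolding dbar_sq_def by (meson sum_nonneg zero_le_power2)
  then have "0 \<le> K * Y" using K by simp
  moreover have "A u x \<le> (1 - \<delta>) * (\<Sum>l\<in>\<Lambda>. Qf (D l u) x) + K * Qf u x + 2 * (1 - \<delta>) * c x * X"
    using X True by (intro S1 u) simp
  moreover have "(\<Sum>l\<in>\<Lambda>. Qf (D l u) x) = QQ u 1 x"
    unfolding QQ_def by (subst sum_tuples_1[OF fin\<Lambda>]) (simp add: dbars_Cons dbars_Nil)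
  ultimately show ?thesis using True
    by (simp add: main_def tuples_0 dbars_Nil QQ_def)
next
  case False
  then obtain k where k: "n = Suc (Suc k)" using n by (metis One_nat_def Suc_le_D not0_implies_Suc)
  let ?I = "tuples k \<Lambda>"
  have t2: "(\<Sum>\<kappa>\<in>tuples n \<Lambda>. F \<kappa>) = (\<Sum>\<nu>\<in>?I. \<Sum>\<mu>\<in>tuples 2 \<Lambda>. F (\<mu> @ \<nu>))" for F :: "_ \<Rightarrow> real"
  proof -
    have "n = 2 + k" using k by simp
    then show ?thesis by (simp only: sum_tuples_append[OF fin\<Lambda>]) (rule sum.swap)
  qed
  have t1: "(\<Sum>\<kappa>\<in>tuples (Suc k) \<Lambda>. F \<kappa>) = (\<Sum>\<nu>\<in>?I. \<Sum>l\<in>\<Lambda>. F (l # \<nu>))" for F :: "_ \<Rightarrow> real"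
    unfolding sum_tuples_Suc[OF fin\<Lambda>] by (rule sum.swap)
  have "real n * (\<Sum>i\<in>?I. \<Sum>l\<in>\<Lambda>. A (D l (Ds i u)) x)
       + real n * (real n - 1) * (\<Sum>i\<in>?I. \<Sum>\<mu>\<in>tuples 2 \<Lambda>. Ds \<mu> (Ds i u) x * Qo \<mu> (shs \<mu> (Ds i u)) x)
       \<le> (1 - \<delta>) * (\<Sum>i\<in>?I. \<Sum>\<mu>\<in>tuples 2 \<Lambda>. Qf (Ds \<mu> (Ds i u)) x)
            + K * (\<Sum>i\<in>?I. \<Sum>l\<in>\<Lambda>. Qf (D l (Ds i u)) x)
            + 2 * (1 - \<delta>) * c x * X + K * Y"
  proof (rule S2)
    show "(\<Sum>i\<in>?I. Dsq 2 (Ds i u) z) \<le> X" for z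
      using X[of z] by (simp add: dbar_sq_def t2 dbars_append)
    show "(\<Sum>i\<in>?I. Dsq 1 (Ds i u) z) \<le> Y" for z
    proof -
      have "(\<Sum>i\<in>?I. Dsq 1 (Ds i u) z) = Dsq (n - 1) u z"
        unfolding Dsq_1 by (simp add: dbar_sq_def k t1 dbars_Cons)
      then show ?thesis using Y[of z] by simp
    qed
  qed (use n k u fin\<Lambda> smb_Ds finite_tuples[OF fin\<Lambda>] in auto)
  then show ?thesis
    by (simp add: main_def QQ_def k t1 t2[unfolded k] dbars_append dbars_Cons)
qed

text \<open>Cauchy-Schwarz over the tuples bounds the lower order part by a multiple of
  \<open>sqrt (Dsq (Suc k) u x)\<close>, which is linear in the unknown size, whereas the term with
  \<open>c\<close> is quadratic.\<close>

lemma Lz_Dsq_ge: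
  assumes u: "smb u" "bd k B u" and g: "smb g" "bd (Suc k) B g" and k: "Suc k \<le> m"
    and eq: "\<And>x. Lz u x - c x * u x + g x = 0"
    and X: "\<And>z. Dsq (Suc k) u z \<le> X"
  shows "\<delta> * QQ u (Suc k) x - K * QQ u k x + 2 * c x * Dsq (Suc k) u x - 2 * (1 - \<delta>) * c x * X
     - K * (SS ^ k * B\<^sup>2) - 2 * (sqrt (SS ^ Suc k) * (CR (Suc k) * B)) * sqrt (Dsq (Suc k) u x)
    \<le> Lz (Dsq (Suc k) u) x"
proof -
  have B: "0 \<le> B" using u(2) bd_nonneg by blast
  have "main u (Suc k) x \<le> (1 - \<delta>) * QQ u (Suc k) x + K * QQ u (Suc k - 1) x + 2 * (1 - \<delta>) * c x * X + K * (SS ^ k * B\<^sup>2)"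
    using Dsq_bound[OF u] k by (intro main_bound u X) auto
  moreover have "- (2 * (sqrt (SS ^ Suc k) * (CR (Suc k) * B)) * sqrt (Dsq (Suc k) u x))
      \<le> 2 * (\<Sum>\<kappa>\<in>tuples (Suc k) \<Lambda>. Ds \<kappa> u x * rest u g \<kappa> x)"
  proof -
    have "\<bar>\<Sum>\<kappa>\<in>tuples (Suc k) \<Lambda>. Ds \<kappa> u x * rest u g \<kappa> x\<bar> \<le>
        (\<Sum>\<kappa>\<in>tuples (Suc k) \<Lambda>. \<bar>Ds \<kappa> u x\<bar> * \<bar>rest u g \<kappa> x\<bar>)"
      unfolding abs_mult[symmetric] by (rule sum_abs)
    also have "\<dots> \<le> L2_set (\<lambda>\<kappa>. Ds \<kappa> u x) (tuples (Suc k) \<Lambda>) * L2_set (\<lambda>\<kappa>. rest u g \<kappa> x) (tuples (Suc k) \<Lambda>)"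
      by (rule L2_set_mult_ineq)
    also have "\<dots> \<le> sqrt (Dsq (Suc k) u x) * (sqrt (SS ^ Suc k) * (CR (Suc k) * B))"
    proof (rule mult_mono)
      show "L2_set (\<lambda>\<kappa>. rest u g \<kappa> x) (tuples (Suc k) \<Lambda>) \<le> sqrt (SS ^ Suc k) * (CR (Suc k) * B)"
        using rest_bound[OF u g k] B CR_nonneg[of "Suc k"] by (intro weighted_L2_bound) (auto simp: tuples_def)
    qed (auto simp: L2_set_def dbar_sq_def sum_nonneg)
    finally show ?thesis by (simp add: abs_le_iff mult_ac)
  qed
  ultimately show ?thesis
    unfolding Lz_Dsq[OF u(1) g(1) eq, of "Suc k" x, simplified] by (simp add: algebra_simps)
qed

end

section \<open>Induction over the order: its constants and the a priori estimate\<close>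

context cst
begin

text \<open>The loss in the lower bound of \<open>Lz (Dsq k u)\<close> once \<open>u\<close> and the
  source are bounded up to order \<open>k\<close>. At order zero it is the \<open>2\<close> in
  \<open>2 * u * g\<close>.\<close>

fun EE :: "nat \<Rightarrow> real" where
  "EE 0 = 2"
| "EE (Suc j) = K * (CQ * SS ^ j) + 2 * Mb * SS ^ Suc j + K * SS ^ j + 2 * (SS ^ Suc j * CR (Suc j))"

text \<open>\<open>ca\<close> and \<open>cb\<close> are the coefficients of \<open>B\<^sup>2\<close>
  and of \<open>B * sqrt X\<close> in the quadratic inequality for the supremum \<open>X\<close> of
  \<open>Dsq (Suc k) u\<close> derived in \<open>sup_Dsq_bound\<close>.\<close>

definition ca :: "nat \<Rightarrow> real" where
  "ca k = K * SS ^ k + K / \<delta> * EE k + 2 * Mb * (K / \<delta> * SS ^ k)"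

definition cb :: "nat \<Rightarrow> real" where
  "cb k = 2 * (sqrt (SS ^ Suc k) * CR (Suc k))"

text \<open>Growth of the bound from order \<open>k\<close> to order \<open>k + 1\<close>. Division
  by \<open>\<tau>0 ^ Suc k\<close> recovers partial derivatives from differences along coordinate
  labels; the summand \<open>1\<close> keeps the bound for the lower orders.\<close>

definition FK :: "nat \<Rightarrow> real" where
  "FK k = 1 + ((ca k + cb k) / (2 * c0 * \<delta>) + 1) / \<tau>0 ^ Suc k"

primrec NB :: "nat \<Rightarrow> real" where
  "NB 0 = 1 + 1 / c0"
| "NB (Suc k) = FK k * NB k"

lemma EE_nonneg: "0 \<le> EE k"
  using K Mb SS_nonneg CQ_nonneg CR_nonneg by (cases k) auto

lemma ca_nonneg: "0 \<le> ca k"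
  using K Mb SS_nonneg EE_nonneg \<delta> by (simp add: ca_def)

lemma cb_nonneg: "0 \<le> cb k"
  using SS_nonneg CR_nonneg by (simp add: cb_def)

lemma FK_ge_1: "1 \<le> FK k"
  using ca_nonneg cb_nonneg c0 \<delta> \<tau>0_pos by (simp add: FK_def)

lemma NB_ge_1: "1 \<le> NB k"
proof (induction k)
  case 0 then show ?case using c0 by simp
next
  case (Suc k) then show ?case using mult_mono[OF FK_ge_1[of k] Suc] FK_ge_1[of k] by simp
qed

end

context bern
begin

lemma c_le: "c x \<le> Mb" "0 < c x"
  using c_bound bd_D0[of m Mb c x] c_ge[of x] c0 by auto

text \<open>Everything of order up to \<open>k\<close> is already under control here, so all terms
  except the quadratic form of order \<open>k\<close> go into \<open>EE k\<close>. That form is kept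
  because it has to compensate the one produced at order \<open>k + 1\<close>.\<close>

lemma Lz_Dsq_lower:
  assumes u: "smb u" "bd k B u" and g: "smb g" "bd k B g" and k: "k \<le> m"
    and eq: "\<And>x. Lz u x - c x * u x + g x = 0"
  shows "\<delta> * QQ u k x - EE k * B\<^sup>2 \<le> Lz (Dsq k u) x"
proof (cases k)
  case 0
  have B: "0 \<le> B" using u(2) bd_nonneg by blast
  have "Dsq 0 u = (\<lambda>x. (u x)\<^sup>2)" by (simp add: dbar_sq_def tuples_0 dbars_Nil fun_eq_iff)
  then have "Lz (Dsq 0 u) x = 2 * u x * Lz u x + Qf u x" by (simp add: Lz_square)
  also have "Lz u x = c x * u x - g x" using eq[of x] by simp
  also have "2 * u x * (c x * u x - g x) = 2 * (c x * (u x)\<^sup>2) - 2 * (u x * g x)"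
    by (simp add: algebra_simps power2_eq_square)
  finally have 1: "Lz (Dsq 0 u) x = 2 * (c x * (u x)\<^sup>2) - 2 * (u x * g x) + Qf u x" .
  have "\<bar>u x * g x\<bar> \<le> B * B"
    unfolding abs_mult using bd_D0[OF u(2)] bd_D0[OF g(2)] B by (intro mult_mono) auto
  then have 2: "u x * g x \<le> B\<^sup>2" by (simp add: power2_eq_square)
  have 3: "0 \<le> c x * (u x)\<^sup>2" using c_le(2)[of x] by simp
  have 4: "\<delta> * Qf u x \<le> Qf u x" using \<delta> Qf_nonneg[of u x] by (simp add: mult_left_le_one_le)
  have "QQ u 0 x = Qf u x" by (simp add: QQ_def tuples_0 dbars_Nil)
  then show ?thesis using 1 2 3 4 0 by simp
next
  case (Suc j)
  have B: "0 \<le> B" using u(2) bd_nonneg by blast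
  have uj: "bd j B u" using u(2) Suc bd_SucD by blast
  let ?X = "SS ^ k * B\<^sup>2"
  have X: "Dsq k u z \<le> ?X" for z by (rule Dsq_bound[OF u])
  have main: "\<delta> * QQ u k x - K * QQ u j x + 2 * c x * Dsq k u x - 2 * (1 - \<delta>) * c x * ?X
     - K * (SS ^ j * B\<^sup>2) - 2 * (sqrt (SS ^ k) * (CR k * B)) * sqrt (Dsq k u x) \<le> Lz (Dsq k u) x"
    using Lz_Dsq_ge[OF u(1) uj g(1) _ _ eq, of ?X x] g(2) k X unfolding Suc by simp
  have "QQ u j x \<le> CQ * (SS ^ j * B\<^sup>2)"
  proof -
    have "QQ u j x \<le> (\<Sum>\<kappa>\<in>tuples j \<Lambda>. CQ * (wts \<kappa> * B)\<^sup>2)"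
      unfolding QQ_def
    proof (intro sum_mono Qf_bound smb_Ds u)
      fix \<kappa> assume "\<kappa> \<in> tuples j \<Lambda>"
      then have "bd (1 + length \<kappa>) B u" using u(2) Suc by (simp add: tuples_def)
      then show "bd 1 (wts \<kappa> * B) (Ds \<kappa> u)" by (rule tinv_bd[OF tinv_Ds u(1)])
    qed
    also have "\<dots> = CQ * ((\<Sum>\<kappa>\<in>tuples j \<Lambda>. (wts \<kappa>)\<^sup>2) * B\<^sup>2)"
      by (simp add: sum_distrib_left sum_distrib_right power_mult_distrib)
    also have "\<dots> \<le> CQ * (SS ^ j * B\<^sup>2)"
      using wts_sq_sum CQ_nonneg by (intro mult_left_mono mult_right_mono) auto
    finally show ?thesis .
  qed
  then have 1: "K * QQ u j x \<le> K * (CQ * (SS ^ j * B\<^sup>2))" using K by simp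
  have D0: "0 \<le> Dsq k u x" by (simp add: dbar_sq_def sum_nonneg)
  have 2: "0 \<le> 2 * c x * Dsq k u x" using c_le(2)[of x] D0 by simp
  have 3: "2 * (1 - \<delta>) * c x * ?X \<le> 2 * Mb * ?X"
  proof -
    have "(1 - \<delta>) * c x \<le> 1 * Mb" using \<delta> c_le[of x] by (intro mult_mono) auto
    then have "2 * (1 - \<delta>) * c x \<le> 2 * Mb" unfolding mult.assoc by linarith
    then show ?thesis using SS_nonneg by (intro mult_right_mono) auto
  qed
  have "sqrt (Dsq k u x) \<le> sqrt (SS ^ k) * B"
    using real_sqrt_le_mono[OF X[of x]] B by (simp add: real_sqrt_mult)
  then have "2 * (sqrt (SS ^ k) * (CR k * B)) * sqrt (Dsq k u x) \<le> 2 * (sqrt (SS ^ k) * (CR k * B)) * (sqrt (SS ^ k) * B)"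
    using CR_nonneg B SS_nonneg by (intro mult_left_mono) auto
  also have "\<dots> = 2 * (SS ^ k * CR k) * B\<^sup>2"
  proof -
    have "sqrt (SS ^ k) * sqrt (SS ^ k) = SS ^ k" using SS_nonneg by simp
    then show ?thesis by (simp add: power2_eq_square mult.left_commute mult.assoc)
  qed
  finally have 4: "2 * (sqrt (SS ^ k) * (CR k * B)) * sqrt (Dsq k u x) \<le> 2 * (SS ^ k * CR k) * B\<^sup>2" .
  have "EE k * B\<^sup>2 = K * (CQ * (SS ^ j * B\<^sup>2)) + 2 * Mb * ?X + K * (SS ^ j * B\<^sup>2) + 2 * (SS ^ k * CR k) * B\<^sup>2"
    by (simp add: Suc algebra_simps)
  then show ?thesis using main 1 2 3 4 by linarith
qed

lemma coeff_bounds: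
  "l \<in> \<Lambda>1 \<Longrightarrow> 0 \<le> (q l x + h * p l x) / h\<^sup>2 \<and> (q l x + h * p l x) / h\<^sup>2 \<le> 2 * Mb / h\<^sup>2"
  using qp qp_le h by (simp add: divide_right_mono)

text \<open>At an almost maximal point of \<open>W\<close> the lower bounds for \<open>Lz\<close>
  meet the upper bound \<open>\<epsilon>\<close>. There \<open>Dsq (Suc k) u\<close> is close to its
  supremum \<open>X\<close> up to terms in \<open>B\<close>, so \<open>2 * c * X\<close> minus the
  structural term \<open>2 * (1 - \<delta>) * c * X\<close> leaves
  \<open>2 * \<delta> * c * X\<close>, to be bounded by terms of lower degree in
  \<open>sqrt X\<close>.\<close>

lemma sup_Dsq_bound:
  assumes u: "smb u" "bd k B u" and g: "smb g" "bd (Suc k) B g" and k: "Suc k \<le> m"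
    and eq: "\<And>x. Lz u x - c x * u x + g x = 0"
  shows "sqrt (Dsq (Suc k) u z) \<le> ((ca k + cb k) / (2 * c0 * \<delta>) + 1) * B"
proof -
  have B: "0 \<le> B" using u(2) bd_nonneg by blast
  let ?n = "Suc k"
  obtain B' where B': "bd ?n B' u" using smb_bd[OF u(1)] by blast
  define X where "X = (SUP z. Dsq ?n u z)"
  have bdd: "bdd_above (range (Dsq ?n u))" using Dsq_bound[OF u(1) B'] by (auto intro!: bdd_aboveI)
  have X: "Dsq ?n u z \<le> X" for z unfolding X_def using bdd by (simp add: cSUP_upper)
  have pos: "0 \<le> Dsq j u z" for j z by (simp add: dbar_sq_def sum_nonneg)
  have X0: "0 \<le> X" using X[of 0] pos[of ?n 0] by linarith
  define Y where "Y = SS ^ k * B\<^sup>2"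
  have Y: "Dsq k u z \<le> Y" for z unfolding Y_def by (rule Dsq_bound[OF u])
  have Y0: "0 \<le> Y" using SS_nonneg by (simp add: Y_def)
  \<comment> \<open>The second term contributes \<open>K\<close> times the quadratic form of order \<open>k\<close>, which dominates the one
      on the right of the structural inequality.\<close>
  define W where "W z = Dsq ?n u z + K / \<delta> * Dsq k u z" for z
  have K\<delta>: "0 \<le> K / \<delta>" using K \<delta> by simp
  have bddW: "bdd_above (range W)"
  proof (rule bdd_aboveI[of _ "X + K / \<delta> * Y"], safe)
    fix z show "W z \<le> X + K / \<delta> * Y"
      unfolding W_def using X Y K\<delta> by (intro add_mono mult_left_mono) auto
  qed
  have step: "2 * c0 * \<delta> * X \<le> ca k * B\<^sup>2 + cb k * B * sqrt X + (1 + 2 * Mb) * \<epsilon>" if \<epsilon>: "0 < \<epsilon>" for \<epsilon>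
  proof -
    have "\<exists>x. (SUP z. W z) - \<epsilon> \<le> W x \<and> (\<Sum>l\<in>\<Lambda>1. (q l x + h * p l x) / h\<^sup>2 * (W (x + h *\<^sub>R l) - W x)) \<le> \<epsilon>"
      by (rule approximate_maximum[where A = "\<lambda>l. 2 * Mb / h\<^sup>2" and y = "\<lambda>l. h *\<^sub>R l", OF bddW coeff_bounds \<epsilon>])
    then obtain x where x: "(SUP z. W z) - \<epsilon> \<le> W x" and Lx: "Lz W x \<le> \<epsilon>" unfolding Lz_alt by blast
    have "X \<le> (SUP z. W z)"
      unfolding X_def
    proof (rule cSUP_mono)
      fix z
      have "0 \<le> K / \<delta> * Dsq k u z" using K\<delta> pos by (rule mult_nonneg_nonneg)
      then show "\<exists>z'\<in>UNIV. Dsq ?n u z \<le> W z'" by (intro bexI[of _ z]) (auto simp: W_def)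
    qed (use bddW in auto)
    moreover have "K / \<delta> * Dsq k u x \<le> K / \<delta> * Y" using Y K\<delta> by (rule mult_left_mono)
    \<comment> \<open>Maximality concerns \<open>W\<close>. Its auxiliary summand lies between
      \<open>0\<close> and \<open>K / \<delta> * Y\<close>, which is therefore the loss for
      \<open>Dsq ?n u\<close>.\<close>
    ultimately have Ux: "X - \<epsilon> - K / \<delta> * Y \<le> Dsq ?n u x" using x unfolding W_def by linarith
    have "Lz W x = Lz (Dsq ?n u) x + K / \<delta> * Lz (Dsq k u) x"
      unfolding W_def Lz_add Lz_cmult ..
    moreover have "K / \<delta> * (\<delta> * QQ u k x - EE k * B\<^sup>2) \<le> K / \<delta> * Lz (Dsq k u) x"
      using k bd_SucD[OF g(2)] K\<delta> by (intro mult_left_mono Lz_Dsq_lower[OF u g(1) _ _ eq]) auto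
    moreover have "K / \<delta> * (\<delta> * QQ u k x - EE k * B\<^sup>2) = K * QQ u k x - K / \<delta> * EE k * B\<^sup>2"
      using \<delta> by (simp add: field_simps)
    moreover have "\<delta> * QQ u ?n x - K * QQ u k x + 2 * c x * Dsq ?n u x - 2 * (1 - \<delta>) * c x * X
       - K * (SS ^ k * B\<^sup>2) - 2 * (sqrt (SS ^ ?n) * (CR ?n * B)) * sqrt (Dsq ?n u x) \<le> Lz (Dsq ?n u) x"
      by (rule Lz_Dsq_ge[OF u g k eq X])
    moreover have "0 \<le> \<delta> * QQ u ?n x" using \<delta> QQ_nonneg by simp
    moreover have "2 * (sqrt (SS ^ ?n) * (CR ?n * B)) * sqrt (Dsq ?n u x) \<le> cb k * B * sqrt X"
    proof -
      have "cb k * B * sqrt (Dsq ?n u x) \<le> cb k * B * sqrt X"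
        using X cb_nonneg B by (intro mult_left_mono) auto
      then show ?thesis by (simp add: cb_def mult_ac)
    qed
    ultimately have e1: "2 * c x * Dsq ?n u x - 2 * (1 - \<delta>) * c x * X \<le>
        \<epsilon> + K / \<delta> * EE k * B\<^sup>2 + K * (SS ^ k * B\<^sup>2) + cb k * B * sqrt X"
      using Lx by linarith
    have "2 * c x * (X - \<epsilon> - K / \<delta> * Y) \<le> 2 * c x * Dsq ?n u x"
      using Ux c_le(2)[of x] by (intro mult_left_mono) auto
    then have e2: "2 * c x * \<delta> * X \<le> 2 * c x * Dsq ?n u x - 2 * (1 - \<delta>) * c x * X + 2 * c x * (\<epsilon> + K / \<delta> * Y)"
      by (simp add: algebra_simps)
    have e3: "2 * c x * (\<epsilon> + K / \<delta> * Y) \<le> 2 * Mb * (\<epsilon> + K / \<delta> * Y)"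
    proof (rule mult_right_mono)
      show "0 \<le> \<epsilon> + K / \<delta> * Y" using \<epsilon> mult_nonneg_nonneg[OF K\<delta> Y0] by linarith
    qed (use c_le(1)[of x] in simp)
    have e4: "2 * c0 * \<delta> * X \<le> 2 * c x * \<delta> * X"
      using c_ge[of x] \<delta> X0 by (intro mult_right_mono) auto
    have "2 * Mb * (\<epsilon> + K / \<delta> * Y) + (K / \<delta> * EE k * B\<^sup>2 + K * (SS ^ k * B\<^sup>2)) = ca k * B\<^sup>2 + 2 * Mb * \<epsilon>"
      by (simp add: ca_def Y_def algebra_simps)
    then show ?thesis using e1 e2 e3 e4 by (simp add: algebra_simps)
  qed
  have "2 * c0 * \<delta> * X \<le> ca k * B\<^sup>2 + cb k * B * sqrt X"
  proof (rule field_le_epsilon)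
    fix \<epsilon> :: real assume "0 < \<epsilon>"
    then have "0 < \<epsilon> / (1 + 2 * Mb)" "(1 + 2 * Mb) * (\<epsilon> / (1 + 2 * Mb)) = \<epsilon>" using Mb by auto
    then show "2 * c0 * \<delta> * X \<le> ca k * B\<^sup>2 + cb k * B * sqrt X + \<epsilon>" using step by metis
  qed
  moreover define s where "s = sqrt X"
  ultimately have s: "2 * c0 * \<delta> * (s * s) \<le> ca k * (B * B) + cb k * B * s"
    using X0 by (simp add: power2_eq_square)
  have s0: "0 \<le> s" using X0 by (simp add: s_def)
  have pos2: "0 < 2 * c0 * \<delta>" using c0 \<delta> by simp
  \<comment> \<open>If \<open>s\<close> exceeds \<open>B\<close>, then
    \<open>B * B \<le> B * s\<close>, and the quadratic inequality can be divided by
    \<open>s\<close>.\<close>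
  have "s \<le> ((ca k + cb k) / (2 * c0 * \<delta>) + 1) * B"
  proof (cases "s \<le> B")
    case True
    have "1 * B \<le> ((ca k + cb k) / (2 * c0 * \<delta>) + 1) * B"
      using ca_nonneg[of k] cb_nonneg[of k] pos2 B by (intro mult_right_mono) auto
    then show ?thesis using True by linarith
  next
    case False
    then have sp: "0 < s" using B by linarith
    have "ca k * (B * B) \<le> ca k * (B * s)"
      using ca_nonneg[of k] B False by (intro mult_left_mono) auto
    then have "2 * c0 * \<delta> * s * s \<le> (ca k + cb k) * B * s" using s by (simp add: algebra_simps)
    then have "2 * c0 * \<delta> * s \<le> (ca k + cb k) * B" using sp by simp
    then have "s \<le> (ca k + cb k) / (2 * c0 * \<delta>) * B"
      using pos2 by (simp add: field_simps)
    then show ?thesis using B by (simp add: algebra_simps)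
  qed
  moreover have "sqrt (Dsq ?n u z) \<le> s" unfolding s_def using X by simp
  ultimately show ?thesis by linarith
qed

lemma Ds_coordinates: "smb u \<Longrightarrow> Ds (map e is) u = (\<lambda>x. \<tau>0 ^ length is * foldr partial is u x)"
proof (induction "is")
  case (Cons i "is")
  have "e i \<notin> \<Lambda>1" using disj by auto
  then show ?case using Cons
    by (simp add: dbars_Cons dbar_def[abs_def] partial_cmult_smb smb_foldr e inv_f_f mult_ac)
qed (simp add: dbars_Nil)

lemma a_priori_step:
  assumes u: "smb u" "bd k B u" and g: "smb g" "bd (Suc k) B g" and k: "Suc k \<le> m"
    and eq: "\<And>x. Lz u x - c x * u x + g x = 0"
  shows "bd (Suc k) (FK k * B) u"
proof (rule bd_foldrI)
  fix "is" :: "'n list" and x assume len: "length is \<le> Suc k"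
  have B: "0 \<le> B" using u(2) bd_nonneg by blast
  let ?C = "(ca k + cb k) / (2 * c0 * \<delta>) + 1"
  have C: "0 \<le> ?C" using ca_nonneg[of k] cb_nonneg[of k] c0 \<delta> by simp
  have FB: "FK k * B = B + ?C * B / \<tau>0 ^ Suc k" by (simp add: FK_def algebra_simps)
  have CB: "0 \<le> ?C * B / \<tau>0 ^ Suc k" using C B \<tau>0 by simp
  show "\<bar>foldr partial is u x\<bar> \<le> FK k * B"
  proof (cases "length is = Suc k")
    case True
    have "(Ds (map e is) u x)\<^sup>2 \<le> Dsq (Suc k) u x"
      unfolding dbar_sq_def using finite_tuples[OF fin\<Lambda>] True
      by (intro member_le_sum) (auto simp: tuples_def)
    then have "\<bar>Ds (map e is) u x\<bar> \<le> sqrt (Dsq (Suc k) u x)"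
      using real_sqrt_le_mono by fastforce
    also have "\<dots> \<le> ?C * B" by (rule sup_Dsq_bound[OF u g k eq])
    finally have "\<tau>0 ^ Suc k * \<bar>foldr partial is u x\<bar> \<le> ?C * B"
      using \<tau>0 True by (simp add: Ds_coordinates[OF u(1)] abs_mult)
    then have "\<bar>foldr partial is u x\<bar> \<le> ?C * B / \<tau>0 ^ Suc k"
      using \<tau>0 by (simp add: field_simps)
    then show ?thesis using FB B by linarith
  next
    case False
    then have "\<bar>foldr partial is u x\<bar> \<le> B"
      using len bd_D0[OF bd_foldr[OF u(2), of "is"]] by simp
    then show ?thesis using FB CB by linarith
  qed
qed

theorem a_priori:
  assumes u: "smb u" and eq: "\<And>x. Lz u x - c x * u x + g x = 0"
    and g: "smb g" "bd n B g" and n: "n \<le> m"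
  shows "bd n (NB n * B) u"
  using g(2) n
proof (induction n)
  case 0
  have B: "0 \<le> B" using g bd_nonneg by blast
  have "\<bar>u x\<bar> \<le> B / c0" for x
    using 0 bd_D0 eq smb_bounded[OF u] c_ge c0
    by (intro maximum_principle[where S = \<Lambda>1 and a = "\<lambda>l x. (q l x + h * p l x) / h\<^sup>2"
          and y = "\<lambda>l. h *\<^sub>R l" and c = c and g = g and A = "\<lambda>l. 2 * Mb / h\<^sup>2"] coeff_bounds)
       (auto simp: Lz_alt)
  moreover have "B / c0 \<le> NB 0 * B" using B by (simp add: algebra_simps)
  ultimately show ?case by (auto intro: order_trans)
next
  case (Suc k)
  have B: "0 \<le> B" using Suc.prems bd_nonneg by blast
  have "bd k (NB k * B) u" using Suc.IH[OF bd_SucD[OF Suc.prems(1)]] Suc.prems(2) by simp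
  \<comment> \<open>The step lemma wants one constant for the solution and the source.\<close>
  moreover have "B \<le> NB k * B" using NB_ge_1[of k] B mult_right_mono[of 1 "NB k" B] by simp
  then have "bd (Suc k) (NB k * B) g" using Suc.prems(1) bd_mono by blast
  ultimately have "bd (Suc k) (FK k * (NB k * B)) u"
    using Suc.prems(2) by (intro a_priori_step[OF u _ g(1) _ _ eq])
  then show ?case by (simp add: mult.assoc)
qed

lemma solution_smb:
  assumes "smb g"
  shows "\<exists>u. smb u \<and> (\<forall>x. Lz u x - c x * u x + g x = 0)"
proof -
  have "smb (\<lambda>x. (q l x + h * p l x) / h\<^sup>2)" if "l \<in> \<Lambda>1" for l
    by (intro smb_intros smb_qpc that)
  then show ?thesis
    unfolding Lz_alt using coeff_bounds
    by (intro solution_exists[OF fin _ _ smb_qpc(3) c0 c_ge assms, of "\<lambda>l x. (q l x + h * p l x) / h\<^sup>2" "\<lambda>l. h *\<^sub>R l"]) auto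
qed

end

section \<open>Derivatives of the difference operator in the mesh size\<close>

text \<open>A weighted average of shifts along \<open>l\<close>. Unlike a difference quotient it
  makes sense for every real \<open>h\<close>, including zero and negative values, and it loses no
  derivatives.\<close>

definition J :: "(real \<Rightarrow> real) \<Rightarrow> real \<Rightarrow> real^'n::finite \<Rightarrow> (real^'n \<Rightarrow> real) \<Rightarrow> real^'n \<Rightarrow> real" where
  "J w h l \<phi> x = integral {0..1} (\<lambda>t. w t * \<phi> (x + (t * h) *\<^sub>R l))"

definition weight :: "(real \<Rightarrow> real) \<Rightarrow> bool" where
  "weight w \<longleftrightarrow> continuous_on {0..1} w \<and> (\<forall>t\<in>{0..1}. \<bar>w t\<bar> \<le> 1)"

lemma weight_simple: "weight (\<lambda>t. (1 - t) * t ^ j)" "weight (\<lambda>t. t ^ j)"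
  unfolding weight_def
  by (auto intro!: continuous_intros simp: abs_mult power_abs mult_le_one power_le_one)

lemma weight_times: "weight w \<Longrightarrow> weight (\<lambda>t. t * w t)"
  unfolding weight_def by (auto intro!: continuous_intros simp: abs_mult mult_le_one)

lemma continuous_J_integrand:
  assumes "weight w" "smb \<phi>"
  shows "continuous_on {0..1} (\<lambda>t. w t * \<phi> (x + (t * h) *\<^sub>R l))"
proof -
  have "continuous_on {0..1} (\<phi> \<circ> (\<lambda>t. x + (t * h) *\<^sub>R l))"
    by (intro continuous_on_compose continuous_intros smb_continuous_on assms)
  then show ?thesis using assms unfolding weight_def o_def by (intro continuous_intros) auto
qed

lemma tinv_J:
  fixes l :: "real^'n::finite"
  assumes w: "weight w"
  shows "tinv (J w h l) 0 1"
proof (rule tinvI)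
  note integrable = integrable_continuous_real[OF continuous_J_integrand[OF w]]
  show "J w h l (\<lambda>x. a * \<phi> x + b * \<psi> x) = (\<lambda>x. a * J w h l \<phi> x + b * J w h l \<psi> x)"
    if s: "smb \<phi>" "smb \<psi>" for \<phi> \<psi> :: "real^'n \<Rightarrow> real" and a b
  proof
    fix x
    have "J w h l (\<lambda>x. a * \<phi> x + b * \<psi> x) x =
       integral {0..1} (\<lambda>t. a * (w t * \<phi> (x + (t * h) *\<^sub>R l)) + b * (w t * \<psi> (x + (t * h) *\<^sub>R l)))"
      unfolding J_def by (simp add: algebra_simps)
    also have "\<dots> = a * J w h l \<phi> x + b * J w h l \<psi> x"
      unfolding J_def using integrable[OF s(1)] integrable[OF s(2)]
      by (subst integral_add) (auto intro: integrable_on_mult_right)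
    finally show "J w h l (\<lambda>x. a * \<phi> x + b * \<psi> x) x = a * J w h l \<phi> x + b * J w h l \<psi> x" .
  qed
  show "J w h l (\<lambda>z. \<phi> (z + y)) = (\<lambda>z. J w h l \<phi> (z + y))" for \<phi> :: "real^'n \<Rightarrow> real" and y
    by (simp add: J_def fun_eq_iff add_ac)
  show "\<bar>J w h l \<phi> x\<bar> \<le> 1 * B" if s: "smb \<phi>" "bd 0 B \<phi>" for \<phi> :: "real^'n \<Rightarrow> real" and B x
  proof -
    have "norm (integral {0..1} (\<lambda>t. w t * \<phi> (x + (t * h) *\<^sub>R l))) \<le> B * (1 - 0)"
    proof (rule integral_bound[OF _ continuous_J_integrand[OF w s(1)]])
      fix t :: real assume t: "t \<in> {0..1}"
      have "\<bar>w t\<bar> * \<bar>\<phi> (x + (t * h) *\<^sub>R l)\<bar> \<le> 1 * B"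
        using w t s(2) by (intro mult_mono) (auto simp: weight_def)
      then show "norm (w t * \<phi> (x + (t * h) *\<^sub>R l)) \<le> B" by (simp add: abs_mult)
    qed simp
    then show ?thesis by (simp add: J_def)
  qed
qed simp

lemma J_diff_bound:
  fixes l :: "real^'n::finite"
  assumes w: "weight w" and s: "smb \<phi>" "bd 1 B \<phi>"
  shows "\<bar>J w h' l \<phi> x - J w h l \<phi> x\<bar> \<le> (\<bar>h' - h\<bar> * (real CARD('n) * norm l)) * B"
proof -
  note c = continuous_J_integrand[OF w s(1)]
  have B: "0 \<le> B" using s(2) bd_nonneg by blast
  have "J w h' l \<phi> x - J w h l \<phi> x =
     integral {0..1} (\<lambda>t. w t * \<phi> (x + (t * h') *\<^sub>R l) - w t * \<phi> (x + (t * h) *\<^sub>R l))"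
    unfolding J_def by (intro integral_diff[symmetric] integrable_continuous_real c)
  moreover have "norm (integral {0..1} (\<lambda>t. w t * \<phi> (x + (t * h') *\<^sub>R l) - w t * \<phi> (x + (t * h) *\<^sub>R l)))
     \<le> ((\<bar>h' - h\<bar> * (real CARD('n) * norm l)) * B) * (1 - 0)"
  proof (rule integral_bound)
    fix t :: real assume t: "t \<in> {0..1}"
    have eq: "x + (t * h') *\<^sub>R l = (x + (t * h) *\<^sub>R l) + (t * (h' - h)) *\<^sub>R l"
      by (simp add: algebra_simps)
    have "\<bar>\<phi> (x + (t * h') *\<^sub>R l) - \<phi> (x + (t * h) *\<^sub>R l)\<bar> \<le> real CARD('n) * norm ((t * (h' - h)) *\<^sub>R l) * B"
      unfolding eq by (rule increment_bound_smb[OF s])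
    also have "\<dots> \<le> (\<bar>h' - h\<bar> * (real CARD('n) * norm l)) * B"
    proof -
      have "t * (\<bar>h' - h\<bar> * (real CARD('n) * norm l) * B) \<le> 1 * (\<bar>h' - h\<bar> * (real CARD('n) * norm l) * B)"
        using t B by (intro mult_right_mono) auto
      then show ?thesis using t by (simp add: abs_mult mult_ac)
    qed
    finally have "\<bar>w t\<bar> * \<bar>\<phi> (x + (t * h') *\<^sub>R l) - \<phi> (x + (t * h) *\<^sub>R l)\<bar> \<le> 1 * ((\<bar>h' - h\<bar> * (real CARD('n) * norm l)) * B)"
      using w t by (intro mult_mono) (auto simp: weight_def)
    then show "norm (w t * \<phi> (x + (t * h') *\<^sub>R l) - w t * \<phi> (x + (t * h) *\<^sub>R l)) \<le> (\<bar>h' - h\<bar> * (real CARD('n) * norm l)) * B"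
      by (simp add: abs_mult right_diff_distrib[symmetric])
  qed (auto intro: continuous_on_diff c)
  ultimately show ?thesis by simp
qed

text \<open>Differentiation in \<open>h\<close> under the integral brings down a factor
  \<open>t\<close> and a derivative along \<open>l\<close>. The remainder is bounded by
  \<open>taylor2_bound\<close> for each \<open>t\<close>, uniformly in \<open>x\<close> and
  \<open>h\<close>.\<close>

lemma J_taylor_bound:
  fixes l :: "real^'n::finite"
  assumes w: "weight w" and s: "smb \<phi>" "bd 2 B \<phi>"
  shows "\<bar>J w h' l \<phi> x - J w h l \<phi> x - (h' - h) * J (\<lambda>t. t * w t) h l (dir l \<phi>) x\<bar>
    \<le> ((h' - h)\<^sup>2 * (real CARD('n) * norm l)\<^sup>2) * B"
proof -
  note c = continuous_J_integrand[OF w s(1)]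
  have sd: "smb (dir l \<phi>)" by (rule tinv_smb[OF tinv_dir s(1)])
  note c2 = continuous_J_integrand[OF weight_times[OF w] sd]
  have B: "0 \<le> B" using s(2) bd_nonneg by blast
  let ?f = "\<lambda>t. w t * \<phi> (x + (t * h') *\<^sub>R l) - w t * \<phi> (x + (t * h) *\<^sub>R l) - (h' - h) * (t * w t * dir l \<phi> (x + (t * h) *\<^sub>R l))"
  have "J w h' l \<phi> x - J w h l \<phi> x - (h' - h) * J (\<lambda>t. t * w t) h l (dir l \<phi>) x = integral {0..1} ?f"
    unfolding J_def
    by (subst integral_diff, (intro integrable_diff integrable_on_mult_right integrable_continuous_real c c2)+,
        subst integral_diff, (intro integrable_continuous_real c)+, simp)
  moreover have "norm (integral {0..1} ?f) \<le> (((h' - h)\<^sup>2 * (real CARD('n) * norm l)\<^sup>2) * B) * (1 - 0)"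
  proof (rule integral_bound)
    fix t :: real assume t: "t \<in> {0..1}"
    define z where "z = x + (t * h) *\<^sub>R l"
    define y where "y = (t * (h' - h)) *\<^sub>R l"
    have eq: "x + (t * h') *\<^sub>R l = z + y" by (simp add: z_def y_def algebra_simps)
    have S: "(\<Sum>i\<in>UNIV. y$i * partial i \<phi> z) = t * (h' - h) * dir l \<phi> z"
      by (simp add: y_def dir_def sum_distrib_left mult_ac)
    have f: "?f t = w t * (\<phi> (z + y) - \<phi> z - (\<Sum>i\<in>UNIV. y$i * partial i \<phi> z))"
      unfolding eq z_def[symmetric] S by (simp add: algebra_simps)
    have "\<bar>\<phi> (z + y) - \<phi> z - (\<Sum>i\<in>UNIV. y$i * partial i \<phi> z)\<bar> \<le> (real CARD('n))\<^sup>2 * B * (norm y)\<^sup>2"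
      by (rule taylor2_bound[OF s])
    also have "\<dots> \<le> ((h' - h)\<^sup>2 * (real CARD('n) * norm l)\<^sup>2) * B"
    proof -
      have "t\<^sup>2 * ((h' - h)\<^sup>2 * (real CARD('n) * norm l)\<^sup>2 * B) \<le> 1 * ((h' - h)\<^sup>2 * (real CARD('n) * norm l)\<^sup>2 * B)"
        using t B by (intro mult_right_mono) (auto simp: power_le_one)
      then show ?thesis by (simp add: y_def power_mult_distrib mult_ac)
    qed
    finally have "\<bar>w t\<bar> * \<bar>\<phi> (z + y) - \<phi> z - (\<Sum>i\<in>UNIV. y$i * partial i \<phi> z)\<bar> \<le> 1 * (((h' - h)\<^sup>2 * (real CARD('n) * norm l)\<^sup>2) * B)"
      using w t by (intro mult_mono) (auto simp: weight_def)
    then show "norm (?f t) \<le> ((h' - h)\<^sup>2 * (real CARD('n) * norm l)\<^sup>2) * B"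
      unfolding f by (simp add: abs_mult)
  qed (simp, rule continuous_on_diff[OF continuous_on_diff[OF c c] continuous_on_mult_left[OF c2]])
  ultimately show ?thesis by simp
qed

lemma line_derivative:
  assumes "smb \<phi>"
  shows "((\<lambda>t. \<phi> (x + (t * h) *\<^sub>R l)) has_real_derivative h * dir l \<phi> (x + (t * h) *\<^sub>R l)) (at t within S)"
proof -
  have "((\<lambda>t. x + (t * h) *\<^sub>R l) has_derivative (\<lambda>s. (s * h) *\<^sub>R l)) (at t)"
    by (auto intro!: derivative_eq_intros)
  from diff_chain_at[OF this smb_has_derivative[OF assms]]
  have "((\<lambda>t. \<phi> (x + (t * h) *\<^sub>R l)) has_derivative (\<lambda>s. h * dir l \<phi> (x + (t * h) *\<^sub>R l) * s)) (at t)"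
    by (simp add: o_def dir_def sum_distrib_left sum_distrib_right mult_ac)
  then show ?thesis
    unfolding has_field_derivative_def by (rule has_derivative_at_withinI)
qed

lemma J_first_order:
  assumes "smb \<phi>"
  shows "\<phi> (x + h *\<^sub>R l) - \<phi> x = h * J (\<lambda>t. 1) h l (dir l \<phi>) x"
proof -
  have "((\<lambda>t. h * dir l \<phi> (x + (t * h) *\<^sub>R l)) has_integral
     (\<phi> (x + (1 * h) *\<^sub>R l) - \<phi> (x + (0 * h) *\<^sub>R l))) {0..1}"
    by (intro fundamental_theorem_of_calculus) (auto intro!: line_derivative assms
        simp: has_real_derivative_iff_has_vector_derivative[symmetric])
  from integral_unique[OF this] show ?thesis by (simp add: J_def)
qed

lemma J_second_order:
  assumes s: "smb \<phi>"
  shows "\<phi> (x + h *\<^sub>R l) - \<phi> x - h * dir l \<phi> x = h\<^sup>2 * J (\<lambda>t. 1 - t) h l (dir l (dir l \<phi>)) x"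
proof -
  \<comment> \<open>An antiderivative of the integrand: in its derivative the two first order
    contributions cancel.\<close>
  let ?g = "\<lambda>t. (1 - t) * (h * dir l \<phi> (x + (t * h) *\<^sub>R l)) + \<phi> (x + (t * h) *\<^sub>R l)"
  have sd: "smb (dir l \<phi>)" by (rule tinv_smb[OF tinv_dir s])
  have "((\<lambda>t. h\<^sup>2 * ((1 - t) * dir l (dir l \<phi>) (x + (t * h) *\<^sub>R l))) has_integral (?g 1 - ?g 0)) {0..1}"
    by (intro fundamental_theorem_of_calculus)
       (auto intro!: derivative_eq_intros line_derivative s sd
        simp: has_real_derivative_iff_has_vector_derivative[symmetric] power2_eq_square)
  from integral_unique[OF this] show ?thesis by (simp add: J_def)
qed

text \<open>For symmetric data \<open>LJ \<Lambda>1 q p 0 h\<close> is \<open>L_op\<close> without the term \<open>- c \<phi>\<close>, written with the integral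
  remainder of Taylor's formula, and \<open>LJ \<Lambda>1 q p j h\<close> is its \<open>j\<close>-th derivative in \<open>h\<close>.\<close>

definition LJ :: "(real^'n::finite) set \<Rightarrow> (real^'n \<Rightarrow> real^'n \<Rightarrow> real) \<Rightarrow> (real^'n \<Rightarrow> real^'n \<Rightarrow> real) \<Rightarrow>
    nat \<Rightarrow> real \<Rightarrow> (real^'n \<Rightarrow> real) \<Rightarrow> real^'n \<Rightarrow> real" where
  "LJ \<Lambda>1 q p j h \<phi> x =
    (\<Sum>l\<in>\<Lambda>1. q l x * J (\<lambda>t. (1 - t) * t ^ j) h l ((dir l ^^ (j + 2)) \<phi>) x) +
    (\<Sum>l\<in>\<Lambda>1. p l x * J (\<lambda>t. t ^ j) h l ((dir l ^^ (j + 1)) \<phi>) x)"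

lemma tinv_J_dir:
  fixes l :: "real^'n::finite"
  assumes "weight w"
  shows "tinv (\<lambda>\<phi>. J w h l ((dir l ^^ k) \<phi>)) k ((real CARD('n) * norm l) ^ k)"
  using tinv_comp[OF tinv_J[OF assms] tinv_dir_pow] by simp

text \<open>Each \<open>norm l\<close> is at most \<open>s1\<close>, and two of the powers are
  summed through \<open>s1\<^sup>2\<close>; with exponents of at least two the bound ignores the
  number of directions. This is why \<open>LJ_bd\<close> requires \<open>1 \<le> j\<close>: its term
  with \<open>p\<close> has exponent \<open>j + 1\<close>.\<close>

lemma coefficient_sum_bd:
  fixes \<Lambda>1 :: "(real^'n::finite) set"
  assumes fin: "finite \<Lambda>1" and s1: "0 \<le> s1" "(\<Sum>l\<in>\<Lambda>1. (norm l)\<^sup>2) \<le> s1\<^sup>2"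
    and r: "\<And>l. l \<in> \<Lambda>1 \<Longrightarrow> smb (r l)" "\<And>l. l \<in> \<Lambda>1 \<Longrightarrow> bd n M (r l)" and M: "0 \<le> M"
    and T: "\<And>l. l \<in> \<Lambda>1 \<Longrightarrow> tinv (T l) k (a * (real CARD('n) * norm l) ^ (i + 2))"
    and \<phi>: "smb \<phi>" "bd (n + k) A \<phi>" and a: "0 \<le> a"
  shows "bd n (2 ^ n * M * ((real CARD('n) * s1) ^ (i + 2)) * (a * A)) (\<lambda>x. \<Sum>l\<in>\<Lambda>1. r l x * T l \<phi> x)"
proof -
  let ?d = "real CARD('n)"
  have A: "0 \<le> A" using \<phi> bd_nonneg by blast
  have "bd n (\<Sum>l\<in>\<Lambda>1. 2 ^ n * M * (a * (?d * norm l) ^ (i + 2) * A)) (\<lambda>x. \<Sum>l\<in>\<Lambda>1. r l x * T l \<phi> x)"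
    using tinv_smb[OF T \<phi>(1)] tinv_bd[OF T \<phi>] r
    by (intro bd_sum bd_mult) (auto intro: smb_mult)
  moreover have "(\<Sum>l\<in>\<Lambda>1. 2 ^ n * M * (a * (?d * norm l) ^ (i + 2) * A)) \<le> 2 ^ n * M * ((?d * s1) ^ (i + 2)) * (a * A)"
  proof -
    have "(norm l) ^ (i + 2) \<le> s1 ^ i * (norm l)\<^sup>2" if l: "l \<in> \<Lambda>1" for l
    proof -
      have "(norm l)\<^sup>2 \<le> (\<Sum>l\<in>\<Lambda>1. (norm l)\<^sup>2)" using l fin by (intro member_le_sum) auto
      then have "norm l \<le> s1" using s1 by (smt (verit) power2_le_imp_le)
      then show ?thesis unfolding power_add by (intro mult_right_mono power_mono) auto
    qed
    then have "(\<Sum>l\<in>\<Lambda>1. (norm l) ^ (i + 2)) \<le> (\<Sum>l\<in>\<Lambda>1. s1 ^ i * (norm l)\<^sup>2)" by (rule sum_mono)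
    also have "\<dots> \<le> s1 ^ i * s1\<^sup>2" unfolding sum_distrib_left[symmetric] using s1 by (intro mult_left_mono) auto
    finally have "(\<Sum>l\<in>\<Lambda>1. (norm l) ^ (i + 2)) \<le> s1 ^ (i + 2)" by (simp only: power_add[of s1])
    then have "(2 ^ n * M * (a * A) * ?d ^ (i + 2)) * (\<Sum>l\<in>\<Lambda>1. (norm l) ^ (i + 2)) \<le> (2 ^ n * M * (a * A) * ?d ^ (i + 2)) * s1 ^ (i + 2)"
      using M a A by (intro mult_left_mono) auto
    moreover have "(\<Sum>l\<in>\<Lambda>1. 2 ^ n * M * (a * (?d * norm l) ^ (i + 2) * A)) =
       (2 ^ n * M * (a * A) * ?d ^ (i + 2)) * (\<Sum>l\<in>\<Lambda>1. (norm l) ^ (i + 2))"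
      unfolding sum_distrib_left by (intro sum.cong refl) (simp only: power_mult_distrib mult_ac)
    ultimately show ?thesis by (simp only: power_mult_distrib mult_ac)
  qed
  ultimately show ?thesis by (rule bd_mono)
qed

text \<open>Neither symmetry nor ellipticity is assumed, and \<open>n\<close> and \<open>M\<close>
  are free, so that the locale also applies to the difference of two sets of coefficients, with
  \<open>M\<close> small.\<close>

locale coeffs =
  fixes \<Lambda>1 :: "(real^'n::finite) set" and s1 :: real and n :: nat and M :: real
    and q p :: "real^'n \<Rightarrow> real^'n \<Rightarrow> real"
  assumes fin: "finite \<Lambda>1" and s1: "0 \<le> s1" "(\<Sum>l\<in>\<Lambda>1. (norm l)\<^sup>2) \<le> s1\<^sup>2" and M: "0 \<le> M"
    and smb_q: "\<And>l. l \<in> \<Lambda>1 \<Longrightarrow> smb (q l)" and smb_p: "\<And>l. l \<in> \<Lambda>1 \<Longrightarrow> smb (p l)"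
    and bd_q: "\<And>l. l \<in> \<Lambda>1 \<Longrightarrow> bd n M (q l)" and bd_p: "\<And>l. l \<in> \<Lambda>1 \<Longrightarrow> bd n M (p l)"
begin

lemma smb_LJ: "smb \<phi> \<Longrightarrow> smb (LJ \<Lambda>1 q p j h \<phi>)"
  unfolding LJ_def
  by (intro smb_intros smb_q smb_p tinv_smb[OF tinv_J_dir] weight_simple)

lemma LJ_diff_arg:
  assumes "smb \<phi>" "smb \<psi>"
  shows "LJ \<Lambda>1 q p j h (\<lambda>x. \<phi> x - \<psi> x) x = LJ \<Lambda>1 q p j h \<phi> x - LJ \<Lambda>1 q p j h \<psi> x"
  unfolding LJ_def
  by (simp add: tinv_diff[OF tinv_J_dir[OF weight_simple(1)]] tinv_diff[OF tinv_J_dir[OF weight_simple(2)]]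
      assms right_diff_distrib sum_subtractf del: funpow.simps)

lemma LJ_cmult_arg:
  assumes "smb \<phi>"
  shows "LJ \<Lambda>1 q p j h (\<lambda>x. k * \<phi> x) x = k * LJ \<Lambda>1 q p j h \<phi> x"
  unfolding LJ_def
  by (simp add: tinv_cmult[OF tinv_J_dir[OF weight_simple(1)]] tinv_cmult[OF tinv_J_dir[OF weight_simple(2)]]
      assms sum_distrib_left mult_ac distrib_left del: funpow.simps)

lemma LJ_bd:
  assumes \<phi>: "smb \<phi>" "bd (n + j + 2) A \<phi>" and j: "1 \<le> j"
  shows "bd n (2 ^ n * M * ((real CARD('n) * s1) ^ (j + 2) + (real CARD('n) * s1) ^ (j + 1)) * A) (LJ \<Lambda>1 q p j h \<phi>)"
proof -
  obtain i where i: "j = Suc i" using j by (cases j) auto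
  have 1: "bd n (2 ^ n * M * ((real CARD('n) * s1) ^ (j + 2)) * (1 * A))
    (\<lambda>x. \<Sum>l\<in>\<Lambda>1. q l x * (\<lambda>\<phi>. J (\<lambda>t. (1 - t) * t ^ j) h l ((dir l ^^ (j + 2)) \<phi>)) \<phi> x)"
  proof (rule coefficient_sum_bd[OF fin s1 smb_q bd_q M _ \<phi>(1), where k = "j + 2"])
    show "tinv (\<lambda>\<phi>. J (\<lambda>t. (1 - t) * t ^ j) h l ((dir l ^^ (j + 2)) \<phi>)) (j + 2) (1 * (real CARD('n) * norm l) ^ (j + 2))" for l :: "real^'n"
      using tinv_J_dir[OF weight_simple(1), of j h l "j + 2"] by (simp only: mult_1)
    show "bd (n + (j + 2)) A \<phi>" by (rule bd_le[OF \<phi>(2)]) simp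
  qed auto
  have 2: "bd n (2 ^ n * M * ((real CARD('n) * s1) ^ (i + 2)) * (1 * A))
    (\<lambda>x. \<Sum>l\<in>\<Lambda>1. p l x * (\<lambda>\<phi>. J (\<lambda>t. t ^ j) h l ((dir l ^^ (j + 1)) \<phi>)) \<phi> x)"
  proof (rule coefficient_sum_bd[OF fin s1 smb_p bd_p M _ \<phi>(1), where k = "j + 1"])
    show "tinv (\<lambda>\<phi>. J (\<lambda>t. t ^ j) h l ((dir l ^^ (j + 1)) \<phi>)) (j + 1) (1 * (real CARD('n) * norm l) ^ (i + 2))" for l :: "real^'n"
      using tinv_J_dir[OF weight_simple(2), of j h l "j + 1"] i
      by (simp only: mult_1 Suc_eq_plus1 add.assoc one_add_one)
    show "bd (n + (j + 1)) A \<phi>" by (rule bd_le[OF \<phi>(2)]) simp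
  qed auto
  have "bd n (2 ^ n * M * ((real CARD('n) * s1) ^ (j + 2)) * (1 * A) + 2 ^ n * M * ((real CARD('n) * s1) ^ (i + 2)) * (1 * A)) (LJ \<Lambda>1 q p j h \<phi>)"
    unfolding LJ_def
    by (rule bd_add) (use 1 2 in \<open>auto intro!: smb_sum smb_mult smb_q smb_p tinv_smb[OF tinv_J_dir] weight_simple \<phi>(1) simp del: funpow.simps\<close>)
  then show ?thesis by (simp add: i algebra_simps)
qed

end

section \<open>Variation of the operators in the mesh size\<close>

lemma tinv_J_diff:
  fixes l :: "real^'n::finite"
  assumes w: "weight w"
  shows "tinv (\<lambda>\<phi> x. J w h' l \<phi> x - J w h l \<phi> x) 1 (\<bar>h' - h\<bar> * (real CARD('n) * norm l))"
proof (rule tinv_improve)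
  show "tinv (\<lambda>\<phi> x. J w h' l \<phi> x - J w h l \<phi> x) 0 (1 + \<bar>-1\<bar> * 1)"
    using tinv_plus[OF tinv_J[OF w, of h' l] tinv_scale[OF tinv_J[OF w, of h l], of "-1"]] by simp
qed (auto intro: J_diff_bound[OF w])

lemma tinv_J_taylor:
  fixes l :: "real^'n::finite"
  assumes w: "weight w"
  shows "tinv (\<lambda>\<phi> x. J w h' l \<phi> x - J w h l \<phi> x - (h' - h) * J (\<lambda>t. t * w t) h l (dir l \<phi>) x) 2
    ((h' - h)\<^sup>2 * (real CARD('n) * norm l)\<^sup>2)"
proof (rule tinv_improve)
  have a: "tinv (\<lambda>\<phi> x. J w h' l \<phi> x - J w h l \<phi> x) 1 (\<bar>h' - h\<bar> * (real CARD('n) * norm l))"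
    by (rule tinv_J_diff[OF w])
  have b: "tinv (\<lambda>\<phi> x. - (h' - h) * J (\<lambda>t. t * w t) h l (dir l \<phi>) x) 1 (\<bar>- (h' - h)\<bar> * (1 * (real CARD('n) * norm l)))"
    using tinv_scale[OF tinv_comp[OF tinv_J[OF weight_times[OF w]] tinv_dir]] by simp
  show "tinv (\<lambda>\<phi> x. J w h' l \<phi> x - J w h l \<phi> x - (h' - h) * J (\<lambda>t. t * w t) h l (dir l \<phi>) x) 1
    (\<bar>h' - h\<bar> * (real CARD('n) * norm l) + \<bar>- (h' - h)\<bar> * (1 * (real CARD('n) * norm l)))"
    using tinv_plus[OF a b] by (simp only: mult_minus_left add_uminus_conv_diff)
qed (auto intro: J_taylor_bound[OF w])

lemma dir_pow_neg: "smb \<phi> \<Longrightarrow> (dir (- l) ^^ k) \<phi> = (\<lambda>x. (-1) ^ k * (dir l ^^ k) \<phi> x)"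
proof (induction k)
  case (Suc k)
  have s: "smb ((dir l ^^ k) \<phi>)" by (rule tinv_smb[OF tinv_dir_pow Suc.prems])
  have "dir (- l) \<psi> = (\<lambda>x. - dir l \<psi> x)" for \<psi> by (simp add: dir_def fun_eq_iff sum_negf)
  then show ?case using Suc tinv_cmult[OF tinv_dir s] by simp
qed simp

lemma J_neg: "J w h (- l) \<phi> = J w (- h) l \<phi>"
  by (simp add: J_def fun_eq_iff)

context coeffs
begin

lemma LJ_lipschitz:
  assumes \<phi>: "smb \<phi>" "bd (n + j + 3) A \<phi>"
  shows "bd n (2 ^ n * M * ((real CARD('n) * s1) ^ (j + 3) + (real CARD('n) * s1) ^ (j + 2)) * (\<bar>h' - h\<bar> * A))
    (\<lambda>x. LJ \<Lambda>1 q p j h' \<phi> x - LJ \<Lambda>1 q p j h \<phi> x)"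
proof -
  let ?d = "real CARD('n)"
  let ?T = "\<lambda>w k l \<phi> x. J w h' l ((dir l ^^ k) \<phi>) x - J w h l ((dir l ^^ k) \<phi>) x"
  have T: "tinv (?T w k l) (k + 1) (\<bar>h' - h\<bar> * (?d * norm l) ^ (i + 2))" if "weight w" "k + 1 = i + 2"
    for w k i and l :: "real^'n"
  proof -
    have "\<bar>h' - h\<bar> * (?d * norm l) * (?d * norm l) ^ k = \<bar>h' - h\<bar> * (?d * norm l) ^ (i + 2)"
      using that(2) by (metis mult.assoc power_Suc Suc_eq_plus1)
    then show ?thesis
      using tinv_comp[OF tinv_J_diff[OF that(1), of h' l h] tinv_dir_pow[where l = l and j = k]] by (simp only: add.commute[of 1 k])
  qed
  have 1: "bd n (2 ^ n * M * ((?d * s1) ^ (j + 1 + 2)) * (\<bar>h' - h\<bar> * A)) (\<lambda>x. \<Sum>l\<in>\<Lambda>1. q l x * ?T (\<lambda>t. (1 - t) * t ^ j) (j + 2) l \<phi> x)"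
  proof (rule coefficient_sum_bd[OF fin s1 smb_q bd_q M, where k = "j + 2 + 1" and T = "?T (\<lambda>t. (1 - t) * t ^ j) (j + 2)"])
    show "tinv (?T (\<lambda>t. (1 - t) * t ^ j) (j + 2) l) (j + 2 + 1) (\<bar>h' - h\<bar> * (?d * norm l) ^ (j + 1 + 2))" for l :: "real^'n"
      by (rule T[OF weight_simple(1)]) simp
    show "bd (n + (j + 2 + 1)) A \<phi>" by (rule bd_le[OF \<phi>(2)]) simp
  qed (use \<phi> in auto)
  have 2: "bd n (2 ^ n * M * ((?d * s1) ^ (j + 2)) * (\<bar>h' - h\<bar> * A)) (\<lambda>x. \<Sum>l\<in>\<Lambda>1. p l x * ?T (\<lambda>t. t ^ j) (j + 1) l \<phi> x)"
  proof (rule coefficient_sum_bd[OF fin s1 smb_p bd_p M, where k = "j + 1 + 1" and T = "?T (\<lambda>t. t ^ j) (j + 1)"])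
    show "tinv (?T (\<lambda>t. t ^ j) (j + 1) l) (j + 1 + 1) (\<bar>h' - h\<bar> * (?d * norm l) ^ (j + 2))" for l :: "real^'n"
      by (rule T[OF weight_simple(2)]) simp
    show "bd (n + (j + 1 + 1)) A \<phi>" by (rule bd_le[OF \<phi>(2)]) simp
  qed (use \<phi> in auto)
  have s: "smb (\<lambda>x. \<Sum>l\<in>\<Lambda>1. r l x * ?T w k l \<phi> x)" if "\<And>l. l \<in> \<Lambda>1 \<Longrightarrow> smb (r l)" "weight w" for r w k
    by (intro smb_intros that tinv_smb[OF tinv_J_dir[OF that(2)]] \<phi>)
  have "bd n (2 ^ n * M * ((?d * s1) ^ (j + 1 + 2)) * (\<bar>h' - h\<bar> * A) + 2 ^ n * M * ((?d * s1) ^ (j + 2)) * (\<bar>h' - h\<bar> * A))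
     (\<lambda>x. (\<Sum>l\<in>\<Lambda>1. q l x * ?T (\<lambda>t. (1 - t) * t ^ j) (j + 2) l \<phi> x) + (\<Sum>l\<in>\<Lambda>1. p l x * ?T (\<lambda>t. t ^ j) (j + 1) l \<phi> x))"
    by (rule bd_add[OF s s 1 2]) (auto intro: smb_q smb_p weight_simple)
  moreover have "(\<lambda>x. (\<Sum>l\<in>\<Lambda>1. q l x * ?T (\<lambda>t. (1 - t) * t ^ j) (j + 2) l \<phi> x) + (\<Sum>l\<in>\<Lambda>1. p l x * ?T (\<lambda>t. t ^ j) (j + 1) l \<phi> x))
     = (\<lambda>x. LJ \<Lambda>1 q p j h' \<phi> x - LJ \<Lambda>1 q p j h \<phi> x)"
    unfolding LJ_def by (simp add: fun_eq_iff right_diff_distrib sum_subtractf del: funpow.simps)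
  moreover have "j + 1 + 2 = j + 3" by simp
  ultimately show ?thesis by (simp only: distrib_left distrib_right)
qed

text \<open>Identifies the operator of index \<open>Suc j\<close> as the \<open>h\<close>-derivative
  of the one of index \<open>j\<close>, for all real \<open>h\<close>. Each differentiation
  multiplies the weight by \<open>t\<close>, which raises the exponent in
  \<open>t ^ j\<close>.\<close>

lemma LJ_taylor:
  assumes \<phi>: "smb \<phi>" "bd (n + j + 4) A \<phi>"
  shows "bd n (2 ^ n * M * ((real CARD('n) * s1) ^ (j + 4) + (real CARD('n) * s1) ^ (j + 3)) * ((h' - h)\<^sup>2 * A))
    (\<lambda>x. LJ \<Lambda>1 q p j h' \<phi> x - LJ \<Lambda>1 q p j h \<phi> x - (h' - h) * LJ \<Lambda>1 q p (Suc j) h \<phi> x)"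
proof -
  let ?d = "real CARD('n)"
  let ?T = "\<lambda>w k l \<phi> x. J w h' l ((dir l ^^ k) \<phi>) x - J w h l ((dir l ^^ k) \<phi>) x
     - (h' - h) * J (\<lambda>t. t * w t) h l (dir l ((dir l ^^ k) \<phi>)) x"
  have T: "tinv (?T w k l) (k + 2) ((h' - h)\<^sup>2 * (?d * norm l) ^ (k + 2))" if "weight w"
    for w k and l :: "real^'n"
  proof -
    have "(h' - h)\<^sup>2 * (?d * norm l)\<^sup>2 * (?d * norm l) ^ k = (h' - h)\<^sup>2 * (?d * norm l) ^ (k + 2)"
      unfolding power_add by (simp only: mult.assoc mult.commute mult.left_commute)
    then show ?thesis
      using tinv_comp[OF tinv_J_taylor[OF that(1), of h' l h] tinv_dir_pow[where l = l and j = k]]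
      unfolding add.commute[of 2 k] by (simp only:)
  qed
  have 1: "bd n (2 ^ n * M * ((?d * s1) ^ (j + 2 + 2)) * ((h' - h)\<^sup>2 * A)) (\<lambda>x. \<Sum>l\<in>\<Lambda>1. q l x * ?T (\<lambda>t. (1 - t) * t ^ j) (j + 2) l \<phi> x)"
  proof (rule coefficient_sum_bd[OF fin s1 smb_q bd_q M, where k = "j + 2 + 2" and T = "?T (\<lambda>t. (1 - t) * t ^ j) (j + 2)"])
    show "tinv (?T (\<lambda>t. (1 - t) * t ^ j) (j + 2) l) (j + 2 + 2) ((h' - h)\<^sup>2 * (?d * norm l) ^ (j + 2 + 2))" for l :: "real^'n"
      by (rule T[OF weight_simple(1)])
    show "bd (n + (j + 2 + 2)) A \<phi>" by (rule bd_le[OF \<phi>(2)]) simp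
  qed (use \<phi> in auto)
  have 2: "bd n (2 ^ n * M * ((?d * s1) ^ (j + 1 + 2)) * ((h' - h)\<^sup>2 * A)) (\<lambda>x. \<Sum>l\<in>\<Lambda>1. p l x * ?T (\<lambda>t. t ^ j) (j + 1) l \<phi> x)"
  proof (rule coefficient_sum_bd[OF fin s1 smb_p bd_p M, where k = "j + 1 + 2" and T = "?T (\<lambda>t. t ^ j) (j + 1)"])
    show "tinv (?T (\<lambda>t. t ^ j) (j + 1) l) (j + 1 + 2) ((h' - h)\<^sup>2 * (?d * norm l) ^ (j + 1 + 2))" for l :: "real^'n"
      by (rule T[OF weight_simple(2)])
    show "bd (n + (j + 1 + 2)) A \<phi>" by (rule bd_le[OF \<phi>(2)]) simp
  qed (use \<phi> in auto)
  have s: "smb (\<lambda>x. \<Sum>l\<in>\<Lambda>1. r l x * ?T w k l \<phi> x)" if "\<And>l. l \<in> \<Lambda>1 \<Longrightarrow> smb (r l)" "weight w" for r w k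
    by (intro smb_intros that tinv_smb[OF T[OF that(2)]] \<phi>)
  have "bd n (2 ^ n * M * ((?d * s1) ^ (j + 2 + 2)) * ((h' - h)\<^sup>2 * A) + 2 ^ n * M * ((?d * s1) ^ (j + 1 + 2)) * ((h' - h)\<^sup>2 * A))
     (\<lambda>x. (\<Sum>l\<in>\<Lambda>1. q l x * ?T (\<lambda>t. (1 - t) * t ^ j) (j + 2) l \<phi> x) + (\<Sum>l\<in>\<Lambda>1. p l x * ?T (\<lambda>t. t ^ j) (j + 1) l \<phi> x))"
    by (rule bd_add[OF s s 1 2]) (auto intro: smb_q smb_p weight_simple)
  moreover have "(\<lambda>x. (\<Sum>l\<in>\<Lambda>1. q l x * ?T (\<lambda>t. (1 - t) * t ^ j) (j + 2) l \<phi> x) + (\<Sum>l\<in>\<Lambda>1. p l x * ?T (\<lambda>t. t ^ j) (j + 1) l \<phi> x))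
     = (\<lambda>x. LJ \<Lambda>1 q p j h' \<phi> x - LJ \<Lambda>1 q p j h \<phi> x - (h' - h) * LJ \<Lambda>1 q p (Suc j) h \<phi> x)"
  proof -
    have w: "(\<lambda>t. t * ((1 - t) * t ^ j)) = (\<lambda>t::real. (1 - t) * t ^ Suc j)" "(\<lambda>t. t * t ^ j) = (\<lambda>t::real. t ^ Suc j)"
      by (auto simp: fun_eq_iff)
    have k: "dir l ((dir l ^^ (j + 2)) \<phi>) = (dir l ^^ (Suc j + 2)) \<phi>" "dir l ((dir l ^^ (j + 1)) \<phi>) = (dir l ^^ (Suc j + 1)) \<phi>" for l
      by simp_all
    show ?thesis
      unfolding LJ_def w k
      by (simp only: fun_eq_iff right_diff_distrib sum_subtractf sum_distrib_left distrib_left mult.left_commute) simp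
  qed
  moreover have "j + 2 + 2 = j + 4" "j + 1 + 2 = j + 3" by simp_all
  ultimately show ?thesis by (simp only: distrib_left distrib_right)
qed

end

section \<open>Symmetric coefficients and parity in the mesh size\<close>

locale scoeffs = coeffs \<Lambda>1 s1 n M q p
  for \<Lambda>1 :: "(real^'n::finite) set" and s1 n M q p +
  assumes sym: "uminus ` \<Lambda>1 = \<Lambda>1" "\<And>l. l \<in> \<Lambda>1 \<Longrightarrow> q (- l) = q l"
      "\<And>l. l \<in> \<Lambda>1 \<Longrightarrow> p (- l) = (\<lambda>x. - p l x)"
begin

lemma sum_neg: "(\<Sum>l\<in>\<Lambda>1. F l) = (\<Sum>l\<in>\<Lambda>1. F (- l))" for F :: "_ \<Rightarrow> real"
  using sum.reindex[of uminus \<Lambda>1 F] sym(1) by (simp add: o_def)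

text \<open>Replacing \<open>l\<close> by \<open>- l\<close> in the sums turns \<open>h\<close> into
  \<open>- h\<close> inside \<open>J\<close> and contributes one sign for each derivative along
  \<open>l\<close>, and one more for \<open>p\<close>. In both sums the total sign is
  \<open>(-1) ^ j\<close>.\<close>

lemma LJ_reflect:
  assumes "smb \<phi>"
  shows "LJ \<Lambda>1 q p j h \<phi> x = (-1) ^ j * LJ \<Lambda>1 q p j (- h) \<phi> x"
proof -
  have "(\<Sum>l\<in>\<Lambda>1. q l x * J (\<lambda>t. (1 - t) * t ^ j) h l ((dir l ^^ (j + 2)) \<phi>) x) =
     (\<Sum>l\<in>\<Lambda>1. (-1) ^ j * (q l x * J (\<lambda>t. (1 - t) * t ^ j) (- h) l ((dir l ^^ (j + 2)) \<phi>) x))"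
  proof (subst sum_neg, intro sum.cong refl)
    fix l assume l: "l \<in> \<Lambda>1"
    have s: "smb ((dir l ^^ (j + 2)) \<phi>)" by (rule tinv_smb[OF tinv_dir_pow assms])
    have "(-1) ^ (j + 2) = ((-1) ^ j :: real)" by simp
    then show "q (- l) x * J (\<lambda>t. (1 - t) * t ^ j) h (- l) ((dir (- l) ^^ (j + 2)) \<phi>) x =
      (-1) ^ j * (q l x * J (\<lambda>t. (1 - t) * t ^ j) (- h) l ((dir l ^^ (j + 2)) \<phi>) x)"
      using sym(2)[OF l] unfolding J_neg dir_pow_neg[OF assms] tinv_cmult[OF tinv_J[OF weight_simple(1)] s]
      by (simp only: mult.left_commute)
  qed
  moreover have "(\<Sum>l\<in>\<Lambda>1. p l x * J (\<lambda>t. t ^ j) h l ((dir l ^^ (j + 1)) \<phi>) x) =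
     (\<Sum>l\<in>\<Lambda>1. (-1) ^ j * (p l x * J (\<lambda>t. t ^ j) (- h) l ((dir l ^^ (j + 1)) \<phi>) x))"
  proof (subst sum_neg, intro sum.cong refl)
    fix l assume l: "l \<in> \<Lambda>1"
    have s: "smb ((dir l ^^ (j + 1)) \<phi>)" by (rule tinv_smb[OF tinv_dir_pow assms])
    have "(-1) ^ (j + 1) = (- ((-1) ^ j) :: real)" by simp
    then show "p (- l) x * J (\<lambda>t. t ^ j) h (- l) ((dir (- l) ^^ (j + 1)) \<phi>) x =
      (-1) ^ j * (p l x * J (\<lambda>t. t ^ j) (- h) l ((dir l ^^ (j + 1)) \<phi>) x)"
      using sym(3)[OF l] unfolding J_neg dir_pow_neg[OF assms] tinv_cmult[OF tinv_J[OF weight_simple(2)] s]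
      by (simp only: mult_minus_left mult_minus_right minus_minus mult.left_commute)
  qed
  ultimately show ?thesis unfolding LJ_def by (simp only: sum_distrib_left distrib_left)
qed

text \<open>For odd \<open>j\<close> the operator is half of its own increment from
  \<open>- h\<close> to \<open>h\<close>. The Lipschitz bound yields the factor \<open>h\<close> and
  costs one derivative more than \<open>LJ_bd\<close>.\<close>

lemma LJ_odd_bd:
  assumes \<phi>: "smb \<phi>" "bd (n + j + 3) A \<phi>" and j: "odd j" and h: "0 \<le> h"
  shows "bd n (2 ^ n * M * ((real CARD('n) * s1) ^ (j + 3) + (real CARD('n) * s1) ^ (j + 2)) * (h * A)) (LJ \<Lambda>1 q p j h \<phi>)"
proof -
  have eq: "LJ \<Lambda>1 q p j h \<phi> = (\<lambda>x. (1/2) * (LJ \<Lambda>1 q p j h \<phi> x - LJ \<Lambda>1 q p j (- h) \<phi> x))"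
    using LJ_reflect[OF \<phi>(1), of j h] j by (simp add: fun_eq_iff)
  have b: "bd n (2 ^ n * M * ((real CARD('n) * s1) ^ (j + 3) + (real CARD('n) * s1) ^ (j + 2)) * (\<bar>h - - h\<bar> * A))
     (\<lambda>x. LJ \<Lambda>1 q p j h \<phi> x - LJ \<Lambda>1 q p j (- h) \<phi> x)"
    by (rule LJ_lipschitz[OF \<phi>])
  have "bd n (\<bar>1/2\<bar> * (2 ^ n * M * ((real CARD('n) * s1) ^ (j + 3) + (real CARD('n) * s1) ^ (j + 2)) * (\<bar>h - - h\<bar> * A)))
     (\<lambda>x. (1/2) * (LJ \<Lambda>1 q p j h \<phi> x - LJ \<Lambda>1 q p j (- h) \<phi> x))"
    by (rule bd_cmult[OF _ b]) (intro smb_diff smb_LJ \<phi>)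
  moreover have "\<bar>1/2\<bar> * (X * (\<bar>h - - h\<bar> * A)) = X * (h * A)" for X using h by simp
  ultimately show ?thesis unfolding eq[symmetric] by (simp only:)
qed

lemma sum_q_dir: "(\<Sum>l\<in>\<Lambda>1. q l x * dir l \<phi> x) = 0"
proof -
  have "dir (- l) \<phi> x = - dir l \<phi> x" for l by (simp add: dir_def sum_negf)
  then have "(\<Sum>l\<in>\<Lambda>1. q l x * dir l \<phi> x) = - (\<Sum>l\<in>\<Lambda>1. q l x * dir l \<phi> x)"
    by (subst sum_neg) (simp add: sym(2) sum_negf)
  then show ?thesis by simp
qed

text \<open>The Taylor expansion of the difference operator contains the singular factor
  \<open>1 / h\<close> in front of the sum of \<open>q l * dir l \<phi>\<close>, which vanishes by
  symmetry; the rest is regular in \<open>h\<close>.\<close>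

lemma LJ_0:
  assumes \<phi>: "smb \<phi>" and h: "0 < h"
  shows "LJ \<Lambda>1 q p 0 h \<phi> x = (\<Sum>l\<in>\<Lambda>1. (q l x + h * p l x) / h\<^sup>2 * (\<phi> (x + h *\<^sub>R l) - \<phi> x))"
proof -
  have "q l x * J (\<lambda>t. (1 - t) * t ^ 0) h l ((dir l ^^ (0 + 2)) \<phi>) x + p l x * J (\<lambda>t. t ^ 0) h l ((dir l ^^ (0 + 1)) \<phi>) x
     + (1 / h) * (q l x * dir l \<phi> x) = (q l x + h * p l x) / h\<^sup>2 * (\<phi> (x + h *\<^sub>R l) - \<phi> x)" for l
  proof -
    have 1: "J (\<lambda>t. (1 - t) * t ^ 0) h l ((dir l ^^ (0 + 2)) \<phi>) x = (\<phi> (x + h *\<^sub>R l) - \<phi> x - h * dir l \<phi> x) / h\<^sup>2"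
      using J_second_order[OF \<phi>, of x h l] h by (simp add: numeral_2_eq_2 field_simps)
    have 2: "J (\<lambda>t. t ^ 0) h l ((dir l ^^ (0 + 1)) \<phi>) x = (\<phi> (x + h *\<^sub>R l) - \<phi> x) / h"
      using J_first_order[OF \<phi>, of x h l] h by (simp add: field_simps)
    show ?thesis unfolding 1 2 using h by (simp add: field_simps power2_eq_square)
  qed
  then have "(\<Sum>l\<in>\<Lambda>1. (q l x + h * p l x) / h\<^sup>2 * (\<phi> (x + h *\<^sub>R l) - \<phi> x)) =
      LJ \<Lambda>1 q p 0 h \<phi> x + (1 / h) * (\<Sum>l\<in>\<Lambda>1. q l x * dir l \<phi> x)"
    unfolding LJ_def sum_distrib_left sum.distrib[symmetric] by (intro sum.cong refl) simp
  then show ?thesis by (simp add: sum_q_dir)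
qed

end

section \<open>Derivatives of the solution in the mesh size\<close>

definition sol ::
  "(real^'n::finite) set \<Rightarrow> (real^'n \<Rightarrow> real^'n \<Rightarrow> real) \<Rightarrow> (real^'n \<Rightarrow> real^'n \<Rightarrow> real) \<Rightarrow>
    (real^'n \<Rightarrow> real) \<Rightarrow> real \<Rightarrow> (real^'n \<Rightarrow> real) \<Rightarrow> real^'n \<Rightarrow> real" where
  "sol \<Lambda>1 q p c h g = (SOME u. smb u \<and> (\<forall>x. LJ \<Lambda>1 q p 0 h u x - c x * u x + g x = 0))"

text \<open>The equation differentiated \<open>k\<close> times in \<open>h\<close>, solved
  recursively. This is only a candidate for the \<open>k\<close>-th derivative of the solution;
  \<open>V_has_derivative\<close> shows that it is one.\<close>

function V ::
  "(real^'n::finite) set \<Rightarrow> (real^'n \<Rightarrow> real^'n \<Rightarrow> real) \<Rightarrow> (real^'n \<Rightarrow> real^'n \<Rightarrow> real) \<Rightarrow>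
    (real^'n \<Rightarrow> real) \<Rightarrow> (real^'n \<Rightarrow> real) \<Rightarrow> nat \<Rightarrow> real \<Rightarrow> real^'n \<Rightarrow> real" where
  "V \<Lambda>1 q p c f k h = sol \<Lambda>1 q p c h
     (if k = 0 then f else (\<lambda>x. \<Sum>i<k. real (k choose i) * LJ \<Lambda>1 q p (k - i) h (V \<Lambda>1 q p c f i h) x))"
  by pat_completeness auto
termination by (relation "Wellfounded.measure (\<lambda>(\<Lambda>1, q, p, c, f, k, h). k)") auto

declare V.simps [simp del]

definition V_source ::
  "(real^'n::finite) set \<Rightarrow> (real^'n \<Rightarrow> real^'n \<Rightarrow> real) \<Rightarrow> (real^'n \<Rightarrow> real^'n \<Rightarrow> real) \<Rightarrow>
    (real^'n \<Rightarrow> real) \<Rightarrow> (real^'n \<Rightarrow> real) \<Rightarrow> nat \<Rightarrow> real \<Rightarrow> real^'n \<Rightarrow> real" where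
  "V_source \<Lambda>1 q p c f k h =
     (if k = 0 then f else (\<lambda>x. \<Sum>i<k. real (k choose i) * LJ \<Lambda>1 q p (k - i) h (V \<Lambda>1 q p c f i h) x))"

context cst
begin

definition CL :: "nat \<Rightarrow> nat \<Rightarrow> real" where
  "CL j n = 2 ^ n * Mb * ((d * s1) ^ (j + 2) + (d * s1) ^ (j + 1))"

definition CLo :: "nat \<Rightarrow> nat \<Rightarrow> real" where
  "CLo j n = 2 ^ n * Mb * ((d * s1) ^ (j + 3) + (d * s1) ^ (j + 2))"

function CV :: "nat \<Rightarrow> real" where
  "CV k = NB (m - 3 * k) * (if k = 0 then 1 else (\<Sum>i<k. real (k choose i) * (CL (k - i) (m - 3 * k) * CV i)))"
  by pat_completeness auto
termination by (relation "Wellfounded.measure id") auto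

text \<open>For odd \<open>k\<close> the factor \<open>h\<close> in a summand comes from the
  operator if \<open>k - i\<close> is odd, and otherwise from the solution of odd index
  \<open>i\<close>.\<close>

function CW :: "nat \<Rightarrow> real" where
  "CW k = NB (m - 3 * k - 1) * (\<Sum>i<k. real (k choose i) *
      (if odd (k - i) then CLo (k - i) (m - 3 * k - 1) * CV i else CL (k - i) (m - 3 * k - 1) * CW i))"
  by pat_completeness auto
termination by (relation "Wellfounded.measure id") auto

declare CV.simps [simp del] CW.simps [simp del]

end

locale sdata = cst m d \<delta> c0 \<tau>0 K s1 s2 Mb
  for m d \<delta> c0 \<tau>0 K s1 s2 Mb +
  fixes \<Lambda>1 :: "(real^'n::finite) set" and e :: "'n \<Rightarrow> real^'n" and \<tau> :: "real^'n \<Rightarrow> real" and h0 :: real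
    and q p :: "real^'n \<Rightarrow> real^'n \<Rightarrow> real" and c :: "real^'n \<Rightarrow> real"
  assumes h0: "0 < h0"
    and bern: "\<And>h. h \<in> {0<..h0} \<Longrightarrow> bern m d \<delta> c0 \<tau>0 K s1 s2 Mb \<Lambda>1 e \<tau> h q p c"
begin

abbreviation L where "L \<equiv> LJ \<Lambda>1 q p"
abbreviation VV where "VV \<equiv> V \<Lambda>1 q p c"
abbreviation Vs where "Vs \<equiv> V_source \<Lambda>1 q p c"

lemma d_card: "d = real CARD('n)"
  using bern[of h0] h0 by (simp add: bern_def bern_axioms_def)

lemma smb_c: "smb c"
  using bern[of h0] h0 by (simp add: bern_def bern_axioms_def)

lemma scoeffs: "n \<le> m \<Longrightarrow> scoeffs \<Lambda>1 s1 n Mb q p"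
proof -
  assume n: "n \<le> m"
  interpret b: bern m d \<delta> c0 \<tau>0 K s1 s2 Mb \<Lambda>1 e \<tau> h0 q p c using bern[of h0] h0 by simp
  have bdr: "bd n Mb (r l)"
    if "\<And>is x. length is \<le> m \<Longrightarrow> (\<Sum>l\<in>\<Lambda>1. (foldr partial is (r l) x)\<^sup>2) \<le> Mb\<^sup>2" "l \<in> \<Lambda>1"
    for r :: "real^'n \<Rightarrow> real^'n \<Rightarrow> real" and l
  proof (rule bd_foldrI)
    fix "is" :: "'n list" and x assume "length is \<le> n"
    then have "(\<Sum>l\<in>\<Lambda>1. (foldr partial is (r l) x)\<^sup>2) \<le> Mb\<^sup>2" using that(1) n by simp
    moreover have "(foldr partial is (r l) x)\<^sup>2 \<le> (\<Sum>l\<in>\<Lambda>1. (foldr partial is (r l) x)\<^sup>2)"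
      using that(2) b.fin by (intro member_le_sum) auto
    ultimately have "(foldr partial is (r l) x)\<^sup>2 \<le> Mb\<^sup>2" by linarith
    then show "\<bar>foldr partial is (r l) x\<bar> \<le> Mb" using Mb abs_le_square_iff[of "foldr partial is (r l) x" Mb] by simp
  qed
  show ?thesis
    by unfold_locales ((rule b.fin s1 b.s1_bound Mb b.smb_qpc bdr[OF b.q_bound] bdr[OF b.p_bound] b.sym; assumption?)+)
qed

lemma smb_L: "smb \<phi> \<Longrightarrow> smb (L j h \<phi>)"
  using coeffs.smb_LJ[OF scoeffs.axioms(1)[OF scoeffs[of 0]]] by simp

lemma L_diff: "smb \<phi> \<Longrightarrow> smb \<psi> \<Longrightarrow> L j h (\<lambda>x. \<phi> x - \<psi> x) x = L j h \<phi> x - L j h \<psi> x"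
  using coeffs.LJ_diff_arg[OF scoeffs.axioms(1)[OF scoeffs[of 0]]] by simp

lemma L_cmult: "smb \<phi> \<Longrightarrow> L j h (\<lambda>x. k * \<phi> x) x = k * L j h \<phi> x"
  using coeffs.LJ_cmult_arg[OF scoeffs.axioms(1)[OF scoeffs[of 0]]] by simp

lemma L_bd: "n \<le> m \<Longrightarrow> smb \<phi> \<Longrightarrow> bd (n + j + 2) A \<phi> \<Longrightarrow> 1 \<le> j \<Longrightarrow> bd n (CL j n * A) (L j h \<phi>)"
  using coeffs.LJ_bd[OF scoeffs.axioms(1)[OF scoeffs], folded d_card] unfolding CL_def by blast

lemma L_odd_bd:
  "n \<le> m \<Longrightarrow> smb \<phi> \<Longrightarrow> bd (n + j + 3) A \<phi> \<Longrightarrow> odd j \<Longrightarrow> 0 \<le> h \<Longrightarrow> bd n (CLo j n * (h * A)) (L j h \<phi>)"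
  using scoeffs.LJ_odd_bd[OF scoeffs, folded d_card] unfolding CLo_def by blast

lemma L_0:
  assumes h: "h \<in> {0<..h0}" and u: "smb u"
  shows "L 0 h u x = (\<Sum>l\<in>\<Lambda>1. (q l x + h * p l x) / h\<^sup>2 * (u (x + h *\<^sub>R l) - u x))"
  using scoeffs.LJ_0[OF scoeffs[of 0] u] h by simp

lemma a_priori_L:
  assumes h: "h \<in> {0<..h0}" and u: "smb u" "\<And>x. L 0 h u x - c x * u x + g x = 0"
    and g: "smb g" "bd n B g" "n \<le> m"
  shows "bd n (NB n * B) u"
proof -
  interpret b: bern m d \<delta> c0 \<tau>0 K s1 s2 Mb \<Lambda>1 e \<tau> h q p c using bern[OF h] .
  show ?thesis using b.a_priori[OF u(1) _ g] u(2) unfolding b.Lz_alt L_0[OF h u(1)] by blast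
qed

lemma sol_exists:
  assumes h: "h \<in> {0<..h0}" and g: "smb g"
  shows "smb (sol \<Lambda>1 q p c h g)" "L 0 h (sol \<Lambda>1 q p c h g) x - c x * sol \<Lambda>1 q p c h g x + g x = 0"
proof -
  interpret b: bern m d \<delta> c0 \<tau>0 K s1 s2 Mb \<Lambda>1 e \<tau> h q p c using bern[OF h] .
  obtain u where "smb u" "\<And>x. b.Lz u x - c x * u x + g x = 0" using b.solution_smb[OF g] by blast
  then have "\<exists>u. smb u \<and> (\<forall>x. L 0 h u x - c x * u x + g x = 0)"
    unfolding b.Lz_alt using L_0[OF h] by (metis (no_types, lifting))
  from someI_ex[OF this]
  show "smb (sol \<Lambda>1 q p c h g)" "L 0 h (sol \<Lambda>1 q p c h g) x - c x * sol \<Lambda>1 q p c h g x + g x = 0"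
    unfolding sol_def by blast+
qed

lemma V_sol: "VV f k h = sol \<Lambda>1 q p c h (Vs f k h)"
  unfolding V_source_def by (subst V.simps) simp

lemma V_smb:
  assumes h: "h \<in> {0<..h0}" and f: "smb f"
  shows "smb (VV f k h) \<and> smb (Vs f k h)"
proof (induction k rule: less_induct)
  case (less k)
  have "smb (Vs f k h)"
    unfolding V_source_def using less f by (auto intro!: smb_intros smb_L simp del: LJ_def)
  then show ?case unfolding V_sol using sol_exists(1)[OF h] by blast
qed

lemma V_eq:
  assumes h: "h \<in> {0<..h0}" and f: "smb f"
  shows "L 0 h (VV f k h) x - c x * VV f k h x + Vs f k h x = 0"
  unfolding V_sol using sol_exists(2)[OF h] V_smb[OF h f] by blast

text \<open>With \<open>n = m - 3 * k\<close>, the bound for \<open>VV f i\<close> at order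
  \<open>m - 3 * i\<close> is used at order \<open>n + (k - i) + 2\<close>. This is possible since
  \<open>k - i + 2 \<le> 3 * (k - i)\<close>, with equality for \<open>i = k - 1\<close>.\<close>

lemma V_bd:
  assumes h: "h \<in> {0<..h0}" and f: "smb f" "bd m B f"
  shows "3 * k \<le> m \<Longrightarrow> bd (m - 3 * k) (CV k * B) (VV f k h)"
proof (induction k rule: less_induct)
  case (less k)
  let ?n = "m - 3 * k"
  let ?C = "if k = 0 then 1 else (\<Sum>i<k. real (k choose i) * (CL (k - i) ?n * CV i))"
  have "bd ?n (?C * B) (Vs f k h)"
  proof (cases "k = 0")
    case True then show ?thesis using f by (simp add: V_source_def)
  next
    case False
    have "bd ?n (CL (k - i) ?n * (CV i * B)) (L (k - i) h (VV f i h))" if i: "i < k" for i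
    proof (rule L_bd)
      have "bd (m - 3 * i) (CV i * B) (VV f i h)" using less i by simp
      then show "bd (?n + (k - i) + 2) (CV i * B) (VV f i h)"
        by (rule bd_le) (use i less.prems in linarith)
    qed (use V_smb[OF h f(1)] i in auto)
    then have "bd ?n (\<Sum>i<k. \<bar>real (k choose i)\<bar> * (CL (k - i) ?n * (CV i * B)))
        (\<lambda>x. \<Sum>i<k. real (k choose i) * L (k - i) h (VV f i h) x)"
      using V_smb[OF h f(1)] by (intro bd_sum bd_cmult smb_cmult smb_L) auto
    moreover have "(\<Sum>i<k. \<bar>real (k choose i)\<bar> * (CL (k - i) ?n * (CV i * B))) = ?C * B"
      using False by (simp add: sum_distrib_right mult.assoc)
    ultimately show ?thesis using False by (simp add: V_source_def)
  qed
  then have "bd ?n (NB ?n * (?C * B)) (VV f k h)"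
    using V_smb[OF h f(1)] by (intro a_priori_L[OF h _ V_eq[OF h f(1)]]) auto
  moreover have "CV k * B = NB ?n * (?C * B)" by (subst CV.simps) (simp only: mult.assoc)
  ultimately show ?case by (simp only:)
qed

text \<open>If \<open>k - i\<close> is odd, the operator supplies \<open>h\<close>, and its extra
  derivative is taken from \<open>V_bd\<close>, which holds at the full order
  \<open>m - 3 * i\<close>. If \<open>k - i\<close> is even, then \<open>i\<close> is odd and the
  induction hypothesis supplies \<open>h\<close>. One derivative is thus lost once and not at each
  step.\<close>

lemma V_odd_bd:
  assumes h: "h \<in> {0<..h0}" and f: "smb f" "bd m B f"
  shows "odd k \<Longrightarrow> 3 * k + 1 \<le> m \<Longrightarrow> bd (m - 3 * k - 1) (CW k * (h * B)) (VV f k h)"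
proof (induction k rule: less_induct)
  case (less k)
  let ?n = "m - 3 * k - 1"
  let ?C = "\<lambda>i. if odd (k - i) then CLo (k - i) ?n * CV i else CL (k - i) ?n * CW i"
  have k0: "k \<noteq> 0" using less.prems(1) by (cases k) auto
  have "bd ?n (?C i * (h * B)) (L (k - i) h (VV f i h))" if i: "i < k" for i
  proof (cases "odd (k - i)")
    case True
    have "bd (m - 3 * i) (CV i * B) (VV f i h)" using i less.prems by (intro V_bd[OF h f]) simp
    then have "bd (?n + (k - i) + 3) (CV i * B) (VV f i h)"
      by (rule bd_le) (use i less.prems in linarith)
    then have "bd ?n (CLo (k - i) ?n * (h * (CV i * B))) (L (k - i) h (VV f i h))"
      using V_smb[OF h f(1)] h True by (intro L_odd_bd) auto
    then show ?thesis using True by (simp add: mult.left_commute mult.assoc)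
  next
    case False
    then have "odd i" using less.prems(1) i by simp
    then have "bd (m - 3 * i - 1) (CW i * (h * B)) (VV f i h)" using i less by simp
    moreover have "?n + (k - i) + 2 \<le> m - 3 * i - 1"
    proof -
      have "2 \<le> k - i" using False i by (cases "k - i = 1") auto
      then show ?thesis using i less.prems(2) by linarith
    qed
    ultimately have "bd (?n + (k - i) + 2) (CW i * (h * B)) (VV f i h)" by (rule bd_le)
    then have "bd ?n (CL (k - i) ?n * (CW i * (h * B))) (L (k - i) h (VV f i h))"
      using V_smb[OF h f(1)] i by (intro L_bd) auto
    then show ?thesis using False by (simp add: mult.assoc)
  qed
  then have "bd ?n (\<Sum>i<k. \<bar>real (k choose i)\<bar> * (?C i * (h * B)))
      (\<lambda>x. \<Sum>i<k. real (k choose i) * L (k - i) h (VV f i h) x)"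
    using V_smb[OF h f(1)] by (intro bd_sum bd_cmult smb_cmult smb_L) auto
  then have "bd ?n (\<Sum>i<k. \<bar>real (k choose i)\<bar> * (?C i * (h * B))) (Vs f k h)"
    using k0 by (simp only: V_source_def if_False)
  then have "bd ?n (NB ?n * (\<Sum>i<k. \<bar>real (k choose i)\<bar> * (?C i * (h * B)))) (VV f k h)"
    using V_smb[OF h f(1)] by (intro a_priori_L[OF h _ V_eq[OF h f(1)]]) auto
  moreover have "CW k * (h * B) = NB ?n * (\<Sum>i<k. \<bar>real (k choose i)\<bar> * (?C i * (h * B)))"
    by (subst CW.simps) (simp only: mult.assoc sum_distrib_right abs_of_nat)
  ultimately show ?case by (simp only:)
qed

text \<open>Differentiability in \<open>h\<close>, relative to \<open>(0, h0]\<close>, in the norm given by \<open>bd n\<close>.\<close>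

definition Ed :: "nat \<Rightarrow> (real \<Rightarrow> real^'n \<Rightarrow> real) \<Rightarrow> (real^'n \<Rightarrow> real) \<Rightarrow> real \<Rightarrow> bool" where
  "Ed n u u' h \<longleftrightarrow> (\<forall>\<eta>>0. \<exists>r>0. \<forall>h'\<in>{0<..h0}. \<bar>h' - h\<bar> < r \<longrightarrow>
     bd n (\<eta> * \<bar>h' - h\<bar>) (\<lambda>x. u h' x - u h x - (h' - h) * u' x))"

lemma Ed_le: "Ed n u u' h \<Longrightarrow> k \<le> n \<Longrightarrow> Ed k u u' h"
  unfolding Ed_def by (meson bd_le)

lemma Ed_const: "Ed n (\<lambda>h. f) (\<lambda>x. 0) h"
  unfolding Ed_def by (auto intro!: exI[of _ 1] bd_zero)

lemma Ed_add:
  assumes u: "Ed n u u' h" "\<And>h. h \<in> {0<..h0} \<Longrightarrow> smb (u h)" "smb u'"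
    and v: "Ed n v v' h" "\<And>h. h \<in> {0<..h0} \<Longrightarrow> smb (v h)" "smb v'" and h: "h \<in> {0<..h0}"
  shows "Ed n (\<lambda>h x. u h x + v h x) (\<lambda>x. u' x + v' x) h"
  unfolding Ed_def
proof (intro allI impI)
  fix \<eta> :: real assume "0 < \<eta>"
  then have \<eta>: "0 < \<eta> / 2" by simp
  obtain r where r: "0 < r" "\<And>h'. h' \<in> {0<..h0} \<Longrightarrow> \<bar>h' - h\<bar> < r \<Longrightarrow>
     bd n (\<eta> / 2 * \<bar>h' - h\<bar>) (\<lambda>x. u h' x - u h x - (h' - h) * u' x)"
    using u(1) \<eta> unfolding Ed_def by blast
  obtain s where s: "0 < s" "\<And>h'. h' \<in> {0<..h0} \<Longrightarrow> \<bar>h' - h\<bar> < s \<Longrightarrow>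
     bd n (\<eta> / 2 * \<bar>h' - h\<bar>) (\<lambda>x. v h' x - v h x - (h' - h) * v' x)"
    using v(1) \<eta> unfolding Ed_def by blast
  have "bd n (\<eta> * \<bar>h' - h\<bar>) (\<lambda>x. (u h' x + v h' x) - (u h x + v h x) - (h' - h) * (u' x + v' x))"
    if h': "h' \<in> {0<..h0}" "\<bar>h' - h\<bar> < min r s" for h'
  proof -
    have "bd n (\<eta> / 2 * \<bar>h' - h\<bar> + \<eta> / 2 * \<bar>h' - h\<bar>)
       (\<lambda>x. (u h' x - u h x - (h' - h) * u' x) + (v h' x - v h x - (h' - h) * v' x))"
      using h' by (intro bd_add smb_diff smb_cmult u v h r s) auto
    then show ?thesis by (simp add: algebra_simps)
  qed
  then show "\<exists>r>0. \<forall>h'\<in>{0<..h0}. \<bar>h' - h\<bar> < r \<longrightarrow>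
     bd n (\<eta> * \<bar>h' - h\<bar>) (\<lambda>x. (u h' x + v h' x) - (u h x + v h x) - (h' - h) * (u' x + v' x))"
    using r(1) s(1) by (intro exI[of _ "min r s"]) auto
qed

lemma Ed_cmult:
  assumes u: "Ed n u u' h" "\<And>h. h \<in> {0<..h0} \<Longrightarrow> smb (u h)" "smb u'" and h: "h \<in> {0<..h0}"
  shows "Ed n (\<lambda>h x. a * u h x) (\<lambda>x. a * u' x) h"
  unfolding Ed_def
proof (intro allI impI)
  fix \<eta> :: real assume \<eta>: "0 < \<eta>"
  define \<eta>' where "\<eta>' = \<eta> / (\<bar>a\<bar> + 1)"
  have \<eta>': "0 < \<eta>'" "\<bar>a\<bar> * \<eta>' \<le> \<eta>" using \<eta> by (auto simp: \<eta>'_def field_simps)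
  obtain r where r: "0 < r" "\<And>h'. h' \<in> {0<..h0} \<Longrightarrow> \<bar>h' - h\<bar> < r \<Longrightarrow>
     bd n (\<eta>' * \<bar>h' - h\<bar>) (\<lambda>x. u h' x - u h x - (h' - h) * u' x)"
    using u(1) \<eta>'(1) unfolding Ed_def by blast
  have "bd n (\<eta> * \<bar>h' - h\<bar>) (\<lambda>x. a * u h' x - a * u h x - (h' - h) * (a * u' x))"
    if h': "h' \<in> {0<..h0}" "\<bar>h' - h\<bar> < r" for h'
  proof -
    have "bd n (\<bar>a\<bar> * (\<eta>' * \<bar>h' - h\<bar>)) (\<lambda>x. a * (u h' x - u h x - (h' - h) * u' x))"
      using h' by (intro bd_cmult smb_diff smb_cmult u h r) auto
    moreover have "\<bar>a\<bar> * (\<eta>' * \<bar>h' - h\<bar>) \<le> \<eta> * \<bar>h' - h\<bar>"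
      using \<eta>'(2) by (metis abs_ge_zero mult.assoc mult_right_mono)
    ultimately have "bd n (\<eta> * \<bar>h' - h\<bar>) (\<lambda>x. a * (u h' x - u h x - (h' - h) * u' x))" by (rule bd_mono)
    then show ?thesis by (simp add: algebra_simps)
  qed
  then show "\<exists>r>0. \<forall>h'\<in>{0<..h0}. \<bar>h' - h\<bar> < r \<longrightarrow>
     bd n (\<eta> * \<bar>h' - h\<bar>) (\<lambda>x. a * u h' x - a * u h x - (h' - h) * (a * u' x))"
    using r(1) by blast
qed

lemma Ed_sum:
  assumes "finite I" "\<And>i. i \<in> I \<Longrightarrow> Ed n (u i) (u' i) h"
    "\<And>i h. i \<in> I \<Longrightarrow> h \<in> {0<..h0} \<Longrightarrow> smb (u i h)" "\<And>i. i \<in> I \<Longrightarrow> smb (u' i)" and h: "h \<in> {0<..h0}"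
  shows "Ed n (\<lambda>h x. \<Sum>i\<in>I. u i h x) (\<lambda>x. \<Sum>i\<in>I. u' i x) h"
  using assms(1-4)
proof (induction I rule: finite_induct)
  case empty then show ?case by (simp add: Ed_const)
next
  case (insert i I)
  have "Ed n (\<lambda>h x. u i h x + (\<Sum>i\<in>I. u i h x)) (\<lambda>x. u' i x + (\<Sum>i\<in>I. u' i x)) h"
    by (rule Ed_add[OF _ _ _ _ _ _ h]) (use insert in \<open>auto intro!: smb_sum\<close>)
  then show ?case using insert by simp
qed

lemma quadratic_absorbed:
  fixes \<eta> C :: real
  assumes "0 < \<eta>"
  obtains r where "0 < r" "\<And>t. \<bar>t\<bar> < r \<Longrightarrow> C * t\<^sup>2 \<le> \<eta> * \<bar>t\<bar>"
proof
  show "0 < \<eta> / (\<bar>C\<bar> + 1)" using assms by simp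
  fix t :: real assume "\<bar>t\<bar> < \<eta> / (\<bar>C\<bar> + 1)"
  then have 1: "(\<bar>C\<bar> + 1) * \<bar>t\<bar> \<le> \<eta>" by (simp add: field_simps)
  have "C * t\<^sup>2 \<le> (\<bar>C\<bar> + 1) * t\<^sup>2" by (intro mult_right_mono) auto
  also have "\<dots> = ((\<bar>C\<bar> + 1) * \<bar>t\<bar>) * \<bar>t\<bar>" by (simp add: power2_eq_square)
  also have "\<dots> \<le> \<eta> * \<bar>t\<bar>" using 1 by (intro mult_right_mono) auto
  finally show "C * t\<^sup>2 \<le> \<eta> * \<bar>t\<bar>" .
qed

lemma L_lipschitz_ex:
  assumes "n \<le> m" "smb \<phi>"
  shows "\<exists>C. \<forall>h h'. bd n (C * \<bar>h' - h\<bar>) (\<lambda>x. L j h' \<phi> x - L j h \<phi> x)"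
proof -
  obtain A where A: "bd (n + j + 3) A \<phi>" using smb_bd[OF assms(2)] by blast
  note b = coeffs.LJ_lipschitz[OF scoeffs.axioms(1)[OF scoeffs[OF assms(1)]] assms(2) A]
  show ?thesis
  proof (intro exI allI)
    fix h h'
    show "bd n ((2 ^ n * Mb * ((real CARD('n) * s1) ^ (j + 3) + (real CARD('n) * s1) ^ (j + 2)) * A) * \<bar>h' - h\<bar>)
      (\<lambda>x. L j h' \<phi> x - L j h \<phi> x)"
      using b[of h' h] by (simp only: mult.assoc mult.commute[of A])
  qed
qed

lemma L_taylor_ex:
  assumes "n \<le> m" "smb \<phi>"
  shows "\<exists>C. \<forall>h h'. bd n (C * (h' - h)\<^sup>2) (\<lambda>x. L j h' \<phi> x - L j h \<phi> x - (h' - h) * L (Suc j) h \<phi> x)"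
proof -
  obtain A where A: "bd (n + j + 4) A \<phi>" using smb_bd[OF assms(2)] by blast
  note b = coeffs.LJ_taylor[OF scoeffs.axioms(1)[OF scoeffs[OF assms(1)]] assms(2) A]
  show ?thesis
  proof (intro exI allI)
    fix h h'
    show "bd n ((2 ^ n * Mb * ((real CARD('n) * s1) ^ (j + 4) + (real CARD('n) * s1) ^ (j + 3)) * A) * (h' - h)\<^sup>2)
      (\<lambda>x. L j h' \<phi> x - L j h \<phi> x - (h' - h) * L (Suc j) h \<phi> x)"
      using b[of h' h] by (simp only: mult.assoc mult.commute[of A])
  qed
qed

end

context sdata
begin

text \<open>Product rule. With \<open>t = h' - h\<close> the remainder is the sum of
  \<open>L j h'\<close> on the remainder of \<open>u\<close>, of \<open>t\<close> times the
  increment of \<open>L j\<close> on \<open>u'\<close>, and of the Taylor remainder of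
  \<open>L j\<close> on \<open>u h\<close>. The last two are quadratic in \<open>t\<close>, as
  \<open>u'\<close> and \<open>u h\<close> are fixed smooth functions; only the first uses the order
  \<open>n + j + 2\<close>.\<close>

lemma Ed_L:
  assumes n: "n \<le> m" and j: "1 \<le> j" and h: "h \<in> {0<..h0}"
    and u: "Ed (n + j + 2) u u' h" "\<And>h. h \<in> {0<..h0} \<Longrightarrow> smb (u h)" "smb u'"
  shows "Ed n (\<lambda>h. L j h (u h)) (\<lambda>x. L j h u' x + L (Suc j) h (u h) x) h"
  unfolding Ed_def
proof (intro allI impI)
  fix \<eta> :: real assume \<eta>: "0 < \<eta>"
  define \<eta>1 where "\<eta>1 = \<eta> / (2 * (\<bar>CL j n\<bar> + 1))"
  have \<eta>1: "0 < \<eta>1" "CL j n * \<eta>1 \<le> \<eta> / 2"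
  proof -
    show "0 < \<eta>1" using \<eta> by (simp add: \<eta>1_def)
    then have "CL j n * \<eta>1 \<le> (\<bar>CL j n\<bar> + 1) * \<eta>1" by (intro mult_right_mono) auto
    also have "\<dots> = \<eta> / 2"
    proof -
      have "\<bar>CL j n\<bar> + 1 \<noteq> 0" using abs_ge_zero[of "CL j n"] by linarith
      moreover have "X * (\<eta> / (2 * X)) = \<eta> / 2" if "X \<noteq> 0" for X :: real using that by simp
      ultimately show ?thesis unfolding \<eta>1_def by blast
    qed
    finally show "CL j n * \<eta>1 \<le> \<eta> / 2" .
  qed
  obtain r where r: "0 < r" "\<And>h'. h' \<in> {0<..h0} \<Longrightarrow> \<bar>h' - h\<bar> < r \<Longrightarrow>
     bd (n + j + 2) (\<eta>1 * \<bar>h' - h\<bar>) (\<lambda>x. u h' x - u h x - (h' - h) * u' x)"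
    using u(1) \<eta>1(1) unfolding Ed_def by blast
  obtain C1 where C1: "\<And>h h'. bd n (C1 * \<bar>h' - h\<bar>) (\<lambda>x. L j h' u' x - L j h u' x)"
    using L_lipschitz_ex[OF n u(3)] by blast
  obtain C2 where C2: "\<And>h1 h'. bd n (C2 * (h' - h1)\<^sup>2) (\<lambda>x. L j h' (u h) x - L j h1 (u h) x - (h' - h1) * L (Suc j) h1 (u h) x)"
    using L_taylor_ex[OF n u(2)[OF h]] by blast
  obtain s where s: "0 < s" "\<And>t. \<bar>t\<bar> < s \<Longrightarrow> (C1 + C2) * t\<^sup>2 \<le> \<eta> / 2 * \<bar>t\<bar>"
    using quadratic_absorbed[of "\<eta> / 2" "C1 + C2"] \<eta> by auto
  have "bd n (\<eta> * \<bar>h' - h\<bar>) (\<lambda>x. L j h' (u h') x - L j h (u h) x - (h' - h) * (L j h u' x + L (Suc j) h (u h) x))"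
    if h': "h' \<in> {0<..h0}" "\<bar>h' - h\<bar> < min r s" for h'
  proof -
    let ?t = "h' - h"
    let ?w = "\<lambda>x. u h' x - u h x - ?t * u' x"
    have sw: "smb ?w" using h' h by (intro smb_diff smb_cmult u)
    have 1: "bd n (CL j n * (\<eta>1 * \<bar>?t\<bar>)) (L j h' ?w)"
      using h' by (intro L_bd n sw j r) auto
    have 2: "bd n (\<bar>?t\<bar> * (C1 * \<bar>?t\<bar>)) (\<lambda>x. ?t * (L j h' u' x - L j h u' x))"
      by (intro bd_cmult C1 smb_diff smb_L u)
    have 3: "bd n (C2 * ?t\<^sup>2) (\<lambda>x. L j h' (u h) x - L j h (u h) x - ?t * L (Suc j) h (u h) x)"
      by (rule C2)
    have "bd n (CL j n * (\<eta>1 * \<bar>?t\<bar>) + \<bar>?t\<bar> * (C1 * \<bar>?t\<bar>) + C2 * ?t\<^sup>2)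
      (\<lambda>x. L j h' ?w x + ?t * (L j h' u' x - L j h u' x) + (L j h' (u h) x - L j h (u h) x - ?t * L (Suc j) h (u h) x))"
      by (intro bd_add 1 2 3 smb_add smb_diff smb_cmult smb_L sw u h h'(1))
    moreover have "L j h' ?w x = L j h' (u h') x - L j h' (u h) x - ?t * L j h' u' x" for x
      using h h' u by (simp add: L_diff L_cmult smb_diff smb_cmult)
    then have "(\<lambda>x. L j h' ?w x + ?t * (L j h' u' x - L j h u' x) + (L j h' (u h) x - L j h (u h) x - ?t * L (Suc j) h (u h) x)) =
       (\<lambda>x. L j h' (u h') x - L j h (u h) x - ?t * (L j h u' x + L (Suc j) h (u h) x))"
      by (simp add: fun_eq_iff algebra_simps)
    moreover have "CL j n * (\<eta>1 * \<bar>?t\<bar>) + \<bar>?t\<bar> * (C1 * \<bar>?t\<bar>) + C2 * ?t\<^sup>2 \<le> \<eta> * \<bar>?t\<bar>"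
    proof -
      have a: "CL j n * (\<eta>1 * \<bar>?t\<bar>) \<le> \<eta> / 2 * \<bar>?t\<bar>"
        using mult_right_mono[OF \<eta>1(2) abs_ge_zero[of ?t]] by (simp only: mult.assoc)
      have b: "\<bar>?t\<bar> * (C1 * \<bar>?t\<bar>) = C1 * ?t\<^sup>2"
      proof -
        have "\<bar>?t\<bar> * \<bar>?t\<bar> = ?t\<^sup>2" by (simp add: power2_eq_square)
        then show ?thesis by (simp only: mult.left_commute)
      qed
      have "(C1 + C2) * ?t\<^sup>2 \<le> \<eta> / 2 * \<bar>?t\<bar>" using s(2) h'(2) by simp
      then have "C1 * ?t\<^sup>2 + C2 * ?t\<^sup>2 \<le> \<eta> / 2 * \<bar>?t\<bar>" by (simp only: distrib_right)
      then show ?thesis using a unfolding b by simp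
    qed
    ultimately show ?thesis using bd_mono by (simp only:)
  qed
  then show "\<exists>r>0. \<forall>h'\<in>{0<..h0}. \<bar>h' - h\<bar> < r \<longrightarrow>
     bd n (\<eta> * \<bar>h' - h\<bar>) (\<lambda>x. L j h' (u h') x - L j h (u h) x - (h' - h) * (L j h u' x + L (Suc j) h (u h) x))"
    using r(1) s(1) by (intro exI[of _ "min r s"]) auto
qed

text \<open>The remainder \<open>u h' - u h - (h' - h) * w\<close> solves the equation with mesh
  size \<open>h'\<close> and a source small compared with \<open>h' - h\<close>, and the a priori
  estimate is uniform in \<open>h'\<close>. Only the fixed functions \<open>u h\<close> and
  \<open>w\<close> undergo an expansion of the operator, so no order is lost between
  \<open>g\<close> and \<open>u\<close>.\<close>

lemma Ed_solution:
  assumes n: "n \<le> m" and h: "h \<in> {0<..h0}"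
    and g: "Ed n g g' h" "\<And>h. h \<in> {0<..h0} \<Longrightarrow> smb (g h)" "smb g'"
    and u: "\<And>h. h \<in> {0<..h0} \<Longrightarrow> smb (u h)"
      "\<And>h x. h \<in> {0<..h0} \<Longrightarrow> L 0 h (u h) x - c x * u h x + g h x = 0"
    and w: "smb w" "\<And>x. L 0 h w x - c x * w x + (g' x + L 1 h (u h) x) = 0"
  shows "Ed n u w h"
  unfolding Ed_def
proof (intro allI impI)
  fix \<eta> :: real assume \<eta>: "0 < \<eta>"
  have NB: "1 \<le> NB n" by (rule NB_ge_1)
  define \<eta>1 where "\<eta>1 = \<eta> / (2 * NB n)"
  have \<eta>1: "0 < \<eta>1" "NB n * (2 * \<eta>1) = \<eta>" using \<eta> NB by (auto simp: \<eta>1_def)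
  obtain r where r: "0 < r" "\<And>h'. h' \<in> {0<..h0} \<Longrightarrow> \<bar>h' - h\<bar> < r \<Longrightarrow>
     bd n (\<eta>1 * \<bar>h' - h\<bar>) (\<lambda>x. g h' x - g h x - (h' - h) * g' x)"
    using g(1) \<eta>1(1) unfolding Ed_def by blast
  obtain C1 where C1: "\<And>h h'. bd n (C1 * \<bar>h' - h\<bar>) (\<lambda>x. L 0 h' w x - L 0 h w x)"
    using L_lipschitz_ex[OF n w(1)] by blast
  obtain C2 where C2: "\<And>h1 h'. bd n (C2 * (h' - h1)\<^sup>2) (\<lambda>x. L 0 h' (u h) x - L 0 h1 (u h) x - (h' - h1) * L (Suc 0) h1 (u h) x)"
    using L_taylor_ex[OF n u(1)[OF h]] by blast
  obtain s where s: "0 < s" "\<And>t. \<bar>t\<bar> < s \<Longrightarrow> (C1 + C2) * t\<^sup>2 \<le> \<eta>1 * \<bar>t\<bar>"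
    using quadratic_absorbed[of \<eta>1 "C1 + C2"] \<eta>1 by auto
  have "bd n (\<eta> * \<bar>h' - h\<bar>) (\<lambda>x. u h' x - u h x - (h' - h) * w x)"
    if h': "h' \<in> {0<..h0}" "\<bar>h' - h\<bar> < min r s" for h'
  proof -
    let ?t = "h' - h"
    let ?z = "\<lambda>x. u h' x - u h x - ?t * w x"
    let ?G1 = "\<lambda>x. g h' x - g h x - ?t * g' x"
    let ?G2 = "\<lambda>x. ?t * (L 0 h' w x - L 0 h w x)"
    let ?G3 = "\<lambda>x. L 0 h' (u h) x - L 0 h (u h) x - ?t * L (Suc 0) h (u h) x"
    have sz: "smb ?z" using h' h by (intro smb_diff smb_cmult u w)
    have b: "bd n (\<eta>1 * \<bar>?t\<bar> + \<bar>?t\<bar> * (C1 * \<bar>?t\<bar>) + C2 * ?t\<^sup>2) (\<lambda>x. ?G1 x + ?G2 x + ?G3 x)"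
      using h' h by (intro bd_add bd_cmult C1 C2 r smb_add smb_diff smb_cmult smb_L u g w) auto
    have "\<eta>1 * \<bar>?t\<bar> + \<bar>?t\<bar> * (C1 * \<bar>?t\<bar>) + C2 * ?t\<^sup>2 \<le> 2 * \<eta>1 * \<bar>?t\<bar>"
    proof -
      have "\<bar>?t\<bar> * \<bar>?t\<bar> = ?t\<^sup>2" by (simp add: power2_eq_square)
      then have "\<bar>?t\<bar> * (C1 * \<bar>?t\<bar>) = C1 * ?t\<^sup>2" by (simp only: mult.left_commute)
      moreover have "(C1 + C2) * ?t\<^sup>2 \<le> \<eta>1 * \<bar>?t\<bar>" using s(2) h'(2) by simp
      then have "C1 * ?t\<^sup>2 + C2 * ?t\<^sup>2 \<le> \<eta>1 * \<bar>?t\<bar>" by (simp only: distrib_right)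
      ultimately show ?thesis by linarith
    qed
    with b have b2: "bd n (2 * \<eta>1 * \<bar>?t\<bar>) (\<lambda>x. ?G1 x + ?G2 x + ?G3 x)" by (rule bd_mono)
    have "L 0 h' ?z x - c x * ?z x + (?G1 x + ?G2 x + ?G3 x) = 0" for x
    proof -
      have "L 0 h' ?z x = L 0 h' (u h') x - L 0 h' (u h) x - ?t * L 0 h' w x"
        using h h' u w by (simp add: L_diff L_cmult smb_diff smb_cmult)
      moreover have "?t * (L 0 h w x - c x * w x + (g' x + L (Suc 0) h (u h) x)) = 0" using w(2)[of x] by simp
      then have "?t * L 0 h w x - ?t * (c x * w x) + ?t * g' x + ?t * L (Suc 0) h (u h) x = 0"
        by (simp only: distrib_left right_diff_distrib add.assoc)
      ultimately show ?thesis using u(2)[OF h, of x] u(2)[OF h'(1), of x]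
        unfolding right_diff_distrib mult.left_commute[of "c x"] by linarith
    qed
    then have "bd n (NB n * (2 * \<eta>1 * \<bar>?t\<bar>)) ?z"
      using h h' by (intro a_priori_L[OF h'(1) sz _ _ b2 n] smb_add smb_diff smb_cmult smb_L u g w) auto
    moreover have "NB n * (2 * \<eta>1 * \<bar>?t\<bar>) = \<eta> * \<bar>?t\<bar>" using \<eta>1(2) by (metis mult.assoc)
    ultimately show ?thesis by (simp only:)
  qed
  then show "\<exists>r>0. \<forall>h'\<in>{0<..h0}. \<bar>h' - h\<bar> < r \<longrightarrow>
     bd n (\<eta> * \<bar>h' - h\<bar>) (\<lambda>x. u h' x - u h x - (h' - h) * w x)"
    using r(1) s(1) by (intro exI[of _ "min r s"]) auto
qed

text \<open>Pascal's rule: the derivative of the source of index \<open>k\<close>, together with the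
  term from differentiating the operator itself, is the source of index
  \<open>k + 1\<close>.\<close>

lemma V_source_Suc:
  "(\<Sum>i<k. real (k choose i) * (L (k - i) h (VV f (Suc i) h) x + L (Suc (k - i)) h (VV f i h) x)) + L 1 h (VV f k h) x
    = Vs f (Suc k) h x"
proof -
  define a where "a i = L (Suc k - i) h (VV f i h) x" for i
  have "Vs f (Suc k) h x = (\<Sum>i<Suc k. real (Suc k choose i) * a i)"
    by (simp add: V_source_def a_def)
  also have "\<dots> = a 0 + (\<Sum>i<k. real (Suc k choose Suc i) * a (Suc i))"
    by (subst sum.lessThan_Suc_shift) simp
  also have "(\<Sum>i<k. real (Suc k choose Suc i) * a (Suc i)) =
      (\<Sum>i<k. real (k choose i) * a (Suc i)) + (\<Sum>i<k. real (k choose Suc i) * a (Suc i))"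
    by (simp add: sum.distrib[symmetric] algebra_simps)
  also have "a 0 + (\<dots>) = (\<Sum>i<k. real (k choose i) * a (Suc i)) + (\<Sum>i<Suc k. real (k choose i) * a i)"
    by (subst sum.lessThan_Suc_shift) simp
  also have "\<dots> = (\<Sum>i<k. real (k choose i) * a (Suc i)) + (\<Sum>i<k. real (k choose i) * a i) + a k"
    by simp
  also have "\<dots> = (\<Sum>i<k. real (k choose i) * (L (k - i) h (VV f (Suc i) h) x + L (Suc (k - i)) h (VV f i h) x)) + L 1 h (VV f k h) x"
    unfolding sum.distrib[symmetric] by (simp add: a_def distrib_left Suc_diff_le)
  finally show ?thesis by simp
qed

text \<open>The count of orders is that of \<open>V_bd\<close>. The derivative
  \<open>VV f (Suc k) h\<close> enters only as a fixed smooth function, hence the condition is the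
  one for \<open>k\<close> and not the one for \<open>Suc k\<close>.\<close>

lemma V_Ed:
  assumes f: "smb f" and h: "h \<in> {0<..h0}"
  shows "3 * k \<le> m \<Longrightarrow> Ed (m - 3 * k) (VV f k) (VV f (Suc k) h) h"
proof (induction k rule: less_induct)
  case (less k)
  note sV = V_smb[OF _ f]
  show ?case
  proof (cases "k = 0")
    case True
    have s: "Vs f 0 = (\<lambda>h. f)" by (simp add: V_source_def fun_eq_iff)
    show ?thesis
    proof (rule Ed_solution[where g = "Vs f k" and g' = "\<lambda>x. 0"])
      show "L 0 h (VV f (Suc k) h) x - c x * VV f (Suc k) h x + (0 + L 1 h (VV f k h) x) = 0" for x
        using V_eq[OF h f, of "Suc k" x] V_source_Suc[of k h f x] True by simp
      show "Ed (m - 3 * k) (Vs f k) (\<lambda>x. 0) h" using True s Ed_const by simp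
    qed (use sV h V_eq[OF _ f] smb_const in auto)
  next
    case False
    let ?n = "m - 3 * k"
    have E: "Ed ?n (\<lambda>h x. \<Sum>i<k. real (k choose i) * L (k - i) h (VV f i h) x)
      (\<lambda>x. \<Sum>i<k. real (k choose i) * (L (k - i) h (VV f (Suc i) h) x + L (Suc (k - i)) h (VV f i h) x)) h"
    proof (intro Ed_sum Ed_cmult h smb_cmult smb_add smb_L)
      fix i assume i: "i \<in> {..<k}"
      have "Ed (m - 3 * i) (VV f i) (VV f (Suc i) h) h" using less i by simp
      then have "Ed (?n + (k - i) + 2) (VV f i) (VV f (Suc i) h) h"
        by (rule Ed_le) (use i less.prems in auto)
      then show "Ed ?n (\<lambda>h. L (k - i) h (VV f i h)) (\<lambda>x. L (k - i) h (VV f (Suc i) h) x + L (Suc (k - i)) h (VV f i h) x) h"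
        using i h sV by (intro Ed_L) auto
    qed (use sV h in auto)
    show ?thesis
    proof (rule Ed_solution[OF _ h])
      show "Ed ?n (Vs f k) (\<lambda>x. \<Sum>i<k. real (k choose i) * (L (k - i) h (VV f (Suc i) h) x + L (Suc (k - i)) h (VV f i h) x)) h"
        using E False by (simp add: V_source_def[abs_def])
      show "L 0 h (VV f (Suc k) h) x - c x * VV f (Suc k) h x +
         ((\<Sum>i<k. real (k choose i) * (L (k - i) h (VV f (Suc i) h) x + L (Suc (k - i)) h (VV f i h) x)) + L 1 h (VV f k h) x) = 0" for x
        using V_eq[OF h f, of "Suc k" x] unfolding V_source_Suc .
    qed (use sV h V_eq[OF _ f] in \<open>auto intro!: smb_sum smb_cmult smb_add smb_L\<close>)
  qed
qed

lemma V_has_derivative: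
  assumes f: "smb f" and h: "h \<in> {0<..h0}" and k: "3 * k \<le> m"
  shows "((\<lambda>h. VV f k h x) has_real_derivative VV f (Suc k) h x) (at h within {0<..h0})"
  unfolding has_field_derivative_def has_derivative_within_alt
proof (intro conjI allI impI)
  show "bounded_linear ((*) (VV f (Suc k) h x))" by (rule bounded_linear_mult_right)
  fix \<eta> :: real assume \<eta>: "0 < \<eta>"
  obtain r where r: "0 < r" "\<And>h'. h' \<in> {0<..h0} \<Longrightarrow> \<bar>h' - h\<bar> < r \<Longrightarrow>
     bd (m - 3 * k) (\<eta> * \<bar>h' - h\<bar>) (\<lambda>x. VV f k h' x - VV f k h x - (h' - h) * VV f (Suc k) h x)"
    using V_Ed[OF f h k] \<eta> unfolding Ed_def by blast
  have "\<bar>VV f k h' x - VV f k h x - VV f (Suc k) h x * (h' - h)\<bar> \<le> \<eta> * \<bar>h' - h\<bar>"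
    if "h' \<in> {0<..h0}" "\<bar>h' - h\<bar> < r" for h'
    using bd_D0[OF r(2)[OF that], of x] by (simp add: mult.commute)
  then show "\<exists>d>0. \<forall>y\<in>{0<..h0}. norm (y - h) < d \<longrightarrow>
     norm (VV f k y x - VV f k h x - VV f (Suc k) h x * (y - h)) \<le> \<eta> * norm (y - h)"
    using r(1) by (intro exI[of _ r]) auto
qed

end

section \<open>Stability under perturbation of the data\<close>

lemma LJ_diff_coeff:
  "LJ \<Lambda>1 (\<lambda>l x. q1 l x - q2 l x) (\<lambda>l x. p1 l x - p2 l x) j h \<phi> x =
    LJ \<Lambda>1 q1 p1 j h \<phi> x - LJ \<Lambda>1 q2 p2 j h \<phi> x"
  unfolding LJ_def by (simp add: left_diff_distrib sum_subtractf)

definition close_data ::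
  "nat \<Rightarrow> real \<Rightarrow> (real^'n::finite) set \<Rightarrow>
   (real^'n \<Rightarrow> real^'n \<Rightarrow> real) \<Rightarrow> (real^'n \<Rightarrow> real^'n \<Rightarrow> real) \<Rightarrow> (real^'n \<Rightarrow> real) \<Rightarrow> (real^'n \<Rightarrow> real) \<Rightarrow>
   (real^'n \<Rightarrow> real^'n \<Rightarrow> real) \<Rightarrow> (real^'n \<Rightarrow> real^'n \<Rightarrow> real) \<Rightarrow> (real^'n \<Rightarrow> real) \<Rightarrow> (real^'n \<Rightarrow> real) \<Rightarrow> bool" where
  "close_data n \<omega> \<Lambda>1 q1 p1 c1 f1 q2 p2 c2 f2 \<longleftrightarrow> 0 \<le> \<omega> \<and>
     (\<forall>l\<in>\<Lambda>1. bd n \<omega> (\<lambda>x. q1 l x - q2 l x) \<and> bd n \<omega> (\<lambda>x. p1 l x - p2 l x)) \<and>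
     bd n \<omega> (\<lambda>x. c1 x - c2 x) \<and> bd n \<omega> (\<lambda>x. f1 x - f2 x)"

lemma close_data_le: "close_data n \<omega> \<Lambda>1 q1 p1 c1 f1 q2 p2 c2 f2 \<Longrightarrow> k \<le> n \<Longrightarrow> close_data k \<omega> \<Lambda>1 q1 p1 c1 f1 q2 p2 c2 f2"
  unfolding close_data_def using bd_le by blast

context cst
begin

text \<open>The difference of the two solutions solves the equation of the first data. Its source
  contains the perturbed operator acting on the second solution; at index zero this is bounded
  through the explicit quotients by \<open>h\<^sup>2\<close> instead of derivatives. The constant
  therefore depends on \<open>h1\<close>, which is harmless because it serves convergence
  only.\<close>

lemma V_stable:
  fixes \<Lambda>1 :: "(real^'n::finite) set"
  assumes h1: "0 < h1"
  shows "3 * k + 1 \<le> m \<Longrightarrow> \<exists>C. \<forall>q1 p1 c1 f1 q2 p2 c2 f2 \<omega> h.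
    sdata m d \<delta> c0 \<tau>0 K s1 s2 Mb \<Lambda>1 e \<tau> h0 q1 p1 c1 \<and> smb f1 \<and> bd m B f1 \<and>
    sdata m d \<delta> c0 \<tau>0 K s1 s2 Mb \<Lambda>1 e \<tau> h0 q2 p2 c2 \<and> smb f2 \<and> bd m B f2 \<and>
    close_data (m - 1) \<omega> \<Lambda>1 q1 p1 c1 f1 q2 p2 c2 f2 \<and> h1 \<le> h \<and> h \<le> h0 \<longrightarrow>
    bd (m - 1 - 3 * k) (C * \<omega>) (\<lambda>x. V \<Lambda>1 q1 p1 c1 f1 k h x - V \<Lambda>1 q2 p2 c2 f2 k h x)"
proof (induction k rule: less_induct)
  case (less k)
  let ?n = "m - 1 - 3 * k"
  have "\<forall>i\<in>{..<k}. \<exists>C. \<forall>q1 p1 c1 f1 q2 p2 c2 f2 \<omega> h.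
    sdata m d \<delta> c0 \<tau>0 K s1 s2 Mb \<Lambda>1 e \<tau> h0 q1 p1 c1 \<and> smb f1 \<and> bd m B f1 \<and>
    sdata m d \<delta> c0 \<tau>0 K s1 s2 Mb \<Lambda>1 e \<tau> h0 q2 p2 c2 \<and> smb f2 \<and> bd m B f2 \<and>
    close_data (m - 1) \<omega> \<Lambda>1 q1 p1 c1 f1 q2 p2 c2 f2 \<and> h1 \<le> h \<and> h \<le> h0 \<longrightarrow>
    bd (m - 1 - 3 * i) (C * \<omega>) (\<lambda>x. V \<Lambda>1 q1 p1 c1 f1 i h x - V \<Lambda>1 q2 p2 c2 f2 i h x)"
    using less by simp
  from bchoice[OF this] obtain D where D0: "\<forall>i\<in>{..<k}. \<forall>q1 p1 c1 f1 q2 p2 c2 f2 \<omega> h.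
    sdata m d \<delta> c0 \<tau>0 K s1 s2 Mb \<Lambda>1 e \<tau> h0 q1 p1 c1 \<and> smb f1 \<and> bd m B f1 \<and>
    sdata m d \<delta> c0 \<tau>0 K s1 s2 Mb \<Lambda>1 e \<tau> h0 q2 p2 c2 \<and> smb f2 \<and> bd m B f2 \<and>
    close_data (m - 1) \<omega> \<Lambda>1 q1 p1 c1 f1 q2 p2 c2 f2 \<and> h1 \<le> h \<and> h \<le> h0 \<longrightarrow>
    bd (m - 1 - 3 * i) (D i * \<omega>) (\<lambda>x. V \<Lambda>1 q1 p1 c1 f1 i h x - V \<Lambda>1 q2 p2 c2 f2 i h x)"
    by (rule exE)
  have D: "\<And>i q1 p1 c1 f1 q2 p2 c2 f2 \<omega> h. i < k \<Longrightarrow>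
    sdata m d \<delta> c0 \<tau>0 K s1 s2 Mb \<Lambda>1 e \<tau> h0 q1 p1 c1 \<Longrightarrow> smb f1 \<Longrightarrow> bd m B f1 \<Longrightarrow>
    sdata m d \<delta> c0 \<tau>0 K s1 s2 Mb \<Lambda>1 e \<tau> h0 q2 p2 c2 \<Longrightarrow> smb f2 \<Longrightarrow> bd m B f2 \<Longrightarrow>
    close_data (m - 1) \<omega> \<Lambda>1 q1 p1 c1 f1 q2 p2 c2 f2 \<Longrightarrow> h1 \<le> h \<Longrightarrow> h \<le> h0 \<Longrightarrow>
    bd (m - 1 - 3 * i) (D i * \<omega>) (\<lambda>x. V \<Lambda>1 q1 p1 c1 f1 i h x - V \<Lambda>1 q2 p2 c2 f2 i h x)"
    using D0 by simp
  define E where "E i = CL (k - i) ?n * D i + 2 ^ ?n * ((d * s1) ^ (k - i + 2) + (d * s1) ^ (k - i + 1)) * (CV i * B)" for i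
  define Es where "Es = (if k = 0 then 1 else (\<Sum>i<k. real (k choose i) * E i))"
  define Eq where "Eq = (\<Sum>l\<in>\<Lambda>1. 2 ^ ?n * ((1 + h0) / h1\<^sup>2) * (CV k * B + CV k * B))"
  define C where "C = NB ?n * (Es + (Eq + 2 ^ ?n * (CV k * B)))"
  have "bd ?n (C * \<omega>) (\<lambda>x. V \<Lambda>1 q1 p1 c1 f1 k h x - V \<Lambda>1 q2 p2 c2 f2 k h x)"
    if d1: "sdata m d \<delta> c0 \<tau>0 K s1 s2 Mb \<Lambda>1 e \<tau> h0 q1 p1 c1" and f1: "smb f1" "bd m B f1"
      and d2: "sdata m d \<delta> c0 \<tau>0 K s1 s2 Mb \<Lambda>1 e \<tau> h0 q2 p2 c2" and f2: "smb f2" "bd m B f2"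
      and cl: "close_data (m - 1) \<omega> \<Lambda>1 q1 p1 c1 f1 q2 p2 c2 f2" and hh: "h1 \<le> h" "h \<le> h0"
    for q1 p1 c1 f1 q2 p2 c2 f2 \<omega> h
  proof -
    interpret a: sdata m d \<delta> c0 \<tau>0 K s1 s2 Mb \<Lambda>1 e \<tau> h0 q1 p1 c1 by fact
    interpret b: sdata m d \<delta> c0 \<tau>0 K s1 s2 Mb \<Lambda>1 e \<tau> h0 q2 p2 c2 by fact
    interpret ac: scoeffs \<Lambda>1 s1 0 Mb q1 p1 by (rule a.scoeffs) simp
    interpret bc: scoeffs \<Lambda>1 s1 0 Mb q2 p2 by (rule b.scoeffs) simp
    have h: "h \<in> {0<..h0}" using h1 hh by simp
    have B: "0 \<le> B" using f1 bd_nonneg by blast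
    have cln: "close_data ?n \<omega> \<Lambda>1 q1 p1 c1 f1 q2 p2 c2 f2" by (rule close_data_le[OF cl]) simp
    note \<omega> = cln[unfolded close_data_def]
    note V1 = a.V_smb[OF h f1(1)] and V2 = b.V_smb[OF h f2(1)]
    have V2b: "bd (m - 3 * i) (CV i * B) (b.VV f2 i h)" if "i \<le> k" for i
      using that less.prems by (intro b.V_bd[OF h f2]) simp
    \<comment> \<open>The differences of the coefficients obey the bounds of \<open>coeffs\<close>
      with \<open>\<omega>\<close> in place of \<open>Mb\<close>, so the operators built from them
      are small.\<close>
    interpret co: coeffs \<Lambda>1 s1 ?n \<omega> "\<lambda>l x. q1 l x - q2 l x" "\<lambda>l x. p1 l x - p2 l x"
      by unfold_locales (use \<omega> ac.fin s1 ac.s1(2) ac.smb_q bc.smb_q ac.smb_p bc.smb_p in \<open>auto intro: smb_diff\<close>)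
    have src: "bd ?n (Es * \<omega>) (\<lambda>x. a.Vs f1 k h x - b.Vs f2 k h x)"
    proof (cases "k = 0")
      case True then show ?thesis using \<omega> by (simp add: V_source_def Es_def)
    next
      case False
      have t: "bd ?n (E i * \<omega>) (\<lambda>x. a.L (k - i) h (a.VV f1 i h) x - b.L (k - i) h (b.VV f2 i h) x)" if i: "i < k" for i
      proof -
        have "bd (m - 1 - 3 * i) (D i * \<omega>) (\<lambda>x. a.VV f1 i h x - b.VV f2 i h x)"
          by (rule D[OF i d1 f1 d2 f2 cl hh])
        then have "bd (?n + (k - i) + 2) (D i * \<omega>) (\<lambda>x. a.VV f1 i h x - b.VV f2 i h x)"
          by (rule bd_le) (use i less.prems in linarith)
        then have 1: "bd ?n (CL (k - i) ?n * (D i * \<omega>)) (a.L (k - i) h (\<lambda>x. a.VV f1 i h x - b.VV f2 i h x))"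
          using V1 V2 i by (intro a.L_bd smb_diff) auto
        have "bd (?n + (k - i) + 2) (CV i * B) (b.VV f2 i h)"
          by (rule bd_le[OF V2b]) (use i less.prems in linarith)+
        then have 2: "bd ?n (2 ^ ?n * \<omega> * ((d * s1) ^ (k - i + 2) + (d * s1) ^ (k - i + 1)) * (CV i * B))
           (LJ \<Lambda>1 (\<lambda>l x. q1 l x - q2 l x) (\<lambda>l x. p1 l x - p2 l x) (k - i) h (b.VV f2 i h))"
          using V2 i unfolding a.d_card by (intro co.LJ_bd) auto
        have "bd ?n (CL (k - i) ?n * (D i * \<omega>) + 2 ^ ?n * \<omega> * ((d * s1) ^ (k - i + 2) + (d * s1) ^ (k - i + 1)) * (CV i * B))
          (\<lambda>x. a.L (k - i) h (\<lambda>x. a.VV f1 i h x - b.VV f2 i h x) x +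
            LJ \<Lambda>1 (\<lambda>l x. q1 l x - q2 l x) (\<lambda>l x. p1 l x - p2 l x) (k - i) h (b.VV f2 i h) x)"
          using V1 V2 by (intro bd_add 1 2 a.smb_L co.smb_LJ smb_diff) auto
        moreover have "(\<lambda>x. a.L (k - i) h (\<lambda>x. a.VV f1 i h x - b.VV f2 i h x) x +
            LJ \<Lambda>1 (\<lambda>l x. q1 l x - q2 l x) (\<lambda>l x. p1 l x - p2 l x) (k - i) h (b.VV f2 i h) x)
          = (\<lambda>x. a.L (k - i) h (a.VV f1 i h) x - b.L (k - i) h (b.VV f2 i h) x)"
          using V1 V2 by (simp add: fun_eq_iff a.L_diff LJ_diff_coeff)
        moreover have "CL (k - i) ?n * (D i * \<omega>) + 2 ^ ?n * \<omega> * ((d * s1) ^ (k - i + 2) + (d * s1) ^ (k - i + 1)) * (CV i * B) = E i * \<omega>"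
          unfolding E_def by (simp only: distrib_right mult.assoc mult.commute[of \<omega>])
        ultimately show ?thesis by (simp only:)
      qed
      have "bd ?n (\<Sum>i<k. \<bar>real (k choose i)\<bar> * (E i * \<omega>))
         (\<lambda>x. \<Sum>i<k. real (k choose i) * (a.L (k - i) h (a.VV f1 i h) x - b.L (k - i) h (b.VV f2 i h) x))"
        using V1 V2 t by (intro bd_sum bd_cmult smb_cmult smb_diff a.smb_L b.smb_L) auto
      moreover have "(\<Sum>i<k. \<bar>real (k choose i)\<bar> * (E i * \<omega>)) = Es * \<omega>"
        using False by (simp add: Es_def sum_distrib_right mult.assoc)
      ultimately show ?thesis using False
        by (simp add: V_source_def right_diff_distrib sum_subtractf)
    qed
    let ?P = "\<lambda>x. a.L 0 h (b.VV f2 k h) x - b.L 0 h (b.VV f2 k h) x"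
    have V2n: "bd ?n (CV k * B) (b.VV f2 k h)" by (rule bd_le[OF V2b]) auto
    have P: "bd ?n (Eq * \<omega>) ?P"
    proof -
      let ?r = "\<lambda>l x. (1 / h\<^sup>2) * ((q1 l x - q2 l x) + h * (p1 l x - p2 l x))"
      have eq: "?P = (\<lambda>x. \<Sum>l\<in>\<Lambda>1. ?r l x * (b.VV f2 k h (x + h *\<^sub>R l) - b.VV f2 k h x))"
      proof
        fix x
        have "?P x = (\<Sum>l\<in>\<Lambda>1. (q1 l x + h * p1 l x) / h\<^sup>2 * (b.VV f2 k h (x + h *\<^sub>R l) - b.VV f2 k h x) -
            (q2 l x + h * p2 l x) / h\<^sup>2 * (b.VV f2 k h (x + h *\<^sub>R l) - b.VV f2 k h x))"
          using V2 by (simp only: a.L_0[OF h] b.L_0[OF h] sum_subtractf)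
        also have "\<dots> = (\<Sum>l\<in>\<Lambda>1. ?r l x * (b.VV f2 k h (x + h *\<^sub>R l) - b.VV f2 k h x))"
          by (intro sum.cong refl)
             (simp add: add_divide_distrib diff_divide_distrib algebra_simps)
        finally show "?P x = (\<Sum>l\<in>\<Lambda>1. ?r l x * (b.VV f2 k h (x + h *\<^sub>R l) - b.VV f2 k h x))" .
      qed
      have r: "bd ?n ((1 + h0) / h1\<^sup>2 * \<omega>) (?r l)" "smb (?r l)" if l: "l \<in> \<Lambda>1" for l
      proof -
        show "smb (?r l)" by (intro smb_cmult smb_add smb_diff ac.smb_q ac.smb_p bc.smb_q bc.smb_p l)
        have "bd ?n (\<bar>1 / h\<^sup>2\<bar> * (\<omega> + \<bar>h\<bar> * \<omega>)) (?r l)"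
          using \<omega> l by (intro bd_cmult bd_add smb_cmult smb_add smb_diff ac.smb_q ac.smb_p bc.smb_q bc.smb_p) auto
        moreover have "\<bar>1 / h\<^sup>2\<bar> * (\<omega> + \<bar>h\<bar> * \<omega>) \<le> (1 + h0) / h1\<^sup>2 * \<omega>"
        proof -
          have "1 / h\<^sup>2 \<le> 1 / h1\<^sup>2" using h1 hh by (intro divide_left_mono power_mono) auto
          then have "1 / h\<^sup>2 * (1 + h) \<le> 1 / h1\<^sup>2 * (1 + h0)" using h1 hh by (intro mult_mono) auto
          then have "1 / h\<^sup>2 * (1 + h) * \<omega> \<le> 1 / h1\<^sup>2 * (1 + h0) * \<omega>" using \<omega> by (intro mult_right_mono) auto
          moreover have "\<bar>1 / h\<^sup>2\<bar> * (\<omega> + \<bar>h\<bar> * \<omega>) = 1 / h\<^sup>2 * (1 + h) * \<omega>"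
            using h by (simp add: algebra_simps add_divide_distrib)
          ultimately have "\<bar>1 / h\<^sup>2\<bar> * (\<omega> + \<bar>h\<bar> * \<omega>) \<le> 1 / h1\<^sup>2 * (1 + h0) * \<omega>" by (simp only:)
          then show ?thesis by (simp only: times_divide_eq_left mult_1_left)
        qed
        ultimately show "bd ?n ((1 + h0) / h1\<^sup>2 * \<omega>) (?r l)" by (rule bd_mono)
      qed
      have "bd ?n (\<Sum>l\<in>\<Lambda>1. 2 ^ ?n * ((1 + h0) / h1\<^sup>2 * \<omega>) * (CV k * B + CV k * B)) ?P"
      proof -
        have sv: "smb (b.VV f2 k h)" using V2 by blast
        have s: "smb (\<lambda>x. b.VV f2 k h (x + h *\<^sub>R l) - b.VV f2 k h x)" for l
          by (rule smb_diff[OF smb_translate[OF sv] sv])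
        have "bd ?n (CV k * B + CV k * B) (\<lambda>x. b.VV f2 k h (x + h *\<^sub>R l) - b.VV f2 k h x)" for l
          by (rule bd_diff[OF smb_translate[OF sv] sv bd_translate[OF sv V2n] V2n])
        then show ?thesis
          unfolding eq by (intro bd_sum smb_mult[OF r(2) s] bd_mult[OF r(2) s r(1)])
      qed
      moreover have "(\<Sum>l\<in>\<Lambda>1. 2 ^ ?n * ((1 + h0) / h1\<^sup>2 * \<omega>) * (CV k * B + CV k * B)) = Eq * \<omega>"
        unfolding Eq_def sum_distrib_right by (intro sum.cong refl) (simp only: mult_ac)
      ultimately show ?thesis by (simp only:)
    qed
    let ?Q = "\<lambda>x. (c1 x - c2 x) * b.VV f2 k h x"
    have Q: "bd ?n (2 ^ ?n * \<omega> * (CV k * B)) ?Q"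
      using \<omega> V2 V2n a.smb_c b.smb_c by (intro bd_mult smb_diff) auto
    have sQ: "smb ?Q" "smb ?P" "smb (\<lambda>x. a.Vs f1 k h x - b.Vs f2 k h x)"
      using V1 V2 a.smb_c b.smb_c by (auto intro!: smb_mult smb_diff a.smb_L b.smb_L)
    let ?G = "\<lambda>x. (a.Vs f1 k h x - b.Vs f2 k h x) + (?P x - ?Q x)"
    have G: "bd ?n (Es * \<omega> + (Eq * \<omega> + 2 ^ ?n * \<omega> * (CV k * B))) ?G"
      by (intro bd_add bd_diff src P Q sQ smb_diff)
    let ?z = "\<lambda>x. a.VV f1 k h x - b.VV f2 k h x"
    have "bd ?n (NB ?n * (Es * \<omega> + (Eq * \<omega> + 2 ^ ?n * \<omega> * (CV k * B)))) ?z"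
    proof (rule a.a_priori_L[OF h _ _ _ G])
      show "smb ?z" using V1 V2 by (auto intro: smb_diff)
      show "smb ?G" by (intro smb_add smb_diff sQ)
      fix x
      have "a.L 0 h ?z x = a.L 0 h (a.VV f1 k h) x - a.L 0 h (b.VV f2 k h) x"
        using V1 V2 by (simp add: a.L_diff)
      then show "a.L 0 h ?z x - c1 x * ?z x + ?G x = 0"
        using a.V_eq[OF h f1(1), of k x] b.V_eq[OF h f2(1), of k x] by (simp add: algebra_simps)
    qed simp
    moreover have "NB ?n * (Es * \<omega> + (Eq * \<omega> + 2 ^ ?n * \<omega> * (CV k * B))) = C * \<omega>"
      by (simp add: C_def algebra_simps)
    ultimately show ?thesis by (simp only:)
  qed
  then show ?case by blast
qed

end

section \<open>Passage to the limit in the data\<close>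

lemma finite_mi_order: "finite {\<alpha> :: 'n::finite \<Rightarrow> nat. mi_order \<alpha> \<le> r}"
proof (rule finite_subset)
  show "{\<alpha> :: 'n \<Rightarrow> nat. mi_order \<alpha> \<le> r} \<subseteq> PiE UNIV (\<lambda>_. {..r})"
    unfolding mi_order_def by (auto intro: order_trans[OF member_le_sum[of _ UNIV]])
  show "finite (PiE (UNIV :: 'n set) (\<lambda>_. {..r}))" by (intro finite_PiE) auto
qed

text \<open>Guarantees that the choice in \<open>mi_deriv\<close> succeeds.\<close>

lemma count_list_exists:
  fixes \<alpha> :: "'n::finite \<Rightarrow> nat"
  shows "\<exists>is. \<forall>i. count_list is i = \<alpha> i"
proof -
  obtain xs :: "'n list" where xs: "set xs = UNIV" "distinct xs"
    using finite_distinct_list[OF finite[of "UNIV :: 'n set"]] by blast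
  define ys where "ys = concat (map (\<lambda>i. replicate (\<alpha> i) i) xs)"
  have rep: "count_list (replicate n j) i = (if i = j then n else 0)" for n and i j :: 'n
    by (induction n) auto
  have "count_list (concat (map (\<lambda>i. replicate (\<alpha> i) i) zs)) i = (if i \<in> set zs then \<alpha> i else 0)"
    if "distinct zs" for zs i
    using that by (induction zs) (auto simp: rep)
  then show ?thesis using xs by (intro exI[of _ ys]) (simp add: ys_def)
qed

definition mi_list :: "('n::finite \<Rightarrow> nat) \<Rightarrow> 'n list" where
  "mi_list \<alpha> = (SOME is. \<forall>i. count_list is i = \<alpha> i)"

lemma count_mi_list: "count_list (mi_list \<alpha>) i = \<alpha> i"
  using someI_ex[OF count_list_exists[of \<alpha>]] by (simp add: mi_list_def)

lemma mi_deriv_foldr: "mi_deriv \<alpha> \<phi> = foldr partial (mi_list \<alpha>) \<phi>"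
  by (simp add: mi_deriv_def mi_list_def)

lemma length_count_list: "length is = (\<Sum>i\<in>UNIV. count_list is i)" for "is" :: "'n::finite list"
  using sum_count_set[of "is" UNIV] by simp

lemma length_mi_list: "length (mi_list \<alpha>) = mi_order \<alpha>"
  unfolding length_count_list by (simp add: count_mi_list mi_order_def)

lemma Dnorm_bound:
  fixes \<phi> :: "real^'n::finite \<Rightarrow> real"
  assumes "bd n B \<phi>" "r \<le> n"
  shows "Dnorm r \<phi> x \<le> sqrt (real (card {\<alpha> :: 'n \<Rightarrow> nat. mi_order \<alpha> = r})) * B"
proof -
  have B: "0 \<le> B" using assms(1) bd_nonneg by blast
  have "(\<Sum>\<alpha> | mi_order \<alpha> = r. (mi_deriv \<alpha> \<phi> x)\<^sup>2) \<le> (\<Sum>\<alpha> | mi_order (\<alpha> :: 'n \<Rightarrow> nat) = r. B\<^sup>2)"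
  proof (rule sum_mono)
    fix \<alpha> :: "'n \<Rightarrow> nat" assume "\<alpha> \<in> {\<alpha>. mi_order \<alpha> = r}"
    then have "length (mi_list \<alpha>) \<le> n" using assms(2) by (simp add: length_mi_list)
    then have "\<bar>mi_deriv \<alpha> \<phi> x\<bar> \<le> B"
      unfolding mi_deriv_foldr by (rule bd_D0[OF bd_foldr[OF assms(1)]])
    then show "(mi_deriv \<alpha> \<phi> x)\<^sup>2 \<le> B\<^sup>2" using B abs_le_square_iff[of "mi_deriv \<alpha> \<phi> x" B] by simp
  qed
  then have "Dnorm r \<phi> x \<le> sqrt (real (card {\<alpha> :: 'n \<Rightarrow> nat. mi_order \<alpha> = r}) * B\<^sup>2)"
    unfolding Dnorm_def by simp
  then show ?thesis using B by (simp add: real_sqrt_mult)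
qed

lemma Ck_le: "Ck n \<phi> \<Longrightarrow> r \<le> n \<Longrightarrow> Ck r \<phi>"
  unfolding Ck_def by auto

text \<open>The data converge in the Cauchy sense at order \<open>m - 1\<close> and pointwise to
  their limits, while uniform bounds hold at order \<open>m\<close>.\<close>

locale approx = cst m d \<delta> c0 \<tau>0 K s1 s2 Mb
  for m d \<delta> c0 \<tau>0 K s1 s2 Mb +
  fixes \<Lambda>1 :: "(real^'n::finite) set" and e :: "'n \<Rightarrow> real^'n" and \<tau> :: "real^'n \<Rightarrow> real" and h0 B :: real
    and q p :: "real^'n \<Rightarrow> real^'n \<Rightarrow> real" and c f :: "real^'n \<Rightarrow> real"
    and qs ps :: "nat \<Rightarrow> real^'n \<Rightarrow> real^'n \<Rightarrow> real" and cs fs :: "nat \<Rightarrow> real^'n \<Rightarrow> real"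
  assumes data: "\<And>i. sdata m d \<delta> c0 \<tau>0 K s1 s2 Mb \<Lambda>1 e \<tau> h0 (qs i) (ps i) (cs i)"
    and fs: "\<And>i. smb (fs i)" "\<And>i. bd m B (fs i)"
    and cauchy: "\<And>\<omega>. 0 < \<omega> \<Longrightarrow> \<exists>N. \<forall>i\<ge>N. \<forall>j\<ge>N.
       close_data (m - 1) \<omega> \<Lambda>1 (qs i) (ps i) (cs i) (fs i) (qs j) (ps j) (cs j) (fs j)"
    and lim: "\<And>l x. l \<in> \<Lambda>1 \<Longrightarrow> (\<lambda>i. qs i l x) \<longlonglongrightarrow> q l x" "\<And>l x. l \<in> \<Lambda>1 \<Longrightarrow> (\<lambda>i. ps i l x) \<longlonglongrightarrow> p l x"
       "\<And>x. (\<lambda>i. cs i x) \<longlonglongrightarrow> c x" "\<And>x. (\<lambda>i. fs i x) \<longlonglongrightarrow> f x"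
begin

abbreviation Vn where "Vn k i h \<equiv> V \<Lambda>1 (qs i) (ps i) (cs i) (fs i) k h"

lemma smb_Vn: "h \<in> {0<..h0} \<Longrightarrow> smb (Vn k i h)"
  using sdata.V_smb[OF data _ fs(1)] by blast

lemma Vn_cauchy:
  assumes "0 < h1" "3 * k + 1 \<le> m" "0 < \<eta>"
  shows "\<exists>N. \<forall>i\<ge>N. \<forall>j\<ge>N. \<forall>h\<in>{h1..h0}. bd (m - 1 - 3 * k) \<eta> (\<lambda>x. Vn k i h x - Vn k j h x)"
proof -
  obtain C where C: "\<And>q1 p1 c1 f1 q2 p2 c2 f2 \<omega> h.
    sdata m d \<delta> c0 \<tau>0 K s1 s2 Mb \<Lambda>1 e \<tau> h0 q1 p1 c1 \<and> smb f1 \<and> bd m B f1 \<and>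
    sdata m d \<delta> c0 \<tau>0 K s1 s2 Mb \<Lambda>1 e \<tau> h0 q2 p2 c2 \<and> smb f2 \<and> bd m B f2 \<and>
    close_data (m - 1) \<omega> \<Lambda>1 q1 p1 c1 f1 q2 p2 c2 f2 \<and> h1 \<le> h \<and> h \<le> h0 \<Longrightarrow>
    bd (m - 1 - 3 * k) (C * \<omega>) (\<lambda>x. V \<Lambda>1 q1 p1 c1 f1 k h x - V \<Lambda>1 q2 p2 c2 f2 k h x)"
    using V_stable[OF assms(1,2), of \<Lambda>1 e \<tau> h0 B] by blast
  define \<omega> where "\<omega> = \<eta> / (\<bar>C\<bar> + 1)"
  have \<omega>: "0 < \<omega>" "C * \<omega> \<le> \<eta>"
  proof -
    show "0 < \<omega>" using assms(3) by (simp add: \<omega>_def)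
    then have "C * \<omega> \<le> (\<bar>C\<bar> + 1) * \<omega>" by (intro mult_right_mono) auto
    also have "\<dots> = \<eta>"
      unfolding \<omega>_def using abs_ge_zero[of C] by (intro nonzero_mult_div_cancel_left[of "\<bar>C\<bar> + 1", folded times_divide_eq_right]) linarith
    finally show "C * \<omega> \<le> \<eta>" .
  qed
  obtain N where N: "\<And>i j. N \<le> i \<Longrightarrow> N \<le> j \<Longrightarrow>
      close_data (m - 1) \<omega> \<Lambda>1 (qs i) (ps i) (cs i) (fs i) (qs j) (ps j) (cs j) (fs j)"
    using cauchy[OF \<omega>(1)] by blast
  have "bd (m - 1 - 3 * k) \<eta> (\<lambda>x. Vn k i h x - Vn k j h x)" if "N \<le> i" "N \<le> j" "h \<in> {h1..h0}" for i j h
    using bd_mono[OF C \<omega>(2)] data fs N that by auto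
  then show ?thesis by blast
qed

lemma Vn_cvg_ex:
  assumes h: "h \<in> {0<..h0}" and k: "3 * k + 1 \<le> m"
  shows "\<exists>\<phi>. cvg (m - 1 - 3 * k) (\<lambda>i. Vn k i h) \<phi>"
proof (rule cvg_exists)
  show "ucauchy (m - 1 - 3 * k) (\<lambda>i. Vn k i h)"
    unfolding ucauchy_def
  proof (intro allI impI)
    fix \<eta> :: real assume "0 < \<eta>"
    then obtain N where "\<forall>i\<ge>N. \<forall>j\<ge>N. \<forall>h'\<in>{h..h0}. bd (m - 1 - 3 * k) \<eta> (\<lambda>x. Vn k i h' x - Vn k j h' x)"
      using Vn_cauchy[of h k \<eta>] h k by auto
    then show "\<exists>N. \<forall>i\<ge>N. \<forall>j\<ge>N. bd (m - 1 - 3 * k) \<eta> (\<lambda>x. Vn k i h x - Vn k j h x)"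
      using h by (intro exI[of _ N]) auto
  qed
qed (rule smb_Vn[OF h])

definition W :: "nat \<Rightarrow> real \<Rightarrow> real^'n \<Rightarrow> real" where
  "W k h = (SOME \<phi>. cvg (m - 1 - 3 * k) (\<lambda>i. Vn k i h) \<phi>)"

lemma W_cvg: "h \<in> {0<..h0} \<Longrightarrow> 3 * k + 1 \<le> m \<Longrightarrow> cvg (m - 1 - 3 * k) (\<lambda>i. Vn k i h) (W k h)"
  unfolding W_def by (rule someI_ex[OF Vn_cvg_ex])

lemma W_lim: "h \<in> {0<..h0} \<Longrightarrow> 3 * k + 1 \<le> m \<Longrightarrow> (\<lambda>i. Vn k i h x) \<longlonglongrightarrow> W k h x"
  by (rule cvg_pointwise[OF W_cvg])

lemma W_uniform:
  assumes "0 < h1" "3 * k + 1 \<le> m" "0 < \<eta>"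
  shows "\<forall>\<^sub>F i in sequentially. \<forall>h\<in>{h1..h0}. \<bar>Vn k i h x - W k h x\<bar> \<le> \<eta>"
proof -
  obtain N where N: "\<And>i j h. N \<le> i \<Longrightarrow> N \<le> j \<Longrightarrow> h \<in> {h1..h0} \<Longrightarrow> bd (m - 1 - 3 * k) \<eta> (\<lambda>x. Vn k i h x - Vn k j h x)"
    using Vn_cauchy[OF assms] by blast
  have "\<bar>Vn k i h x - W k h x\<bar> \<le> \<eta>" if i: "N \<le> i" and h: "h \<in> {h1..h0}" for i h
  proof (rule LIMSEQ_le_const2)
    show "(\<lambda>j. \<bar>Vn k i h x - Vn k j h x\<bar>) \<longlonglongrightarrow> \<bar>Vn k i h x - W k h x\<bar>"
      using h assms by (intro tendsto_intros W_lim) auto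
    show "\<exists>N. \<forall>j\<ge>N. \<bar>Vn k i h x - Vn k j h x\<bar> \<le> \<eta>"
      using bd_D0[OF N[OF i _ h]] by blast
  qed
  then show ?thesis unfolding eventually_sequentially by blast
qed

text \<open>Limit and \<open>h\<close>-derivative may be interchanged because the derivatives
  \<open>Vn (Suc k)\<close> converge uniformly on every interval \<open>[h1, h0]\<close> with
  \<open>h1 > 0\<close>.\<close>

lemma W_has_derivative:
  assumes h: "h \<in> {0<..h0}" and k: "3 * Suc k + 1 \<le> m"
  shows "((\<lambda>h. W k h x) has_real_derivative W (Suc k) h x) (at h within {0<..h0})"
proof -
  \<comment> \<open>Uniform convergence is known only away from zero; this left endpoint stays
    strictly below \<open>h\<close>.\<close>
  define h1 where "h1 = h / 2"
  have h1: "0 < h1" "h1 < h" using h by (auto simp: h1_def)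
  let ?S = "{h1..h0}"
  have hS: "h \<in> ?S" using h h1 by simp
  have "\<exists>g. \<forall>t\<in>?S. (\<lambda>i. Vn k i t x) \<longlonglongrightarrow> g t \<and> (g has_derivative (\<lambda>s. W (Suc k) t x * s)) (at t within ?S)"
  proof (rule has_derivative_sequence[where f' = "\<lambda>i t s. Vn (Suc k) i t x * s"])
    show "((\<lambda>t. Vn k i t x) has_derivative (\<lambda>s. Vn (Suc k) i t x * s)) (at t within ?S)" if "t \<in> ?S" for i t
    proof -
      have "((\<lambda>t. Vn k i t x) has_real_derivative Vn (Suc k) i t x) (at t within {0<..h0})"
        using that h1 k by (intro sdata.V_has_derivative[OF data fs(1)]) auto
      then have "((\<lambda>t. Vn k i t x) has_real_derivative Vn (Suc k) i t x) (at t within ?S)"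
        by (rule DERIV_subset) (use h1 in auto)
      then show ?thesis by (simp add: has_field_derivative_def)
    qed
    show "\<forall>\<^sub>F i in sequentially. \<forall>t\<in>?S. \<forall>s. norm (Vn (Suc k) i t x * s - W (Suc k) t x * s) \<le> \<eta> * norm s"
      if "0 < \<eta>" for \<eta>
      using W_uniform[OF h1(1) k that, of x]
    proof eventually_elim
      case (elim i)
      then show ?case by (auto simp: left_diff_distrib[symmetric] abs_mult intro: mult_right_mono)
    qed
    show "(\<lambda>i. Vn k i h x) \<longlonglongrightarrow> W k h x" using h k by (intro W_lim) auto
  qed (use hS in auto)
  then obtain g where g: "\<And>t. t \<in> ?S \<Longrightarrow> (\<lambda>i. Vn k i t x) \<longlonglongrightarrow> g t"
     "\<And>t. t \<in> ?S \<Longrightarrow> (g has_derivative (\<lambda>s. W (Suc k) t x * s)) (at t within ?S)" by blast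
  have gW: "g t = W k t x" if "t \<in> ?S" for t
    using g(1)[OF that] W_lim[of t k x] that h1 k by (intro LIMSEQ_unique[of "\<lambda>i. Vn k i t x"]) auto
  have "((\<lambda>h. W k h x) has_derivative (\<lambda>s. W (Suc k) h x * s)) (at h within ?S)"
    by (rule has_derivative_transform[OF hS gW[symmetric] g(2)[OF hS]])
  then have 1: "((\<lambda>h. W k h x) has_real_derivative W (Suc k) h x) (at h within ?S)"
    by (simp add: has_field_derivative_def)
  \<comment> \<open>Near \<open>h\<close> the two sets coincide, also when \<open>h\<close> is the
    endpoint \<open>h0\<close>.\<close>
  have "at h within ?S = at h within {0<..h0}"
    using h1 by (intro at_within_nhd[of h "{h1<..}"]) auto
  then show ?thesis using 1 by simp
qed

text \<open>Uniqueness concerns all bounded functions and is proved for the limit data themselves: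
  nonnegativity and bounds of the coefficients pass to the limit, so the maximum principle applies
  to the difference of two solutions.\<close>

lemma fd_solution_W:
  assumes h: "h \<in> {0<..h0}" and m: "1 \<le> m"
  shows "fd_solution \<Lambda>1 q p c f h = W 0 h"
proof -
  have fin: "finite \<Lambda>1" and bq: "bd 0 Mb (qs i l)" "bd 0 Mb (ps i l)" if "l \<in> \<Lambda>1" for i l
  proof -
    interpret a: sdata m d \<delta> c0 \<tau>0 K s1 s2 Mb \<Lambda>1 e \<tau> h0 "qs i" "ps i" "cs i" by (rule data)
    interpret ac: scoeffs \<Lambda>1 s1 0 Mb "qs i" "ps i" by (rule a.scoeffs) simp
    show "finite \<Lambda>1" by (rule ac.fin)
    show "bd 0 Mb (qs i l)" "bd 0 Mb (ps i l)" using ac.bd_q ac.bd_p that by blast+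
  qed
  have bern: "bern m d \<delta> c0 \<tau>0 K s1 s2 Mb \<Lambda>1 e \<tau> h (qs i) (ps i) (cs i)" for i
    by (rule sdata.bern[OF data h])
  have L: "L_op \<Lambda>1 q p c h u x = (\<Sum>l\<in>\<Lambda>1. (q l x + h * p l x) / h\<^sup>2 * (u (x + h *\<^sub>R l) - u x)) - c x * u x" for u x
    using h unfolding L_op_def fd_def sum_distrib_left sum.distrib[symmetric]
    by (intro arg_cong2[of _ _ _ _ minus] sum.cong refl) (simp add: field_simps power2_eq_square)
  have coef: "0 \<le> (q l x + h * p l x) / h\<^sup>2 \<and> (q l x + h * p l x) / h\<^sup>2 \<le> 2 * Mb / h\<^sup>2" if l: "l \<in> \<Lambda>1" for l x
  proof
    have lm: "(\<lambda>i. (qs i l x + h * ps i l x) / h\<^sup>2) \<longlonglongrightarrow> (q l x + h * p l x) / h\<^sup>2"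
      using h by (intro tendsto_intros lim l) auto
    show "0 \<le> (q l x + h * p l x) / h\<^sup>2"
      by (rule LIMSEQ_le_const[OF lm]) (use bern.coeff_bounds[OF bern l] in blast)
    show "(q l x + h * p l x) / h\<^sup>2 \<le> 2 * Mb / h\<^sup>2"
      by (rule LIMSEQ_le_const2[OF lm]) (use bern.coeff_bounds[OF bern l] in blast)
  qed
  have c_ge: "c0 \<le> c x" for x
    by (rule LIMSEQ_le_const[OF lim(3)]) (use bern.c_ge[OF bern] in blast)
  have Wb: "bounded (range (W 0 h))"
  proof -
    have "bd (m - 3 * 0) (CV 0 * B) (Vn 0 i h)" for i by (rule sdata.V_bd[OF data h fs]) simp
    then have "bd (m - 1 - 3 * 0) (CV 0 * B) (Vn 0 i h)" for i by (rule bd_le) simp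
    moreover have "cvg (m - 1 - 3 * 0) (\<lambda>i. Vn 0 i h) (W 0 h)" using m by (intro W_cvg h) simp
    ultimately have "bd (m - 1 - 3 * 0) (CV 0 * B) (W 0 h)" using cvg_bd by blast
    then show ?thesis unfolding bounded_range_real by (intro exI allI) (rule bd_D0)
  qed
  have WL: "L_op \<Lambda>1 q p c h (W 0 h) x + f x = 0" for x
  proof (rule LIMSEQ_unique)
    let ?X = "\<lambda>i. (\<Sum>l\<in>\<Lambda>1. (qs i l x + h * ps i l x) / h\<^sup>2 * (Vn 0 i h (x + h *\<^sub>R l) - Vn 0 i h x)) - cs i x * Vn 0 i h x + fs i x"
    show "?X \<longlonglongrightarrow> L_op \<Lambda>1 q p c h (W 0 h) x + f x"
      unfolding L using h m by (intro tendsto_intros lim W_lim) auto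
    have "?X i = 0" for i
      using sdata.V_eq[OF data h fs(1), of i i 0 x]
      by (simp add: V_source_def sdata.L_0[OF data h smb_Vn[OF h]])
    then show "?X \<longlonglongrightarrow> 0" by simp
  qed
  show ?thesis
    unfolding fd_solution_def
  proof (rule the_equality)
    fix v assume v: "bounded (range v) \<and> (\<forall>x. L_op \<Lambda>1 q p c h v x + f x = 0)"
    have "\<bar>v z - W 0 h z\<bar> \<le> 0 / c0" for z
    proof (rule maximum_principle[where u = "\<lambda>x. v x - W 0 h x" and S = \<Lambda>1 and y = "\<lambda>l. h *\<^sub>R l"
          and A = "\<lambda>l. 2 * Mb / h\<^sup>2" and g = "\<lambda>x. 0", OF _ coef c0 c_ge])
      show "bounded (range (\<lambda>x. v x - W 0 h x))"
        using bounded_range_add[of v "\<lambda>x. - W 0 h x"] v Wb by (simp add: bounded_range_real)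
      show "(\<Sum>l\<in>\<Lambda>1. (q l x + h * p l x) / h\<^sup>2 * (v (x + h *\<^sub>R l) - W 0 h (x + h *\<^sub>R l) - (v x - W 0 h x)))
          - c x * (v x - W 0 h x) + 0 = 0" for x
      proof -
        have "(\<Sum>l\<in>\<Lambda>1. (q l x + h * p l x) / h\<^sup>2 * (v (x + h *\<^sub>R l) - W 0 h (x + h *\<^sub>R l) - (v x - W 0 h x))) =
          (\<Sum>l\<in>\<Lambda>1. (q l x + h * p l x) / h\<^sup>2 * (v (x + h *\<^sub>R l) - v x)) -
          (\<Sum>l\<in>\<Lambda>1. (q l x + h * p l x) / h\<^sup>2 * (W 0 h (x + h *\<^sub>R l) - W 0 h x))"
          unfolding sum_subtractf[symmetric] by (intro sum.cong refl) (simp only: right_diff_distrib) 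
        moreover have "L_op \<Lambda>1 q p c h v x + f x = 0" "L_op \<Lambda>1 q p c h (W 0 h) x + f x = 0"
          using v WL by blast+
        ultimately show ?thesis unfolding L right_diff_distrib[of "c x"] by linarith
      qed
    qed auto
    then show "v = W 0 h" by (simp add: fun_eq_iff)
  qed (use Wb WL in blast)
qed

lemma hderiv_Suc: "hderiv h0 (Suc k) u = (\<lambda>h. vector_derivative (hderiv h0 k u) (at h within {0<..h0}))"
  by (simp add: hderiv_def)

lemma hderiv_W:
  assumes m: "1 \<le> m" and k: "3 * k + 1 \<le> m" and h: "h \<in> {0<..h0}"
  shows "hderiv h0 k (\<lambda>t. fd_solution \<Lambda>1 q p c f t x) h = W k h x \<and>
    (3 * Suc k + 1 \<le> m \<longrightarrow>
      (hderiv h0 k (\<lambda>t. fd_solution \<Lambda>1 q p c f t x) has_real_derivative W (Suc k) h x) (at h within {0<..h0}))"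
proof -
  let ?u = "\<lambda>t. fd_solution \<Lambda>1 q p c f t x"
  have step: "(hderiv h0 k ?u has_real_derivative W (Suc k) h x) (at h within {0<..h0})"
    if "\<And>h. h \<in> {0<..h0} \<Longrightarrow> hderiv h0 k ?u h = W k h x" "3 * Suc k + 1 \<le> m" "h \<in> {0<..h0}" for k h
    unfolding has_field_derivative_def
    by (rule has_derivative_transform[OF that(3) that(1) W_has_derivative[OF that(3,2), unfolded has_field_derivative_def]])
  have "\<forall>h\<in>{0<..h0}. hderiv h0 k ?u h = W k h x" if "3 * k + 1 \<le> m" for k
    using that
  proof (induction k)
    case 0 then show ?case by (simp add: hderiv_def fd_solution_W)
  next
    case (Suc k)
    show ?case
    proof
      fix h assume h: "h \<in> {0<..h0}"
      have "(hderiv h0 k ?u has_real_derivative W (Suc k) h x) (at h within {0<..h0})"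
        using Suc h by (intro step) auto
      then have "(hderiv h0 k ?u has_vector_derivative W (Suc k) h x) (at h within {0<..h0})"
        by (simp add: has_real_derivative_iff_has_vector_derivative)
      \<comment> \<open>\<open>vector_derivative\<close> is determined only at limit points of the
        set; approach from the left covers \<open>h0\<close> as well.\<close>
      moreover have "at h within {0<..h0} \<noteq> bot"
      proof -
        have "h islimpt {0<..h0}"
        proof (rule islimpt_subset)
          show "h islimpt {0<..<h}" using h islimpt_greaterThanLessThan2[of 0 h] by simp
        qed (use h in auto)
        then show ?thesis by (simp add: trivial_limit_within)
      qed
      ultimately show "hderiv h0 (Suc k) ?u h = W (Suc k) h x"
        unfolding hderiv_Suc by (intro vector_derivative_within)
    qed
  qed
  then show ?thesis using step k h by blast
qed

lemma conclusion:
  assumes k: "odd k" "3 * k + r \<le> m - 1" "3 * k + 1 \<le> m"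
  shows "let v = fd_solution \<Lambda>1 q p c f;
         w = (\<lambda>h x. hderiv h0 k (\<lambda>t. v t x) h)
     in (\<forall>x. \<forall>j<k. \<forall>h\<in>{0<..h0}.
           hderiv h0 j (\<lambda>t. v t x) differentiable (at h within {0<..h0})) \<and>
        (\<forall>h\<in>{0<..h0}. Ck r (w h) \<and>
           (\<forall>x. Dnorm r (w h) x \<le> sqrt (real (card {\<alpha> :: 'n \<Rightarrow> nat. mi_order \<alpha> = r})) * (CW k * (h * B))))"
  unfolding Let_def
proof (intro conjI allI ballI impI)
  have m: "1 \<le> m" using k by simp
  fix x j h assume j: "j < k" and h: "h \<in> {0<..h0}"
  have "(hderiv h0 j (\<lambda>t. fd_solution \<Lambda>1 q p c f t x) has_real_derivative W (Suc j) h x) (at h within {0<..h0})"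
    using hderiv_W[OF m _ h, of j x] j k(3) by simp
  then show "hderiv h0 j (\<lambda>t. fd_solution \<Lambda>1 q p c f t x) differentiable (at h within {0<..h0})"
    unfolding has_field_derivative_def differentiable_def by blast
next
  have m: "1 \<le> m" using k by simp
  fix h assume h: "h \<in> {0<..h0}"
  have w: "(\<lambda>x. hderiv h0 k (\<lambda>t. fd_solution \<Lambda>1 q p c f t x) h) = W k h"
    using hderiv_W[OF m k(3) h] by (simp add: fun_eq_iff)
  have "Ck (m - 1 - 3 * k) (W k h)" by (rule cvg_Ck[OF W_cvg[OF h k(3)] smb_Vn[OF h]])
  then show "Ck r (\<lambda>x. hderiv h0 k (\<lambda>t. fd_solution \<Lambda>1 q p c f t x) h)"
    unfolding w by (rule Ck_le) (use k in linarith)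
  have "bd (m - 3 * k - 1) (CW k * (h * B)) (Vn k i h)" for i
    by (rule sdata.V_odd_bd[OF data h fs k(1,3)])
  then have "bd (m - 1 - 3 * k) (CW k * (h * B)) (W k h)"
    by (intro cvg_bd[OF W_cvg[OF h k(3)]]) (metis diff_commute)
  then show "Dnorm r (\<lambda>x. hderiv h0 k (\<lambda>t. fd_solution \<Lambda>1 q p c f t x) h) x
      \<le> sqrt (real (card {\<alpha> :: 'n \<Rightarrow> nat. mi_order \<alpha> = r})) * (CW k * (h * B))" for x
    unfolding w by (rule Dnorm_bound) (use k in linarith)
qed

end

section \<open>A smooth kernel with compact support\<close>

definition expp :: "real poly \<Rightarrow> real \<Rightarrow> real" where
  "expp P t = (if 0 < t then poly P (1 / t) * exp (- (1 / t)) else 0)"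

text \<open>In the variable \<open>s = 1 / t\<close>, differentiation in \<open>t\<close> is
  \<open>- s\<^sup>2\<close> times differentiation in \<open>s\<close>, and
  \<open>P(s) exp(-s)\<close> has the \<open>s\<close>-derivative
  \<open>(P' - P)(s) exp(-s)\<close>. Functions of this type are thus stable under
  differentiation.\<close>

definition expp_step :: "real poly \<Rightarrow> real poly" where
  "expp_step P = [:0, 0, 1:] * (P - pderiv P)"

lemma poly_div_exp_0: "((\<lambda>x. poly P x / exp x) \<longlongrightarrow> (0::real)) at_top"
proof -
  have "((\<lambda>x. \<Sum>i\<le>degree P. coeff P i * (x ^ i / exp x)) \<longlongrightarrow> (\<Sum>i\<le>degree P. coeff P i * 0)) at_top"
    by (intro tendsto_intros tendsto_power_div_exp_0)
  moreover have "(\<lambda>x. \<Sum>i\<le>degree P. coeff P i * (x ^ i / exp x)) = (\<lambda>x. poly P x / exp x)"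
    by (simp add: poly_altdef sum_divide_distrib fun_eq_iff)
  ultimately show ?thesis by simp
qed

lemma expp_has_derivative: "(expp P has_real_derivative expp (expp_step P) t) (at t)"
proof -
  consider "t < 0" | "t = 0" | "0 < t" by linarith
  then show ?thesis
  proof cases
    case 1
    have "((\<lambda>_. 0) has_real_derivative 0) (at t)" by simp
    then have "(expp P has_real_derivative 0) (at t)"
      by (rule has_field_derivative_transform_within_open[where S = "{..<0}"]) (use 1 in \<open>auto simp: expp_def\<close>)
    then show ?thesis using 1 by (simp add: expp_def)
  next
    case 3
    have "((\<lambda>t. poly P (1 / t) * exp (- (1 / t))) has_real_derivative
        (poly P (1 / t) * (exp (- (1 / t)) * (1 / (t * t))) + poly (pderiv P) (1 / t) * (- (1 / (t * t))) * exp (- (1 / t)))) (at t)"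
      using 3 by (auto intro!: derivative_eq_intros DERIV_chain2[OF poly_DERIV] simp: divide_inverse)
    moreover have "poly P (1 / t) * (exp (- (1 / t)) * (1 / (t * t))) + poly (pderiv P) (1 / t) * (- (1 / (t * t))) * exp (- (1 / t))
       = expp (expp_step P) t"
      using 3 by (simp add: expp_def expp_step_def algebra_simps)
    ultimately have "((\<lambda>t. poly P (1 / t) * exp (- (1 / t))) has_real_derivative expp (expp_step P) t) (at t)" by simp
    then show ?thesis
      by (rule has_field_derivative_transform_within_open[where S = "{0<..}"]) (use 3 in \<open>auto simp: expp_def\<close>)
  next
    case 2
    have "((\<lambda>s. (expp P (0 + s) - expp P 0) / s) \<longlongrightarrow> 0) (at_right 0)"
    proof -
      \<comment> \<open>Dividing by \<open>s\<close> multiplies the polynomial in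
        \<open>1 / s\<close> by its variable; the exponential still dominates.\<close>
      have "((\<lambda>s. poly (P * [:0, 1:]) (1 / s) / exp (1 / s)) \<longlongrightarrow> 0) (at_right (0::real))"
        by (rule filterlim_compose[OF poly_div_exp_0]) (simp add: filterlim_inverse_at_top_right divide_inverse)
      then show ?thesis
        by (rule Lim_transform_eventually)
           (auto simp: eventually_at_filter expp_def exp_minus field_simps)
    qed
    moreover have "((\<lambda>s. (expp P (0 + s) - expp P 0) / s) \<longlongrightarrow> 0) (at_left 0)"
      by (rule Lim_transform_eventually[OF tendsto_const]) (auto simp: eventually_at_filter expp_def)
    ultimately show ?thesis
      using 2 by (simp add: DERIV_def filterlim_split_at expp_def)
  qed
qed

text \<open>Sums of products of two one-sided exponentials, one for each end of
  \<open>(-1, 1)\<close>. Differentiation acts on the list of polynomial pairs, so every derivative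
  of the bump has a closed form; the sign in \<open>bump_step\<close> is the inner derivative of
  \<open>1 - t\<close>.\<close>

definition bump_pairs :: "(real poly \<times> real poly) list \<Rightarrow> real \<Rightarrow> real" where
  "bump_pairs xs t = (\<Sum>(P, Q)\<leftarrow>xs. expp P (1 + t) * expp Q (1 - t))"

definition bump_step :: "(real poly \<times> real poly) list \<Rightarrow> (real poly \<times> real poly) list" where
  "bump_step xs = concat (map (\<lambda>(P, Q). [(expp_step P, Q), (P, - expp_step Q)]) xs)"

definition bump :: "nat \<Rightarrow> real \<Rightarrow> real" where
  "bump k = bump_pairs ((bump_step ^^ k) [(1, 1)])"

lemma bump_pairs_has_derivative: "(bump_pairs xs has_real_derivative bump_pairs (bump_step xs) t) (at t)"
proof (induction xs)
  case Nil
  have "bump_pairs [] = (\<lambda>_. 0)" by (simp add: bump_pairs_def fun_eq_iff)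
  then show ?case by (simp add: bump_step_def)
next
  case (Cons a xs)
  obtain P Q where a: "a = (P, Q)" by (cases a)
  have m: "expp (- P) t = - expp P t" for P t by (simp add: expp_def)
  have 1: "((\<lambda>t. expp P (1 + t)) has_real_derivative expp (expp_step P) (1 + t) * 1) (at t)"
    by (rule DERIV_chain2[OF expp_has_derivative]) (auto intro!: derivative_eq_intros)
  have 2: "((\<lambda>t. expp Q (1 - t)) has_real_derivative expp (expp_step Q) (1 - t) * (- 1)) (at t)"
    by (rule DERIV_chain2[OF expp_has_derivative]) (auto intro!: derivative_eq_intros)
  have "((\<lambda>t. expp P (1 + t) * expp Q (1 - t) + bump_pairs xs t) has_real_derivative
      expp (expp_step P) (1 + t) * 1 * expp Q (1 - t) + expp (expp_step Q) (1 - t) * (- 1) * expp P (1 + t) + bump_pairs (bump_step xs) t) (at t)"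
    by (intro DERIV_add DERIV_mult 1 2 Cons)
  moreover have "(\<lambda>t. expp P (1 + t) * expp Q (1 - t) + bump_pairs xs t) = bump_pairs (a # xs)"
    by (simp add: bump_pairs_def a fun_eq_iff)
  moreover have "expp (expp_step P) (1 + t) * 1 * expp Q (1 - t) + expp (expp_step Q) (1 - t) * (- 1) * expp P (1 + t) + bump_pairs (bump_step xs) t
     = bump_pairs (bump_step (a # xs)) t"
    by (simp add: bump_pairs_def bump_step_def a m)
  ultimately show ?case by simp
qed

lemma bump_has_derivative: "(bump k has_real_derivative bump (Suc k) t) (at t)"
  unfolding bump_def using bump_pairs_has_derivative by simp

lemma bump_support: "1 \<le> \<bar>t\<bar> \<Longrightarrow> bump k t = 0"
proof -
  assume "1 \<le> \<bar>t\<bar>"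
  then have z: "expp P (1 + t) * expp Q (1 - t) = 0" for P Q by (auto simp: expp_def)
  have "bump_pairs xs t = 0" for xs
  proof (induction xs)
    case (Cons a xs)
    then show ?case using z[of "fst a" "snd a"] by (simp add: bump_pairs_def case_prod_unfold)
  qed (simp add: bump_pairs_def)
  then show ?thesis by (simp add: bump_def)
qed

lemma bump_0: "bump 0 t = (if \<bar>t\<bar> < 1 then exp (- (1 / (1 + t))) * exp (- (1 / (1 - t))) else 0)"
  by (auto simp: bump_def bump_pairs_def expp_def)

text \<open>A compactly supported function for each coordinate together with all its derivatives,
  indexed by \<open>k\<close>. Partial derivatives of the tensor product then merely raise an
  index.\<close>

definition chain :: "real \<Rightarrow> ('n::finite \<Rightarrow> nat \<Rightarrow> real \<Rightarrow> real) \<Rightarrow> bool" where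
  "chain R b \<longleftrightarrow> (\<forall>i k t. (b i k has_real_derivative b i (Suc k) t) (at t)) \<and> (\<forall>i k t. R \<le> \<bar>t\<bar> \<longrightarrow> b i k t = 0)"

definition tens :: "('n::finite \<Rightarrow> nat \<Rightarrow> real \<Rightarrow> real) \<Rightarrow> ('n \<Rightarrow> nat) \<Rightarrow> real^'n \<Rightarrow> real" where
  "tens b \<kappa> x = (\<Prod>i\<in>UNIV. b i (\<kappa> i) (x$i))"

lemma tens_has_derivative:
  assumes "chain R b"
  shows "(tens b \<kappa> has_derivative (\<lambda>y. \<Sum>i\<in>UNIV. y$i * tens b (\<kappa>(i := Suc (\<kappa> i))) x)) (at x)"
proof -
  have "((\<lambda>x. b i (\<kappa> i) (x$i)) has_derivative (\<lambda>y. b i (Suc (\<kappa> i)) (x$i) * y$i)) (at x)" for i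
  proof -
    have "((\<lambda>x. x$i) has_derivative (\<lambda>y. y$i)) (at x)" by (intro bounded_linear_imp_has_derivative bounded_linear_vec_nth)
    moreover have "(b i (\<kappa> i) has_derivative (*) (b i (Suc (\<kappa> i)) (x$i))) (at (x$i))"
      using assms unfolding chain_def has_field_derivative_def by blast
    ultimately show ?thesis using diff_chain_at[of "\<lambda>x. x$i" "\<lambda>y. y$i" x "b i (\<kappa> i)"] by (simp add: o_def)
  qed
  then have "((\<lambda>x. \<Prod>i\<in>UNIV. b i (\<kappa> i) (x$i)) has_derivative
     (\<lambda>y. \<Sum>i\<in>UNIV. b i (Suc (\<kappa> i)) (x$i) * y$i * (\<Prod>j\<in>UNIV - {i}. b j (\<kappa> j) (x$j)))) (at x)"
    by (intro has_derivative_prod) auto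
  moreover have "tens b (\<kappa>(i := Suc (\<kappa> i))) x = b i (Suc (\<kappa> i)) (x$i) * (\<Prod>j\<in>UNIV - {i}. b j (\<kappa> j) (x$j))" for i
    unfolding tens_def by (subst prod.remove[of UNIV i]) (auto intro!: prod.cong)
  ultimately show ?thesis by (simp add: tens_def[abs_def] mult_ac)
qed

lemma partial_tens: "chain R b \<Longrightarrow> partial i (tens b \<kappa>) = tens b (\<kappa>(i := Suc (\<kappa> i)))"
  by (intro ext partialI tens_has_derivative)

lemma foldr_partial_tens:
  "chain R b \<Longrightarrow> foldr partial is (tens b \<kappa>) = tens b (\<lambda>i. \<kappa> i + count_list is i)"
proof (induction "is")
  case (Cons j "is")
  have "(\<lambda>i. \<kappa> i + count_list is i)(j := Suc (\<kappa> j + count_list is j)) = (\<lambda>i. \<kappa> i + count_list (j # is) i)"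
    by (auto simp: fun_eq_iff)
  then show ?case using Cons by (simp add: partial_tens)
qed simp

lemma chain_bounded:
  assumes "chain R b"
  shows "\<exists>C. \<forall>t. \<bar>b i k t\<bar> \<le> C"
proof -
  have "continuous_on {- R..R} (b i k)"
  proof (intro continuous_at_imp_continuous_on ballI)
    fix t
    have "(b i k has_real_derivative b i (Suc k) t) (at t)" using assms by (simp add: chain_def)
    then show "isCont (b i k) t" by (rule DERIV_isCont)
  qed
  then have "bounded (b i k ` {- R..R})"
    by (intro compact_imp_bounded compact_continuous_image) auto
  then obtain C where C: "\<forall>t\<in>{- R..R}. \<bar>b i k t\<bar> \<le> C" by (auto simp: bounded_iff)
  have "\<bar>b i k t\<bar> \<le> max C 0" for t
  proof (cases "R \<le> \<bar>t\<bar>")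
    case True then show ?thesis using assms by (simp add: chain_def)
  next
    case False then have "t \<in> {- R..R}" by auto
    then show ?thesis using C by fastforce
  qed
  then show ?thesis by blast
qed

lemma bounded_tens:
  assumes "chain R b"
  shows "bounded (range (tens b \<kappa>))"
proof -
  have "\<forall>i. \<exists>C. \<forall>t. \<bar>b i (\<kappa> i) t\<bar> \<le> C" using chain_bounded[OF assms] by blast
  then obtain C where C: "\<And>i t. \<bar>b i (\<kappa> i) t\<bar> \<le> C i" by metis
  have "\<bar>tens b \<kappa> x\<bar> \<le> (\<Prod>i\<in>UNIV. C i)" for x
    unfolding tens_def abs_prod using C by (intro prod_mono) auto
  then show ?thesis by (auto simp: bounded_range_real)
qed

lemma smb_tens:
  assumes "chain R b"
  shows "smb (tens b \<kappa>)"
proof (rule smb_coinduct[of _ "range (tens b)"], blast, safe)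
  fix \<kappa> x i
  show "bounded (range (tens b \<kappa>))" by (rule bounded_tens[OF assms])
  show "tens b \<kappa> differentiable at x" using tens_has_derivative[OF assms] differentiable_def by blast
  show "partial i (tens b \<kappa>) \<in> range (tens b)" using partial_tens[OF assms] by blast
qed

lemma tens_support: "chain R b \<Longrightarrow> tens b \<kappa> x \<noteq> 0 \<Longrightarrow> \<bar>x$i\<bar> < R"
proof (rule ccontr)
  assume "chain R b" "tens b \<kappa> x \<noteq> 0" "\<not> \<bar>x$i\<bar> < R"
  then have "b i (\<kappa> i) (x$i) = 0" by (auto simp: chain_def not_less)
  then have "tens b \<kappa> x = 0" unfolding tens_def by (intro prod_zero) auto
  then show False using \<open>tens b \<kappa> x \<noteq> 0\<close> by simp
qed

definition box1 :: "real^'n::finite \<Rightarrow> real \<Rightarrow> (real^'n) set" where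
  "box1 x r = cbox (x - (\<chi> i. r)) (x + (\<chi> i. r))"

lemma mem_box1: "z \<in> box1 x r \<longleftrightarrow> (\<forall>i. \<bar>z$i - x$i\<bar> \<le> r)"
  by (auto simp: box1_def mem_box_cart abs_le_iff algebra_simps)

lemma box1_borel [measurable]: "box1 x r \<in> sets borel" by (simp add: box1_def)

lemma integrable_box1: "integrable lborel (indicator (box1 x r) :: _ \<Rightarrow> real)"
  unfolding box1_def by (intro integrable_real_indicator emeasure_lborel_cbox_finite) simp

lemma compact_support_tens:
  assumes "chain R b"
  shows "compact (closure {x. tens b \<kappa> x \<noteq> 0})"
proof -
  have "{x. tens b \<kappa> x \<noteq> 0} \<subseteq> box1 0 R"
    using tens_support[OF assms, THEN less_imp_le] by (auto simp: mem_box1)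
  then have "bounded {x. tens b \<kappa> x \<noteq> 0}"
    unfolding box1_def using bounded_cbox bounded_subset by blast
  then show ?thesis by (simp add: compact_closure)
qed

section \<open>Mollification\<close>

text \<open>\<open>rho \<epsilon> \<kappa>\<close> is the derivative with multi-index
  \<open>\<kappa>\<close> of the kernel with index zero; the powers of \<open>\<epsilon>\<close>
  come from rescaling the argument. The kernel is not normalised, and \<open>moll\<close> divides by
  its integral.\<close>

definition rho :: "real \<Rightarrow> ('n::finite \<Rightarrow> nat) \<Rightarrow> real^'n \<Rightarrow> real" where
  "rho \<epsilon> = tens (\<lambda>i k t. bump k (t / \<epsilon>) / \<epsilon> ^ k)"

lemma chain_bump: "0 < \<epsilon> \<Longrightarrow> chain \<epsilon> (\<lambda>i k t. bump k (t / \<epsilon>) / \<epsilon> ^ k)"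
  unfolding chain_def
proof (intro conjI allI impI)
  fix k t assume \<epsilon>: "0 < \<epsilon>"
  have "((\<lambda>t. bump k (t / \<epsilon>)) has_real_derivative bump (Suc k) (t / \<epsilon>) * (1 / \<epsilon>)) (at t)"
    by (rule DERIV_chain2[OF bump_has_derivative]) (use \<epsilon> in \<open>auto intro!: derivative_eq_intros\<close>)
  from DERIV_cdivide[OF this, of "\<epsilon> ^ k"]
  show "((\<lambda>t. bump k (t / \<epsilon>) / \<epsilon> ^ k) has_real_derivative bump (Suc k) (t / \<epsilon>) / \<epsilon> ^ Suc k) (at t)"
    using \<epsilon> by (simp add: field_simps)
  assume "\<epsilon> \<le> \<bar>t\<bar>"
  then show "bump k (t / \<epsilon>) / \<epsilon> ^ k = 0" using \<epsilon> bump_support[of "t / \<epsilon>"] by (simp add: field_simps)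
qed

locale mollifier =
  fixes \<epsilon> :: real and I :: "'n::finite itself"
  assumes \<epsilon>: "0 < \<epsilon>"
begin

abbreviation rh :: "('n \<Rightarrow> nat) \<Rightarrow> real^'n \<Rightarrow> real" where "rh \<equiv> rho \<epsilon>"

lemma chain_rh: "chain \<epsilon> (\<lambda>(i::'n) k t. bump k (t / \<epsilon>) / \<epsilon> ^ k)" by (rule chain_bump[OF \<epsilon>])

lemma smb_rh: "smb (rh \<kappa>)" unfolding rho_def by (rule smb_tens[OF chain_rh])

lemma rh_borel [measurable]: "rh \<kappa> \<in> borel_measurable borel"
  by (rule smb_borel[OF smb_rh])

lemma partial_rh: "partial i (rh \<kappa>) = rh (\<kappa>(i := Suc (\<kappa> i)))"
  unfolding rho_def by (rule partial_tens[OF chain_rh])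

lemma rh_support: "rh \<kappa> (x - z) \<noteq> 0 \<Longrightarrow> z \<in> box1 x \<epsilon>"
  using tens_support[OF chain_rh, of \<kappa> "x - z"] by (auto simp: mem_box1 rho_def abs_minus_commute intro: less_imp_le)

lemma rh_bounded: "\<exists>C. \<forall>x. \<bar>rh \<kappa> x\<bar> \<le> C"
  using smb_bounded[OF smb_rh] by (simp add: bounded_range_real)

definition rb :: "('n \<Rightarrow> nat) \<Rightarrow> real" where "rb \<kappa> = (SOME C. \<forall>x. \<bar>rh \<kappa> x\<bar> \<le> C)"

lemma rb: "\<bar>rh \<kappa> x\<bar> \<le> rb \<kappa>"
  unfolding rb_def using someI_ex[OF rh_bounded] by blast

definition vol :: real where "vol = measure lborel (box1 (0 :: real^'n) \<epsilon>)"

lemma measure_box1: "measure lborel (box1 (x :: real^'n) \<epsilon>) = vol"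
proof -
  have "measure lborel (box1 x \<epsilon>) = measure lborel (box1 (0 :: real^'n) \<epsilon>)"
    unfolding box1_def using \<epsilon>
    by (subst (1 2) measure_lborel_cbox_eq) (auto simp: inner_diff_left inner_add_left Basis_vec_def inner_axis')
  then show ?thesis by (simp add: vol_def)
qed

definition conv :: "('n \<Rightarrow> nat) \<Rightarrow> (real^'n \<Rightarrow> real) \<Rightarrow> real^'n \<Rightarrow> real" where
  "conv \<kappa> g x = (LINT z|lborel. g z * rh \<kappa> (x - z))"

lemma conv_integrand:
  assumes "bounded_borel g" "smb r" "\<And>z. r (x - z) \<noteq> 0 \<Longrightarrow> z \<in> S" "integrable lborel (indicator S :: _ \<Rightarrow> real)"
  shows "integrable lborel (\<lambda>z. g z * r (x - z))"
proof -
  obtain G where G: "\<And>z. \<bar>g z\<bar> \<le> G" using assms(1) by (auto simp: bounded_borel_def bounded_range_real)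
  obtain C where C: "\<And>z. \<bar>r z\<bar> \<le> C" using smb_bounded[OF assms(2)] by (auto simp: bounded_range_real)
  have [measurable]: "g \<in> borel_measurable borel" using assms(1) by (simp add: bounded_borel_def)
  have [measurable]: "r \<in> borel_measurable borel" by (rule smb_borel[OF assms(2)])
  show ?thesis
  proof (rule Bochner_Integration.integrable_bound)
    show "integrable lborel (\<lambda>z. (G * C) * indicator S z)" using assms(4) by (rule integrable_mult_right)
    show "AE z in lborel. norm (g z * r (x - z)) \<le> norm (G * C * indicator S z)"
    proof (rule AE_I2)
      fix z
      have G0: "0 \<le> G" "0 \<le> C" using G C abs_ge_zero order_trans by blast+
      show "norm (g z * r (x - z)) \<le> norm (G * C * indicator S z)"
      proof (cases "r (x - z) = 0")
        case False
        then have "z \<in> S" by (rule assms(3))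
        then show ?thesis using G0 G[of z] C[of "x - z"] by (simp add: abs_mult mult_mono)
      qed simp
    qed
  qed measurable
qed

lemma conv_integrable: "bounded_borel g \<Longrightarrow> integrable lborel (\<lambda>z. g z * rh \<kappa> (x - z))"
  by (rule conv_integrand[OF _ smb_rh rh_support integrable_box1])

lemma conv_bound:
  assumes g: "bounded_borel g" "\<And>z. \<bar>g z\<bar> \<le> G"
  shows "\<bar>conv \<kappa> g x\<bar> \<le> G * rb \<kappa> * vol"
proof -
  have "\<bar>conv \<kappa> g x\<bar> \<le> (LINT z|lborel. \<bar>g z * rh \<kappa> (x - z)\<bar>)"
    unfolding conv_def by (rule integral_abs_bound)
  also have "\<dots> \<le> (LINT z|lborel. (G * rb \<kappa>) * indicator (box1 x \<epsilon>) z)"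
  proof (rule integral_mono)
    show "integrable lborel (\<lambda>z. \<bar>g z * rh \<kappa> (x - z)\<bar>)" using conv_integrable[OF g(1)] by (rule integrable_abs)
    show "integrable lborel (\<lambda>z. (G * rb \<kappa>) * indicator (box1 x \<epsilon>) z)" by (intro integrable_mult_right integrable_box1)
    fix z
    have "0 \<le> G" "0 \<le> rb \<kappa>" using g(2) rb abs_ge_zero order_trans by blast+
    then show "\<bar>g z * rh \<kappa> (x - z)\<bar> \<le> (G * rb \<kappa>) * indicator (box1 x \<epsilon>) z"
      using g(2)[of z] rb[of \<kappa> "x - z"] rh_support[of \<kappa> x z]
      by (cases "rh \<kappa> (x - z) = 0") (auto simp: abs_mult intro: mult_mono)
  qed
  also have "\<dots> = G * rb \<kappa> * vol" by (simp add: measure_box1)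
  finally show ?thesis .
qed

text \<open>The second order Taylor bound of the kernel is integrated against \<open>g\<close>. The
  integrand vanishes outside two boxes of fixed volume, so the error is quadratic in
  \<open>y\<close> for merely bounded measurable \<open>g\<close>.\<close>

lemma conv_has_derivative:
  assumes g: "bounded_borel g"
  shows "(conv \<kappa> g has_derivative (\<lambda>y. \<Sum>i\<in>UNIV. y$i * conv (\<kappa>(i := Suc (\<kappa> i))) g x)) (at x)"
proof -
  obtain B where B: "bd 2 B (rh \<kappa>)" using smb_bd[OF smb_rh] by blast
  obtain G where G: "\<And>z. \<bar>g z\<bar> \<le> G" using g by (auto simp: bounded_borel_def bounded_range_real)
  have G0: "0 \<le> G" using G abs_ge_zero order_trans by blast
  have B0: "0 \<le> B" using B bd_nonneg by blast
  let ?d = "real CARD('n)"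
  show ?thesis
  proof (rule has_derivative_quadratic[OF bounded_linear_component_sum])
    fix y :: "real^'n"
    let ?r = "\<lambda>w. rh \<kappa> (w + y) - rh \<kappa> w - (\<Sum>i\<in>UNIV. y$i * rh (\<kappa>(i := Suc (\<kappa> i))) w)"
    have int1: "integrable lborel (\<lambda>z. g z * rh \<kappa> (x + y - z))" by (rule conv_integrable[OF g])
    have int2: "integrable lborel (\<lambda>z. g z * rh \<kappa> (x - z))" for \<kappa> by (rule conv_integrable[OF g])
    have eq: "conv \<kappa> g (x + y) - conv \<kappa> g x - (\<Sum>i\<in>UNIV. y$i * conv (\<kappa>(i := Suc (\<kappa> i))) g x)
       = (LINT z|lborel. g z * ?r (x - z))"
    proof -
      have "(\<Sum>i\<in>UNIV. y$i * conv (\<kappa>(i := Suc (\<kappa> i))) g x) =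
          (LINT z|lborel. (\<Sum>i\<in>UNIV. y$i * (g z * rh (\<kappa>(i := Suc (\<kappa> i))) (x - z))))"
        unfolding conv_def by (subst Bochner_Integration.integral_sum) (auto intro: integrable_mult_right int2)
      then have "conv \<kappa> g (x + y) - conv \<kappa> g x - (\<Sum>i\<in>UNIV. y$i * conv (\<kappa>(i := Suc (\<kappa> i))) g x) =
         (LINT z|lborel. g z * rh \<kappa> (x + y - z) - g z * rh \<kappa> (x - z) - (\<Sum>i\<in>UNIV. y$i * (g z * rh (\<kappa>(i := Suc (\<kappa> i))) (x - z))))"
        unfolding conv_def
        by (subst Bochner_Integration.integral_diff) (auto intro!: int1 int2 Bochner_Integration.integrable_diff
            Bochner_Integration.integrable_sum integrable_mult_right simp: Bochner_Integration.integral_diff[OF int1 int2])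
      also have "\<dots> = (LINT z|lborel. g z * ?r (x - z))"
        by (intro Bochner_Integration.integral_cong refl)
           (simp add: algebra_simps sum_distrib_left)
      finally show ?thesis .
    qed
    let ?D = "?d\<^sup>2 * B * (norm y)\<^sup>2"
    let ?S = "\<lambda>z. G * ?D * (indicator (box1 (x + y) \<epsilon>) z + indicator (box1 x \<epsilon>) z)"
    have D0: "0 \<le> ?D" using B0 by simp
    have int3: "integrable lborel (\<lambda>z. g z * ?r (x - z))"
    proof -
      have "integrable lborel (\<lambda>z. g z * rh \<kappa> (x + y - z) - g z * rh \<kappa> (x - z) - (\<Sum>i\<in>UNIV. y$i * (g z * rh (\<kappa>(i := Suc (\<kappa> i))) (x - z))))"
        by (intro Bochner_Integration.integrable_diff int1 int2 Bochner_Integration.integrable_sum integrable_mult_right)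
      then show ?thesis by (simp add: algebra_simps sum_distrib_left)
    qed
    have "\<bar>LINT z|lborel. g z * ?r (x - z)\<bar> \<le> (LINT z|lborel. \<bar>g z * ?r (x - z)\<bar>)"
      by (rule integral_abs_bound)
    also have "\<dots> \<le> (LINT z|lborel. ?S z)"
    proof (rule integral_mono)
      show "integrable lborel (\<lambda>z. \<bar>g z * ?r (x - z)\<bar>)" using int3 by (rule integrable_abs)
      show "integrable lborel ?S" by (intro integrable_mult_right Bochner_Integration.integrable_add integrable_box1)
      fix z
      show "\<bar>g z * ?r (x - z)\<bar> \<le> ?S z"
      proof (cases "z \<in> box1 (x + y) \<epsilon> \<or> z \<in> box1 x \<epsilon>")
        case True
        have "\<bar>?r (x - z)\<bar> \<le> ?D"
          using taylor2_bound[OF smb_rh B, of "x - z" y] by (simp add: partial_rh)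
        then have "\<bar>g z\<bar> * \<bar>?r (x - z)\<bar> \<le> G * ?D" using G[of z] G0 by (intro mult_mono) auto
        also have "\<dots> \<le> ?S z"
        proof -
          have "1 \<le> indicator (box1 (x + y) \<epsilon>) z + (indicator (box1 x \<epsilon>) z :: real)"
            using True by (auto simp: indicator_def)
          then have "(G * ?D) * 1 \<le> (G * ?D) * (indicator (box1 (x + y) \<epsilon>) z + indicator (box1 x \<epsilon>) z)"
            using G0 D0 by (intro mult_left_mono) auto
          then show ?thesis by simp
        qed
        finally show ?thesis by (simp add: abs_mult)
      next
        case False
        have "x + y - z = x - z + y" by simp
        then have "rh \<kappa> (x - z + y) = 0" using False rh_support[of \<kappa> "x + y" z] by metis
        moreover have "rh \<kappa>' (x - z) = 0" for \<kappa>' using False rh_support[of \<kappa>' x z] by blast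
        ultimately show ?thesis using False by simp
      qed
    qed
    also have "\<dots> = G * ?D * (vol + vol)"
      by (simp add: Bochner_Integration.integral_add integrable_box1 measure_box1)
    also have "\<dots> = (G * ?d\<^sup>2 * B * (vol + vol)) * (norm y)\<^sup>2" by (simp add: algebra_simps)
    finally show "\<bar>conv \<kappa> g (x + y) - conv \<kappa> g x - (\<Sum>i\<in>UNIV. y$i * conv (\<kappa>(i := Suc (\<kappa> i))) g x)\<bar>
       \<le> (G * ?d\<^sup>2 * B * (vol + vol)) * (norm y)\<^sup>2" unfolding eq .
  qed
qed

lemma partial_conv: "bounded_borel g \<Longrightarrow> partial i (conv \<kappa> g) = conv (\<kappa>(i := Suc (\<kappa> i))) g"
  by (intro ext partialI conv_has_derivative)

lemma foldr_partial_conv: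
  "bounded_borel g \<Longrightarrow> foldr partial is (conv \<kappa> g) = conv (\<lambda>i. \<kappa> i + count_list is i) g"
proof (induction "is")
  case (Cons j "is")
  have "(\<lambda>i. \<kappa> i + count_list is i)(j := Suc (\<kappa> j + count_list is j)) = (\<lambda>i. \<kappa> i + count_list (j # is) i)"
    by (auto simp: fun_eq_iff)
  then show ?case using Cons by (simp add: partial_conv)
qed simp

lemma smb_conv:
  assumes g: "bounded_borel g"
  shows "smb (conv \<kappa> g)"
proof (rule smb_coinduct[of _ "{conv \<kappa> g |\<kappa>. True}"], blast, safe)
  fix \<kappa> x i
  obtain G where "\<And>z. \<bar>g z\<bar> \<le> G" using g by (auto simp: bounded_borel_def bounded_range_real)
  then have "\<bar>conv \<kappa> g x\<bar> \<le> G * rb \<kappa> * vol" for x using conv_bound[OF g] by blast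
  then show "bounded (range (conv \<kappa> g))" by (auto simp: bounded_range_real)
  show "conv \<kappa> g differentiable at x" using conv_has_derivative[OF g] differentiable_def by blast
  show "\<exists>\<kappa>'. partial i (conv \<kappa> g) = conv \<kappa>' g \<and> True" using partial_conv[OF g] by blast
qed

end

lemma lint_reflect:
  fixes F :: "real^'n::finite \<Rightarrow> real"
  assumes [measurable]: "F \<in> borel_measurable borel"
  shows "(LINT z|lborel. F (x - z)) = (LINT z|lborel. F z)"
proof -
  have "(LINT z|lborel. F z) = (LINT z|density (distr lborel borel (\<lambda>z. x + (- 1) *\<^sub>R z)) (\<lambda>_. ennreal (\<bar>- 1\<bar> ^ DIM(real^'n))). F z)"
    by (subst lborel_affine[of "- 1" x]) auto
  also have "\<dots> = (LINT z|distr lborel borel (\<lambda>z. x + (- 1) *\<^sub>R z). F z)"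
    by (simp add: density_1)
  also have "\<dots> = (LINT z|lborel. F (x - z))"
    by (subst integral_distr) auto
  finally show ?thesis by simp
qed

lemma lint_translate:
  fixes F :: "real^'n::finite \<Rightarrow> real"
  assumes [measurable]: "F \<in> borel_measurable borel"
  shows "(LINT z|lborel. F (z + y)) = (LINT z|lborel. F z)"
proof -
  have "(LINT z|lborel. F (y - (0 - z))) = (LINT z|lborel. F (y - z))"
    by (rule lint_reflect[of "\<lambda>z. F (y - z)" 0, symmetric, THEN sym]) measurable
  then show ?thesis by (simp add: lint_reflect add.commute)
qed

lemma bb_borel [measurable_dest]: "bounded_borel g \<Longrightarrow> g \<in> borel_measurable borel"
  by (simp add: bounded_borel_def)

lemma bb_bound: "bounded_borel g \<Longrightarrow> \<exists>G. \<forall>z. \<bar>g z\<bar> \<le> G"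
  by (simp add: bounded_borel_def bounded_range_real)

lemma bbI: "g \<in> borel_measurable borel \<Longrightarrow> (\<And>z. \<bar>g z\<bar> \<le> G) \<Longrightarrow> bounded_borel g"
  by (auto simp: bounded_borel_def bounded_range_real)

lemma bb_const: "bounded_borel (\<lambda>x. k)"
  by (rule bbI[where G = "\<bar>k\<bar>"]) auto

lemma bb_add: "bounded_borel f \<Longrightarrow> bounded_borel g \<Longrightarrow> bounded_borel (\<lambda>x. f x + g x)"
  unfolding bounded_borel_def by (auto intro: borel_measurable_add bounded_range_add)

lemma bb_cmult: "bounded_borel g \<Longrightarrow> bounded_borel (\<lambda>x. k * g x)"
  unfolding bounded_borel_def
  by (auto intro!: borel_measurable_times bounded_range_mult simp: bounded_range_real[of "\<lambda>x. k"])

lemma bb_sum: "(\<And>i. i \<in> S \<Longrightarrow> bounded_borel (g i)) \<Longrightarrow> bounded_borel (\<lambda>x. \<Sum>i\<in>S. g i x)"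
  by (induction S rule: infinite_finite_induct) (auto intro: bb_const bb_add)

lemma bb_smb: "smb g \<Longrightarrow> bounded_borel g"
  by (simp add: bounded_borel_def smb_bounded smb_borel)

section \<open>Normalised mollification\<close>

context mollifier
begin

abbreviation k0 :: "'n \<Rightarrow> nat" where "k0 \<equiv> (\<lambda>_. 0)"

lemma bump_0_nonneg: "0 \<le> bump 0 t" by (simp add: bump_0)

lemma rh0_nonneg: "0 \<le> rh k0 x"
  unfolding rho_def tens_def by (intro prod_nonneg) (simp add: bump_0_nonneg)

lemma rh0_pos: "(\<And>i. \<bar>x$i\<bar> < \<epsilon>) \<Longrightarrow> 0 < rh k0 x"
  unfolding rho_def tens_def using \<epsilon> by (intro prod_pos) (simp add: bump_0)

definition I0 :: real where "I0 = (LINT z|lborel. rh k0 z)"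

lemma integrable_rh: "integrable lborel (\<lambda>z. rh \<kappa> (x - z))"
  using conv_integrable[OF bb_const[of 1]] by simp

lemma integral_rh0: "(LINT z|lborel. rh k0 (x - z)) = I0"
  unfolding I0_def by (rule lint_reflect) measurable

lemma I0_pos: "0 < I0"
proof -
  have int: "integrable lborel (\<lambda>z. rh k0 (0 - z))" by (rule integrable_rh)
  have "I0 \<noteq> 0"
  proof
    assume "I0 = 0"
    then have "AE z in lborel. rh k0 (0 - z) = 0"
      using integral_nonneg_eq_0_iff_AE[OF int] rh0_nonneg integral_rh0[of 0] by simp
    then have "AE z in lborel. z \<notin> box (- (\<chi> i. \<epsilon>)) ((\<chi> i. \<epsilon>) :: real^'n)"
    proof (rule AE_mp, intro AE_I2 impI notI)
      fix z :: "real^'n" assume "rh k0 (0 - z) = 0" "z \<in> box (- (\<chi> i. \<epsilon>)) (\<chi> i. \<epsilon>)"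
      moreover from this have "\<bar>(0 - z)$i\<bar> < \<epsilon>" for i
        by (auto simp: mem_box_cart abs_less_iff minus_less_iff)
      ultimately show False using rh0_pos[of "0 - z"] by simp
    qed
    then have "emeasure lborel (box (- (\<chi> i. \<epsilon>)) ((\<chi> i. \<epsilon>) :: real^'n)) = 0"
      by (subst (asm) AE_iff_measurable[OF _ refl]) auto
    moreover have "emeasure lborel (box (- (\<chi> i. \<epsilon>)) ((\<chi> i. \<epsilon>) :: real^'n)) \<noteq> 0"
    proof -
      have "emeasure lborel (box a b) \<noteq> 0" if "\<And>i. a$i < b$i" for a b :: "real^'n"
        using that by (subst emeasure_lborel_box)
          (auto simp: Basis_vec_def inner_axis inner_diff_left ennreal_eq_0_iff not_le less_imp_le intro!: prod_pos)
      then show ?thesis using \<epsilon> by simp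
    qed
    ultimately show False by simp
  qed
  moreover have "0 \<le> I0" unfolding integral_rh0[of 0, symmetric] using rh0_nonneg by simp
  ultimately show ?thesis by simp
qed

definition moll :: "(real^'n \<Rightarrow> real) \<Rightarrow> real^'n \<Rightarrow> real" where
  "moll g x = conv k0 g x / I0"

lemma moll_add:
  assumes "bounded_borel f" "bounded_borel g"
  shows "moll (\<lambda>z. f z + g z) x = moll f x + moll g x"
  unfolding moll_def conv_def distrib_right
  by (subst Bochner_Integration.integral_add) (auto intro: conv_integrable assms simp: add_divide_distrib)

lemma moll_cmult: "moll (\<lambda>z. a * g z) x = a * moll g x"
  unfolding moll_def conv_def mult.assoc by simp

lemma moll_const: "moll (\<lambda>z. a) x = a"
  unfolding moll_def conv_def using integral_rh0[of x] I0_pos by simp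

lemma moll_mono:
  assumes "bounded_borel f" "bounded_borel g" "\<And>z. z \<in> box1 x \<epsilon> \<Longrightarrow> f z \<le> g z"
  shows "moll f x \<le> moll g x"
  unfolding moll_def conv_def
proof (intro divide_right_mono integral_mono conv_integrable assms)
  fix z show "f z * rh k0 (x - z) \<le> g z * rh k0 (x - z)"
    using assms(3)[of z] rh0_nonneg[of "x - z"] rh_support[of k0 x z]
    by (cases "rh k0 (x - z) = 0") (auto intro: mult_right_mono)
qed (use I0_pos in simp)

lemma moll_bound:
  assumes "bounded_borel g" "\<And>z. \<bar>g z\<bar> \<le> G"
  shows "\<bar>moll g x\<bar> \<le> G"
proof -
  have "moll g x \<le> moll (\<lambda>_. G) x" "moll (\<lambda>_. - G) x \<le> moll g x"
    using assms by (auto intro!: moll_mono bb_const simp: abs_le_iff minus_le_iff)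
  then show ?thesis by (simp add: moll_const abs_le_iff)
qed

lemma moll_approx:
  assumes g: "bounded_borel g" and "\<And>z. z \<in> box1 x \<epsilon> \<Longrightarrow> \<bar>g z - g x\<bar> \<le> \<eta>"
  shows "\<bar>moll g x - g x\<bar> \<le> \<eta>"
proof -
  have "g z \<le> g x + \<eta>" "g x - \<eta> \<le> g z" if "z \<in> box1 x \<epsilon>" for z
    using assms(2)[OF that] by (auto simp: abs_le_iff)
  then have "moll g x \<le> moll (\<lambda>_. g x + \<eta>) x" "moll (\<lambda>_. g x - \<eta>) x \<le> moll g x"
    by (auto intro!: moll_mono bb_const g)
  then show ?thesis by (simp add: moll_const abs_le_iff)
qed

lemma moll_translate:
  assumes g: "bounded_borel g"
  shows "moll (\<lambda>z. g (z + y)) x = moll g (x + y)"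
proof -
  have [measurable]: "g \<in> borel_measurable borel" by (rule bb_borel[OF g])
  have "(LINT z|lborel. (\<lambda>z. g z * rh k0 (x + y - z)) (z + y)) = (LINT z|lborel. g z * rh k0 (x + y - z))"
    by (rule lint_translate) measurable
  then show ?thesis by (simp add: moll_def conv_def)
qed

lemma tinv_moll: "tinv moll 0 1"
proof (rule tinvI)
  show "moll (\<lambda>x. a * \<phi> x + b * \<psi> x) = (\<lambda>x. a * moll \<phi> x + b * moll \<psi> x)" if "smb \<phi>" "smb \<psi>" for a b \<phi> \<psi>
    using that by (simp add: fun_eq_iff moll_add moll_cmult bb_cmult bb_smb)
  show "moll (\<lambda>z. \<phi> (z + y)) = (\<lambda>z. moll \<phi> (z + y))" if "smb \<phi>" for \<phi> y
    using that by (simp add: fun_eq_iff moll_translate bb_smb)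
  show "\<bar>moll \<phi> x\<bar> \<le> 1 * B" if "smb \<phi>" "bd 0 B \<phi>" for \<phi> B x
    using that moll_bound[OF bb_smb, of \<phi> B x] by simp
qed simp

text \<open>Averaging over a box of size \<open>\<epsilon>\<close> changes a function by its
  oscillation there, at the price of one derivative. This is the origin of the order
  \<open>m - 1\<close> in the convergence of the data.\<close>

lemma tinv_moll_diff: "tinv (\<lambda>\<phi> x. moll \<phi> x - \<phi> x) 1 ((real CARD('n))\<^sup>2 * \<epsilon>)"
proof (rule tinv_improve)
  show "tinv (\<lambda>\<phi> x. moll \<phi> x - \<phi> x) 0 (1 + \<bar>- 1\<bar> * 1)"
    using tinv_plus[OF tinv_moll tinv_scale[OF tinv_id, of "- 1"]] by simp
  show "\<bar>moll \<phi> x - \<phi> x\<bar> \<le> (real CARD('n))\<^sup>2 * \<epsilon> * B" if s: "smb \<phi>" "bd 1 B \<phi>" for \<phi> B x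
  proof (rule moll_approx[OF bb_smb[OF s(1)]])
    fix z assume z: "z \<in> box1 x \<epsilon>"
    have B: "0 \<le> B" using s bd_nonneg by blast
    have "norm (z - x) \<le> (\<Sum>i\<in>UNIV. \<bar>(z - x)$i\<bar>)" by (rule norm_le_l1_cart)
    also have "\<dots> \<le> (\<Sum>i\<in>(UNIV::'n set). \<epsilon>)" using z by (intro sum_mono) (simp add: mem_box1)
    finally have n: "norm (z - x) \<le> real CARD('n) * \<epsilon>" by simp
    have "\<bar>\<phi> (x + (z - x)) - \<phi> x\<bar> \<le> real CARD('n) * norm (z - x) * B"
      by (rule increment_bound_smb[OF s])
    also have "\<dots> \<le> real CARD('n) * (real CARD('n) * \<epsilon>) * B"
      using n B by (intro mult_right_mono mult_left_mono) auto
    finally show "\<bar>\<phi> z - \<phi> x\<bar> \<le> (real CARD('n))\<^sup>2 * \<epsilon> * B" by (simp add: power2_eq_square mult_ac)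
  qed
qed (use \<epsilon> in simp)

lemma smb_moll: "bounded_borel g \<Longrightarrow> smb (moll g)"
  unfolding moll_def[abs_def] by (intro smb_divide smb_conv)

lemma foldr_partial_moll:
  assumes g: "bounded_borel g"
  shows "foldr partial is (moll g) = (\<lambda>x. conv (count_list is) g x / I0)"
proof -
  have "foldr partial is (\<lambda>x. \<psi> x / I0) = (\<lambda>x. foldr partial is \<psi> x / I0)" if "smb \<psi>" for \<psi>
    using that by (induction "is") (simp_all add: partial_divide_smb smb_foldr)
  then show ?thesis
    unfolding moll_def[abs_def] using smb_conv[OF g] foldr_partial_conv[OF g, of "is" k0] by simp
qed

text \<open>All derivatives fall on the kernel, so the supremum of \<open>g\<close> suffices. The
  constant depends on \<open>\<epsilon>\<close>, which the application in \<open>moll_Ds\<close>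
  keeps fixed.\<close>

lemma moll_bd_ex: "\<exists>C. \<forall>g G. bounded_borel g \<and> (\<forall>z. \<bar>g z\<bar> \<le> G) \<longrightarrow> bd n (C * G) (moll g)"
proof -
  define C where "C = (\<Sum>is\<in>{is :: 'n list. length is \<le> n}. rb (count_list is) * vol / I0)"
  have fin: "finite {is :: 'n list. length is \<le> n}"
    using finite_lists_length_le[of "UNIV :: 'n set" n] by simp
  have rb0: "0 \<le> rb \<kappa>" for \<kappa> using rb abs_ge_zero order_trans by blast
  have vol0: "0 \<le> vol" by (simp add: vol_def)
  have "bd n (C * G) (moll g)" if g: "bounded_borel g" "\<And>z. \<bar>g z\<bar> \<le> G" for g G
  proof (rule bd_foldrI)
    fix "is" :: "'n list" and x assume l: "length is \<le> n"
    have G: "0 \<le> G" using g(2) abs_ge_zero order_trans by blast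
    have "\<bar>foldr partial is (moll g) x\<bar> \<le> G * rb (count_list is) * vol / I0"
      unfolding foldr_partial_moll[OF g(1)] using conv_bound[OF g, of "count_list is" x] I0_pos
      by (simp add: divide_right_mono)
    also have "\<dots> = (rb (count_list is) * vol / I0) * G" by simp
    also have "\<dots> \<le> C * G"
      unfolding C_def using l fin rb0 vol0 I0_pos G
      by (intro mult_right_mono member_le_sum) auto
    finally show "\<bar>foldr partial is (moll g) x\<bar> \<le> C * G" .
  qed
  then show ?thesis by blast
qed

lemma conv_lim:
  assumes g: "\<And>j. bounded_borel (g j)" "\<And>j z. \<bar>g j z\<bar> \<le> G" and lim: "\<And>z. (\<lambda>j. g j z) \<longlonglongrightarrow> g' z"
  shows "(\<lambda>j. conv \<kappa> (g j) x) \<longlonglongrightarrow> conv \<kappa> g' x"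
  unfolding conv_def
proof (rule integral_dominated_convergence[where w = "\<lambda>z. (G * rb \<kappa>) * indicator (box1 x \<epsilon>) z"])
  have [measurable]: "g j \<in> borel_measurable borel" for j by (rule bb_borel[OF g(1)])
  have [measurable]: "g' \<in> borel_measurable borel"
    by (rule borel_measurable_LIMSEQ_real[OF lim]) simp
  show "(\<lambda>z. g' z * rh \<kappa> (x - z)) \<in> borel_measurable lborel" by measurable
  show "(\<lambda>z. g j z * rh \<kappa> (x - z)) \<in> borel_measurable lborel" for j by measurable
  show "integrable lborel (\<lambda>z. (G * rb \<kappa>) * indicator (box1 x \<epsilon>) z)" by (intro integrable_mult_right integrable_box1)
  show "AE z in lborel. (\<lambda>j. g j z * rh \<kappa> (x - z)) \<longlonglongrightarrow> g' z * rh \<kappa> (x - z)"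
    by (intro AE_I2 tendsto_intros lim)
  show "AE z in lborel. norm (g j z * rh \<kappa> (x - z)) \<le> (G * rb \<kappa>) * indicator (box1 x \<epsilon>) z" for j
  proof (rule AE_I2)
    fix z
    have "0 \<le> G" "0 \<le> rb \<kappa>" using g(2) rb abs_ge_zero order_trans by blast+
    then show "norm (g j z * rh \<kappa> (x - z)) \<le> (G * rb \<kappa>) * indicator (box1 x \<epsilon>) z"
      using g(2)[of j z] rb[of \<kappa> "x - z"] rh_support[of \<kappa> x z]
      by (cases "rh \<kappa> (x - z) = 0") (auto simp: abs_mult intro: mult_mono)
  qed
qed

lemma moll_lim:
  assumes "\<And>j. bounded_borel (g j)" "\<And>j z. \<bar>g j z\<bar> \<le> G" "\<And>z. (\<lambda>j. g j z) \<longlonglongrightarrow> g' z"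
  shows "(\<lambda>j. moll (g j) x) \<longlonglongrightarrow> moll g' x"
  unfolding moll_def using I0_pos by (intro tendsto_intros conv_lim[where G = G] assms) auto

text \<open>As a function of \<open>z\<close> the reflected kernel is again a tensor product, of the
  reflected profiles; each derivative contributes the inner derivative \<open>-1\<close>.\<close>

lemma test_function:
  "smooth (\<lambda>z. rh k0 (x - z))" "compact (closure {z. rh k0 (x - z) \<noteq> 0})"
  "mi_deriv \<alpha> (\<lambda>z. rh k0 (x - z)) z = (-1) ^ mi_order \<alpha> * rh \<alpha> (x - z)"
proof -
  define b where "b = (\<lambda>(i::'n) k t. (-1) ^ k * (bump k ((x$i - t) / \<epsilon>) / \<epsilon> ^ k))"
  \<comment> \<open>The profiles are centred at the coordinates of \<open>x\<close>, so the radius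
    has to include \<open>norm x\<close>.\<close>
  have ch: "chain (norm x + \<epsilon>) b"
    unfolding chain_def
  proof (intro conjI allI impI)
    fix i k t
    have "((\<lambda>t. bump k ((x$i - t) / \<epsilon>)) has_real_derivative bump (Suc k) ((x$i - t) / \<epsilon>) * (- (1 / \<epsilon>))) (at t)"
      by (rule DERIV_chain2[OF bump_has_derivative]) (use \<epsilon> in \<open>auto intro!: derivative_eq_intros\<close>)
    from DERIV_cmult[OF DERIV_cdivide[OF this, of "\<epsilon> ^ k"], of "(-1) ^ k"]
    show "(b i k has_real_derivative b i (Suc k) t) (at t)"
      unfolding b_def using \<epsilon> by (simp add: field_simps)
    assume "norm x + \<epsilon> \<le> \<bar>t\<bar>"
    moreover have "\<bar>x$i\<bar> \<le> norm x" by (rule component_le_norm_cart)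
    ultimately have "\<epsilon> \<le> \<bar>x$i - t\<bar>" by linarith
    then show "b i k t = 0" using \<epsilon> bump_support[of "(x$i - t) / \<epsilon>"] by (simp add: b_def field_simps)
  qed
  have tens: "tens b \<kappa> z = (-1) ^ (\<Sum>i\<in>UNIV. \<kappa> i) * rh \<kappa> (x - z)" for \<kappa> z
    by (simp add: tens_def b_def rho_def power_sum flip: prod.distrib)
  have eta: "(\<lambda>z. rh k0 (x - z)) = tens b k0" by (simp add: fun_eq_iff tens)
  show "smooth (\<lambda>z. rh k0 (x - z))" unfolding eta by (intro smb_smooth smb_tens[OF ch])
  have "{z. rh k0 (x - z) \<noteq> 0} = {z. tens b k0 z \<noteq> 0}" using eta by metis
  then show "compact (closure {z. rh k0 (x - z) \<noteq> 0})" using compact_support_tens[OF ch] by simp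
  show "mi_deriv \<alpha> (\<lambda>z. rh k0 (x - z)) z = (-1) ^ mi_order \<alpha> * rh \<alpha> (x - z)"
    unfolding eta mi_deriv_foldr foldr_partial_tens[OF ch] by (simp add: count_mi_list tens mi_order_def)
qed

lemma weak_integrable:
  assumes w: "is_weak_deriv \<alpha> g w"
  shows "integrable lborel (\<lambda>z. w z * rh k0 (x - z))"
proof (rule Bochner_Integration.integrable_bound)
  have [measurable]: "w \<in> borel_measurable borel" using w by (simp add: is_weak_deriv_def)
  have "set_integrable lborel (box1 x \<epsilon>) w" using w by (simp add: is_weak_deriv_def box1_def)
  then show "integrable lborel (\<lambda>z. rb k0 * (indicator (box1 x \<epsilon>) z *\<^sub>R w z))"
    unfolding set_integrable_def by (rule integrable_mult_right)
  show "(\<lambda>z. w z * rh k0 (x - z)) \<in> borel_measurable lborel" by measurable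
  show "AE z in lborel. norm (w z * rh k0 (x - z)) \<le> norm (rb k0 * (indicator (box1 x \<epsilon>) z *\<^sub>R w z))"
  proof (rule AE_I2)
    fix z
    have "0 \<le> rb k0" using rb abs_ge_zero order_trans by blast
    then show "norm (w z * rh k0 (x - z)) \<le> norm (rb k0 * (indicator (box1 x \<epsilon>) z *\<^sub>R w z))"
      using rb[of k0 "x - z"] rh_support[of k0 x z]
      by (cases "rh k0 (x - z) = 0") (auto simp: abs_mult mult.commute[of _ "\<bar>w z\<bar>"] intro: mult_left_mono)
  qed
qed

text \<open>The kernel is an admissible test function, and the sign of its derivative cancels the
  one in the definition of a weak derivative.\<close>

lemma moll_weak:
  assumes g: "bounded_borel g" and w: "is_weak_deriv (count_list is) g w"
  shows "foldr partial is (moll g) x = (LINT z|lborel. w z * rh k0 (x - z)) / I0"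
proof -
  let ?\<alpha> = "count_list is"
  have "(LINT z|lborel. g z * mi_deriv ?\<alpha> (\<lambda>z. rh k0 (x - z)) z) =
      (-1) ^ mi_order ?\<alpha> * (LINT z|lborel. w z * rh k0 (x - z))"
    using w test_function(1,2)[of x] unfolding is_weak_deriv_def by blast
  moreover have "(LINT z|lborel. g z * mi_deriv ?\<alpha> (\<lambda>z. rh k0 (x - z)) z) = (-1) ^ mi_order ?\<alpha> * conv ?\<alpha> g x"
    unfolding test_function(3) conv_def integral_mult_right_zero[symmetric]
    by (simp only: mult.left_commute)
  ultimately have "conv ?\<alpha> g x = (LINT z|lborel. w z * rh k0 (x - z))" by simp
  then show ?thesis unfolding foldr_partial_moll[OF g] by simp
qed

lemma weighted_AE_bound:
  assumes "AE z in lborel. \<bar>w z\<bar> \<le> C" "integrable lborel (\<lambda>z. w z * rh k0 (x - z))"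
  shows "\<bar>(LINT z|lborel. w z * rh k0 (x - z)) / I0\<bar> \<le> C"
proof -
  have "\<bar>LINT z|lborel. w z * rh k0 (x - z)\<bar> \<le> (LINT z|lborel. \<bar>w z * rh k0 (x - z)\<bar>)"
    by (rule integral_abs_bound)
  also have "\<dots> \<le> (LINT z|lborel. C * rh k0 (x - z))"
  proof (rule integral_mono_AE)
    show "integrable lborel (\<lambda>z. \<bar>w z * rh k0 (x - z)\<bar>)" using assms(2) by (rule integrable_abs)
    show "integrable lborel (\<lambda>z. C * rh k0 (x - z))" by (intro integrable_mult_right integrable_rh)
    show "AE z in lborel. \<bar>w z * rh k0 (x - z)\<bar> \<le> C * rh k0 (x - z)"
      using assms(1)
    proof eventually_elim
      case (elim z)
      then show ?case using rh0_nonneg[of "x - z"] by (simp add: abs_mult mult_right_mono)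
    qed
  qed
  also have "\<dots> = C * I0" by (simp add: integral_rh0)
  finally show ?thesis using I0_pos by (simp add: field_simps)
qed

end

section \<open>Generalized derivatives\<close>

text \<open>The indicator of a box is a bounded pointwise limit of test functions: shrink the box by
  \<open>eps j\<close> and mollify with radius \<open>eps j\<close>, so that the support stays
  inside.\<close>

lemma integral_box_zero:
  fixes D :: "real^'n::finite \<Rightarrow> real"
  assumes D: "D \<in> borel_measurable borel" "\<And>C. compact C \<Longrightarrow> set_integrable lborel C D"
    and test: "\<And>\<eta>. smooth \<eta> \<Longrightarrow> compact (closure {x. \<eta> x \<noteq> 0}) \<Longrightarrow> (LINT x|lborel. D x * \<eta> x) = 0"
  shows "(LINT x|lborel. D x * indicator (box a b) x) = 0"
proof -
  define eps where "eps j = 1 / real (Suc j)" for j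
  have eps: "0 < eps j" for j by (simp add: eps_def)
  define g where "g j = (indicator (box (a + (\<chi> i. eps j)) (b - (\<chi> i. eps j))) :: real^'n \<Rightarrow> real)" for j
  have g: "bounded_borel (g j)" for j
    unfolding g_def by (rule bbI[where G = 1]) (auto simp: indicator_def)
  define F where "F j = mollifier.moll (eps j) (g j)" for j
  have mol: "mollifier (eps j)" for j by (simp add: mollifier_def eps)
  have sF: "smb (F j)" for j unfolding F_def by (rule mollifier.smb_moll[OF mol g])
  have bF: "\<bar>F j x\<bar> \<le> 1" for j x
    unfolding F_def by (rule mollifier.moll_bound[OF mol g]) (simp add: g_def indicator_def)
  have F0: "F j x = 0" if x: "x \<notin> box a b" for j x
  proof -
    have "g j z = 0" if z: "z \<in> box1 x (eps j)" for z
    proof (rule ccontr)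
      assume "g j z \<noteq> 0"
      then have "z \<in> box (a + (\<chi> i. eps j)) (b - (\<chi> i. eps j))" by (simp add: g_def indicator_def split: if_splits)
      then have "a$i < x$i \<and> x$i < b$i" for i
        using z by (auto simp: mem_box_cart mem_box1 abs_le_iff dest!: spec[of _ i])
      then show False using x by (simp add: mem_box_cart)
    qed
    moreover have "g j x = 0"
      using calculation[of x] eps[of j] by (simp add: mem_box1 less_imp_le)
    ultimately have "\<bar>F j x - g j x\<bar> \<le> 0"
      unfolding F_def by (intro mollifier.moll_approx[OF mol g]) simp
    then show ?thesis using \<open>g j x = 0\<close> by simp
  qed
  have lim0: "eps \<longlonglongrightarrow> 0"
    unfolding eps_def using LIMSEQ_Suc[OF lim_1_over_n] by simp
  have F1: "\<forall>\<^sub>F j in sequentially. F j x = 1" if x: "x \<in> box a b" for x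
  proof -
    have "\<forall>\<^sub>F j in sequentially. 2 * eps j < min (x$i - a$i) (b$i - x$i)" for i
    proof -
      \<comment> \<open>One \<open>eps j\<close> pays for the shrinking and one for the
        radius.\<close>
      have l: "(\<lambda>j. 2 * eps j) \<longlonglongrightarrow> 0" using tendsto_mult[OF tendsto_const[of 2] lim0] by simp
      have "0 < min (x$i - a$i) (b$i - x$i)" using x by (simp add: mem_box_cart)
      then show ?thesis by (rule order_tendstoD(2)[OF l])
    qed
    then have "\<forall>\<^sub>F j in sequentially. \<forall>i. 2 * eps j < min (x$i - a$i) (b$i - x$i)"
      by (intro eventually_all_finite)
    then show ?thesis
    proof eventually_elim
      case (elim j)
      have "g j z = 1" if z: "z \<in> box1 x (eps j)" for z
      proof -
        have "a$i + eps j < z$i \<and> z$i < b$i - eps j" for i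
          using z elim[rule_format, of i] by (auto simp: mem_box1 abs_le_iff dest!: spec[of _ i])
        then show ?thesis by (simp add: g_def mem_box_cart)
      qed
      moreover have "g j x = 1"
        using calculation[of x] eps[of j] by (simp add: mem_box1 less_imp_le)
      ultimately have "\<bar>F j x - g j x\<bar> \<le> 0"
        unfolding F_def by (intro mollifier.moll_approx[OF mol g]) simp
      then show ?case using \<open>g j x = 1\<close> by simp
    qed
  qed
  have "(\<lambda>j. LINT x|lborel. D x * F j x) \<longlonglongrightarrow> (LINT x|lborel. D x * indicator (box a b) x)"
  proof (rule integral_dominated_convergence[where w = "\<lambda>x. \<bar>indicator (cbox a b) x *\<^sub>R D x\<bar>"])
    have [measurable]: "D \<in> borel_measurable borel" "F j \<in> borel_measurable borel" for j
      using D smb_borel[OF sF] by auto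
    show "(\<lambda>x. D x * indicator (box a b) x) \<in> borel_measurable lborel"
      "(\<lambda>x. D x * F j x) \<in> borel_measurable lborel" for j by measurable
    show "integrable lborel (\<lambda>x. \<bar>indicator (cbox a b) x *\<^sub>R D x\<bar>)"
      using D(2)[of "cbox a b"] unfolding set_integrable_def by (auto intro: integrable_abs)
    show "AE x in lborel. (\<lambda>j. D x * F j x) \<longlonglongrightarrow> D x * indicator (box a b) x"
    proof (rule AE_I2)
      fix x
      have "(\<lambda>j. F j x) \<longlonglongrightarrow> indicator (box a b) x"
        by (cases "x \<in> box a b") (use F1 F0 in \<open>auto intro: tendsto_eventually\<close>)
      then show "(\<lambda>j. D x * F j x) \<longlonglongrightarrow> D x * indicator (box a b) x" by (intro tendsto_intros)
    qed
    show "AE x in lborel. norm (D x * F j x) \<le> \<bar>indicator (cbox a b) x *\<^sub>R D x\<bar>" for j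
    proof (rule AE_I2)
      fix x
      show "norm (D x * F j x) \<le> \<bar>indicator (cbox a b) x *\<^sub>R D x\<bar>"
      proof (cases "x \<in> box a b")
        case True
        then have "x \<in> cbox a b" using box_subset_cbox by blast
        then show ?thesis using mult_left_mono[OF bF[of j x], of "\<bar>D x\<bar>"] by (simp add: abs_mult)
      qed (simp add: F0)
    qed
  qed
  moreover have "(LINT x|lborel. D x * F j x) = 0" for j
  proof (rule test)
    show "smooth (F j)" by (rule smb_smooth[OF sF])
    have "{x. F j x \<noteq> 0} \<subseteq> box a b" using F0 by blast
    then have "bounded {x. F j x \<noteq> 0}" using bounded_box bounded_subset by blast
    then show "compact (closure {x. F j x \<noteq> 0})" by (simp add: compact_closure)
  qed
  ultimately have "(\<lambda>j. 0) \<longlonglongrightarrow> (LINT x|lborel. D x * indicator (box a b) x)" by simp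
  then show ?thesis using LIMSEQ_unique tendsto_const by blast
qed

text \<open>Boxes are an intersection stable generator of the Borel sets, so vanishing integrals
  extend from boxes to all Borel sets. Cutting off with the boxes \<open>?B n\<close> makes
  \<open>D\<close> integrable and maps boxes to boxes.\<close>

lemma AE_zero_of_boxes:
  fixes D :: "real^'n::finite \<Rightarrow> real"
  assumes D: "D \<in> borel_measurable borel" "\<And>C. compact C \<Longrightarrow> set_integrable lborel C D"
    and boxes: "\<And>a b. (LINT x|lborel. D x * indicator (box a b) x) = 0"
  shows "AE x in lborel. D x = 0"
proof -
  let ?B = "\<lambda>n::nat. box (- (\<chi> i. real n)) ((\<chi> i. real n) :: real^'n)"
  have [measurable]: "D \<in> borel_measurable borel" by fact
  have "AE x in lborel. D x * indicator (?B n) x = 0" for n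
  proof (rule sigma_finite_measure.density_zero[OF sigma_finite_lborel])
    let ?f = "\<lambda>x. D x * indicator (?B n) x"
    have "set_integrable lborel (cbox (- (\<chi> i. real n)) (\<chi> i. real n)) D" by (rule D(2)) simp
    then have "set_integrable lborel (?B n) D"
      by (rule set_integrable_subset) (simp, rule box_subset_cbox)
    then show int: "integrable lborel ?f" unfolding set_integrable_def by (simp add: mult.commute)
    have tot: "(LINT x|lborel. ?f x) = 0" by (rule boxes)
    have si: "set_integrable lborel A ?f" if "A \<in> sets lborel" for A
      using integrable_mult_indicator[OF that int] by (simp add: set_integrable_def)
    fix A :: "(real^'n) set" assume "A \<in> sets lborel"
    then have A: "A \<in> sigma_sets UNIV (range (\<lambda>(a, b). box a b))" by (simp add: borel_eq_box)
    have stable: "Int_stable (range (\<lambda>(a, b). box a b :: (real^'n) set))"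
      by (auto simp: Int_stable_def box_Int_box)
    have "A \<in> sets borel \<and> set_lebesgue_integral lborel A ?f = 0"
      using stable subset_UNIV[of "range (\<lambda>(a, b). box a b)", unfolded Pow_UNIV[symmetric]] A
    proof (induction rule: sigma_sets_induct_disjoint)
      case (basic A)
      then obtain a b where A: "A = box a b" by auto
      obtain a' b' where "box a b \<inter> ?B n = box a' b'" using box_Int_box[of a b] by blast
      then have "indicator (box a b) x * indicator (?B n) x = (indicator (box a' b') x :: real)" for x
        by (metis indicator_inter_arith)
      then have "indicator (box a b) x *\<^sub>R ?f x = D x * indicator (box a' b') x" for x
        by (metis mult.left_commute real_scaleR_def)
      then have fe: "(\<lambda>x. indicator (box a b) x *\<^sub>R ?f x) = (\<lambda>x. D x * indicator (box a' b') x)" by (rule ext)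
      show ?case
        unfolding A set_lebesgue_integral_def fe boxes[of a' b'] by simp
    next
      case empty then show ?case by (simp add: set_lebesgue_integral_def)
    next
      case (compl A)
      have "A \<in> sets borel" using compl by blast
      then have "set_lebesgue_integral lborel (UNIV - A \<union> A) ?f =
          set_lebesgue_integral lborel (UNIV - A) ?f + set_lebesgue_integral lborel A ?f"
        by (intro set_integral_Un si) auto
      then have "set_lebesgue_integral lborel (UNIV - A) ?f + set_lebesgue_integral lborel A ?f = set_lebesgue_integral lborel UNIV ?f"
        by (simp only: Un_Diff_cancel2 Un_UNIV_left)
      moreover have "set_lebesgue_integral lborel UNIV ?f = 0" using tot by (simp add: set_lebesgue_integral_def)
      ultimately show ?case using \<open>A \<in> sets borel\<close> compl by (simp add: borel_comp Compl_eq_Diff_UNIV[symmetric])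
    next
      case (union A)
      have "set_lebesgue_integral lborel (\<Union>i. A i) ?f = (\<Sum>i. set_lebesgue_integral lborel (A i) ?f)"
        using union by (intro lebesgue_integral_countable_add si) (auto simp: disjoint_family_on_def)
      then show ?case using union by auto
    qed
    then show "set_lebesgue_integral lborel A ?f = 0" by blast
  qed
  then have "AE x in lborel. \<forall>n. D x * indicator (?B n) x = 0" unfolding AE_all_countable by blast
  then show ?thesis
  proof eventually_elim
    case (elim x)
    obtain n :: nat where n: "norm x < real n" using reals_Archimedean2 by blast
    have "x \<in> ?B n"
    proof -
      have "\<bar>x$i\<bar> < real n" for i using component_le_norm_cart[of x i] n by linarith
      then show ?thesis by (auto simp: mem_box_cart abs_less_iff minus_less_iff)
    qed
    then show ?case using elim[rule_format, of n] by simp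
  qed
qed

lemma smb_test:
  assumes "smooth \<eta>" "compact (closure {x. \<eta> x \<noteq> 0})" and w: "w \<in> borel_measurable borel" "\<And>C. compact C \<Longrightarrow> set_integrable lborel C w"
  shows "integrable lborel (\<lambda>x. w x * \<eta> x)"
proof -
  let ?C = "closure {x. \<eta> x \<noteq> 0}"
  have cont: "continuous_on UNIV \<eta>"
  proof -
    have "Ck 0 \<eta>" using assms(1) by (simp add: smooth_def)
    then have "\<forall>is. length is \<le> 0 \<longrightarrow> continuous_on UNIV (foldr partial is \<eta>)"
      unfolding Ck_def by (rule conjunct2)
    from this[rule_format, of "[]"] show ?thesis by simp
  qed
  then have [measurable]: "\<eta> \<in> borel_measurable borel" by (rule borel_measurable_continuous_onI)
  have [measurable]: "w \<in> borel_measurable borel" by fact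
  have "bounded (\<eta> ` ?C)"
    using assms(2) cont by (intro compact_imp_bounded compact_continuous_image) (auto intro: continuous_on_subset)
  then obtain G where G: "\<And>x. x \<in> ?C \<Longrightarrow> \<bar>\<eta> x\<bar> \<le> G" by (auto simp: bounded_iff)
  show ?thesis
  proof (rule Bochner_Integration.integrable_bound)
    show "integrable lborel (\<lambda>x. G * (indicator ?C x *\<^sub>R w x))"
      using w(2)[OF assms(2)] unfolding set_integrable_def by (rule integrable_mult_right)
    show "(\<lambda>x. w x * \<eta> x) \<in> borel_measurable lborel" by measurable
    show "AE x in lborel. norm (w x * \<eta> x) \<le> norm (G * (indicator ?C x *\<^sub>R w x))"
    proof (rule AE_I2)
      fix x
      show "norm (w x * \<eta> x) \<le> norm (G * (indicator ?C x *\<^sub>R w x))"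
      proof (cases "\<eta> x = 0")
        case False
        then have "x \<in> ?C" by (intro subsetD[OF closure_subset]) simp
        moreover have "\<bar>w x\<bar> * \<bar>\<eta> x\<bar> \<le> \<bar>w x\<bar> * \<bar>G\<bar>"
          using G[OF \<open>x \<in> ?C\<close>] by (intro mult_left_mono) auto
        ultimately show ?thesis by (simp add: abs_mult mult.commute)
      qed simp
    qed
  qed
qed

text \<open>The representative chosen by \<open>weak_deriv\<close> and the bounded one provided by
  \<open>in_B\<close> may differ; uniqueness transfers bounds from one to the other almost
  everywhere.\<close>

lemma weak_deriv_unique:
  fixes g1 g2 :: "real^'n::finite \<Rightarrow> real"
  assumes "is_weak_deriv \<alpha> \<psi> g1" "is_weak_deriv \<alpha> \<psi> g2"
  shows "AE x in lborel. g1 x = g2 x"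
proof -
  have g: "g1 \<in> borel_measurable borel" "g2 \<in> borel_measurable borel"
     "\<And>C. compact C \<Longrightarrow> set_integrable lborel C g1" "\<And>C. compact C \<Longrightarrow> set_integrable lborel C g2"
    using assms by (auto simp: is_weak_deriv_def)
  have D: "(\<lambda>x. g1 x - g2 x) \<in> borel_measurable borel" "\<And>C. compact C \<Longrightarrow> set_integrable lborel C (\<lambda>x. g1 x - g2 x)"
    using g by (auto intro: set_integral_diff(1))
  have test: "(LINT x|lborel. (g1 x - g2 x) * \<eta> x) = 0"
    if \<eta>: "smooth \<eta>" "compact (closure {x. \<eta> x \<noteq> 0})" for \<eta>
  proof -
    have "(-1) ^ mi_order \<alpha> * (LINT x|lborel. g1 x * \<eta> x) = (-1) ^ mi_order \<alpha> * (LINT x|lborel. g2 x * \<eta> x)"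
    proof -
      have "(LINT x|lborel. \<psi> x * mi_deriv \<alpha> \<eta> x) = (-1) ^ mi_order \<alpha> * (LINT x|lborel. g x * \<eta> x)"
        if "is_weak_deriv \<alpha> \<psi> g" for g
        using that \<eta> unfolding is_weak_deriv_def by blast
      from this[OF assms(1)] this[OF assms(2)] show ?thesis by (rule subst)
    qed
    then have "(LINT x|lborel. g1 x * \<eta> x) = (LINT x|lborel. g2 x * \<eta> x)" by simp
    then show "(LINT x|lborel. (g1 x - g2 x) * \<eta> x) = 0"
      unfolding left_diff_distrib
      by (subst Bochner_Integration.integral_diff) (auto intro: smb_test[OF \<eta>] g)
  qed
  have "AE x in lborel. g1 x - g2 x = 0"
    by (rule AE_zero_of_boxes[OF D integral_box_zero[OF D test]])
  then show ?thesis by simp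
qed

lemma in_B_weak_deriv:
  assumes "in_B m \<psi>" "mi_order \<alpha> \<le> m"
  shows "is_weak_deriv \<alpha> \<psi> (weak_deriv \<alpha> \<psi>)"
proof -
  obtain g where "is_weak_deriv \<alpha> \<psi> g" using assms unfolding in_B_def by blast
  then show ?thesis unfolding weak_deriv_def by (rule someI[where P = "is_weak_deriv \<alpha> \<psi>"])
qed

lemma in_B_bounded_borel: "in_B m \<psi> \<Longrightarrow> bounded_borel \<psi>"
  by (simp add: in_B_def bounded_borel_def borel_measurable_continuous_onI)

lemma weak_deriv_borel: "in_B m \<psi> \<Longrightarrow> mi_order \<alpha> \<le> m \<Longrightarrow> weak_deriv \<alpha> \<psi> \<in> borel_measurable borel"
  using in_B_weak_deriv unfolding is_weak_deriv_def by blast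

text \<open>\<open>real_of_ereal\<close> is informative only for a finite argument. Finiteness comes
  from the bounded representatives, and nonnegativity from the fact that Lebesgue measure is not
  zero.\<close>

lemma B_norm_AE:
  fixes f :: "real^'n::finite \<Rightarrow> real"
  assumes f: "in_B m f"
  shows "0 \<le> B_norm m f"
    "AE x in lborel. (\<Sum>\<alpha> | mi_order \<alpha> \<le> m. (weak_deriv \<alpha> f x)\<^sup>2) \<le> (B_norm m f)\<^sup>2"
proof -
  let ?S = "\<lambda>x. \<Sum>\<alpha> | mi_order \<alpha> \<le> m. (weak_deriv \<alpha> f x)\<^sup>2"
  let ?E = "esssup lborel (\<lambda>x. ereal (?S x))"
  have meas: "(\<lambda>x. ereal (?S x)) \<in> borel_measurable lborel"
    using weak_deriv_borel[OF f] by (auto intro!: borel_measurable_ereal borel_measurable_sum borel_measurable_power)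
  have "\<forall>\<alpha>. \<exists>G. mi_order \<alpha> \<le> m \<longrightarrow> (AE x in lborel. \<bar>weak_deriv \<alpha> f x\<bar> \<le> G)"
  proof
    fix \<alpha> :: "'n \<Rightarrow> nat"
    show "\<exists>G. mi_order \<alpha> \<le> m \<longrightarrow> (AE x in lborel. \<bar>weak_deriv \<alpha> f x\<bar> \<le> G)"
    proof (cases "mi_order \<alpha> \<le> m")
      case True
      then obtain g where g: "is_weak_deriv \<alpha> f g" "bounded (range g)" using f unfolding in_B_def by blast
      then obtain G where G: "\<And>x. \<bar>g x\<bar> \<le> G" by (auto simp: bounded_range_real)
      have "AE x in lborel. weak_deriv \<alpha> f x = g x"
        by (rule weak_deriv_unique[OF in_B_weak_deriv[OF f True] g(1)])
      then have "AE x in lborel. \<bar>weak_deriv \<alpha> f x\<bar> \<le> G" by eventually_elim (simp add: G)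
      then show ?thesis by blast
    qed simp
  qed
  then obtain G where G: "\<And>\<alpha>. mi_order \<alpha> \<le> m \<Longrightarrow> AE x in lborel. \<bar>weak_deriv \<alpha> f x\<bar> \<le> G \<alpha>" by metis
  have "AE x in lborel. \<forall>\<alpha>\<in>{\<alpha>. mi_order \<alpha> \<le> m}. \<bar>weak_deriv \<alpha> f x\<bar> \<le> G \<alpha>"
    by (rule AE_finite_allI[OF finite_mi_order]) (use G in auto)
  then have "AE x in lborel. ereal (?S x) \<le> ereal (\<Sum>\<alpha> | mi_order \<alpha> \<le> m. (G \<alpha>)\<^sup>2)"
  proof eventually_elim
    case (elim x)
    have "(weak_deriv \<alpha> f x)\<^sup>2 \<le> (G \<alpha>)\<^sup>2" if "mi_order \<alpha> \<le> m" for \<alpha>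
      using elim that abs_le_square_iff[of "weak_deriv \<alpha> f x" "G \<alpha>"] by fastforce
    then show ?case by (auto intro: sum_mono)
  qed
  then have fin: "?E \<le> ereal (\<Sum>\<alpha> | mi_order \<alpha> \<le> m. (G \<alpha>)\<^sup>2)" by (rule esssup_I[OF meas])
  have AE: "AE x in lborel. ereal (?S x) \<le> ?E" by (rule esssup_AE)
  have nonneg: "0 \<le> ?E"
  proof (rule ccontr)
    assume neg: "\<not> 0 \<le> ?E"
    from AE have "AE x in (lborel :: (real^'n) measure). False"
    proof eventually_elim
      case (elim x)
      have "0 \<le> ereal (?S x)" by (simp add: sum_nonneg)
      from order_trans[OF this elim] show ?case using neg by (rule notE[rotated])
    qed
    then have "emeasure (lborel :: (real^'n) measure) UNIV = 0"
      using ae_filter_eq_bot_iff[of "lborel :: (real^'n) measure"] by (simp add: trivial_limit_def)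
    then show False by simp
  qed
  define E where "E = real_of_ereal ?E"
  have E: "?E = ereal E" unfolding E_def using fin nonneg by (cases ?E) auto
  have E0: "0 \<le> E" using nonneg E by simp
  show "0 \<le> B_norm m f" unfolding B_norm_def using E0 E_def by simp
  have "(B_norm m f)\<^sup>2 = E" unfolding B_norm_def using E0 E_def by simp
  then show "AE x in lborel. ?S x \<le> (B_norm m f)\<^sup>2" using AE unfolding E by simp
qed

lemma mi_order_count_list: "mi_order (count_list is) = length is"
  by (simp add: mi_order_def length_count_list)

context mollifier
begin

lemma moll_bd_B_norm:
  fixes f :: "real^'n \<Rightarrow> real"
  assumes f: "in_B m f"
  shows "bd m (B_norm m f) (moll f)"
proof (rule bd_foldrI)
  fix "is" :: "'n list" and x assume l: "length is \<le> m"
  let ?w = "weak_deriv (count_list is) f"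
  have w: "is_weak_deriv (count_list is) f ?w"
    using l by (intro in_B_weak_deriv[OF f]) (simp add: mi_order_count_list)
  have "AE z in lborel. \<bar>?w z\<bar> \<le> B_norm m f"
    using B_norm_AE(2)[OF f]
  proof eventually_elim
    case (elim z)
    have "(?w z)\<^sup>2 \<le> (\<Sum>\<alpha> | mi_order \<alpha> \<le> m. (weak_deriv \<alpha> f z)\<^sup>2)"
      using l finite_mi_order by (intro member_le_sum) (auto simp: mi_order_count_list)
    then show ?case using elim B_norm_AE(1)[OF f] abs_le_square_iff[of "?w z" "B_norm m f"] by simp
  qed
  then show "\<bar>foldr partial is (moll f) x\<bar> \<le> B_norm m f"
    unfolding moll_weak[OF in_B_bounded_borel[OF f] w]
    by (rule weighted_AE_bound[OF _ weak_integrable[OF w]])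
qed

text \<open>Duality: for the values \<open>g l\<close> to be estimated, the sum of squares is the
  average of the combination of the weak derivatives with weights \<open>g l\<close>. By
  Cauchy-Schwarz that combination is at most \<open>L2_set g S * M\<close>, and one factor
  \<open>L2_set g S\<close> cancels. The constant does not see the number of functions.\<close>

lemma moll_sum_squares:
  assumes fin: "finite S" and r: "\<And>l. l \<in> S \<Longrightarrow> in_B m (r l)" and l: "length is \<le> m" and M: "0 \<le> M"
    and AE: "AE z in lborel. (\<Sum>l\<in>S. (weak_deriv (count_list is) (r l) z)\<^sup>2) \<le> M\<^sup>2"
  shows "(\<Sum>l\<in>S. (foldr partial is (moll (r l)) x)\<^sup>2) \<le> M\<^sup>2"
proof -
  let ?w = "\<lambda>l. weak_deriv (count_list is) (r l)"
  define g where "g l = foldr partial is (moll (r l)) x" for l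
  have w: "is_weak_deriv (count_list is) (r l) (?w l)" if "l \<in> S" for l
    using l that by (intro in_B_weak_deriv[OF r]) (simp_all add: mi_order_count_list)
  have int: "integrable lborel (\<lambda>z. ?w l z * rh k0 (x - z))" if "l \<in> S" for l
    by (rule weak_integrable[OF w[OF that]])
  have gl: "g l = (LINT z|lborel. ?w l z * rh k0 (x - z)) / I0" if "l \<in> S" for l
    unfolding g_def by (rule moll_weak[OF in_B_bounded_borel[OF r[OF that]] w[OF that]])
  let ?W = "\<lambda>z. \<Sum>l\<in>S. g l * ?w l z"
  have eq: "(\<lambda>z. ?W z * rh k0 (x - z)) = (\<lambda>z. \<Sum>l\<in>S. g l * (?w l z * rh k0 (x - z)))"
    by (simp add: sum_distrib_right mult.assoc)
  have intW: "integrable lborel (\<lambda>z. ?W z * rh k0 (x - z))"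
    unfolding eq by (intro Bochner_Integration.integrable_sum integrable_mult_right int)
  have "(\<Sum>l\<in>S. (g l)\<^sup>2) = (\<Sum>l\<in>S. g l * ((LINT z|lborel. ?w l z * rh k0 (x - z)) / I0))"
    by (intro sum.cong refl) (simp add: gl power2_eq_square)
  also have "\<dots> = (LINT z|lborel. ?W z * rh k0 (x - z)) / I0"
    unfolding eq using int by (subst Bochner_Integration.integral_sum) (auto simp: sum_divide_distrib intro: integrable_mult_right)
  finally have sq: "(\<Sum>l\<in>S. (g l)\<^sup>2) = (LINT z|lborel. ?W z * rh k0 (x - z)) / I0" .
  have "AE z in lborel. \<bar>?W z\<bar> \<le> L2_set g S * M"
    using AE
  proof eventually_elim
    case (elim z)
    have "\<bar>?W z\<bar> \<le> (\<Sum>l\<in>S. \<bar>g l\<bar> * \<bar>?w l z\<bar>)" unfolding abs_mult[symmetric] by (rule sum_abs)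
    also have "\<dots> \<le> L2_set g S * L2_set (\<lambda>l. ?w l z) S" by (rule L2_set_mult_ineq)
    also have "\<dots> \<le> L2_set g S * M"
      using elim M by (intro mult_left_mono) (auto simp: L2_set_def intro: real_le_lsqrt sum_nonneg)
    finally show ?case .
  qed
  from abs_le_D1[OF weighted_AE_bound[OF this intW]] have "(\<Sum>l\<in>S. (g l)\<^sup>2) \<le> L2_set g S * M" unfolding sq .
  moreover have "(\<Sum>l\<in>S. (g l)\<^sup>2) = L2_set g S * L2_set g S"
    unfolding L2_set_def by (simp add: sum_nonneg)
  ultimately have "L2_set g S * L2_set g S \<le> L2_set g S * M" by simp
  moreover have "0 \<le> L2_set g S" by simp
  ultimately have "L2_set g S \<le> M" using M by (metis mult_le_cancel_left_pos order_le_less)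
  then have "L2_set g S * L2_set g S \<le> M * M" using M by (intro mult_mono) auto
  then show ?thesis using \<open>(\<Sum>l\<in>S. (g l)\<^sup>2) = L2_set g S * L2_set g S\<close>
    by (simp add: g_def power2_eq_square)
qed

end

section \<open>Mollified coefficients\<close>

definition eps :: "nat \<Rightarrow> real" where "eps j = 1 / real (Suc j)"

definition mo :: "nat \<Rightarrow> (real^'n::finite \<Rightarrow> real) \<Rightarrow> real^'n \<Rightarrow> real" where
  "mo j = mollifier.moll (eps j)"

lemma eps_pos: "0 < eps j" by (simp add: eps_def)

lemma eps_lim: "eps \<longlonglongrightarrow> 0"
  unfolding eps_def using LIMSEQ_Suc[OF lim_1_over_n] by simp

lemma mollifier_eps: "mollifier (eps j)" by (simp add: mollifier_def eps_pos)

lemmas smb_mo = mollifier.smb_moll[OF mollifier_eps, folded mo_def]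
lemmas mo_bound = mollifier.moll_bound[OF mollifier_eps, folded mo_def]

lemma mo_lim:
  fixes g :: "real^'n::finite \<Rightarrow> real"
  assumes g: "bounded_borel g" "continuous_on UNIV g"
  shows "(\<lambda>j. mo j g x) \<longlonglongrightarrow> g x"
  unfolding LIMSEQ_iff real_norm_def
proof (intro allI impI)
  fix r :: real assume r: "0 < r"
  then obtain s where s: "0 < s" "\<And>z. dist z x < s \<Longrightarrow> dist (g z) (g x) < r / 2"
    using g(2) half_gt_zero[OF r] unfolding continuous_on_iff by (metis UNIV_I)
  have "(\<lambda>j. real CARD('n) * eps j) \<longlonglongrightarrow> 0"
    using tendsto_mult[OF tendsto_const[of "real CARD('n)"] eps_lim] by simp
  from order_tendstoD(2)[OF this s(1)] obtain N where N: "\<And>j. N \<le> j \<Longrightarrow> real CARD('n) * eps j < s"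
    unfolding eventually_sequentially by blast
  have "\<bar>mo j g x - g x\<bar> < r" if j: "N \<le> j" for j
  proof -
    have "\<bar>mo j g x - g x\<bar> \<le> r / 2"
      unfolding mo_def
    proof (rule mollifier.moll_approx[OF mollifier_eps g(1)])
      fix z assume z: "z \<in> box1 x (eps j)"
      have "norm (z - x) \<le> (\<Sum>i\<in>UNIV. \<bar>(z - x)$i\<bar>)" by (rule norm_le_l1_cart)
      also have "\<dots> \<le> (\<Sum>i\<in>(UNIV::'n set). eps j)" using z by (intro sum_mono) (simp add: mem_box1)
      also have "\<dots> < s" using N[OF j] by simp
      finally have "dist (g z) (g x) < r / 2" by (intro s(2)) (simp add: dist_norm)
      then show "\<bar>g z - g x\<bar> \<le> r / 2" by (simp add: dist_real_def)
    qed
    then show ?thesis using r by simp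
  qed
  then show "\<exists>N. \<forall>j\<ge>N. \<bar>mo j g x - g x\<bar> < r" by blast
qed

lemma foldr_partial_diff:
  "smb f \<Longrightarrow> smb g \<Longrightarrow> foldr partial is (\<lambda>x. f x - g x) = (\<lambda>x. foldr partial is f x - foldr partial is g x)"
  by (induction "is") (simp_all add: partial_diff_smb smb_foldr)

lemma foldr_moll_lim:
  fixes g :: "real^'n::finite \<Rightarrow> real"
  assumes mol: "mollifier \<epsilon>" and g: "bounded_borel g" "continuous_on UNIV g"
  shows "(\<lambda>j. foldr partial is (mollifier.moll \<epsilon> (mo j g)) x) \<longlonglongrightarrow> foldr partial is (mollifier.moll \<epsilon> g) x"
proof -
  obtain G where G: "\<And>z. \<bar>g z\<bar> \<le> G" using bb_bound[OF g(1)] by blast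
  have bb: "bounded_borel (mo j g)" for j by (intro bb_smb smb_mo g)
  have "0 < mollifier.I0 TYPE('n) \<epsilon>" by (rule mollifier.I0_pos[OF mol])
  then show ?thesis
    unfolding mollifier.foldr_partial_moll[OF mol bb] mollifier.foldr_partial_moll[OF mol g(1)]
    by (intro tendsto_intros mollifier.conv_lim[OF mol bb, where G = G] mo_bound g G mo_lim) simp
qed

text \<open>Mollifying twice reduces the comparison of two mollifications to smooth functions; no
  interchange of integrals is needed.\<close>

lemma moll_diff_bd:
  fixes g :: "real^'n::finite \<Rightarrow> real"
  assumes mol: "mollifier \<epsilon>" "mollifier \<epsilon>'" and g: "bounded_borel g" "continuous_on UNIV g"
    and B: "\<And>j. bd (Suc n) B (mo j g)"
  shows "bd n ((real CARD('n))\<^sup>2 * B * (\<epsilon> + \<epsilon>')) (\<lambda>x. mollifier.moll \<epsilon> g x - mollifier.moll \<epsilon>' g x)"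
proof (rule bd_foldrI)
  fix "is" :: "'n list" and x assume l: "length is \<le> n"
  let ?m = "mollifier.moll \<epsilon>" and ?m' = "mollifier.moll \<epsilon>'"
  have F: "smb (mo j g)" for j by (rule smb_mo[OF g(1)])
  have s: "smb (mollifier.moll \<epsilon> f)" if "mollifier \<epsilon>" "bounded_borel f" for f :: "real^'n \<Rightarrow> real" and \<epsilon>
    by (rule mollifier.smb_moll[OF that])
  have c: "\<bar>foldr partial is (mollifier.moll \<epsilon> (mo j g)) x - foldr partial is (mo j g) x\<bar> \<le> (real CARD('n))\<^sup>2 * \<epsilon> * B"
    if mol: "mollifier \<epsilon>" for \<epsilon> j
  proof -
    have "bd n ((real CARD('n))\<^sup>2 * \<epsilon> * B) (\<lambda>x. mollifier.moll \<epsilon> (mo j g) x - mo j g x)"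
      using B by (intro tinv_bd[OF mollifier.tinv_moll_diff[OF mol] F]) simp
    from bd_D0[OF bd_foldr[OF this l], of x] show ?thesis
      by (simp add: foldr_partial_diff s mol bb_smb F)
  qed
  have "\<bar>foldr partial is (?m (mo j g)) x - foldr partial is (?m' (mo j g)) x\<bar> \<le> (real CARD('n))\<^sup>2 * B * (\<epsilon> + \<epsilon>')" for j
    using c[OF mol(1), of j] c[OF mol(2), of j] by (simp add: abs_le_iff algebra_simps)
  moreover have "(\<lambda>j. \<bar>foldr partial is (?m (mo j g)) x - foldr partial is (?m' (mo j g)) x\<bar>) \<longlonglongrightarrow>
     \<bar>foldr partial is (?m g) x - foldr partial is (?m' g) x\<bar>"
    by (intro tendsto_intros foldr_moll_lim mol g)
  ultimately have "\<bar>foldr partial is (?m g) x - foldr partial is (?m' g) x\<bar> \<le> (real CARD('n))\<^sup>2 * B * (\<epsilon> + \<epsilon>')"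
    using LIMSEQ_le_const2 by blast
  then show "\<bar>foldr partial is (\<lambda>x. ?m g x - ?m' g x) x\<bar> \<le> (real CARD('n))\<^sup>2 * B * (\<epsilon> + \<epsilon>')"
    by (simp add: foldr_partial_diff s mol g)
qed

lemma ucauchy_mo:
  fixes g :: "real^'n::finite \<Rightarrow> real"
  assumes g: "bounded_borel g" "continuous_on UNIV g" and B: "\<And>j. bd (Suc n) B (mo j g)"
  shows "ucauchy n (\<lambda>j. mo j g)"
  unfolding ucauchy_def
proof (intro allI impI)
  fix r :: real assume r: "0 < r"
  let ?C = "(real CARD('n))\<^sup>2 * B"
  have B0: "0 \<le> B" using B bd_nonneg by blast
  have "(\<lambda>j. ?C * (2 * eps j)) \<longlonglongrightarrow> ?C * (2 * 0)" by (intro tendsto_intros eps_lim)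
  then have "(\<lambda>j. ?C * (2 * eps j)) \<longlonglongrightarrow> 0" by simp
  from order_tendstoD(2)[OF this r] obtain N where N: "?C * (2 * eps N) < r"
    unfolding eventually_sequentially by blast
  have "bd n r (\<lambda>x. mo i g x - mo j g x)" if ij: "N \<le> i" "N \<le> j" for i j
  proof (rule bd_mono)
    show "bd n (?C * (eps i + eps j)) (\<lambda>x. mo i g x - mo j g x)"
      unfolding mo_def by (rule moll_diff_bd[OF mollifier_eps mollifier_eps g B])
    have "eps i \<le> eps N" "eps j \<le> eps N" using ij by (auto simp: eps_def frac_le)
    then have "?C * (eps i + eps j) \<le> ?C * (2 * eps N)" using B0 by (intro mult_left_mono) auto
    then show "?C * (eps i + eps j) \<le> r" using N by linarith
  qed
  then show "\<exists>N. \<forall>i\<ge>N. \<forall>j\<ge>N. bd n r (\<lambda>x. mo i g x - mo j g x)" by blast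
qed

lemma bb_lim:
  assumes "\<And>j. bounded_borel (F j)" "\<And>j z. \<bar>F j z\<bar> \<le> G" "\<And>z. (\<lambda>j. F j z) \<longlonglongrightarrow> \<phi> z"
  shows "bounded_borel \<phi>"
proof (rule bbI[where G = G])
  show "\<phi> \<in> borel_measurable borel"
    by (rule borel_measurable_LIMSEQ_real[OF assms(3)]) (use bb_borel[OF assms(1)] in simp)
  show "\<bar>\<phi> z\<bar> \<le> G" for z
    by (rule LIMSEQ_le_const2[OF tendsto_rabs[OF assms(3)]]) (use assms(2) in blast)
qed

section \<open>Differences of limits of smooth functions\<close>

context diffs
begin

text \<open>The limit is given only pointwise. Being Cauchy at order \<open>n\<close>, the sequence
  also has a limit in the sense of \<open>cvg\<close>, necessarily the same one, which justifies the
  partial derivatives among the \<open>D a\<close>.\<close>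

lemma Ds_lim:
  assumes F: "\<And>j. smb (F j)" and uc: "ucauchy n F" and lim: "\<And>x. (\<lambda>j. F j x) \<longlonglongrightarrow> \<phi> x"
    and \<mu>: "length \<mu> \<le> n"
  shows "(\<lambda>j. Ds \<mu> (F j) x) \<longlonglongrightarrow> Ds \<mu> \<phi> x"
  using \<mu>
proof (induction \<mu> arbitrary: x)
  case Nil then show ?case using lim by (simp add: dbars_Nil)
next
  case (Cons a \<mu>)
  have IH: "(\<lambda>j. Ds \<mu> (F j) x) \<longlonglongrightarrow> Ds \<mu> \<phi> x" for x using Cons by simp
  have s: "smb (Ds \<mu> (F j))" for j by (rule smb_Ds[OF F])
  have "ucauchy 1 (\<lambda>j. Ds \<mu> (F j))"
    unfolding ucauchy_def
  proof (intro allI impI)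
    fix r :: real assume r: "0 < r"
    define r' where "r' = r / (wts \<mu> + 1)"
    have r': "0 < r'" "wts \<mu> * r' \<le> r"
      using r wts_nonneg[of \<mu>] by (auto simp: r'_def divide_simps algebra_simps)
    obtain N where N: "\<And>i j. N \<le> i \<Longrightarrow> N \<le> j \<Longrightarrow> bd n r' (\<lambda>x. F i x - F j x)"
      using uc r'(1) unfolding ucauchy_def by blast
    have "bd 1 r (\<lambda>x. Ds \<mu> (F i) x - Ds \<mu> (F j) x)" if "N \<le> i" "N \<le> j" for i j
    proof -
      have "bd (1 + length \<mu>) r' (\<lambda>x. F i x - F j x)" by (rule bd_le[OF N[OF that]]) (use Cons.prems in simp)
      from tinv_bd[OF tinv_Ds smb_diff[OF F F] this]
      have "bd 1 (wts \<mu> * r') (\<lambda>x. Ds \<mu> (F i) x - Ds \<mu> (F j) x)"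
        unfolding tinv_diff[OF tinv_Ds F F] .
      then show ?thesis using r'(2) by (rule bd_mono)
    qed
    then show "\<exists>N. \<forall>i\<ge>N. \<forall>j\<ge>N. bd 1 r (\<lambda>x. Ds \<mu> (F i) x - Ds \<mu> (F j) x)" by blast
  qed
  from cvg_exists[OF s this] obtain \<zeta> where \<zeta>: "cvg 1 (\<lambda>j. Ds \<mu> (F j)) \<zeta>" by blast
  have eq: "\<zeta> = Ds \<mu> \<phi>" by (rule ext, rule LIMSEQ_unique[OF cvg_pointwise[OF \<zeta>] IH])
  have p: "(\<lambda>j. partial i (Ds \<mu> (F j)) x) \<longlonglongrightarrow> partial i (Ds \<mu> \<phi>) x" for i
    using \<zeta> unfolding eq One_nat_def cvg.simps by (intro cvg_pointwise[of 0]) simp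
  show ?case
    unfolding dbars_Cons dbar_def by (cases "a \<in> \<Lambda>1") (use h in \<open>auto intro!: tendsto_intros IH p\<close>)
qed

lemma Ds_lim_bounded:
  assumes F: "\<And>j. smb (F j)" "\<And>j. bd n B (F j)" and uc: "ucauchy n F" and lim: "\<And>x. (\<lambda>j. F j x) \<longlonglongrightarrow> \<phi> x"
    and \<mu>: "length \<mu> \<le> n"
  shows "bounded_borel (Ds \<mu> \<phi>)" "\<bar>Ds \<mu> (F j) x\<bar> \<le> wts \<mu> * B"
proof -
  show b: "\<bar>Ds \<mu> (F j) x\<bar> \<le> wts \<mu> * B" for j x
    by (rule tinv_bound[OF tinv_Ds F(1) bd_le[OF F(2) \<mu>]])
  show "bounded_borel (Ds \<mu> \<phi>)"
    by (rule bb_lim[OF _ b Ds_lim[OF F(1) uc lim \<mu>]]) (intro bb_smb smb_Ds F)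
qed

text \<open>For smooth functions the commutation is \<open>tinv_commute_Ds\<close>, and it is
  applied to \<open>mo j g\<close>. On one side dominated convergence removes \<open>j\<close>; on
  the other it is the uniform convergence of \<open>mo j g\<close> together with
  \<open>moll_bd_ex\<close> at the fixed radius \<open>\<epsilon>\<close>.\<close>

lemma moll_Ds:
  assumes mol: "mollifier \<epsilon>" and g: "bounded_borel g" "continuous_on UNIV g"
    and B: "\<And>j. bd (Suc n) B (mo j g)" and \<mu>: "length \<mu> \<le> n"
  shows "mollifier.moll \<epsilon> (Ds \<mu> g) x = Ds \<mu> (mollifier.moll \<epsilon> g) x"
proof -
  let ?m = "mollifier.moll \<epsilon> :: (real^'n \<Rightarrow> real) \<Rightarrow> _" and ?F = "\<lambda>j. mo j g"
  have F: "smb (?F j)" for j by (rule smb_mo[OF g(1)])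
  have B': "bd n B (?F j)" for j using B bd_SucD by blast
  have uc: "ucauchy n ?F" by (rule ucauchy_mo[OF g B])
  have lim: "(\<lambda>j. ?F j x) \<longlonglongrightarrow> g x" for x by (rule mo_lim[OF g])
  have sm: "smb (?m f)" if "bounded_borel f" for f by (rule mollifier.smb_moll[OF mol that])
  obtain C where C: "\<And>f G. bounded_borel f \<Longrightarrow> (\<And>z. \<bar>f z\<bar> \<le> G) \<Longrightarrow> bd n (C * G) (?m f)"
    using mollifier.moll_bd_ex[OF mol, of n] by blast
  have "(\<lambda>j. ?m (Ds \<mu> (?F j)) x) \<longlonglongrightarrow> ?m (Ds \<mu> g) x"
    by (rule mollifier.moll_lim[OF mol, where G = "wts \<mu> * B"])
      (intro bb_smb smb_Ds F Ds_lim_bounded[OF F B' uc lim \<mu>] Ds_lim[OF F uc lim \<mu>])+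
  then have "(\<lambda>j. Ds \<mu> (?m (?F j)) x) \<longlonglongrightarrow> ?m (Ds \<mu> g) x"
    unfolding tinv_commute_Ds[OF mollifier.tinv_moll[OF mol] F] .
  moreover have "(\<lambda>j. Ds \<mu> (?m (?F j)) x) \<longlonglongrightarrow> Ds \<mu> (?m g) x"
  proof (rule LIM_zero_cancel, rule tendsto_rabs_zero_cancel)
    obtain \<zeta> where \<zeta>: "cvg n ?F \<zeta>" using cvg_exists[OF F uc] by blast
    have eq: "\<zeta> = g" by (rule ext, rule LIMSEQ_unique[OF cvg_pointwise[OF \<zeta>] lim])
    have ul: "uniform_limit UNIV ?F g sequentially" using cvg_uniform[OF \<zeta>] unfolding eq .
    show "(\<lambda>j. \<bar>Ds \<mu> (?m (?F j)) x - Ds \<mu> (?m g) x\<bar>) \<longlonglongrightarrow> 0"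
    proof (rule LIMSEQ_I)
      fix r :: real assume r: "0 < r"
      define r' where "r' = r / (wts \<mu> * \<bar>C\<bar> + 1)"
      have wC: "0 \<le> wts \<mu> * \<bar>C\<bar>" using wts_nonneg by simp
      have r': "0 < r'" using r wC by (simp add: r'_def)
      have "wts \<mu> * \<bar>C\<bar> * r' < (wts \<mu> * \<bar>C\<bar> + 1) * r'" using r' by (simp add: algebra_simps)
      also have "\<dots> = r" using wC by (simp add: r'_def)
      finally have r'r: "wts \<mu> * \<bar>C\<bar> * r' < r" .
      obtain N where N: "\<And>j z. N \<le> j \<Longrightarrow> \<bar>?F j z - g z\<bar> < r'"
        using uniform_limitD[OF ul r'] unfolding eventually_sequentially dist_real_def by auto
      have "norm (\<bar>Ds \<mu> (?m (?F j)) x - Ds \<mu> (?m g) x\<bar> - 0) < r" if j: "N \<le> j" for j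
      proof -
        have bbF: "bounded_borel (?F j)" by (rule bb_smb[OF F])
        have bbd: "bounded_borel (\<lambda>z. ?F j z + (-1) * g z)" by (intro bb_add bb_cmult bbF g(1))
        have "bd n (C * r') (?m (\<lambda>z. ?F j z + (-1) * g z))"
          using N[OF j] by (intro C bbd) (auto intro: less_imp_le)
        moreover have "?m (\<lambda>z. ?F j z + (-1) * g z) = (\<lambda>z. ?m (?F j) z - ?m g z)"
          by (rule ext) (simp only: mollifier.moll_add[OF mol bbF bb_cmult[OF g(1)]] mollifier.moll_cmult[OF mol])
        ultimately have "bd n (C * r') (\<lambda>z. ?m (?F j) z - ?m g z)" by simp
        from tinv_bound[OF tinv_Ds smb_diff[OF sm[OF bbF] sm[OF g(1)]] bd_le[OF this \<mu>], of x]
        have "\<bar>Ds \<mu> (?m (?F j)) x - Ds \<mu> (?m g) x\<bar> \<le> wts \<mu> * (C * r')"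
          unfolding tinv_diff[OF tinv_Ds sm[OF bbF] sm[OF g(1)]] .
        also have "\<dots> \<le> wts \<mu> * (\<bar>C\<bar> * r')"
          using wts_nonneg r' by (intro mult_left_mono mult_right_mono) auto
        also have "\<dots> < r" using r'r by (simp add: mult.assoc)
        finally show ?thesis by simp
      qed
      then show "\<exists>N. \<forall>j\<ge>N. norm (\<bar>Ds \<mu> (?m (?F j)) x - Ds \<mu> (?m g) x\<bar> - 0) < r" by blast
    qed
  qed
  ultimately show ?thesis by (rule LIMSEQ_unique)
qed

end

section \<open>Transfer of the structural inequalities\<close>

lemma admissible_K_sum:
  assumes K: "admissible_K \<K>" and I: "finite I" "\<And>i. i \<in> I \<Longrightarrow> bounded_borel (g i)"
  shows "\<K> (\<lambda>z. \<Sum>i\<in>I. g i z) = (\<lambda>z. \<Sum>i\<in>I. \<K> (g i) z)"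
proof -
  have lin: "\<K> (\<lambda>x. a * \<phi> x + b * \<psi> x) = (\<lambda>x. a * \<K> \<phi> x + b * \<K> \<psi> x)"
    if "bounded_borel \<phi>" "bounded_borel \<psi>" for \<phi> \<psi> a b
    using K that unfolding admissible_K_def by blast
  show ?thesis using I
  proof (induction I rule: finite_induct)
    case empty
    show ?case using lin[OF bb_const[of 0] bb_const[of 0], of 0 0] by simp
  next
    case (insert i I)
    have "\<K> (\<lambda>z. 1 * g i z + 1 * (\<Sum>i\<in>I. g i z)) = (\<lambda>z. 1 * \<K> (g i) z + 1 * \<K> (\<lambda>z. \<Sum>i\<in>I. g i z) z)"
      using insert.prems by (intro lin bb_sum) auto
    then show ?case using insert by simp
  qed
qed

text \<open>Positivity and \<open>\<K> 1 \<le> 1\<close> give the bound after the family has been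
  summed by linearity; \<open>s\<close> bounds the sum and not the summands.\<close>

lemma admissible_K_le:
  assumes K: "admissible_K \<K>" and I: "finite I" "\<And>i. i \<in> I \<Longrightarrow> bounded_borel (g i)"
    and s: "0 \<le> s" "\<And>z. (\<Sum>i\<in>I. g i z) \<le> s"
  shows "(\<Sum>i\<in>I. \<K> (g i) x) \<le> s"
proof -
  let ?G = "\<lambda>z. \<Sum>i\<in>I. g i z"
  have G: "bounded_borel ?G" by (intro bb_sum I)
  have eq: "\<K> ?G = (\<lambda>z. \<Sum>i\<in>I. \<K> (g i) z)" by (rule admissible_K_sum[OF K I])
  have "\<K> (\<lambda>z. s * 1 + (-1) * ?G z) = (\<lambda>z. s * \<K> (\<lambda>_. 1) z + (-1) * \<K> ?G z)"
    using K G bb_const[of 1] unfolding admissible_K_def by blast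
  moreover have "0 \<le> \<K> (\<lambda>z. s * 1 + (-1) * ?G z) x"
  proof -
    have "bounded_borel (\<lambda>z. s * 1 + (-1) * ?G z)" by (intro bb_add bb_const bb_cmult G)
    moreover have "\<forall>z. 0 \<le> s * 1 + (-1) * ?G z" using s(2) by simp
    ultimately show ?thesis using K unfolding admissible_K_def by blast
  qed
  ultimately have "\<K> ?G x \<le> s * \<K> (\<lambda>_. 1) x" by simp
  also have "\<dots> \<le> s * 1" using K s(1) unfolding admissible_K_def by (intro mult_left_mono) auto
  finally show ?thesis unfolding eq by simp
qed

text \<open>The averaging relation is bundled with boundedness and measurability, so that averages
  of large expressions are derived by introduction rules along their structure.\<close>

definition mean :: "nat \<Rightarrow> real^'n::finite \<Rightarrow> (real^'n \<Rightarrow> real) \<Rightarrow> real \<Rightarrow> bool" where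
  "mean j x g a \<longleftrightarrow> bounded_borel g \<and> mo j g x = a"

lemma mean_mo: "bounded_borel g \<Longrightarrow> mean j x g (mo j g x)"
  by (simp add: mean_def)

lemma mean_const: "mean j x (\<lambda>_. a) a"
  by (simp add: mean_def bb_const mo_def mollifier.moll_const[OF mollifier_eps])

lemma mean_add: "mean j x f a \<Longrightarrow> mean j x g b \<Longrightarrow> mean j x (\<lambda>z. f z + g z) (a + b)"
  by (auto simp: mean_def bb_add mo_def mollifier.moll_add[OF mollifier_eps])

lemma mean_cmult: "mean j x g a \<Longrightarrow> mean j x (\<lambda>z. k * g z) (k * a)"
  by (auto simp: mean_def bb_cmult mo_def mollifier.moll_cmult[OF mollifier_eps])

lemma mean_multc: "mean j x g a \<Longrightarrow> mean j x (\<lambda>z. g z * k) (a * k)"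
  using mean_cmult[of j x g a k] by (simp add: mult.commute)

lemma mean_sum: "(\<And>i. i \<in> S \<Longrightarrow> mean j x (g i) (a i)) \<Longrightarrow> mean j x (\<lambda>z. \<Sum>i\<in>S. g i z) (\<Sum>i\<in>S. a i)"
  by (induction S rule: infinite_finite_induct) (auto intro: mean_const mean_add)

lemma mean_le: "mean j x f a \<Longrightarrow> mean j x g b \<Longrightarrow> (\<And>z. f z \<le> g z) \<Longrightarrow> a \<le> b"
  unfolding mean_def mo_def using mollifier.moll_mono[OF mollifier_eps] by blast

lemma mean_le': "\<forall>z. f z \<le> g z \<Longrightarrow> mean j x f a \<Longrightarrow> mean j x g b \<Longrightarrow> a \<le> b"
  using mean_le by blast

lemmas mean_intros = mean_const mean_add mean_cmult mean_multc mean_sum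

locale rough = cst m d \<delta> c0 \<tau>0 K s1 s2 Mb
  for m d \<delta> c0 \<tau>0 K s1 s2 Mb +
  fixes \<Lambda>1 :: "(real^'n::finite) set" and e :: "'n \<Rightarrow> real^'n" and \<tau> :: "real^'n \<Rightarrow> real" and h0 :: real
    and M :: "nat \<Rightarrow> real" and q p :: "real^'n \<Rightarrow> real^'n \<Rightarrow> real" and c f :: "real^'n \<Rightarrow> real"
  assumes h0: "0 < h0" and fin: "finite \<Lambda>1" and \<tau>: "\<And>l. l \<in> \<Lambda>1 \<Longrightarrow> 0 \<le> \<tau> l"
    and e: "inj e" "range e \<inter> \<Lambda>1 = {}"
    and m: "3 \<le> m" and d_eq: "d = real CARD('n)"
    and s1_eq: "(\<Sum>l\<in>\<Lambda>1. (norm l)\<^sup>2) = s1\<^sup>2"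
    and s2_eq: "(\<Sum>l\<in>\<Lambda>1. (norm (\<tau> l *\<^sub>R l))\<^sup>2) = s2\<^sup>2"
    and sym: "uminus ` \<Lambda>1 = \<Lambda>1" "\<And>l x. l \<in> \<Lambda>1 \<Longrightarrow> q (- l) x = q l x"
      "\<And>l x. l \<in> \<Lambda>1 \<Longrightarrow> p (- l) x = - p l x"
    and M: "\<And>k. k \<le> m \<Longrightarrow> (M k)\<^sup>2 \<le> Mb\<^sup>2"
    and reg: "regularity m M \<Lambda>1 q p c f"
    and qp: "\<And>h l x. h \<in> {0<..h0} \<Longrightarrow> l \<in> \<Lambda>1 \<Longrightarrow> 0 \<le> q l x + h * p l x"
    and c_ge: "\<And>x. c0 \<le> c x"
    and first: "first_structural m \<delta> K h0 \<Lambda>1 e \<tau>0 \<tau> q p c"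
    and second: "second_structural m \<delta> K h0 \<Lambda>1 e \<tau>0 \<tau> q p c"
begin

lemma in_B_qpcf: "l \<in> \<Lambda>1 \<Longrightarrow> in_B m (q l)" "l \<in> \<Lambda>1 \<Longrightarrow> in_B m (p l)" "in_B m c" "in_B m f"
  using reg by (auto simp: regularity_def)

lemma bb_qpcf: "l \<in> \<Lambda>1 \<Longrightarrow> bounded_borel (q l)" "l \<in> \<Lambda>1 \<Longrightarrow> bounded_borel (p l)" "bounded_borel c" "bounded_borel f"
  by (auto intro: in_B_bounded_borel in_B_qpcf)

lemma diffs: "h \<in> {0<..h0} \<Longrightarrow> diffs \<Lambda>1 e \<tau>0 \<tau> h"
  using fin \<tau> e \<tau>0_pos by unfold_locales auto

lemma mo_bd: "in_B m g \<Longrightarrow> bd m (B_norm m g) (mo j g)"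
  unfolding mo_def by (rule mollifier.moll_bd_B_norm[OF mollifier_eps])

lemma mean_Ds:
  assumes hh: "h \<in> {0<..h0}" and g: "in_B m g" and \<mu>: "length \<mu> \<le> 2"
  shows "mean j x (dbars \<Lambda>1 e \<tau>0 \<tau> h \<mu> g) (dbars \<Lambda>1 e \<tau>0 \<tau> h \<mu> (mo j g) x)"
proof -
  interpret diffs \<Lambda>1 e \<tau>0 \<tau> h by (rule diffs[OF hh])
  have g': "bounded_borel g" "continuous_on UNIV g"
    using in_B_bounded_borel[OF g] g by (auto simp: in_B_def)
  \<comment> \<open>Two differences, and one derivative more for \<open>ucauchy_mo\<close>; this is
    where \<open>3 \<le> m\<close> enters.\<close>
  have B: "bd (Suc 2) (B_norm m g) (mo j g)" for j by (rule bd_le[OF mo_bd[OF g]]) (use m in simp)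
  have "bounded_borel (Ds \<mu> g)"
    by (rule Ds_lim_bounded(1)[OF smb_mo[OF g'(1)] bd_SucD[OF B] ucauchy_mo[OF g' B] mo_lim[OF g'] \<mu>])
  then show ?thesis
    unfolding mean_def mo_def[of j] using moll_Ds[OF mollifier_eps g' B \<mu>] by blast
qed

text \<open>The structural inequality for the mollified coefficients at \<open>x\<close> is the average over \<open>z\<close> of the
  given one at \<open>z\<close>, applied to the translate of the test function that takes \<open>x\<close> to \<open>z\<close>.\<close>

definition tr :: "real^'n \<Rightarrow> real^'n \<Rightarrow> (real^'n \<Rightarrow> real) \<Rightarrow> real^'n \<Rightarrow> real" where
  "tr x z \<phi> w = \<phi> (w + (x - z))"

lemma tr_eval: "tr x z \<phi> z = \<phi> x" by (simp add: tr_def)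

lemma smb_tr: "smb \<phi> \<Longrightarrow> smb (tr x z \<phi>)"
  unfolding tr_def[abs_def] by (rule smb_translate)

lemma tinv_tr: "tinv T k C \<Longrightarrow> smb \<phi> \<Longrightarrow> T (tr x z \<phi>) = tr x z (T \<phi>)"
  unfolding tr_def[abs_def] by (rule tinv_translate)

text \<open>At \<open>z\<close> the translated function shows the differences that
  \<open>\<phi>\<close> has at \<open>x\<close>. They do not depend on \<open>z\<close>, so
  averaging acts on the coefficients alone.\<close>

lemma mean_L0:
  assumes hh: "h \<in> {0<..h0}" and \<phi>: "smb \<phi>" and \<mu>: "length \<mu> \<le> 2"
  shows "mean j x (\<lambda>z. Q_op \<Lambda>1 e \<tau>0 \<tau> q h \<mu> (tr x z \<phi>) z) (Q_op \<Lambda>1 e \<tau>0 \<tau> (\<lambda>l. mo j (q l)) h \<mu> \<phi> x)"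
    "mean j x (\<lambda>z. L0_op \<Lambda>1 e \<tau>0 \<tau> q p h \<mu> (tr x z \<phi>) z)
      (L0_op \<Lambda>1 e \<tau>0 \<tau> (\<lambda>l. mo j (q l)) (\<lambda>l. mo j (p l)) h \<mu> \<phi> x)"
proof -
  interpret diffs \<Lambda>1 e \<tau>0 \<tau> h by (rule diffs[OF hh])
  have fd: "fd h l (tr x z \<phi>) z = fd h l \<phi> x" for l z
    using tinv_tr[OF tinv_fd[OF h] \<phi>, of l x z] by (simp add: tr_eval)
  show Q: "mean j x (\<lambda>z. Q_op \<Lambda>1 e \<tau>0 \<tau> q h \<mu> (tr x z \<phi>) z) (Q_op \<Lambda>1 e \<tau>0 \<tau> (\<lambda>l. mo j (q l)) h \<mu> \<phi> x)"
    unfolding Q_op_def fd by (intro mean_intros mean_Ds[OF hh] in_B_qpcf \<mu>)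
  show "mean j x (\<lambda>z. L0_op \<Lambda>1 e \<tau>0 \<tau> q p h \<mu> (tr x z \<phi>) z)
      (L0_op \<Lambda>1 e \<tau>0 \<tau> (\<lambda>l. mo j (q l)) (\<lambda>l. mo j (p l)) h \<mu> \<phi> x)"
    unfolding L0_op_def fd by (intro mean_add Q mean_intros mean_Ds[OF hh] in_B_qpcf \<mu>)
qed

lemma mean_A_form:
  assumes hh: "h \<in> {0<..h0}" and \<phi>: "smb \<phi>"
  shows "mean j x (\<lambda>z. A_form \<Lambda>1 e \<tau>0 \<tau> q p h (tr x z \<phi>) z)
      (A_form \<Lambda>1 e \<tau>0 \<tau> (\<lambda>l. mo j (q l)) (\<lambda>l. mo j (p l)) h \<phi> x)"
proof -
  interpret diffs \<Lambda>1 e \<tau>0 \<tau> h by (rule diffs[OF hh])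
  show ?thesis
    unfolding A_form_def tinv_tr[OF tinv_D \<phi>] tinv_tr[OF tinv_sh \<phi>] tr_eval
    by (intro mean_intros mean_L0(2)[OF hh] smb_sh \<phi>) simp
qed

lemma mean_Q_form:
  assumes hh: "h \<in> {0<..h0}" and \<phi>: "smb \<phi>"
  shows "mean j x (\<lambda>z. Q_form \<Lambda>1 q p h (tr x z \<phi>) z)
      (Q_form \<Lambda>1 (\<lambda>l. mo j (q l)) (\<lambda>l. mo j (p l)) h \<phi> x)"
proof -
  interpret diffs \<Lambda>1 e \<tau>0 \<tau> h by (rule diffs[OF hh])
  have fd: "fd h l (tr x z \<phi>) z = fd h l \<phi> x" for l z
    using tinv_tr[OF tinv_fd[OF h] \<phi>, of l x z] by (simp add: tr_eval)
  show ?thesis unfolding Q_form_def fd by (intro mean_intros mean_mo bb_qpcf)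
qed

lemma dbar_sq_tr:
  assumes hh: "h \<in> {0<..h0}" and \<phi>: "smb \<phi>"
  shows "dbar_sq \<Lambda>1 e \<tau>0 \<tau> h k (tr x z \<phi>) w = dbar_sq \<Lambda>1 e \<tau>0 \<tau> h k \<phi> (w + (x - z))"
    "bounded_borel (dbar_sq \<Lambda>1 e \<tau>0 \<tau> h k \<phi>)"
proof -
  interpret diffs \<Lambda>1 e \<tau>0 \<tau> h by (rule diffs[OF hh])
  show "dbar_sq \<Lambda>1 e \<tau>0 \<tau> h k (tr x z \<phi>) w = dbar_sq \<Lambda>1 e \<tau>0 \<tau> h k \<phi> (w + (x - z))"
    unfolding dbar_sq_def tinv_tr[OF tinv_Ds \<phi>] by (simp add: tr_def)
  show "bounded_borel (dbar_sq \<Lambda>1 e \<tau>0 \<tau> h k \<phi>)"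
    unfolding dbar_sq_def[abs_def] by (intro bb_smb smb_intros smb_Ds \<phi>)
qed

lemma bb_bounded: "bounded_borel g \<Longrightarrow> bounded (range g)"
  by (simp add: bounded_borel_def)

lemma Q_form_nonneg: "h \<in> {0<..h0} \<Longrightarrow> 0 \<le> Q_form \<Lambda>1 q p h \<phi> x"
  unfolding Q_form_def using qp by (intro sum_nonneg mult_nonneg_nonneg) auto

text \<open>\<open>\<K>\<close> is eliminated at each \<open>z\<close> before averaging, as it need
  not commute with translations; the bound \<open>s\<close> is the same for all translates.\<close>

lemma mo_S1:
  fixes j :: nat
  assumes hh: "h \<in> {0<..h0}" and \<phi>: "smb \<phi>" and s: "\<And>z. dbar_sq \<Lambda>1 e \<tau>0 \<tau> h 1 \<phi> z \<le> s"
  defines "q' \<equiv> \<lambda>l. mo j (q l)" and "p' \<equiv> \<lambda>l. mo j (p l)"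
  shows "A_form \<Lambda>1 e \<tau>0 \<tau> q' p' h \<phi> x
          \<le> (1 - \<delta>) * (\<Sum>l\<in>\<Lambda>1 \<union> range e. Q_form \<Lambda>1 q' p' h (dbar \<Lambda>1 e \<tau>0 \<tau> h l \<phi>) x)
            + K * Q_form \<Lambda>1 q' p' h \<phi> x + 2 * (1 - \<delta>) * mo j c x * s"
proof -
  interpret diffs \<Lambda>1 e \<tau>0 \<tau> h by (rule diffs[OF hh])
  obtain \<K> where \<K>: "admissible_K \<K>" and S: "\<And>\<phi> x. smooth \<phi> \<Longrightarrow> bounded (range (Dsq 1 \<phi>)) \<Longrightarrow>
      real m * A_form \<Lambda>1 e \<tau>0 \<tau> q p h \<phi> x
      \<le> (1 - \<delta>) * (\<Sum>l\<in>\<Lambda>. Q_form \<Lambda>1 q p h (D l \<phi>) x) + K * Q_form \<Lambda>1 q p h \<phi> x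
        + 2 * (1 - \<delta>) * c x * \<K> (Dsq 1 \<phi>) x"
    using first hh unfolding first_structural_def by blast
  have s0: "0 \<le> s"
  proof -
    have "0 \<le> Dsq 1 \<phi> x" by (simp add: dbar_sq_def sum_nonneg)
    then show ?thesis using s order_trans by blast
  qed
  have "A_form \<Lambda>1 e \<tau>0 \<tau> q p h (tr x z \<phi>) z
      \<le> (1 - \<delta>) * (\<Sum>l\<in>\<Lambda>. Q_form \<Lambda>1 q p h (tr x z (D l \<phi>)) z) + K * Q_form \<Lambda>1 q p h (tr x z \<phi>) z
        + 2 * (1 - \<delta>) * c z * s" (is "?A \<le> ?R") for z
  proof -
    have t: "smb (tr x z \<phi>)" by (rule smb_tr[OF \<phi>])
    have bb: "bounded_borel (Dsq 1 (tr x z \<phi>))" by (rule dbar_sq_tr(2)[OF hh t])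
    have k: "(\<Sum>i\<in>{0::nat}. \<K> (Dsq 1 (tr x z \<phi>)) z) \<le> s"
      by (rule admissible_K_le[OF \<K> _ bb s0]) (use s in \<open>simp_all add: dbar_sq_tr(1)[OF hh \<phi>]\<close>)
    have cz: "0 \<le> 2 * (1 - \<delta>) * c z" using c_ge[of z] c0 \<delta> by simp
    have "real m * ?A \<le> (1 - \<delta>) * (\<Sum>l\<in>\<Lambda>. Q_form \<Lambda>1 q p h (tr x z (D l \<phi>)) z) + K * Q_form \<Lambda>1 q p h (tr x z \<phi>) z
        + 2 * (1 - \<delta>) * c z * \<K> (Dsq 1 (tr x z \<phi>)) z"
      using S[OF smb_smooth[OF t] bb_bounded[OF bb], of z] by (simp add: tinv_tr[OF tinv_D \<phi>])
    also have "\<dots> \<le> ?R" using mult_left_mono[OF _ cz] k by simp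
    finally have 1: "real m * ?A \<le> ?R" .
    have "0 \<le> (1 - \<delta>) * (\<Sum>l\<in>\<Lambda>. Q_form \<Lambda>1 q p h (tr x z (D l \<phi>)) z)"
      using \<delta> by (intro mult_nonneg_nonneg sum_nonneg Q_form_nonneg[OF hh]) simp
    moreover have "0 \<le> K * Q_form \<Lambda>1 q p h (tr x z \<phi>) z"
      using K by (intro mult_nonneg_nonneg Q_form_nonneg[OF hh]) simp
    moreover have "0 \<le> 2 * (1 - \<delta>) * c z * s" using cz s0 by (rule mult_nonneg_nonneg)
    ultimately have R: "0 \<le> ?R" by linarith
    show ?thesis
    proof (cases "0 \<le> ?A")
      case True
      then have "1 * ?A \<le> real m * ?A" using m by (intro mult_right_mono) auto
      then show ?thesis using 1 by linarith
    qed (use R in linarith)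
  qed
  from mean_le[OF mean_A_form[OF hh \<phi>] _ this]
  show ?thesis unfolding q'_def p'_def
    by this (intro mean_intros mean_Q_form[OF hh] mean_mo bb_qpcf \<phi> smb_D)
qed

text \<open>The given inequality is summed over the family at each \<open>z\<close> before
  \<open>\<K>\<close> is bounded, so that \<open>s\<close> and \<open>s'\<close> enter once for the
  whole family.\<close>

lemma mo_S2:
  fixes I :: "(real^'n) list set" and j :: nat
  assumes hh: "h \<in> {0<..h0}" and n: "2 \<le> n" "n \<le> m" and I: "finite I" and \<Phi>: "\<And>i. i \<in> I \<Longrightarrow> smb (\<Phi> i)"
    and s: "\<And>z. (\<Sum>i\<in>I. dbar_sq \<Lambda>1 e \<tau>0 \<tau> h 2 (\<Phi> i) z) \<le> s"
    and s': "\<And>z. (\<Sum>i\<in>I. dbar_sq \<Lambda>1 e \<tau>0 \<tau> h 1 (\<Phi> i) z) \<le> s'"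
  defines "q' \<equiv> \<lambda>l. mo j (q l)" and "p' \<equiv> \<lambda>l. mo j (p l)"
  shows "real n * (\<Sum>i\<in>I. \<Sum>l\<in>\<Lambda>1 \<union> range e. A_form \<Lambda>1 e \<tau>0 \<tau> q' p' h (dbar \<Lambda>1 e \<tau>0 \<tau> h l (\<Phi> i)) x)
       + real n * (real n - 1) * (\<Sum>i\<in>I. \<Sum>\<mu>\<in>tuples 2 (\<Lambda>1 \<union> range e).
              dbars \<Lambda>1 e \<tau>0 \<tau> h \<mu> (\<Phi> i) x * Q_op \<Lambda>1 e \<tau>0 \<tau> q' h \<mu> (shifts \<Lambda>1 h \<mu> (\<Phi> i)) x)
       \<le> (1 - \<delta>) * (\<Sum>i\<in>I. \<Sum>\<mu>\<in>tuples 2 (\<Lambda>1 \<union> range e). Q_form \<Lambda>1 q' p' h (dbars \<Lambda>1 e \<tau>0 \<tau> h \<mu> (\<Phi> i)) x)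
            + K * (\<Sum>i\<in>I. \<Sum>l\<in>\<Lambda>1 \<union> range e. Q_form \<Lambda>1 q' p' h (dbar \<Lambda>1 e \<tau>0 \<tau> h l (\<Phi> i)) x)
            + 2 * (1 - \<delta>) * mo j c x * s + K * s'"
proof -
  interpret diffs \<Lambda>1 e \<tau>0 \<tau> h by (rule diffs[OF hh])
  let ?A = "A_form \<Lambda>1 e \<tau>0 \<tau> q p h" and ?Qo = "Q_op \<Lambda>1 e \<tau>0 \<tau> q h" and ?Qf = "Q_form \<Lambda>1 q p h"
  have "n \<in> {1..m}" using n by simp
  then obtain \<K> where \<K>: "admissible_K \<K>" and S: "\<And>\<phi> x. smooth \<phi> \<Longrightarrow> bounded (range (Dsq 1 \<phi>)) \<Longrightarrow>
      bounded (range (Dsq 2 \<phi>)) \<Longrightarrow>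
      real n * (\<Sum>l\<in>\<Lambda>. ?A (D l \<phi>) x) + real n * (real n - 1) * (\<Sum>\<mu>\<in>tuples 2 \<Lambda>. Ds \<mu> \<phi> x * ?Qo \<mu> (shs \<mu> \<phi>) x)
      \<le> (1 - \<delta>) * (\<Sum>\<mu>\<in>tuples 2 \<Lambda>. ?Qf (Ds \<mu> \<phi>) x) + K * (\<Sum>l\<in>\<Lambda>. ?Qf (D l \<phi>) x)
        + 2 * (1 - \<delta>) * c x * \<K> (Dsq 2 \<phi>) x + K * \<K> (Dsq 1 \<phi>) x"
    using second hh unfolding second_structural_def by blast
  have nn: "0 \<le> (\<Sum>i\<in>I. Dsq k (\<Phi> i) x)" for k by (simp add: dbar_sq_def sum_nonneg)
  have s0: "0 \<le> s" "0 \<le> s'" using order_trans[OF nn s] order_trans[OF nn s'] by auto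
  have "\<forall>z. real n * (\<Sum>i\<in>I. \<Sum>l\<in>\<Lambda>. ?A (tr x z (D l (\<Phi> i))) z)
      + real n * (real n - 1) * (\<Sum>i\<in>I. \<Sum>\<mu>\<in>tuples 2 \<Lambda>. Ds \<mu> (\<Phi> i) x * ?Qo \<mu> (tr x z (shs \<mu> (\<Phi> i))) z)
      \<le> (1 - \<delta>) * (\<Sum>i\<in>I. \<Sum>\<mu>\<in>tuples 2 \<Lambda>. ?Qf (tr x z (Ds \<mu> (\<Phi> i))) z)
        + K * (\<Sum>i\<in>I. \<Sum>l\<in>\<Lambda>. ?Qf (tr x z (D l (\<Phi> i))) z)
        + 2 * (1 - \<delta>) * c z * s + K * s'" (is "\<forall>z. ?L z \<le> ?R z")
  proof
    fix z
    have bb: "bounded_borel (Dsq k (tr x z (\<Phi> i)))" if "i \<in> I" for k i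
      by (rule dbar_sq_tr(2)[OF hh smb_tr[OF \<Phi>[OF that]]])
    have k2: "(\<Sum>i\<in>I. \<K> (Dsq 2 (tr x z (\<Phi> i))) z) \<le> s"
    proof (rule admissible_K_le[OF \<K> I bb s0(1)])
      show "(\<Sum>i\<in>I. Dsq 2 (tr x z (\<Phi> i)) w) \<le> s" for w
        using s[of "w + (x - z)"] by (simp add: dbar_sq_tr(1)[OF hh \<Phi>])
    qed
    have k1: "(\<Sum>i\<in>I. \<K> (Dsq 1 (tr x z (\<Phi> i))) z) \<le> s'"
    proof (rule admissible_K_le[OF \<K> I bb s0(2)])
      show "(\<Sum>i\<in>I. Dsq 1 (tr x z (\<Phi> i)) w) \<le> s'" for w
        using s'[of "w + (x - z)"] by (simp add: dbar_sq_tr(1)[OF hh \<Phi>])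
    qed
    have cz: "0 \<le> 2 * (1 - \<delta>) * c z" using c_ge[of z] c0 \<delta> by simp
    have S': "real n * (\<Sum>l\<in>\<Lambda>. ?A (tr x z (D l (\<Phi> i))) z)
       + real n * (real n - 1) * (\<Sum>\<mu>\<in>tuples 2 \<Lambda>. Ds \<mu> (\<Phi> i) x * ?Qo \<mu> (tr x z (shs \<mu> (\<Phi> i))) z)
      \<le> (1 - \<delta>) * (\<Sum>\<mu>\<in>tuples 2 \<Lambda>. ?Qf (tr x z (Ds \<mu> (\<Phi> i))) z) + K * (\<Sum>l\<in>\<Lambda>. ?Qf (tr x z (D l (\<Phi> i))) z)
        + 2 * (1 - \<delta>) * c z * \<K> (Dsq 2 (tr x z (\<Phi> i))) z + K * \<K> (Dsq 1 (tr x z (\<Phi> i))) z" if i: "i \<in> I" for i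
      using S[OF smb_smooth[OF smb_tr[OF \<Phi>[OF i]]] bb_bounded[OF bb[OF i]] bb_bounded[OF bb[OF i]], of z]
      by (simp only: tinv_tr[OF tinv_D \<Phi>[OF i]] tinv_tr[OF tinv_Ds \<Phi>[OF i]] tinv_tr[OF tinv_shs \<Phi>[OF i]] tr_eval)
    have "?L z = (\<Sum>i\<in>I. real n * (\<Sum>l\<in>\<Lambda>. ?A (tr x z (D l (\<Phi> i))) z)
       + real n * (real n - 1) * (\<Sum>\<mu>\<in>tuples 2 \<Lambda>. Ds \<mu> (\<Phi> i) x * ?Qo \<mu> (tr x z (shs \<mu> (\<Phi> i))) z))"
      by (simp only: sum.distrib sum_distrib_left)
    also have "\<dots> \<le> (\<Sum>i\<in>I. (1 - \<delta>) * (\<Sum>\<mu>\<in>tuples 2 \<Lambda>. ?Qf (tr x z (Ds \<mu> (\<Phi> i))) z) + K * (\<Sum>l\<in>\<Lambda>. ?Qf (tr x z (D l (\<Phi> i))) z)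
        + 2 * (1 - \<delta>) * c z * \<K> (Dsq 2 (tr x z (\<Phi> i))) z + K * \<K> (Dsq 1 (tr x z (\<Phi> i))) z)"
      by (rule sum_mono[OF S'])
    also have "\<dots> = (1 - \<delta>) * (\<Sum>i\<in>I. \<Sum>\<mu>\<in>tuples 2 \<Lambda>. ?Qf (tr x z (Ds \<mu> (\<Phi> i))) z)
        + K * (\<Sum>i\<in>I. \<Sum>l\<in>\<Lambda>. ?Qf (tr x z (D l (\<Phi> i))) z)
        + 2 * (1 - \<delta>) * c z * (\<Sum>i\<in>I. \<K> (Dsq 2 (tr x z (\<Phi> i))) z) + K * (\<Sum>i\<in>I. \<K> (Dsq 1 (tr x z (\<Phi> i))) z)"
      by (simp only: sum.distrib sum_distrib_left)
    also have "\<dots> \<le> ?R z"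
      using mult_left_mono[OF k2 cz] mult_left_mono[OF k1, of K] K by linarith
    finally show "?L z \<le> ?R z" .
  qed
  from mean_le'[where j = j and x = x, OF this]
  show ?thesis unfolding q'_def p'_def
    by this (intro mean_intros mean_Q_form[OF hh] mean_A_form[OF hh] mean_L0(1)[OF hh] mean_mo bb_qpcf \<Phi> smb_D smb_Ds smb_shs;
      simp add: tuples_def)+
qed

end

lemma weak_deriv_sq_le:
  "(weak_deriv (count_list is) (\<psi> :: real^'n::finite \<Rightarrow> real) z)\<^sup>2 \<le> weak_Dsq (length is) \<psi> z"
  unfolding weak_Dsq_def
proof (rule member_le_sum)
  show "finite {\<alpha> :: 'n \<Rightarrow> nat. mi_order \<alpha> = length is}"
    by (rule finite_subset[OF _ finite_mi_order[of "length is"]]) auto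
qed (auto simp: mi_order_count_list)

section \<open>The mollified data meet the requirements of the smooth theory\<close>

context rough
begin

lemma reg_AE:
  assumes l: "length is \<le> m"
  shows "AE z in lborel. (\<Sum>l\<in>\<Lambda>1. (weak_deriv (count_list is) (q l) z)\<^sup>2 + (weak_deriv (count_list is) (p l) z)\<^sup>2)
    + (weak_deriv (count_list is) c z)\<^sup>2 \<le> Mb\<^sup>2"
proof -
  let ?k = "length is"
  let ?F = "\<lambda>z. (\<Sum>l\<in>\<Lambda>1. weak_Dsq ?k (q l) z + weak_Dsq ?k (p l) z) + weak_Dsq ?k c z"
  have "esssup lborel (\<lambda>z. ereal (?F z)) \<le> ereal ((M ?k)\<^sup>2)" using reg l by (simp add: regularity_def)
  moreover have "AE z in lborel. ereal (?F z) \<le> esssup lborel (\<lambda>z. ereal (?F z))" by (rule esssup_AE)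
  ultimately have "AE z in lborel. ?F z \<le> (M ?k)\<^sup>2"
    by (auto elim!: eventually_mono dest: order_trans)
  then show ?thesis
  proof eventually_elim
    case (elim z)
    have "(\<Sum>l\<in>\<Lambda>1. (weak_deriv (count_list is) (q l) z)\<^sup>2 + (weak_deriv (count_list is) (p l) z)\<^sup>2)
        + (weak_deriv (count_list is) c z)\<^sup>2 \<le> ?F z"
      by (intro add_mono sum_mono weak_deriv_sq_le)
    then show ?case using elim M[OF l] by linarith
  qed
qed

lemma mo_coeff_bounds:
  assumes l: "length is \<le> m"
  shows "(\<Sum>l\<in>\<Lambda>1. (foldr partial is (mo j (q l)) x)\<^sup>2) \<le> Mb\<^sup>2"
    "(\<Sum>l\<in>\<Lambda>1. (foldr partial is (mo j (p l)) x)\<^sup>2) \<le> Mb\<^sup>2"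
    "\<bar>foldr partial is (mo j c) x\<bar> \<le> Mb"
proof -
  let ?w = "\<lambda>\<psi> z. (weak_deriv (count_list is) \<psi> z)\<^sup>2"
  have nn: "0 \<le> (\<Sum>l\<in>\<Lambda>1. ?w (r l) z)" for r :: "_ \<Rightarrow> real^'n \<Rightarrow> real" and z by (simp add: sum_nonneg)
  have *: "AE z in lborel. (\<Sum>l\<in>\<Lambda>1. ?w (q l) z) + (\<Sum>l\<in>\<Lambda>1. ?w (p l) z) + ?w c z \<le> Mb\<^sup>2"
    using reg_AE[OF l] by (simp add: sum.distrib)
  have sq: "0 \<le> ?w c z" for z by simp
  have AE: "AE z in lborel. (\<Sum>l\<in>\<Lambda>1. ?w (q l) z) \<le> Mb\<^sup>2" "AE z in lborel. (\<Sum>l\<in>\<Lambda>1. ?w (p l) z) \<le> Mb\<^sup>2"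
    "AE z in lborel. (\<Sum>l\<in>{0::nat}. ?w c z) \<le> Mb\<^sup>2"
  proof -
    show "AE z in lborel. (\<Sum>l\<in>\<Lambda>1. ?w (q l) z) \<le> Mb\<^sup>2"
      using * by eventually_elim (use nn[of p] sq in \<open>smt (verit)\<close>)
    show "AE z in lborel. (\<Sum>l\<in>\<Lambda>1. ?w (p l) z) \<le> Mb\<^sup>2"
      using * by eventually_elim (use nn[of q] sq in \<open>smt (verit)\<close>)
    have "AE z in lborel. ?w c z \<le> Mb\<^sup>2"
      using * by eventually_elim (use nn[of q] nn[of p] in \<open>smt (verit)\<close>)
    then show "AE z in lborel. (\<Sum>l\<in>{0::nat}. ?w c z) \<le> Mb\<^sup>2" by simp
  qed
  show "(\<Sum>l\<in>\<Lambda>1. (foldr partial is (mo j (q l)) x)\<^sup>2) \<le> Mb\<^sup>2"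
    unfolding mo_def by (rule mollifier.moll_sum_squares[OF mollifier_eps fin in_B_qpcf(1) l Mb AE(1)])
  show "(\<Sum>l\<in>\<Lambda>1. (foldr partial is (mo j (p l)) x)\<^sup>2) \<le> Mb\<^sup>2"
    unfolding mo_def by (rule mollifier.moll_sum_squares[OF mollifier_eps fin in_B_qpcf(2) l Mb AE(2)])
  \<comment> \<open>\<open>c\<close> is treated as a family with a single member.\<close>
  have "(\<Sum>l\<in>{0::nat}. (foldr partial is (mo j c) x)\<^sup>2) \<le> Mb\<^sup>2"
    unfolding mo_def by (rule mollifier.moll_sum_squares[OF mollifier_eps _ in_B_qpcf(3) l Mb AE(3)]) simp
  then show "\<bar>foldr partial is (mo j c) x\<bar> \<le> Mb"
    using Mb abs_le_square_iff[of "foldr partial is (mo j c) x" Mb] by simp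
qed

lemma bern_mo:
  assumes hh: "h \<in> {0<..h0}"
  shows "bern m d \<delta> c0 \<tau>0 K s1 s2 Mb \<Lambda>1 e \<tau> h (\<lambda>l. mo j (q l)) (\<lambda>l. mo j (p l)) (mo j c)"
proof (intro bern.intro bern_axioms.intro cst_axioms diffs[OF hh] d_eq)
  show "(\<Sum>l\<in>\<Lambda>1. (norm l)\<^sup>2) \<le> s1\<^sup>2" "(\<Sum>l\<in>\<Lambda>1. (norm (\<tau> l *\<^sub>R l))\<^sup>2) \<le> s2\<^sup>2"
    using s1_eq s2_eq by auto
  show "uminus ` \<Lambda>1 = \<Lambda>1" by (rule sym)
  fix l assume l: "l \<in> \<Lambda>1"
  have q: "q (- l) = q l" and p: "p (- l) = (\<lambda>x. (-1) * p l x)" using sym l by (auto simp: fun_eq_iff)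
  show "mo j (q (- l)) = mo j (q l)" unfolding q ..
  show "mo j (p (- l)) = (\<lambda>x. - mo j (p l) x)"
    unfolding p mo_def mollifier.moll_cmult[OF mollifier_eps] by (rule ext) simp
  show "smb (mo j (q l))" "smb (mo j (p l))" using l by (auto intro: smb_mo bb_qpcf)
  fix x
  have "mean j x (\<lambda>z. q l z + h * p l z) (mo j (q l) x + h * mo j (p l) x)"
    using l by (intro mean_intros mean_mo bb_qpcf)
  from mean_le[OF mean_const this] show "0 \<le> mo j (q l) x + h * mo j (p l) x"
    using qp[OF hh l] by blast
next
  show "smb (mo j c)" by (intro smb_mo bb_qpcf)
  show "c0 \<le> mo j c x" for x
    using mean_le[OF mean_const mean_mo[OF bb_qpcf(3)]] c_ge by blast
  show "bd m Mb (mo j c)" by (rule bd_foldrI) (rule mo_coeff_bounds(3))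
qed (fact mo_coeff_bounds mo_S1[OF hh] mo_S2[OF hh])+

lemma approx_mo:
  "approx m d \<delta> c0 \<tau>0 K s1 s2 Mb \<Lambda>1 e \<tau> h0 (B_norm m f) q p c f
    (\<lambda>j l. mo j (q l)) (\<lambda>j l. mo j (p l)) (\<lambda>j. mo j c) (\<lambda>j. mo j f)"
proof (intro approx.intro approx_axioms.intro cst_axioms)
  show "sdata m d \<delta> c0 \<tau>0 K s1 s2 Mb \<Lambda>1 e \<tau> h0 (\<lambda>l. mo j (q l)) (\<lambda>l. mo j (p l)) (mo j c)" for j
    by (intro sdata.intro sdata_axioms.intro cst_axioms h0 bern_mo)
  show "smb (mo j f)" "bd m (B_norm m f) (mo j f)" for j
    by (intro smb_mo bb_qpcf, intro mo_bd in_B_qpcf)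
  have cont: "continuous_on UNIV g" "bounded_borel g" if "in_B m g" for g
    using that in_B_bounded_borel[OF that] by (auto simp: in_B_def)
  show "(\<lambda>i. mo i (q l) x) \<longlonglongrightarrow> q l x" "(\<lambda>i. mo i (p l) x) \<longlonglongrightarrow> p l x" if "l \<in> \<Lambda>1" for l x
    using that by (intro mo_lim cont in_B_qpcf; assumption)+
  show "(\<lambda>i. mo i c x) \<longlonglongrightarrow> c x" "(\<lambda>i. mo i f x) \<longlonglongrightarrow> f x" for x
    by (intro mo_lim cont in_B_qpcf)+
  fix \<omega> :: real assume \<omega>: "0 < \<omega>"
  let ?P = "\<lambda>g N. \<forall>i\<ge>N. \<forall>j\<ge>N. bd (m - 1) \<omega> (\<lambda>x. mo i g x - mo j g x)"
  have ev: "eventually (?P g) sequentially" if g: "in_B m g" for g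
  proof -
    have "bd (Suc (m - 1)) (B_norm m g) (mo j g)" for j using mo_bd[OF g] m by simp
    from ucauchy_mo[OF cont(2,1)[OF g] this] obtain N where N: "?P g N"
      using \<omega> unfolding ucauchy_def by blast
    then have "\<forall>N'\<ge>N. ?P g N'" by (meson order_trans)
    then show ?thesis unfolding eventually_sequentially by blast
  qed
  have "eventually (\<lambda>N. (\<forall>l\<in>\<Lambda>1. ?P (q l) N) \<and> (\<forall>l\<in>\<Lambda>1. ?P (p l) N) \<and> ?P c N \<and> ?P f N) sequentially"
    by (intro eventually_conj eventually_ball_finite fin ballI ev in_B_qpcf)
  then obtain N where "(\<forall>l\<in>\<Lambda>1. ?P (q l) N) \<and> (\<forall>l\<in>\<Lambda>1. ?P (p l) N) \<and> ?P c N \<and> ?P f N"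
    by (auto simp: eventually_sequentially)
  then show "\<exists>N. \<forall>i\<ge>N. \<forall>j\<ge>N. close_data (m - 1) \<omega> \<Lambda>1 (\<lambda>l. mo i (q l)) (\<lambda>l. mo i (p l)) (mo i c) (mo i f)
      (\<lambda>l. mo j (q l)) (\<lambda>l. mo j (p l)) (mo j c) (mo j f)"
    using \<omega> unfolding close_data_def by (intro exI[of _ N]) simp
qed

end

theorem theorem3p4:
  fixes m :: nat and \<delta> c0 \<tau>0 K size1 size2 :: real and M :: "nat \<Rightarrow> real"
  assumes "0 < \<delta>" "\<delta> \<le> 1" "0 < c0" "0 < \<tau>0" "1 \<le> K"
  shows "\<exists>N. \<forall>(h0::real) (\<Lambda>1 :: (real^'n::finite) set) (\<tau> :: real^'n \<Rightarrow> real) (e :: 'n \<Rightarrow> real^'n)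
      (q :: real^'n \<Rightarrow> real^'n \<Rightarrow> real) (p :: real^'n \<Rightarrow> real^'n \<Rightarrow> real)
      (c :: real^'n \<Rightarrow> real) (f :: real^'n \<Rightarrow> real) (k::nat) (r::nat).
    0 < h0 \<and> finite \<Lambda>1 \<and> 0 \<notin> \<Lambda>1 \<and>
    sqrt (\<Sum>l\<in>\<Lambda>1. (norm l)\<^sup>2) = size1 \<and>
    (\<forall>l\<in>\<Lambda>1. 0 \<le> \<tau> l) \<and>
    sqrt (\<Sum>l\<in>\<Lambda>1. (norm (\<tau> l *\<^sub>R l))\<^sup>2) = size2 \<and>
    inj e \<and> range e \<inter> \<Lambda>1 = {} \<and>
    (\<forall>l\<in>\<Lambda>1. \<forall>x. 0 \<le> q l x) \<and>
    odd k \<and> 1 \<le> k \<and> 3 * k + 1 \<le> m \<and>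
    regularity m M \<Lambda>1 q p c f \<and>
    (\<forall>h\<in>{0<..h0}. \<forall>l\<in>\<Lambda>1. \<forall>x. 0 \<le> q l x + h * p l x) \<and>
    (\<forall>x. (\<Sum>l\<in>\<Lambda>1. q l x *\<^sub>R l) = 0) \<and>
    (\<forall>x. c0 \<le> c x) \<and>
    first_structural m \<delta> K h0 \<Lambda>1 e \<tau>0 \<tau> q p c \<and>
    second_structural m \<delta> K h0 \<Lambda>1 e \<tau>0 \<tau> q p c \<and>
    \<Lambda>1 = uminus ` \<Lambda>1 \<and>
    (\<forall>l\<in>\<Lambda>1. \<forall>x. q l x = q (- l) x \<and> p (- l) x = - p l x) \<and>
    3 * k + r \<le> m - 1 \<longrightarrow>
    (let v = fd_solution \<Lambda>1 q p c f;
         w = (\<lambda>h x. hderiv h0 k (\<lambda>t. v t x) h)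
     in (\<forall>x. \<forall>j<k. \<forall>h\<in>{0<..h0}.
           hderiv h0 j (\<lambda>t. v t x) differentiable (at h within {0<..h0})) \<and>
        (\<forall>h\<in>{0<..h0}. Ck r (w h) \<and> (\<forall>x. Dnorm r (w h) x \<le> N * B_norm m f * h)))"
proof -
  \<comment> \<open>\<open>cst\<close> asks for nonnegative sizes, while \<open>size1\<close> and
    the \<open>M k\<close> are arbitrary reals that matter through their squares; \<open>?Mb\<close>
    dominates all \<open>M k\<close> with index up to \<open>m\<close>.\<close>
  let ?s1 = "\<bar>size1\<bar>" and ?Mb = "\<Sum>k\<le>m. \<bar>M k\<bar>"
  interpret cst m "real CARD('n)" \<delta> c0 \<tau>0 K ?s1 size2 ?Mb
    by unfold_locales (use assms in \<open>auto intro: sum_nonneg\<close>)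
  let ?S = "\<lambda>r. sqrt (real (card {\<alpha> :: 'n \<Rightarrow> nat. mi_order \<alpha> = r}))"
  \<comment> \<open>\<open>N\<close> has to be chosen before \<open>k\<close> and \<open>r\<close>.
    Both are at most \<open>m\<close>, and the sum over all such pairs dominates each individual
    constant.\<close>
  define N where "N = (\<Sum>k\<le>m. \<Sum>r\<le>m. ?S r * \<bar>CW k\<bar>)"
  have N: "?S r * CW k \<le> N" if "k \<le> m" "r \<le> m" for k r
  proof -
    have "?S r * CW k \<le> ?S r * \<bar>CW k\<bar>" by (intro mult_left_mono) auto
    also have "\<dots> \<le> (\<Sum>r\<le>m. ?S r * \<bar>CW k\<bar>)" using that by (intro member_le_sum) auto
    also have "\<dots> \<le> N" unfolding N_def using that by (intro member_le_sum) (auto intro!: sum_nonneg)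
    finally show ?thesis .
  qed
  show ?thesis
  proof (intro exI[of _ N] allI impI, (elim conjE)?)
    fix h0 :: real and \<Lambda>1 :: "(real^'n) set" and \<tau> e q p c f and k r :: nat
    assume *: "0 < h0" "finite \<Lambda>1"
      "sqrt (\<Sum>l\<in>\<Lambda>1. (norm l)\<^sup>2) = size1" "\<forall>l\<in>\<Lambda>1. 0 \<le> \<tau> l"
      "sqrt (\<Sum>l\<in>\<Lambda>1. (norm (\<tau> l *\<^sub>R l))\<^sup>2) = size2"
      "inj e" "range e \<inter> \<Lambda>1 = {}" and k: "odd k" "1 \<le> k" "3 * k + 1 \<le> m"
      and **: "regularity m M \<Lambda>1 q p c f" "\<forall>h\<in>{0<..h0}. \<forall>l\<in>\<Lambda>1. \<forall>x. 0 \<le> q l x + h * p l x"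
      "\<forall>x. c0 \<le> c x" "first_structural m \<delta> K h0 \<Lambda>1 e \<tau>0 \<tau> q p c"
      "second_structural m \<delta> K h0 \<Lambda>1 e \<tau>0 \<tau> q p c" and sym: "\<Lambda>1 = uminus ` \<Lambda>1"
      "\<forall>l\<in>\<Lambda>1. \<forall>x. q l x = q (- l) x \<and> p (- l) x = - p l x" and r: "3 * k + r \<le> m - 1"
    have M: "(M k)\<^sup>2 \<le> ?Mb\<^sup>2" if "k \<le> m" for k
    proof -
      have "\<bar>M k\<bar> \<le> ?Mb" using that by (intro member_le_sum) auto
      then show ?thesis using abs_le_square_iff[of "M k" ?Mb] Mb by simp
    qed
    have s1: "(\<Sum>l\<in>\<Lambda>1. (norm l)\<^sup>2) = ?s1\<^sup>2"
      unfolding *(3)[symmetric] by (simp add: sum_nonneg)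
    have s2: "(\<Sum>l\<in>\<Lambda>1. (norm (\<tau> l *\<^sub>R l))\<^sup>2) = size2\<^sup>2"
      unfolding *(5)[symmetric] by (simp add: sum_nonneg)
    have "rough m (real CARD('n)) \<delta> c0 \<tau>0 K ?s1 size2 ?Mb \<Lambda>1 e \<tau> h0 M q p c f"
      by (intro rough.intro rough_axioms.intro cst_axioms)
        (use * ** k sym(2) M s1 s2 in \<open>auto simp: sym(1)[symmetric]\<close>)
    then interpret A: approx m "real CARD('n)" \<delta> c0 \<tau>0 K ?s1 size2 ?Mb \<Lambda>1 e \<tau> h0 "B_norm m f" q p c f
      "\<lambda>j l. mo j (q l)" "\<lambda>j l. mo j (p l)" "\<lambda>j. mo j c" "\<lambda>j. mo j f"
      by (rule rough.approx_mo)
    have B: "0 \<le> B_norm m f" using **(1) by (intro B_norm_AE(1)) (simp add: regularity_def)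
    have le: "?S r * (CW k * (h * B_norm m f)) \<le> N * B_norm m f * h" if "h \<in> {0<..h0}" for h
    proof -
      have "?S r * CW k * (h * B_norm m f) \<le> N * (h * B_norm m f)"
        using that B k r by (intro mult_right_mono N) auto
      then show ?thesis by (simp add: mult_ac)
    qed
    show "let v = fd_solution \<Lambda>1 q p c f;
         w = (\<lambda>h x. hderiv h0 k (\<lambda>t. v t x) h)
     in (\<forall>x. \<forall>j<k. \<forall>h\<in>{0<..h0}.
           hderiv h0 j (\<lambda>t. v t x) differentiable (at h within {0<..h0})) \<and>
        (\<forall>h\<in>{0<..h0}. Ck r (w h) \<and> (\<forall>x. Dnorm r (w h) x \<le> N * B_norm m f * h))"
      using A.conclusion[OF k(1) r k(3)] le unfolding Let_def by (meson order_trans)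
  qed
qed

end
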